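(* Let $R$ be a quasi-free algebra over a field $k$. Let $(E,\theta)$ be a stratified $\tilde R$-module, and let $\partial^0_{\theta,2}:E\to\partial^1_2(E)$, $e\mapsto\theta_2(e\otimes1)$, be the associated coface map. Then the composite $$\nabla:E\stackrel{\partial^0_{\theta,2}}{\longrightarrow}\partial^1_2(E)=E\oplus E\otimes_{\tilde R}\Omega^1(R)\longrightarrow E\otimes_{\tilde R}\Omega^1(R),$$ where the last map is the projection, is a flat connection. Moreover the assignment $(E,\theta)\mapsto(E,\nabla)$, $f\mapsto f$ is an isomorphism between the category of stratified $\tilde R$-modules and the category of right $\tilde R$-modules with a flat connection.
   Context: $k$ is a field of arbitrary characteristic; "algebra" means associative, not necessarily unital $k$-algebra. $\tilde A=A\oplus k$ is the augmented unital algebra; modules over unital algebras are right unital modules. $R$ is quasi-free if every algebra homomorphism from $R$ lifts through every surjective algebra homomorphism with nilpotent kernel. $Q^m(R)=R*\cdots*R$ ($m+1$ factors, coproduct of algebras); $[m]\mapsto Q^m(R)$ is the coproduct cosimplicial algebra with cofaces $\partial^i$ (induced by the injection $[m]\to[m+1]$ missing $i$). $q^m(R)$ is the kernel of the folding map $Q^m(R)\to R$, $Cyl^m(R)_n=Q^m(R)/q^m(R)^n$ ($n\ge1$), and $\partial^i_n$ are the cofaces of the cosimplicial algebra $Cyl^*(R)_n$. There is an isomorphism $Cyl^1(R)_2\cong R\oplus\Omega^1(R)$ (square-zero extension), under which $\partial^1_2(a)=a$, $\partial^0_2(a)=a+da$; here $\Omega(R)$ is the DGA of noncommutative forms, $\Omega^n(R)=\tilde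 R\otimes R^{\otimes n}$ for $n\ge1$. For a right module $E$ and a coface $\partial^i_n$, $\partial^i_n(E)$ denotes the extension of scalars of $E$ along the induced map of augmented algebras (e.g. $E\otimes_{\tilde R,\partial^i_n}\widetilde{Cyl^1(R)_n}$), and $\partial^i_n(f)$ the induced map for a homomorphism $f$. A stratification on a right $\tilde R$-module $E$ is a sequence of isomorphisms $\theta_n:\partial^0_n(E)\to\partial^1_n(E)$ of right $\widetilde{Cyl^1(R)_n}$-modules ($n\ge1$) with $\theta_1=\mathrm{id}_E$, compatible with the projections $Cyl^1(R)_{n+1}\to Cyl^1(R)_n$, and satisfying the cocycle condition $\partial^2_n(\theta_n)\partial^0_n(\theta_n)=\partial^1_n(\theta_n)$. A morphism of stratified modules $(E,\theta)\to(E',\theta')$ is a module homomorphism $f:E\to E'$ with $\theta'_n\partial^0_n(f)=\partial^1_n(f)\theta_n$ for all $n$. A connection on $E$ is a $k$-linear map $\nabla:E\to E\otimes_{\tilde R}\Omega^1(R)$ with $\nabla(ea)=\nabla(e)a+e\otimes da$, extended to $E\otimes_{\tilde R}\Omega^*(R)\to E\otimes_{\tilde R}\Omega^{*+1}(R)$ by $\nabla(e\otimes\omega)=\nabla(e)\omega+e\otimes d\omega$; it is flat if $\nabla^2=0$ (equivalently $\nabla^2:E\to E\otimes_{\tilde R}\Omega^2(R)$ vanishes). A morphism $(E,\nabla)\to(F,D)$ is a module homomorphism $\alpha$ with $D\alpha=(\alpha\otimes\mathrm{id}_{\Omega^1(R)})\nabla$. *)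

theory Defs
  imports "HOL-Algebra.Module" "HOL-Algebra.QuotRing" "HOL-Algebra.Ideal_Product"
    "HOL-Algebra.Free_Abelian_Groups"
begin

section \<open>Algebras\<close>

text \<open>
  An algebra is associative but not necessarily unital.  As in \<^locale>\<open>module\<close>, the record
  type \<open>module\<close> supplies all the operations; its field \<open>one\<close> is not used unless the algebra is
  unital.
\<close>

locale nu_algebra = field K + module K A for K (structure) and A (structure) +
  assumes nu_mult_closed: "\<lbrakk>x \<in> carrier A; y \<in> carrier A\<rbrakk> \<Longrightarrow> x \<otimes>\<^bsub>A\<^esub> y \<in> carrier A"
    and nu_mult_assoc: "\<lbrakk>x \<in> carrier A; y \<in> carrier A; z \<in> carrier A\<rbrakk> \<Longrightarrow>
      (x \<otimes>\<^bsub>A\<^esub> y) \<otimes>\<^bsub>A\<^esub> z = x \<otimes>\<^bsub>A\<^esub> (y \<otimes>\<^bsub>A\<^esub> z)"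
    and nu_l_distr: "\<lbrakk>x \<in> carrier A; y \<in> carrier A; z \<in> carrier A\<rbrakk> \<Longrightarrow>
      (x \<oplus>\<^bsub>A\<^esub> y) \<otimes>\<^bsub>A\<^esub> z = x \<otimes>\<^bsub>A\<^esub> z \<oplus>\<^bsub>A\<^esub> y \<otimes>\<^bsub>A\<^esub> z"
    and nu_r_distr: "\<lbrakk>x \<in> carrier A; y \<in> carrier A; z \<in> carrier A\<rbrakk> \<Longrightarrow>
      z \<otimes>\<^bsub>A\<^esub> (x \<oplus>\<^bsub>A\<^esub> y) = z \<otimes>\<^bsub>A\<^esub> x \<oplus>\<^bsub>A\<^esub> z \<otimes>\<^bsub>A\<^esub> y"
    and nu_smult_l: "\<lbrakk>c \<in> carrier K; x \<in> carrier A; y \<in> carrier A\<rbrakk> \<Longrightarrow>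
      (c \<odot>\<^bsub>A\<^esub> x) \<otimes>\<^bsub>A\<^esub> y = c \<odot>\<^bsub>A\<^esub> (x \<otimes>\<^bsub>A\<^esub> y)"
    and nu_smult_r: "\<lbrakk>c \<in> carrier K; x \<in> carrier A; y \<in> carrier A\<rbrakk> \<Longrightarrow>
      x \<otimes>\<^bsub>A\<^esub> (c \<odot>\<^bsub>A\<^esub> y) = c \<odot>\<^bsub>A\<^esub> (x \<otimes>\<^bsub>A\<^esub> y)"

definition alg_hom ::
  "('k, 'm) ring_scheme \<Rightarrow> ('k, 'a) module \<Rightarrow> ('k, 'b) module \<Rightarrow> ('a \<Rightarrow> 'b) set" where
  "alg_hom K A B = {h \<in> hom A B \<inter> hom (add_monoid A) (add_monoid B).
     \<forall>c\<in>carrier K. \<forall>x\<in>carrier A. h (c \<odot>\<^bsub>A\<^esub> x) = c \<odot>\<^bsub>B\<^esub> h x}"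

text \<open>Powers of a two-sided ideal; in the absence of a unit, \<open>I\<^sup>1\<close> has to be treated separately.\<close>

fun ideal_pow :: "('a, 'm) ring_scheme \<Rightarrow> 'a set \<Rightarrow> nat \<Rightarrow> 'a set" where
  "ideal_pow A I 0 = carrier A"
| "ideal_pow A I (Suc 0) = I"
| "ideal_pow A I (Suc (Suc n)) = ideal_prod A (ideal_pow A I (Suc n)) I"

definition quot_alg :: "('k, 'a) module \<Rightarrow> 'a set \<Rightarrow> ('k, 'a set) module" where
  "quot_alg A I = \<lparr>carrier = carrier (A Quot I), monoid.mult = monoid.mult (A Quot I),
     one = one (A Quot I), ring.zero = \<zero>\<^bsub>A Quot I\<^esub>, add = add (A Quot I),
     smult = (\<lambda>c X. \<Union>x\<in>X. I +>\<^bsub>A\<^esub> (c \<odot>\<^bsub>A\<^esub> x))\<rparr>"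

text \<open>The augmented algebra; \<open>(a, c)\<close> stands for \<open>a + c\<sqdot>1\<close>.\<close>

definition aug :: "('k, 'm) ring_scheme \<Rightarrow> ('k, 'a) module \<Rightarrow> ('k, 'a \<times> 'k) module" where
  "aug K A = \<lparr>carrier = carrier A \<times> carrier K,
     monoid.mult = (\<lambda>(a, c) (b, d). (a \<otimes>\<^bsub>A\<^esub> b \<oplus>\<^bsub>A\<^esub> d \<odot>\<^bsub>A\<^esub> a \<oplus>\<^bsub>A\<^esub> c \<odot>\<^bsub>A\<^esub> b, c \<otimes>\<^bsub>K\<^esub> d)),
     one = (\<zero>\<^bsub>A\<^esub>, \<one>\<^bsub>K\<^esub>), ring.zero = (\<zero>\<^bsub>A\<^esub>, \<zero>\<^bsub>K\<^esub>),
     add = (\<lambda>(a, c) (b, d). (a \<oplus>\<^bsub>A\<^esub> b, c \<oplus>\<^bsub>K\<^esub> d)),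
     smult = (\<lambda>x (a, c). (x \<odot>\<^bsub>A\<^esub> a, x \<otimes>\<^bsub>K\<^esub> c))\<rparr>"

definition aug_map :: "('a \<Rightarrow> 'b) \<Rightarrow> 'a \<times> 'k \<Rightarrow> 'b \<times> 'k" where
  "aug_map f = (\<lambda>(a, c). (f a, c))"


section \<open>Coproducts of copies of an algebra\<close>

text \<open>
  The coproduct of \<open>m + 1\<close> copies of \<open>R\<close>, as the free algebra on the symbols \<open>Gen i a\<close>
  (\<open>i \<le> m\<close>, \<open>a \<in> R\<close>) modulo the relations which say that each \<open>a \<mapsto> Gen i a\<close> is an algebra
  homomorphism: terms in the operations of an algebra, modulo the least congruence containing the
  axioms of an algebra and these relations.
\<close>

datatype ('k, 'r) cterm =
    Gen nat 'r
  | CZero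
  | CAdd "('k, 'r) cterm" "('k, 'r) cterm"
  | CMult "('k, 'r) cterm" "('k, 'r) cterm"
  | CScal 'k "('k, 'r) cterm"

inductive_set cterms :: "('k, 'n) ring_scheme \<Rightarrow> ('k, 'r) module \<Rightarrow> nat \<Rightarrow> ('k, 'r) cterm set"
  for K R m where
  "\<lbrakk>i \<le> m; a \<in> carrier R\<rbrakk> \<Longrightarrow> Gen i a \<in> cterms K R m"
| "CZero \<in> cterms K R m"
| "\<lbrakk>s \<in> cterms K R m; t \<in> cterms K R m\<rbrakk> \<Longrightarrow> CAdd s t \<in> cterms K R m"
| "\<lbrakk>s \<in> cterms K R m; t \<in> cterms K R m\<rbrakk> \<Longrightarrow> CMult s t \<in> cterms K R m"
| "\<lbrakk>c \<in> carrier K; t \<in> cterms K R m\<rbrakk> \<Longrightarrow> CScal c t \<in> cterms K R m"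

inductive_set ccong ::
  "('k, 'n) ring_scheme \<Rightarrow> ('k, 'r) module \<Rightarrow> nat \<Rightarrow> (('k, 'r) cterm \<times> ('k, 'r) cterm) set"
  for K R m where
  crefl: "t \<in> cterms K R m \<Longrightarrow> (t, t) \<in> ccong K R m"
| csym: "(s, t) \<in> ccong K R m \<Longrightarrow> (t, s) \<in> ccong K R m"
| ctrans: "\<lbrakk>(s, t) \<in> ccong K R m; (t, u) \<in> ccong K R m\<rbrakk> \<Longrightarrow> (s, u) \<in> ccong K R m"
| cong_add: "\<lbrakk>(s, s') \<in> ccong K R m; (t, t') \<in> ccong K R m\<rbrakk> \<Longrightarrow>
    (CAdd s t, CAdd s' t') \<in> ccong K R m"
| cong_mult: "\<lbrakk>(s, s') \<in> ccong K R m; (t, t') \<in> ccong K R m\<rbrakk> \<Longrightarrow>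
    (CMult s t, CMult s' t') \<in> ccong K R m"
| cong_scal: "\<lbrakk>c \<in> carrier K; (t, t') \<in> ccong K R m\<rbrakk> \<Longrightarrow>
    (CScal c t, CScal c t') \<in> ccong K R m"
| add_assoc: "\<lbrakk>s \<in> cterms K R m; t \<in> cterms K R m; u \<in> cterms K R m\<rbrakk> \<Longrightarrow>
    (CAdd (CAdd s t) u, CAdd s (CAdd t u)) \<in> ccong K R m"
| add_comm: "\<lbrakk>s \<in> cterms K R m; t \<in> cterms K R m\<rbrakk> \<Longrightarrow> (CAdd s t, CAdd t s) \<in> ccong K R m"
| add_zero: "t \<in> cterms K R m \<Longrightarrow> (CAdd CZero t, t) \<in> ccong K R m"
| add_neg: "t \<in> cterms K R m \<Longrightarrow> (CAdd (CScal (\<ominus>\<^bsub>K\<^esub> \<one>\<^bsub>K\<^esub>) t) t, CZero) \<in> ccong K R m"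
| scal_l_distr: "\<lbrakk>c \<in> carrier K; d \<in> carrier K; t \<in> cterms K R m\<rbrakk> \<Longrightarrow>
    (CScal (c \<oplus>\<^bsub>K\<^esub> d) t, CAdd (CScal c t) (CScal d t)) \<in> ccong K R m"
| scal_r_distr: "\<lbrakk>c \<in> carrier K; s \<in> cterms K R m; t \<in> cterms K R m\<rbrakk> \<Longrightarrow>
    (CScal c (CAdd s t), CAdd (CScal c s) (CScal c t)) \<in> ccong K R m"
| scal_scal: "\<lbrakk>c \<in> carrier K; d \<in> carrier K; t \<in> cterms K R m\<rbrakk> \<Longrightarrow>
    (CScal (c \<otimes>\<^bsub>K\<^esub> d) t, CScal c (CScal d t)) \<in> ccong K R m"
| scal_one: "t \<in> cterms K R m \<Longrightarrow> (CScal \<one>\<^bsub>K\<^esub> t, t) \<in> ccong K R m"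
| mult_assoc: "\<lbrakk>s \<in> cterms K R m; t \<in> cterms K R m; u \<in> cterms K R m\<rbrakk> \<Longrightarrow>
    (CMult (CMult s t) u, CMult s (CMult t u)) \<in> ccong K R m"
| mult_l_distr: "\<lbrakk>s \<in> cterms K R m; t \<in> cterms K R m; u \<in> cterms K R m\<rbrakk> \<Longrightarrow>
    (CMult (CAdd s t) u, CAdd (CMult s u) (CMult t u)) \<in> ccong K R m"
| mult_r_distr: "\<lbrakk>s \<in> cterms K R m; t \<in> cterms K R m; u \<in> cterms K R m\<rbrakk> \<Longrightarrow>
    (CMult u (CAdd s t), CAdd (CMult u s) (CMult u t)) \<in> ccong K R m"
| mult_scal_l: "\<lbrakk>c \<in> carrier K; s \<in> cterms K R m; t \<in> cterms K R m\<rbrakk> \<Longrightarrow>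
    (CMult (CScal c s) t, CScal c (CMult s t)) \<in> ccong K R m"
| mult_scal_r: "\<lbrakk>c \<in> carrier K; s \<in> cterms K R m; t \<in> cterms K R m\<rbrakk> \<Longrightarrow>
    (CMult s (CScal c t), CScal c (CMult s t)) \<in> ccong K R m"
| gen_add: "\<lbrakk>i \<le> m; a \<in> carrier R; b \<in> carrier R\<rbrakk> \<Longrightarrow>
    (Gen i (a \<oplus>\<^bsub>R\<^esub> b), CAdd (Gen i a) (Gen i b)) \<in> ccong K R m"
| gen_mult: "\<lbrakk>i \<le> m; a \<in> carrier R; b \<in> carrier R\<rbrakk> \<Longrightarrow>
    (Gen i (a \<otimes>\<^bsub>R\<^esub> b), CMult (Gen i a) (Gen i b)) \<in> ccong K R m"
| gen_scal: "\<lbrakk>i \<le> m; c \<in> carrier K; a \<in> carrier R\<rbrakk> \<Longrightarrow>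
    (Gen i (c \<odot>\<^bsub>R\<^esub> a), CScal c (Gen i a)) \<in> ccong K R m"

definition Q_alg ::
  "('k, 'n) ring_scheme \<Rightarrow> ('k, 'r) module \<Rightarrow> nat \<Rightarrow> ('k, ('k, 'r) cterm set) module" where
  "Q_alg K R m = \<lparr>carrier = cterms K R m // ccong K R m,
     monoid.mult = (\<lambda>X Y. \<Union>s\<in>X. \<Union>t\<in>Y. ccong K R m `` {CMult s t}),
     one = undefined,
     ring.zero = ccong K R m `` {CZero},
     add = (\<lambda>X Y. \<Union>s\<in>X. \<Union>t\<in>Y. ccong K R m `` {CAdd s t}),
     smult = (\<lambda>c X. \<Union>t\<in>X. ccong K R m `` {CScal c t})\<rparr>"

definition Q_inj ::
  "('k, 'n) ring_scheme \<Rightarrow> ('k, 'r) module \<Rightarrow> nat \<Rightarrow> nat \<Rightarrow> 'r \<Rightarrow> ('k, 'r) cterm set" where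
  "Q_inj K R m i a = ccong K R m `` {Gen i a}"

primrec ceval :: "('k, 'b) module \<Rightarrow> (nat \<Rightarrow> 'r \<Rightarrow> 'b) \<Rightarrow> ('k, 'r) cterm \<Rightarrow> 'b" where
  "ceval B f (Gen i a) = f i a"
| "ceval B f CZero = \<zero>\<^bsub>B\<^esub>"
| "ceval B f (CAdd s t) = ceval B f s \<oplus>\<^bsub>B\<^esub> ceval B f t"
| "ceval B f (CMult s t) = ceval B f s \<otimes>\<^bsub>B\<^esub> ceval B f t"
| "ceval B f (CScal c t) = c \<odot>\<^bsub>B\<^esub> ceval B f t"

text \<open>The homomorphism from the coproduct to \<open>B\<close> induced by homomorphisms \<open>f i : R \<rightarrow> B\<close>.\<close>

definition copair ::
  "('k, 'b) module \<Rightarrow> (nat \<Rightarrow> 'r \<Rightarrow> 'b) \<Rightarrow> ('k, 'r) cterm set \<Rightarrow> 'b" where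
  "copair B f X = the_elem (ceval B f ` X)"

text \<open>The coface induced by the increasing injection \<open>[m] \<rightarrow> [m + 1]\<close> which misses \<open>i\<close>.\<close>

definition Q_coface ::
  "('k, 'n) ring_scheme \<Rightarrow> ('k, 'r) module \<Rightarrow> nat \<Rightarrow> nat \<Rightarrow> ('k, 'r) cterm set \<Rightarrow> ('k, 'r) cterm set"
  where
  "Q_coface K R i m =
     copair (Q_alg K R (Suc m)) (\<lambda>j. Q_inj K R (Suc m) (if j < i then j else Suc j))"

definition q_ideal ::
  "('k, 'n) ring_scheme \<Rightarrow> ('k, 'r) module \<Rightarrow> nat \<Rightarrow> ('k, 'r) cterm set set" where
  "q_ideal K R m = a_kernel (Q_alg K R m) R (copair R (\<lambda>_ a. a))"


section \<open>The cylinders\<close>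

definition cyl_ideal ::
  "('k, 'n) ring_scheme \<Rightarrow> ('k, 'r) module \<Rightarrow> nat \<Rightarrow> nat \<Rightarrow> ('k, 'r) cterm set set" where
  "cyl_ideal K R m n = ideal_pow (Q_alg K R m) (q_ideal K R m) n"

definition Cyl ::
  "('k, 'n) ring_scheme \<Rightarrow> ('k, 'r) module \<Rightarrow> nat \<Rightarrow> nat \<Rightarrow> ('k, ('k, 'r) cterm set set) module" where
  "Cyl K R m n = quot_alg (Q_alg K R m) (cyl_ideal K R m n)"

definition cyl_class ::
  "('k, 'n) ring_scheme \<Rightarrow> ('k, 'r) module \<Rightarrow> nat \<Rightarrow> nat \<Rightarrow> ('k, 'r) cterm set \<Rightarrow> ('k, 'r) cterm set set"
  where
  "cyl_class K R m n x = cyl_ideal K R m n +>\<^bsub>Q_alg K R m\<^esub> x"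

definition cyl_coface ::
  "('k, 'n) ring_scheme \<Rightarrow> ('k, 'r) module \<Rightarrow> nat \<Rightarrow> nat \<Rightarrow> nat \<Rightarrow>
    ('k, 'r) cterm set set \<Rightarrow> ('k, 'r) cterm set set" where
  "cyl_coface K R i m n X = the_elem ((\<lambda>x. cyl_class K R (Suc m) n (Q_coface K R i m x)) ` X)"

definition cyl_proj ::
  "('k, 'n) ring_scheme \<Rightarrow> ('k, 'r) module \<Rightarrow> nat \<Rightarrow> nat \<Rightarrow>
    ('k, 'r) cterm set set \<Rightarrow> ('k, 'r) cterm set set" where
  "cyl_proj K R m n X = the_elem (cyl_class K R m n ` X)"

text \<open>
  \<open>Q_alg K R 0\<close> and \<open>Cyl K R 0 n\<close> (\<open>n \<ge> 1\<close>) are isomorphic copies of \<open>R\<close>; the cofaces from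
  level 0 are regarded as defined on \<open>R\<close> itself.
\<close>

definition cyl_coface0 ::
  "('k, 'n) ring_scheme \<Rightarrow> ('k, 'r) module \<Rightarrow> nat \<Rightarrow> nat \<Rightarrow> 'r \<Rightarrow> ('k, 'r) cterm set set" where
  "cyl_coface0 K R i n a = cyl_coface K R i 0 n (cyl_class K R 0 n (Q_inj K R 0 0 a))"


section \<open>Right modules, bimodules and tensor products\<close>

text \<open>As in the record \<open>module\<close>, the fields \<open>mult\<close> and \<open>one\<close> inherited from \<open>ring\<close> are not used.\<close>

record ('a, 'e) rmodule = "'e ring" +
  ract :: "'e \<Rightarrow> 'a \<Rightarrow> 'e" (infixl \<open>\<lhd>\<index>\<close> 70)

record ('a, 'b, 'l) bimodule = "('b, 'l) rmodule" +
  lact :: "'a \<Rightarrow> 'l \<Rightarrow> 'l" (infixr \<open>\<rhd>\<index>\<close> 70)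

locale right_module = A?: ring A + M?: abelian_group M for A (structure) and M (structure) +
  assumes ract_closed: "\<lbrakk>x \<in> carrier M; a \<in> carrier A\<rbrakk> \<Longrightarrow> x \<lhd>\<^bsub>M\<^esub> a \<in> carrier M"
    and ract_l_distr: "\<lbrakk>x \<in> carrier M; y \<in> carrier M; a \<in> carrier A\<rbrakk> \<Longrightarrow>
      (x \<oplus>\<^bsub>M\<^esub> y) \<lhd>\<^bsub>M\<^esub> a = x \<lhd>\<^bsub>M\<^esub> a \<oplus>\<^bsub>M\<^esub> y \<lhd>\<^bsub>M\<^esub> a"
    and ract_r_distr: "\<lbrakk>x \<in> carrier M; a \<in> carrier A; b \<in> carrier A\<rbrakk> \<Longrightarrow>
      x \<lhd>\<^bsub>M\<^esub> (a \<oplus>\<^bsub>A\<^esub> b) = x \<lhd>\<^bsub>M\<^esub> a \<oplus>\<^bsub>M\<^esub> x \<lhd>\<^bsub>M\<^esub> b"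
    and ract_assoc: "\<lbrakk>x \<in> carrier M; a \<in> carrier A; b \<in> carrier A\<rbrakk> \<Longrightarrow>
      x \<lhd>\<^bsub>M\<^esub> (a \<otimes>\<^bsub>A\<^esub> b) = (x \<lhd>\<^bsub>M\<^esub> a) \<lhd>\<^bsub>M\<^esub> b"
    and ract_one: "x \<in> carrier M \<Longrightarrow> x \<lhd>\<^bsub>M\<^esub> \<one>\<^bsub>A\<^esub> = x"

definition rmod_hom ::
  "('a, 'm) ring_scheme \<Rightarrow> ('a, 'e, 'p) rmodule_scheme \<Rightarrow> ('a, 'f, 'q) rmodule_scheme \<Rightarrow> ('e \<Rightarrow> 'f) set"
  where
  "rmod_hom A M N = {f \<in> hom (add_monoid M) (add_monoid N) \<inter> extensional (carrier M).
     \<forall>x\<in>carrier M. \<forall>a\<in>carrier A. f (x \<lhd>\<^bsub>M\<^esub> a) = f x \<lhd>\<^bsub>N\<^esub> a}"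

definition rmod_iso ::
  "('a, 'm) ring_scheme \<Rightarrow> ('a, 'e, 'p) rmodule_scheme \<Rightarrow> ('a, 'f, 'q) rmodule_scheme \<Rightarrow> ('e \<Rightarrow> 'f) set"
  where
  "rmod_iso A M N = {f \<in> rmod_hom A M N. bij_betw f (carrier M) (carrier N)}"

text \<open>The abelian group with generators \<open>S\<close> and relators \<open>N\<close>, written additively.\<close>

definition pres_grp :: "'x set \<Rightarrow> ('x \<Rightarrow>\<^sub>0 int) set \<Rightarrow> ('x \<Rightarrow>\<^sub>0 int) set ring" where
  "pres_grp S N = (let G = free_Abelian_group S Mod generate (free_Abelian_group S) N in
     \<lparr>carrier = carrier G, monoid.mult = undefined, one = undefined,
      ring.zero = \<one>\<^bsub>G\<^esub>, add = monoid.mult G\<rparr>)"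

definition pres_class :: "'x set \<Rightarrow> ('x \<Rightarrow>\<^sub>0 int) set \<Rightarrow> ('x \<Rightarrow>\<^sub>0 int) \<Rightarrow> ('x \<Rightarrow>\<^sub>0 int) set" where
  "pres_class S N c = generate (free_Abelian_group S) N #>\<^bsub>free_Abelian_group S\<^esub> c"

text \<open>
  The homomorphism to \<open>M\<close> with prescribed values on generators (meaningful if these values
  satisfy the relations).
\<close>

definition pres_lift ::
  "'x set \<Rightarrow> ('x \<Rightarrow>\<^sub>0 int) set \<Rightarrow> ('y, 'm) ring_scheme \<Rightarrow> ('x \<Rightarrow> 'y) \<Rightarrow> ('x \<Rightarrow>\<^sub>0 int) set \<Rightarrow> 'y" where
  "pres_lift S N M \<phi> = (THE h. h \<in> hom (add_monoid (pres_grp S N)) (add_monoid M) \<and>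
     h \<in> extensional (carrier (pres_grp S N)) \<and> (\<forall>s\<in>S. h (pres_class S N (frag_of s)) = \<phi> s))"

definition tensor_rels ::
  "('a, 'e, 'p) rmodule_scheme \<Rightarrow> ('a, 'm) ring_scheme \<Rightarrow> ('a, 'b, 'l) bimodule \<Rightarrow>
    (('e \<times> 'l) \<Rightarrow>\<^sub>0 int) set" where
  "tensor_rels E A L =
     {frag_of (e \<oplus>\<^bsub>E\<^esub> e', l) - frag_of (e, l) - frag_of (e', l) | e e' l.
        e \<in> carrier E \<and> e' \<in> carrier E \<and> l \<in> carrier L} \<union>
     {frag_of (e, l \<oplus>\<^bsub>L\<^esub> l') - frag_of (e, l) - frag_of (e, l') | e l l'.
        e \<in> carrier E \<and> l \<in> carrier L \<and> l' \<in> carrier L} \<union>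
     {frag_of (e \<lhd>\<^bsub>E\<^esub> a, l) - frag_of (e, a \<rhd>\<^bsub>L\<^esub> l) | e a l.
        e \<in> carrier E \<and> a \<in> carrier A \<and> l \<in> carrier L}"

definition tens ::
  "('a, 'e, 'p) rmodule_scheme \<Rightarrow> ('a, 'm) ring_scheme \<Rightarrow> ('a, 'b, 'l) bimodule \<Rightarrow>
    'e \<Rightarrow> 'l \<Rightarrow> (('e \<times> 'l) \<Rightarrow>\<^sub>0 int) set" where
  "tens E A L e l = pres_class (carrier E \<times> carrier L) (tensor_rels E A L) (frag_of (e, l))"

definition tensor_lift ::
  "('a, 'e, 'p) rmodule_scheme \<Rightarrow> ('a, 'm) ring_scheme \<Rightarrow> ('a, 'b, 'l) bimodule \<Rightarrow>
    ('y, 'q) ring_scheme \<Rightarrow> ('e \<Rightarrow> 'l \<Rightarrow> 'y) \<Rightarrow> (('e \<times> 'l) \<Rightarrow>\<^sub>0 int) set \<Rightarrow> 'y" where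
  "tensor_lift E A L M \<phi> =
     pres_lift (carrier E \<times> carrier L) (tensor_rels E A L) M (\<lambda>(e, l). \<phi> e l)"

text \<open>\<open>E \<otimes>\<^sub>A L\<close> for a right \<open>A\<close>-module \<open>E\<close> and an \<open>A\<close>-\<open>B\<close>-bimodule \<open>L\<close>.\<close>

definition tensor ::
  "('a, 'e, 'p) rmodule_scheme \<Rightarrow> ('a, 'm) ring_scheme \<Rightarrow> ('a, 'b, 'l) bimodule \<Rightarrow>
    ('b, (('e \<times> 'l) \<Rightarrow>\<^sub>0 int) set) rmodule" where
  "tensor E A L = (let G = pres_grp (carrier E \<times> carrier L) (tensor_rels E A L) in
     \<lparr>carrier = carrier G, monoid.mult = undefined, one = undefined, ring.zero = \<zero>\<^bsub>G\<^esub>, add = add G,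
      ract = (\<lambda>t b. tensor_lift E A L G (\<lambda>e l. tens E A L e (l \<lhd>\<^bsub>L\<^esub> b)) t)\<rparr>)"


section \<open>Extension of scalars\<close>

definition ring_bimodule ::
  "('a \<Rightarrow> 'b) \<Rightarrow> ('b, 'm) ring_scheme \<Rightarrow> ('a, 'b, 'b) bimodule" where
  "ring_bimodule \<phi> B = \<lparr>carrier = carrier B, monoid.mult = monoid.mult B, one = one B,
     ring.zero = \<zero>\<^bsub>B\<^esub>, add = add B, ract = monoid.mult B, lact = (\<lambda>a b. \<phi> a \<otimes>\<^bsub>B\<^esub> b)\<rparr>"

definition ext_scal ::
  "('a, 'e, 'p) rmodule_scheme \<Rightarrow> ('a, 'm) ring_scheme \<Rightarrow> ('a \<Rightarrow> 'b) \<Rightarrow> ('b, 'q) ring_scheme \<Rightarrow>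
    ('b, (('e \<times> 'b) \<Rightarrow>\<^sub>0 int) set) rmodule" where
  "ext_scal E A \<phi> B = tensor E A (ring_bimodule \<phi> B)"

definition ext_tens ::
  "('a, 'e, 'p) rmodule_scheme \<Rightarrow> ('a, 'm) ring_scheme \<Rightarrow> ('a \<Rightarrow> 'b) \<Rightarrow> ('b, 'q) ring_scheme \<Rightarrow>
    'e \<Rightarrow> 'b \<Rightarrow> (('e \<times> 'b) \<Rightarrow>\<^sub>0 int) set" where
  "ext_tens E A \<phi> B = tens E A (ring_bimodule \<phi> B)"

text \<open>The homomorphism \<open>f \<otimes> id\<close> of extended modules induced by \<open>f : E \<rightarrow> E'\<close>.\<close>

definition ext_map ::
  "('a, 'e, 'p) rmodule_scheme \<Rightarrow> ('a, 'e2, 'p2) rmodule_scheme \<Rightarrow> ('a, 'm) ring_scheme \<Rightarrow>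
    ('a \<Rightarrow> 'b) \<Rightarrow> ('b, 'q) ring_scheme \<Rightarrow> ('e \<Rightarrow> 'e2) \<Rightarrow>
    (('e \<times> 'b) \<Rightarrow>\<^sub>0 int) set \<Rightarrow> (('e2 \<times> 'b) \<Rightarrow>\<^sub>0 int) set" where
  "ext_map E E' A \<phi> B f =
     tensor_lift E A (ring_bimodule \<phi> B) (ext_scal E' A \<phi> B) (\<lambda>e b. ext_tens E' A \<phi> B (f e) b)"

text \<open>For \<open>\<chi> = \<psi> \<circ> \<phi>\<close>, the map \<open>E \<otimes>\<^sub>\<phi> B \<rightarrow> E \<otimes>\<^sub>\<chi> C\<close>, \<open>e \<otimes> b \<mapsto> e \<otimes> \<psi> b\<close>.\<close>

definition ext_change ::
  "('a, 'e, 'p) rmodule_scheme \<Rightarrow> ('a, 'm) ring_scheme \<Rightarrow> ('a \<Rightarrow> 'b) \<Rightarrow> ('b, 'q) ring_scheme \<Rightarrow>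
    ('b \<Rightarrow> 'c) \<Rightarrow> ('a \<Rightarrow> 'c) \<Rightarrow> ('c, 's) ring_scheme \<Rightarrow>
    (('e \<times> 'b) \<Rightarrow>\<^sub>0 int) set \<Rightarrow> (('e \<times> 'c) \<Rightarrow>\<^sub>0 int) set" where
  "ext_change E A \<phi> B \<psi> \<chi> C =
     tensor_lift E A (ring_bimodule \<phi> B) (ext_scal E A \<chi> C) (\<lambda>e b. ext_tens E A \<chi> C e (\<psi> b))"

text \<open>
  For \<open>\<chi> = \<psi> \<circ> \<phi>\<close>, the canonical isomorphism \<open>(E \<otimes>\<^sub>\<phi> B) \<otimes>\<^sub>\<psi> C \<rightarrow> E \<otimes>\<^sub>\<chi> C\<close>,
  \<open>(e \<otimes> b) \<otimes> c \<mapsto> e \<otimes> \<psi>(b) c\<close>.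
\<close>

definition ext_trans ::
  "('a, 'e, 'p) rmodule_scheme \<Rightarrow> ('a, 'm) ring_scheme \<Rightarrow> ('a \<Rightarrow> 'b) \<Rightarrow> ('b, 'q) ring_scheme \<Rightarrow>
    ('b \<Rightarrow> 'c) \<Rightarrow> ('a \<Rightarrow> 'c) \<Rightarrow> ('c, 's) ring_scheme \<Rightarrow>
    (((('e \<times> 'b) \<Rightarrow>\<^sub>0 int) set \<times> 'c) \<Rightarrow>\<^sub>0 int) set \<Rightarrow> (('e \<times> 'c) \<Rightarrow>\<^sub>0 int) set" where
  "ext_trans E A \<phi> B \<psi> \<chi> C =
     tensor_lift (ext_scal E A \<phi> B) B (ring_bimodule \<psi> C) (ext_scal E A \<chi> C)
       (\<lambda>t c. ext_change E A \<phi> B \<psi> \<chi> C t \<lhd>\<^bsub>ext_scal E A \<chi> C\<^esub> c)"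


section \<open>Stratifications\<close>

type_synonym ('k, 'r) cyl_aug = "('k, 'r) cterm set set \<times> 'k"
type_synonym ('k, 'r, 'e) cyl_ext = "(('e \<times> ('k, 'r) cyl_aug) \<Rightarrow>\<^sub>0 int) set"
type_synonym ('k, 'r, 'e) strat = "nat \<Rightarrow> ('k, 'r, 'e) cyl_ext \<Rightarrow> ('k, 'r, 'e) cyl_ext"

abbreviation cyl1 ::
  "('k, 'n) ring_scheme \<Rightarrow> ('k, 'r) module \<Rightarrow> nat \<Rightarrow> ('k, ('k, 'r) cyl_aug) module" where
  "cyl1 K R n \<equiv> aug K (Cyl K R 1 n)"

abbreviation cyl2 ::
  "('k, 'n) ring_scheme \<Rightarrow> ('k, 'r) module \<Rightarrow> nat \<Rightarrow> ('k, ('k, 'r) cyl_aug) module" where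
  "cyl2 K R n \<equiv> aug K (Cyl K R 2 n)"

abbreviation face0 ::
  "('k, 'n) ring_scheme \<Rightarrow> ('k, 'r) module \<Rightarrow> nat \<Rightarrow> nat \<Rightarrow> 'r \<times> 'k \<Rightarrow> ('k, 'r) cyl_aug" where
  "face0 K R i n \<equiv> aug_map (cyl_coface0 K R i n)"

abbreviation face1 ::
  "('k, 'n) ring_scheme \<Rightarrow> ('k, 'r) module \<Rightarrow> nat \<Rightarrow> nat \<Rightarrow> ('k, 'r) cyl_aug \<Rightarrow> ('k, 'r) cyl_aug" where
  "face1 K R j n \<equiv> aug_map (cyl_coface K R j 1 n)"

text \<open>\<open>face_mod K R E i n\<close> is \<open>\<partial>\<^sup>i\<^sub>n(E)\<close>.\<close>

definition face_mod ::
  "('k, 'n) ring_scheme \<Rightarrow> ('k, 'r) module \<Rightarrow> ('r \<times> 'k, 'e) rmodule \<Rightarrow> nat \<Rightarrow> nat \<Rightarrow>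
    (('k, 'r) cyl_aug, ('k, 'r, 'e) cyl_ext) rmodule" where
  "face_mod K R E i n = ext_scal E (aug K R) (face0 K R i n) (cyl1 K R n)"

definition face_unit ::
  "('k, 'n) ring_scheme \<Rightarrow> ('k, 'r) module \<Rightarrow> ('r \<times> 'k, 'e) rmodule \<Rightarrow> nat \<Rightarrow> nat \<Rightarrow>
    'e \<Rightarrow> ('k, 'r, 'e) cyl_ext" where
  "face_unit K R E i n e = ext_tens E (aug K R) (face0 K R i n) (cyl1 K R n) e \<one>\<^bsub>cyl1 K R n\<^esub>"

definition face_map ::
  "('k, 'n) ring_scheme \<Rightarrow> ('k, 'r) module \<Rightarrow> ('r \<times> 'k, 'e) rmodule \<Rightarrow> ('r \<times> 'k, 'e) rmodule \<Rightarrow>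
    nat \<Rightarrow> nat \<Rightarrow> ('e \<Rightarrow> 'e) \<Rightarrow> ('k, 'r, 'e) cyl_ext \<Rightarrow> ('k, 'r, 'e) cyl_ext" where
  "face_map K R E E' i n f = ext_map E E' (aug K R) (face0 K R i n) (cyl1 K R n) f"

text \<open>The projection \<open>\<partial>\<^sup>i\<^bsub>n+1\<^esub>(E) \<rightarrow> \<partial>\<^sup>i\<^sub>n(E)\<close>.\<close>

definition face_proj ::
  "('k, 'n) ring_scheme \<Rightarrow> ('k, 'r) module \<Rightarrow> ('r \<times> 'k, 'e) rmodule \<Rightarrow> nat \<Rightarrow> nat \<Rightarrow>
    ('k, 'r, 'e) cyl_ext \<Rightarrow> ('k, 'r, 'e) cyl_ext" where
  "face_proj K R E i n = ext_change E (aug K R) (face0 K R i (Suc n)) (cyl1 K R (Suc n))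
     (aug_map (cyl_proj K R 1 n)) (face0 K R i n) (cyl1 K R n)"

text \<open>
  \<open>face2_mod K R E j i n\<close> is the extension of \<open>E\<close> along the composite \<open>\<partial>\<^sup>j \<circ> \<partial>\<^sup>i\<close>, and
  \<open>face2_can\<close> is its identification with the iterated extension \<open>\<partial>\<^sup>j\<^sub>n(\<partial>\<^sup>i\<^sub>n(E))\<close>.  By the
  cosimplicial identities \<open>face2_mod\<close> for \<open>(j, i) = (0, 0), (2, 0), (2, 1)\<close> coincides with
  \<open>face2_mod\<close> for \<open>(1, 0), (0, 1), (1, 1)\<close>, which is implicit in the cocycle condition.
\<close>

definition face2_mod ::
  "('k, 'n) ring_scheme \<Rightarrow> ('k, 'r) module \<Rightarrow> ('r \<times> 'k, 'e) rmodule \<Rightarrow> nat \<Rightarrow> nat \<Rightarrow> nat \<Rightarrow>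
    (('k, 'r) cyl_aug, ('k, 'r, 'e) cyl_ext) rmodule" where
  "face2_mod K R E j i n =
     ext_scal E (aug K R) (face1 K R j n \<circ> face0 K R i n) (cyl2 K R n)"

definition face2_can ::
  "('k, 'n) ring_scheme \<Rightarrow> ('k, 'r) module \<Rightarrow> ('r \<times> 'k, 'e) rmodule \<Rightarrow> nat \<Rightarrow> nat \<Rightarrow> nat \<Rightarrow>
    ((('k, 'r, 'e) cyl_ext \<times> ('k, 'r) cyl_aug) \<Rightarrow>\<^sub>0 int) set \<Rightarrow> ('k, 'r, 'e) cyl_ext" where
  "face2_can K R E j i n = ext_trans E (aug K R) (face0 K R i n) (cyl1 K R n)
     (face1 K R j n) (face1 K R j n \<circ> face0 K R i n) (cyl2 K R n)"

text \<open>\<open>\<partial>\<^sup>j\<^sub>n(\<theta>\<^sub>n) = \<theta>\<^sub>n \<otimes> id\<close>, transported along these identifications.\<close>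

definition face2_map ::
  "('k, 'n) ring_scheme \<Rightarrow> ('k, 'r) module \<Rightarrow> ('r \<times> 'k, 'e) rmodule \<Rightarrow> nat \<Rightarrow> nat \<Rightarrow>
    (('k, 'r, 'e) cyl_ext \<Rightarrow> ('k, 'r, 'e) cyl_ext) \<Rightarrow>
    ('k, 'r, 'e) cyl_ext \<Rightarrow> ('k, 'r, 'e) cyl_ext" where
  "face2_map K R E j n h t =
     face2_can K R E j 1 n
       (ext_map (face_mod K R E 0 n) (face_mod K R E 1 n) (cyl1 K R n) (face1 K R j n) (cyl2 K R n) h
         (inv_into (carrier (ext_scal (face_mod K R E 0 n) (cyl1 K R n) (face1 K R j n) (cyl2 K R n)))
           (face2_can K R E j 0 n) t))"

text \<open>
  Functions are extensional and the value at the unused index 0 is \<open>undefined\<close>, so that equal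
  stratifications are equal as HOL functions.  The condition on \<open>\<theta> 1\<close> is \<open>\<theta>\<^sub>1 = id\<close> under the
  isomorphisms \<open>e \<mapsto> e \<otimes> 1\<close> from \<open>E\<close> to \<open>\<partial>\<^sup>i\<^sub>1(E)\<close>.
\<close>

definition stratification ::
  "('k, 'n) ring_scheme \<Rightarrow> ('k, 'r) module \<Rightarrow> ('r \<times> 'k, 'e) rmodule \<Rightarrow> ('k, 'r, 'e) strat \<Rightarrow> bool" where
  "stratification K R E \<theta> \<longleftrightarrow>
     right_module (aug K R) E \<and>
     \<theta> \<in> extensional {1..} \<and>
     (\<forall>n\<ge>1. \<theta> n \<in> rmod_iso (cyl1 K R n) (face_mod K R E 0 n) (face_mod K R E 1 n)) \<and>
     (\<forall>e\<in>carrier E. \<theta> 1 (face_unit K R E 0 1 e) = face_unit K R E 1 1 e) \<and>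
     (\<forall>n\<ge>1. \<forall>t\<in>carrier (face_mod K R E 0 (Suc n)).
        \<theta> n (face_proj K R E 0 n t) = face_proj K R E 1 n (\<theta> (Suc n) t)) \<and>
     (\<forall>n\<ge>1. \<forall>t\<in>carrier (face2_mod K R E 1 0 n).
        face2_map K R E 2 n (\<theta> n) (face2_map K R E 0 n (\<theta> n) t) = face2_map K R E 1 n (\<theta> n) t)"

definition strat_hom ::
  "('k, 'n) ring_scheme \<Rightarrow> ('k, 'r) module \<Rightarrow>
    ('r \<times> 'k, 'e) rmodule \<times> ('k, 'r, 'e) strat \<Rightarrow> ('r \<times> 'k, 'e) rmodule \<times> ('k, 'r, 'e) strat \<Rightarrow>
    ('e \<Rightarrow> 'e) set" where
  "strat_hom K R = (\<lambda>(E, \<theta>) (E', \<theta>').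
     {f \<in> rmod_hom (aug K R) E E'. \<forall>n\<ge>1. \<forall>t\<in>carrier (face_mod K R E 0 n).
        \<theta>' n (face_map K R E E' 0 n f t) = face_map K R E E' 1 n f (\<theta> n t)})"


section \<open>Noncommutative differential forms\<close>

text \<open>
  \<open>\<Omega>\<^sup>n(R) = \<tilde>R \<otimes> R\<^sup>\<otimes>\<^sup>n\<close> (tensor products over \<open>K\<close>), presented as an abelian group by
  generators \<open>(x, [a\<^sub>1, \<dots>, a\<^sub>n])\<close>, written \<open>x da\<^sub>1 \<dots> da\<^sub>n\<close>.  Only \<open>n \<ge> 1\<close> is used below.
\<close>

type_synonym ('k, 'r) form_gen = "('r \<times> 'k) \<times> 'r list"
type_synonym ('k, 'r) form = "(('k, 'r) form_gen \<Rightarrow>\<^sub>0 int) set"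

definition form_gens ::
  "('k, 'n) ring_scheme \<Rightarrow> ('k, 'r) module \<Rightarrow> nat \<Rightarrow> ('k, 'r) form_gen set" where
  "form_gens K R n = carrier (aug K R) \<times> {as. set as \<subseteq> carrier R \<and> length as = n}"

definition form_rels ::
  "('k, 'n) ring_scheme \<Rightarrow> ('k, 'r) module \<Rightarrow> nat \<Rightarrow> (('k, 'r) form_gen \<Rightarrow>\<^sub>0 int) set" where
  "form_rels K R n =
     {frag_of (x \<oplus>\<^bsub>aug K R\<^esub> y, as) - frag_of (x, as) - frag_of (y, as) | x y as.
        (x, as) \<in> form_gens K R n \<and> (y, as) \<in> form_gens K R n} \<union>
     {frag_of (x, us @ (a \<oplus>\<^bsub>R\<^esub> b) # vs) - frag_of (x, us @ a # vs) - frag_of (x, us @ b # vs)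
        | x us a b vs. (x, us @ a # vs) \<in> form_gens K R n \<and> (x, us @ b # vs) \<in> form_gens K R n} \<union>
     {frag_of (c \<odot>\<^bsub>aug K R\<^esub> x, us @ a # vs) - frag_of (x, us @ (c \<odot>\<^bsub>R\<^esub> a) # vs)
        | c x us a vs. c \<in> carrier K \<and> (x, us @ a # vs) \<in> form_gens K R n}"

definition form_grp ::
  "('k, 'n) ring_scheme \<Rightarrow> ('k, 'r) module \<Rightarrow> nat \<Rightarrow> ('k, 'r) form ring" where
  "form_grp K R n = pres_grp (form_gens K R n) (form_rels K R n)"

definition form_class ::
  "('k, 'n) ring_scheme \<Rightarrow> ('k, 'r) module \<Rightarrow> nat \<Rightarrow> (('k, 'r) form_gen \<Rightarrow>\<^sub>0 int) \<Rightarrow> ('k, 'r) form" where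
  "form_class K R n = pres_class (form_gens K R n) (form_rels K R n)"

definition form_lift ::
  "('k, 'n) ring_scheme \<Rightarrow> ('k, 'r) module \<Rightarrow> nat \<Rightarrow> ('y, 'q) ring_scheme \<Rightarrow>
    ('r \<times> 'k \<Rightarrow> 'r list \<Rightarrow> 'y) \<Rightarrow> ('k, 'r) form \<Rightarrow> 'y" where
  "form_lift K R n M \<phi> = pres_lift (form_gens K R n) (form_rels K R n) M (\<lambda>(x, as). \<phi> x as)"

text \<open>
  The product \<open>(x da\<^sub>1 \<dots> da\<^sub>p) (b db\<^sub>1 \<dots> db\<^sub>q)\<close> for \<open>b \<in> R\<close>, by iterating
  \<open>(\<omega> da) b = \<omega> d(ab) - (\<omega> a) db\<close>; the list \<open>[a\<^sub>1, \<dots>, a\<^sub>p]\<close> is passed in reverse.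
\<close>

fun form_mult_rev ::
  "('k, 'n) ring_scheme \<Rightarrow> ('k, 'r) module \<Rightarrow> 'r \<times> 'k \<Rightarrow> 'r list \<Rightarrow> 'r \<Rightarrow> 'r list \<Rightarrow>
    (('k, 'r) form_gen \<Rightarrow>\<^sub>0 int)" where
  "form_mult_rev K R x [] b bs = frag_of (x \<otimes>\<^bsub>aug K R\<^esub> (b, \<zero>\<^bsub>K\<^esub>), bs)"
| "form_mult_rev K R x (a # ras) b bs =
     frag_of (x, rev ras @ (a \<otimes>\<^bsub>R\<^esub> b) # bs) - form_mult_rev K R x ras a (b # bs)"

definition form_mult_gen ::
  "('k, 'n) ring_scheme \<Rightarrow> ('k, 'r) module \<Rightarrow> 'r \<times> 'k \<Rightarrow> 'r list \<Rightarrow> 'r \<times> 'k \<Rightarrow> 'r list \<Rightarrow>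
    (('k, 'r) form_gen \<Rightarrow>\<^sub>0 int)" where
  "form_mult_gen K R x as y bs =
     frag_of (snd y \<odot>\<^bsub>aug K R\<^esub> x, as @ bs) + form_mult_rev K R x (rev as) (fst y) bs"

definition form_mult ::
  "('k, 'n) ring_scheme \<Rightarrow> ('k, 'r) module \<Rightarrow> nat \<Rightarrow> nat \<Rightarrow>
    ('k, 'r) form \<Rightarrow> ('k, 'r) form \<Rightarrow> ('k, 'r) form" where
  "form_mult K R p q \<omega> \<eta> = form_lift K R p (form_grp K R (p + q)) (\<lambda>x as.
     form_lift K R q (form_grp K R (p + q)) (\<lambda>y bs.
       form_class K R (p + q) (form_mult_gen K R x as y bs)) \<eta>) \<omega>"

definition form_d ::
  "('k, 'n) ring_scheme \<Rightarrow> ('k, 'r) module \<Rightarrow> nat \<Rightarrow> ('k, 'r) form \<Rightarrow> ('k, 'r) form" where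
  "form_d K R n = form_lift K R n (form_grp K R (Suc n)) (\<lambda>x as.
     form_class K R (Suc n) (frag_of (\<one>\<^bsub>aug K R\<^esub>, fst x # as)))"

text \<open>The differential on \<open>R\<close> itself, with values in \<open>\<Omega>\<^sup>1(R)\<close>.\<close>

definition d_elem :: "('k, 'n) ring_scheme \<Rightarrow> ('k, 'r) module \<Rightarrow> 'r \<Rightarrow> ('k, 'r) form" where
  "d_elem K R a = form_class K R 1 (frag_of (\<one>\<^bsub>aug K R\<^esub>, [a]))"

definition Omega ::
  "('k, 'n) ring_scheme \<Rightarrow> ('k, 'r) module \<Rightarrow> nat \<Rightarrow> ('r \<times> 'k, 'r \<times> 'k, ('k, 'r) form) bimodule" where
  "Omega K R n = (let G = form_grp K R n in
     \<lparr>carrier = carrier G, monoid.mult = undefined, one = undefined, ring.zero = \<zero>\<^bsub>G\<^esub>, add = add G,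
      ract = (\<lambda>\<omega> y. form_lift K R n G (\<lambda>x as. form_class K R n (form_mult_gen K R x as y [])) \<omega>),
      lact = (\<lambda>y. form_lift K R n G
        (\<lambda>x as. form_class K R n (frag_of (y \<otimes>\<^bsub>aug K R\<^esub> x, as))))\<rparr>)"


section \<open>Connections\<close>

type_synonym ('k, 'r, 'e) form_ext = "(('e \<times> ('k, 'r) form) \<Rightarrow>\<^sub>0 int) set"

definition mod_forms ::
  "('k, 'n) ring_scheme \<Rightarrow> ('k, 'r) module \<Rightarrow> ('r \<times> 'k, 'e) rmodule \<Rightarrow> nat \<Rightarrow>
    ('r \<times> 'k, ('k, 'r, 'e) form_ext) rmodule" where
  "mod_forms K R E n = tensor E (aug K R) (Omega K R n)"

definition form_tens ::
  "('k, 'n) ring_scheme \<Rightarrow> ('k, 'r) module \<Rightarrow> ('r \<times> 'k, 'e) rmodule \<Rightarrow> nat \<Rightarrow>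
    'e \<Rightarrow> ('k, 'r) form \<Rightarrow> ('k, 'r, 'e) form_ext" where
  "form_tens K R E n = tens E (aug K R) (Omega K R n)"

text \<open>The \<open>K\<close>-vector space structures come from the embedding \<open>c \<mapsto> (\<zero>, c)\<close> of \<open>K\<close> in \<open>\<tilde>R\<close>.\<close>

definition connection ::
  "('k, 'n) ring_scheme \<Rightarrow> ('k, 'r) module \<Rightarrow> ('r \<times> 'k, 'e) rmodule \<Rightarrow>
    ('e \<Rightarrow> ('k, 'r, 'e) form_ext) \<Rightarrow> bool" where
  "connection K R E D \<longleftrightarrow>
     right_module (aug K R) E \<and>
     D \<in> extensional (carrier E) \<and>
     D \<in> hom (add_monoid E) (add_monoid (mod_forms K R E 1)) \<and>
     (\<forall>e\<in>carrier E. \<forall>c\<in>carrier K.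
        D (e \<lhd>\<^bsub>E\<^esub> (\<zero>\<^bsub>R\<^esub>, c)) = D e \<lhd>\<^bsub>mod_forms K R E 1\<^esub> (\<zero>\<^bsub>R\<^esub>, c)) \<and>
     (\<forall>e\<in>carrier E. \<forall>a\<in>carrier R.
        D (e \<lhd>\<^bsub>E\<^esub> (a, \<zero>\<^bsub>K\<^esub>)) = D e \<lhd>\<^bsub>mod_forms K R E 1\<^esub> (a, \<zero>\<^bsub>K\<^esub>)
          \<oplus>\<^bsub>mod_forms K R E 1\<^esub> form_tens K R E 1 e (d_elem K R a))"

text \<open>The product \<open>(e \<otimes> \<omega>) \<eta> = e \<otimes> \<omega>\<eta>\<close> for \<open>\<omega> \<in> \<Omega>\<^sup>p(R)\<close>, \<open>\<eta> \<in> \<Omega>\<^sup>q(R)\<close>.\<close>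

definition mod_forms_mult ::
  "('k, 'n) ring_scheme \<Rightarrow> ('k, 'r) module \<Rightarrow> ('r \<times> 'k, 'e) rmodule \<Rightarrow> nat \<Rightarrow> nat \<Rightarrow>
    ('k, 'r, 'e) form_ext \<Rightarrow> ('k, 'r) form \<Rightarrow> ('k, 'r, 'e) form_ext" where
  "mod_forms_mult K R E p q t \<eta> =
     tensor_lift E (aug K R) (Omega K R p) (mod_forms K R E (p + q))
       (\<lambda>e \<omega>. form_tens K R E (p + q) e (form_mult K R p q \<omega> \<eta>)) t"

text \<open>
  The extension of \<open>\<nabla>\<close> to \<open>E \<otimes> \<Omega>\<^sup>n(R) \<rightarrow> E \<otimes> \<Omega>\<^bsup>n+1\<^esup>(R)\<close>, \<open>n \<ge> 1\<close>.  In degree 0 the complex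
  consists of \<open>E\<close> itself and the differential is \<open>\<nabla>\<close>.
\<close>

definition connection_ext ::
  "('k, 'n) ring_scheme \<Rightarrow> ('k, 'r) module \<Rightarrow> ('r \<times> 'k, 'e) rmodule \<Rightarrow>
    ('e \<Rightarrow> ('k, 'r, 'e) form_ext) \<Rightarrow> nat \<Rightarrow> ('k, 'r, 'e) form_ext \<Rightarrow> ('k, 'r, 'e) form_ext" where
  "connection_ext K R E D n =
     tensor_lift E (aug K R) (Omega K R n) (mod_forms K R E (Suc n))
       (\<lambda>e \<omega>. mod_forms_mult K R E 1 n (D e) \<omega> \<oplus>\<^bsub>mod_forms K R E (Suc n)\<^esub>
              form_tens K R E (Suc n) e (form_d K R n \<omega>))"

definition flat_connection ::
  "('k, 'n) ring_scheme \<Rightarrow> ('k, 'r) module \<Rightarrow> ('r \<times> 'k, 'e) rmodule \<Rightarrow>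
    ('e \<Rightarrow> ('k, 'r, 'e) form_ext) \<Rightarrow> bool" where
  "flat_connection K R E D \<longleftrightarrow>
     connection K R E D \<and>
     (\<forall>e\<in>carrier E. connection_ext K R E D 1 (D e) = \<zero>\<^bsub>mod_forms K R E 2\<^esub>) \<and>
     (\<forall>n\<ge>1. \<forall>t\<in>carrier (mod_forms K R E n).
        connection_ext K R E D (Suc n) (connection_ext K R E D n t) =
          \<zero>\<^bsub>mod_forms K R E (Suc (Suc n))\<^esub>)"

definition conn_hom ::
  "('k, 'n) ring_scheme \<Rightarrow> ('k, 'r) module \<Rightarrow>
    ('r \<times> 'k, 'e) rmodule \<times> ('e \<Rightarrow> ('k, 'r, 'e) form_ext) \<Rightarrow>
    ('r \<times> 'k, 'e) rmodule \<times> ('e \<Rightarrow> ('k, 'r, 'e) form_ext) \<Rightarrow> ('e \<Rightarrow> 'e) set" where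
  "conn_hom K R = (\<lambda>(E, D) (F, D').
     {f \<in> rmod_hom (aug K R) E F. \<forall>e\<in>carrier E.
        D' (f e) = tensor_lift E (aug K R) (Omega K R 1) (mod_forms K R F 1)
                    (\<lambda>e \<omega>. form_tens K R F 1 (f e) \<omega>) (D e)})"


section \<open>The connection of a stratification\<close>

definition sq_zero_ext ::
  "('k, 'n) ring_scheme \<Rightarrow> ('k, 'r) module \<Rightarrow> ('k, 'r \<times> ('k, 'r) form) module" where
  "sq_zero_ext K R = (let L = Omega K R 1 in
     \<lparr>carrier = carrier R \<times> carrier L,
      monoid.mult = (\<lambda>(a, \<omega>) (b, \<eta>).
        (a \<otimes>\<^bsub>R\<^esub> b, ((a, \<zero>\<^bsub>K\<^esub>) \<rhd>\<^bsub>L\<^esub> \<eta>) \<oplus>\<^bsub>L\<^esub> (\<omega> \<lhd>\<^bsub>L\<^esub> (b, \<zero>\<^bsub>K\<^esub>)))),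
      one = undefined,
      ring.zero = (\<zero>\<^bsub>R\<^esub>, \<zero>\<^bsub>L\<^esub>),
      add = (\<lambda>(a, \<omega>) (b, \<eta>). (a \<oplus>\<^bsub>R\<^esub> b, \<omega> \<oplus>\<^bsub>L\<^esub> \<eta>)),
      smult = (\<lambda>c (a, \<omega>). (c \<odot>\<^bsub>R\<^esub> a, (\<zero>\<^bsub>R\<^esub>, c) \<rhd>\<^bsub>L\<^esub> \<omega>))\<rparr>)"

text \<open>
  The isomorphism \<open>Cyl\<^sup>1(R)\<^sub>2 \<rightarrow> R \<oplus> \<Omega>\<^sup>1(R)\<close>, \<open>\<partial>\<^sup>1(a) \<mapsto> a\<close>, \<open>\<partial>\<^sup>0(a) \<mapsto> a + da\<close>.  Since
  \<open>\<partial>\<^sup>1\<close> misses the vertex 1, it is the inclusion of the copy of \<open>R\<close> with index 0.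
\<close>

definition cyl_sq_zero ::
  "('k, 'n) ring_scheme \<Rightarrow> ('k, 'r) module \<Rightarrow> ('k, 'r) cterm set set \<Rightarrow> 'r \<times> ('k, 'r) form" where
  "cyl_sq_zero K R X = the_elem (copair (sq_zero_ext K R)
     (\<lambda>i a. if i = 0 then (a, \<zero>\<^bsub>Omega K R 1\<^esub>) else (a, d_elem K R a)) ` X)"

text \<open>The projection \<open>\<partial>\<^sup>1\<^sub>2(E) = E \<oplus> E \<otimes> \<Omega>\<^sup>1(R) \<rightarrow> E \<otimes> \<Omega>\<^sup>1(R)\<close>.\<close>

definition face_form_proj ::
  "('k, 'n) ring_scheme \<Rightarrow> ('k, 'r) module \<Rightarrow> ('r \<times> 'k, 'e) rmodule \<Rightarrow>
    ('k, 'r, 'e) cyl_ext \<Rightarrow> ('k, 'r, 'e) form_ext" where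
  "face_form_proj K R E =
     tensor_lift E (aug K R) (ring_bimodule (face0 K R 1 2) (cyl1 K R 2)) (mod_forms K R E 1)
       (\<lambda>e (x, c). form_tens K R E 1 e (snd (cyl_sq_zero K R x)))"

definition strat_coface ::
  "('k, 'n) ring_scheme \<Rightarrow> ('k, 'r) module \<Rightarrow> ('r \<times> 'k, 'e) rmodule \<Rightarrow> ('k, 'r, 'e) strat \<Rightarrow>
    'e \<Rightarrow> ('k, 'r, 'e) cyl_ext" where
  "strat_coface K R E \<theta> e = \<theta> 2 (face_unit K R E 0 2 e)"

definition strat_connection ::
  "('k, 'n) ring_scheme \<Rightarrow> ('k, 'r) module \<Rightarrow> ('r \<times> 'k, 'e) rmodule \<Rightarrow> ('k, 'r, 'e) strat \<Rightarrow>
    'e \<Rightarrow> ('k, 'r, 'e) form_ext" where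
  "strat_connection K R E \<theta> =
     restrict (face_form_proj K R E \<circ> strat_coface K R E \<theta>) (carrier E)"


section \<open>Categories\<close>

record ('o, 'h) category =
  Obj :: "'o set"
  Hom :: "'o \<Rightarrow> 'o \<Rightarrow> 'h set"
  Id :: "'o \<Rightarrow> 'h"
  Comp :: "'o \<Rightarrow> 'o \<Rightarrow> 'o \<Rightarrow> 'h \<Rightarrow> 'h \<Rightarrow> 'h" \<comment> \<open>\<open>Comp C X Y Z g f\<close> is \<open>g \<circ> f : X \<rightarrow> Y \<rightarrow> Z\<close>\<close>

definition is_category :: "('o, 'h) category \<Rightarrow> bool" where
  "is_category C \<longleftrightarrow>
     (\<forall>X\<in>Obj C. Id C X \<in> Hom C X X) \<and>
     (\<forall>X\<in>Obj C. \<forall>Y\<in>Obj C. \<forall>Z\<in>Obj C. \<forall>f\<in>Hom C X Y. \<forall>g\<in>Hom C Y Z.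
        Comp C X Y Z g f \<in> Hom C X Z) \<and>
     (\<forall>X\<in>Obj C. \<forall>Y\<in>Obj C. \<forall>f\<in>Hom C X Y.
        Comp C X X Y f (Id C X) = f \<and> Comp C X Y Y (Id C Y) f = f) \<and>
     (\<forall>W\<in>Obj C. \<forall>X\<in>Obj C. \<forall>Y\<in>Obj C. \<forall>Z\<in>Obj C.
        \<forall>f\<in>Hom C W X. \<forall>g\<in>Hom C X Y. \<forall>h\<in>Hom C Y Z.
        Comp C W Y Z h (Comp C W X Y g f) = Comp C W X Z (Comp C X Y Z h g) f)"

definition is_functor ::
  "('o, 'h) category \<Rightarrow> ('p, 'i) category \<Rightarrow> ('o \<Rightarrow> 'p) \<Rightarrow> ('o \<Rightarrow> 'o \<Rightarrow> 'h \<Rightarrow> 'i) \<Rightarrow> bool" where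
  "is_functor C D F \<Phi> \<longleftrightarrow>
     (\<forall>X\<in>Obj C. F X \<in> Obj D) \<and>
     (\<forall>X\<in>Obj C. \<forall>Y\<in>Obj C. \<forall>f\<in>Hom C X Y. \<Phi> X Y f \<in> Hom D (F X) (F Y)) \<and>
     (\<forall>X\<in>Obj C. \<Phi> X X (Id C X) = Id D (F X)) \<and>
     (\<forall>X\<in>Obj C. \<forall>Y\<in>Obj C. \<forall>Z\<in>Obj C. \<forall>f\<in>Hom C X Y. \<forall>g\<in>Hom C Y Z.
        \<Phi> X Z (Comp C X Y Z g f) = Comp D (F X) (F Y) (F Z) (\<Phi> Y Z g) (\<Phi> X Y f))"

definition is_cat_iso ::
  "('o, 'h) category \<Rightarrow> ('p, 'i) category \<Rightarrow> ('o \<Rightarrow> 'p) \<Rightarrow> ('o \<Rightarrow> 'o \<Rightarrow> 'h \<Rightarrow> 'i) \<Rightarrow> bool" where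
  "is_cat_iso C D F \<Phi> \<longleftrightarrow>
     is_category C \<and> is_category D \<and> is_functor C D F \<Phi> \<and>
     (\<exists>G \<Psi>. is_functor D C G \<Psi> \<and>
       (\<forall>X\<in>Obj C. G (F X) = X) \<and> (\<forall>Y\<in>Obj D. F (G Y) = Y) \<and>
       (\<forall>X\<in>Obj C. \<forall>X'\<in>Obj C. \<forall>f\<in>Hom C X X'. \<Psi> (F X) (F X') (\<Phi> X X' f) = f) \<and>
       (\<forall>Y\<in>Obj D. \<forall>Y'\<in>Obj D. \<forall>g\<in>Hom D Y Y'. \<Phi> (G Y) (G Y') (\<Psi> Y Y' g) = g))"

definition strat_category ::
  "('k, 'n) ring_scheme \<Rightarrow> ('k, 'r) module \<Rightarrow>
    (('r \<times> 'k, 'e) rmodule \<times> ('k, 'r, 'e) strat, 'e \<Rightarrow> 'e) category" where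
  "strat_category K R = \<lparr>Obj = {(E, \<theta>). stratification K R E \<theta>}, Hom = strat_hom K R,
     Id = (\<lambda>(E, \<theta>). restrict id (carrier E)),
     Comp = (\<lambda>(E, \<theta>) Y Z g f. compose (carrier E) g f)\<rparr>"

definition conn_category ::
  "('k, 'n) ring_scheme \<Rightarrow> ('k, 'r) module \<Rightarrow>
    (('r \<times> 'k, 'e) rmodule \<times> ('e \<Rightarrow> ('k, 'r, 'e) form_ext), 'e \<Rightarrow> 'e) category" where
  "conn_category K R = \<lparr>Obj = {(E, D). flat_connection K R E D}, Hom = conn_hom K R,
     Id = (\<lambda>(E, D). restrict id (carrier E)),
     Comp = (\<lambda>(E, D) Y Z g f. compose (carrier E) g f)\<rparr>"


section \<open>Quasi-free algebras\<close>

definition quasi_free_lifting ::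
  "('k, 'n) ring_scheme \<Rightarrow> ('k, 'r) module \<Rightarrow> ('k, 'b) module \<Rightarrow> ('k, 'c) module \<Rightarrow> bool" where
  "quasi_free_lifting K R B C \<longleftrightarrow>
     (\<forall>p\<in>alg_hom K B C. \<forall>f\<in>alg_hom K R C.
        p ` carrier B = carrier C \<longrightarrow>
        (\<exists>n\<ge>1. ideal_pow B (a_kernel B C p) n = {\<zero>\<^bsub>B\<^esub>}) \<longrightarrow>
        (\<exists>g\<in>alg_hom K R B. \<forall>a\<in>carrier R. p (g a) = f a))"

text \<open>
  HOL cannot quantify over algebras of all types inside a formula, so the test algebras have
  their carriers in one fixed type.  That type is large enough: see \<open>quasi_free_lifts\<close> below.
\<close>

definition quasi_free :: "('k, 'n) ring_scheme \<Rightarrow> ('k, 'r) module \<Rightarrow> bool" where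
  "quasi_free K R \<longleftrightarrow> nu_algebra K R \<and>
     (\<forall>(B :: ('k, ('k, 'r) cterm set) module) (C :: ('k, ('k, 'r) cterm set) module).
        nu_algebra K B \<longrightarrow> nu_algebra K C \<longrightarrow> quasi_free_lifting K R B C)"

text \<open>A subalgebra \<open>D\<close> of \<open>B\<close>, transported to another type along an injection \<open>j\<close>.\<close>

definition copy_alg :: "('k, 'b) module \<Rightarrow> 'b set \<Rightarrow> ('b \<Rightarrow> 'u) \<Rightarrow> ('k, 'u) module" where
  "copy_alg B D j = \<lparr>carrier = j ` D,
     monoid.mult = (\<lambda>x y. j (inv_into D j x \<otimes>\<^bsub>B\<^esub> inv_into D j y)), one = undefined,
     ring.zero = j \<zero>\<^bsub>B\<^esub>, add = (\<lambda>x y. j (inv_into D j x \<oplus>\<^bsub>B\<^esub> inv_into D j y)),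
     smult = (\<lambda>c x. j (c \<odot>\<^bsub>B\<^esub> inv_into D j x))\<rparr>"

locale subalgebra_copy = nu_algebra K B
  for K :: "('k, 'n) ring_scheme" (structure) and B :: "('k, 'c) module" (structure) +
  fixes D :: "'c set" and j :: "'c \<Rightarrow> 'u"
  assumes sub: "D \<subseteq> carrier B" and inj: "inj_on j D"
    and zero_in: "\<zero>\<^bsub>B\<^esub> \<in> D"
    and add_in: "\<And>x y. \<lbrakk>x \<in> D; y \<in> D\<rbrakk> \<Longrightarrow> x \<oplus>\<^bsub>B\<^esub> y \<in> D"
    and mult_in: "\<And>x y. \<lbrakk>x \<in> D; y \<in> D\<rbrakk> \<Longrightarrow> x \<otimes>\<^bsub>B\<^esub> y \<in> D"
    and smult_in: "\<And>c x. \<lbrakk>c \<in> carrier K; x \<in> D\<rbrakk> \<Longrightarrow> c \<odot>\<^bsub>B\<^esub> x \<in> D"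
begin

lemma copy_carrier: "carrier (copy_alg B D j) = j ` D"
  by (simp add: copy_alg_def)

lemma copy_simps [simp]:
  "\<zero>\<^bsub>copy_alg B D j\<^esub> = j \<zero>\<^bsub>B\<^esub>"
  "x \<in> D \<Longrightarrow> inv_into D j (j x) = x"
  "\<lbrakk>x \<in> D; y \<in> D\<rbrakk> \<Longrightarrow> j x \<otimes>\<^bsub>copy_alg B D j\<^esub> j y = j (x \<otimes>\<^bsub>B\<^esub> y)"
  "\<lbrakk>x \<in> D; y \<in> D\<rbrakk> \<Longrightarrow> j x \<oplus>\<^bsub>copy_alg B D j\<^esub> j y = j (x \<oplus>\<^bsub>B\<^esub> y)"
  "x \<in> D \<Longrightarrow> c \<odot>\<^bsub>copy_alg B D j\<^esub> j x = j (c \<odot>\<^bsub>B\<^esub> x)"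
  using inj by (simp_all add: copy_alg_def)

lemma neg_in: "x \<in> D \<Longrightarrow> \<ominus>\<^bsub>B\<^esub> x \<in> D"
proof -
  assume x: "x \<in> D"
  with sub have xB: "x \<in> carrier B" by auto
  have "(\<ominus> \<one>) \<odot>\<^bsub>B\<^esub> x = \<ominus>\<^bsub>B\<^esub> x"
    using xB smult_l_minus[of \<one> x] smult_one[of x] by simp
  with smult_in[OF _ x, of "\<ominus> \<one>"] show ?thesis by simp
qed

lemma copy_nu_algebra: "nu_algebra K (copy_alg B D j)"
proof -
  let ?T = "copy_alg B D j"
  have mem: "\<And>x. x \<in> D \<Longrightarrow> x \<in> carrier B" using sub by auto
  have ab: "abelian_group ?T"
  proof (rule abelian_groupI)
    fix x assume "x \<in> carrier ?T"
    then obtain a where a: "a \<in> D" "x = j a" by (auto simp: copy_carrier)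
    then show "\<exists>y\<in>carrier ?T. y \<oplus>\<^bsub>?T\<^esub> x = \<zero>\<^bsub>?T\<^esub>"
      by (intro bexI[of _ "j (\<ominus>\<^bsub>B\<^esub> a)"]) (simp_all add: neg_in copy_carrier M.l_neg mem)
  qed (auto simp: copy_carrier add_in zero_in mem M.a_ac)
  have md: "module K ?T"
    by (rule moduleI[OF cring_axioms ab])
      (auto simp: copy_carrier smult_in add_in smult_l_distr smult_r_distr smult_assoc1 mem)
  show ?thesis
    by (intro nu_algebra.intro nu_algebra_axioms.intro md field_axioms)
      (auto simp: copy_carrier add_in mult_in smult_in mem
        nu_mult_assoc nu_l_distr nu_r_distr nu_smult_l nu_smult_r)
qed

end

lemma quasi_free_lifts:
  fixes K :: "('k, 'n) ring_scheme" and R :: "('k, 'r) module"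
    and B :: "('k, 'b) module" and C :: "('k, 'c) module"
  assumes qf: "quasi_free K R" and B: "nu_algebra K B" and C: "nu_algebra K C"
  shows "quasi_free_lifting K R B C"
  unfolding quasi_free_lifting_def
proof (intro ballI impI)
  fix p f
  assume p: "p \<in> alg_hom K B C" and f: "f \<in> alg_hom K R C"
    and surj: "p ` carrier B = carrier C"
    and nil: "\<exists>n\<ge>1. ideal_pow B (a_kernel B C p) n = {\<zero>\<^bsub>B\<^esub>}"
  interpret B: nu_algebra K B by fact
  interpret C: nu_algebra K C by fact
  interpret R: nu_algebra K R using qf by (simp add: quasi_free_def)
  have p_in: "\<And>x. x \<in> carrier B \<Longrightarrow> p x \<in> carrier C"
    and p_add: "\<And>x y. \<lbrakk>x \<in> carrier B; y \<in> carrier B\<rbrakk> \<Longrightarrow> p (x \<oplus>\<^bsub>B\<^esub> y) = p x \<oplus>\<^bsub>C\<^esub> p y"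
    and p_mult: "\<And>x y. \<lbrakk>x \<in> carrier B; y \<in> carrier B\<rbrakk> \<Longrightarrow> p (x \<otimes>\<^bsub>B\<^esub> y) = p x \<otimes>\<^bsub>C\<^esub> p y"
    and p_smult: "\<And>c x. \<lbrakk>c \<in> carrier K; x \<in> carrier B\<rbrakk> \<Longrightarrow> p (c \<odot>\<^bsub>B\<^esub> x) = c \<odot>\<^bsub>C\<^esub> p x"
    using p by (auto simp: alg_hom_def hom_def)
  have f_in: "\<And>x. x \<in> carrier R \<Longrightarrow> f x \<in> carrier C"
    and f_add: "\<And>x y. \<lbrakk>x \<in> carrier R; y \<in> carrier R\<rbrakk> \<Longrightarrow> f (x \<oplus>\<^bsub>R\<^esub> y) = f x \<oplus>\<^bsub>C\<^esub> f y"
    and f_mult: "\<And>x y. \<lbrakk>x \<in> carrier R; y \<in> carrier R\<rbrakk> \<Longrightarrow> f (x \<otimes>\<^bsub>R\<^esub> y) = f x \<otimes>\<^bsub>C\<^esub> f y"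
    and f_smult: "\<And>c x. \<lbrakk>c \<in> carrier K; x \<in> carrier R\<rbrakk> \<Longrightarrow> f (c \<odot>\<^bsub>R\<^esub> x) = c \<odot>\<^bsub>C\<^esub> f x"
    using f by (auto simp: alg_hom_def hom_def)
  have p_zero: "p \<zero>\<^bsub>B\<^esub> = \<zero>\<^bsub>C\<^esub>"
    using p_smult[of "\<zero>\<^bsub>K\<^esub>" "\<zero>\<^bsub>B\<^esub>"] p_in[of "\<zero>\<^bsub>B\<^esub>"] by simp
  have "\<forall>a\<in>carrier R. \<exists>b\<in>carrier B. p b = f a" using surj f_in by (metis imageE)
  then obtain s where s: "\<And>a. a \<in> carrier R \<Longrightarrow> s a \<in> carrier B \<and> p (s a) = f a" by metis
  define ev where "ev = ceval B (\<lambda>_. s)"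
  define D where "D = ev ` cterms K R 0"
  define E where "E = p ` D"
  define j where "j = (\<lambda>d. {t \<in> cterms K R 0. ev t = d})"
  define l where "l = (\<lambda>c. {t \<in> cterms K R 0. p (ev t) = c})"
  have ev_in: "ev t \<in> carrier B" if "t \<in> cterms K R 0" for t
    using that by induction (auto simp: ev_def s B.nu_mult_closed)
  have DB: "D \<subseteq> carrier B" using ev_in by (auto simp: D_def)
  have inj_j: "inj_on j D"
    unfolding inj_on_def D_def j_def by blast
  have inj_l: "inj_on l E"
    unfolding inj_on_def D_def E_def l_def by blast
  have D0: "\<zero>\<^bsub>B\<^esub> \<in> D"
    unfolding D_def by (rule image_eqI[of _ _ CZero]) (auto simp: ev_def intro: cterms.intros)
  have Dadd: "x \<oplus>\<^bsub>B\<^esub> y \<in> D" if xy: "x \<in> D" "y \<in> D" for x y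
  proof -
    from xy obtain t u where "t \<in> cterms K R 0" "u \<in> cterms K R 0" "x = ev t" "y = ev u"
      by (auto simp: D_def)
    then show ?thesis unfolding D_def
      by (intro image_eqI[of _ _ "CAdd t u"]) (auto simp: ev_def intro: cterms.intros)
  qed
  have Dmult: "x \<otimes>\<^bsub>B\<^esub> y \<in> D" if xy: "x \<in> D" "y \<in> D" for x y
  proof -
    from xy obtain t u where "t \<in> cterms K R 0" "u \<in> cterms K R 0" "x = ev t" "y = ev u"
      by (auto simp: D_def)
    then show ?thesis unfolding D_def
      by (intro image_eqI[of _ _ "CMult t u"]) (auto simp: ev_def intro: cterms.intros)
  qed
  have Dsmult: "c \<odot>\<^bsub>B\<^esub> x \<in> D" if cx: "c \<in> carrier K" "x \<in> D" for c x
  proof -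
    from cx obtain t where "t \<in> cterms K R 0" "x = ev t"
      by (auto simp: D_def)
    with cx show ?thesis unfolding D_def
      by (intro image_eqI[of _ _ "CScal c t"]) (auto simp: ev_def intro: cterms.intros)
  qed
  have Dmem: "\<And>x. x \<in> D \<Longrightarrow> x \<in> carrier B" using DB by auto
  interpret JD: subalgebra_copy K B D j
    by unfold_locales (use DB inj_j D0 Dadd Dmult Dsmult in auto)
  have Eadd: "x \<oplus>\<^bsub>C\<^esub> y \<in> E" if "x \<in> E" "y \<in> E" for x y
    using that unfolding E_def by (auto simp: Dmem simp flip: p_add intro!: imageI Dadd)
  have Emult: "x \<otimes>\<^bsub>C\<^esub> y \<in> E" if "x \<in> E" "y \<in> E" for x y
    using that unfolding E_def by (auto simp: Dmem simp flip: p_mult intro!: imageI Dmult)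
  have Esmult: "c \<odot>\<^bsub>C\<^esub> x \<in> E" if "c \<in> carrier K" "x \<in> E" for c x
    using that unfolding E_def by (auto simp: Dmem simp flip: p_smult intro!: imageI Dsmult)
  have E0: "\<zero>\<^bsub>C\<^esub> \<in> E" unfolding E_def using D0 p_zero by force
  interpret JE: subalgebra_copy K C E l
    by unfold_locales (use inj_l E0 Eadd Emult Esmult in \<open>auto simp: E_def Dmem p_in\<close>)
  let ?B = "copy_alg B D j" and ?C = "copy_alg C E l"
  define p' where "p' = (\<lambda>x. l (p (inv_into D j x)))"
  have pE: "\<And>x. x \<in> D \<Longrightarrow> p x \<in> E" by (simp add: E_def)
  have p'_j: "\<And>x. x \<in> D \<Longrightarrow> p' (j x) = l (p x)" by (simp add: p'_def)
  have p'_hom: "p' \<in> alg_hom K ?B ?C"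
    by (auto simp: alg_hom_def hom_def JD.copy_carrier JE.copy_carrier p'_j pE
        Dadd Dmult Dsmult p_add p_mult p_smult Dmem)
  have p'_surj: "p' ` carrier ?B = carrier ?C"
    unfolding JD.copy_carrier JE.copy_carrier by (auto simp: E_def image_image p'_j)
  have fE: "f a \<in> E" if a: "a \<in> carrier R" for a
  proof -
    have "s a \<in> D" unfolding D_def
      by (rule image_eqI[of _ _ "Gen 0 a"]) (auto simp: ev_def a intro: cterms.intros)
    then show ?thesis using s[OF a] unfolding E_def by force
  qed
  define f' where "f' = (\<lambda>a. l (f a))"
  have f'_hom: "f' \<in> alg_hom K R ?C"
    by (auto simp: alg_hom_def hom_def JE.copy_carrier f'_def fE f_add f_mult f_smult)
  obtain n where n: "n \<ge> 1" "ideal_pow B (a_kernel B C p) n = {\<zero>\<^bsub>B\<^esub>}" using nil by blast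
  let ?I = "a_kernel B C p" and ?I' = "a_kernel ?B ?C p'"
  have ker: "\<exists>d\<in>D. x = j d \<and> d \<in> ?I" if x: "x \<in> ?I'" for x
  proof -
    from x obtain d where d: "d \<in> D" "x = j d" "p' x = l \<zero>\<^bsub>C\<^esub>"
      by (auto simp: a_kernel_def' JD.copy_carrier)
    then have "p d = \<zero>\<^bsub>C\<^esub>" using inj_onD[OF inj_l _ pE E0] by (simp add: p'_j)
    with d show ?thesis by (auto simp: a_kernel_def' Dmem)
  qed
  have pow: "\<exists>d\<in>D. x = j d \<and> d \<in> ideal_pow B ?I (Suc m)" if "x \<in> ideal_pow ?B ?I' (Suc m)" for x m
    using that
  proof (induction m arbitrary: x)
    case 0
    then show ?case using ker by simp
  next
    case (Suc m)
    from Suc.prems have "x \<in> ideal_prod ?B (ideal_pow ?B ?I' (Suc m)) ?I'" by simp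
    then have "\<exists>d\<in>D. x = j d \<and> d \<in> ideal_prod B (ideal_pow B ?I (Suc m)) ?I"
    proof induction
      case (prod a b)
      from Suc.IH[OF prod(1)] ker[OF prod(2)] obtain u v
        where uv: "u \<in> D" "a = j u" "u \<in> ideal_pow B ?I (Suc m)" "v \<in> D" "b = j v" "v \<in> ?I"
        by blast
      then have "u \<otimes>\<^bsub>B\<^esub> v \<in> ideal_prod B (ideal_pow B ?I (Suc m)) ?I"
        by (intro ideal_prod.prod)
      with uv Dmult show ?case by (intro bexI[of _ "u \<otimes>\<^bsub>B\<^esub> v"]) simp_all
    next
      case (sum a b)
      then obtain u v where uv: "u \<in> D" "a = j u" "v \<in> D" "b = j v"
        "u \<in> ideal_prod B (ideal_pow B ?I (Suc m)) ?I"
        "v \<in> ideal_prod B (ideal_pow B ?I (Suc m)) ?I"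
        by blast
      then have "u \<oplus>\<^bsub>B\<^esub> v \<in> ideal_prod B (ideal_pow B ?I (Suc m)) ?I"
        by (intro ideal_prod.sum)
      with uv Dadd show ?case by (intro bexI[of _ "u \<oplus>\<^bsub>B\<^esub> v"]) simp_all
    qed
    then show ?case by simp
  qed
  have zero_ker: "j \<zero>\<^bsub>B\<^esub> \<in> ?I'"
    by (auto simp: a_kernel_def' JD.copy_carrier D0 p'_j p_zero)
  have zero_pow: "j \<zero>\<^bsub>B\<^esub> \<in> ideal_pow ?B ?I' (Suc m)" for m
  proof (induction m)
    case 0
    show ?case using zero_ker by simp
  next
    case (Suc m)
    have "\<zero>\<^bsub>B\<^esub> \<otimes>\<^bsub>B\<^esub> \<zero>\<^bsub>B\<^esub> = \<zero>\<^bsub>B\<^esub>"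
      using B.nu_smult_l[of "\<zero>\<^bsub>K\<^esub>" "\<zero>\<^bsub>B\<^esub>" "\<zero>\<^bsub>B\<^esub>"] B.nu_mult_closed[of "\<zero>\<^bsub>B\<^esub>" "\<zero>\<^bsub>B\<^esub>"] by simp
    with ideal_prod.prod[OF Suc.IH zero_ker, of ?B] show ?case by (simp add: D0)
  qed
  obtain m where m: "n = Suc m" using n(1) by (cases n) auto
  have "ideal_pow ?B ?I' n = {\<zero>\<^bsub>?B\<^esub>}"
  proof
    show "ideal_pow ?B ?I' n \<subseteq> {\<zero>\<^bsub>?B\<^esub>}"
    proof
      fix x assume "x \<in> ideal_pow ?B ?I' n"
      with pow[of x m] obtain d where "x = j d" "d \<in> ideal_pow B ?I n" unfolding m by blast
      with n(2) show "x \<in> {\<zero>\<^bsub>?B\<^esub>}" by simp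
    qed
    show "{\<zero>\<^bsub>?B\<^esub>} \<subseteq> ideal_pow ?B ?I' n" using zero_pow[of m] unfolding m by simp
  qed
  with n(1) have nil': "\<exists>n\<ge>1. ideal_pow ?B ?I' n = {\<zero>\<^bsub>?B\<^esub>}" by blast
  from qf JD.copy_nu_algebra JE.copy_nu_algebra have "quasi_free_lifting K R ?B ?C"
    by (simp add: quasi_free_def)
  from this[unfolded quasi_free_lifting_def, THEN bspec, OF p'_hom, THEN bspec, OF f'_hom,
      THEN mp, OF p'_surj, THEN mp, OF nil']
  obtain g' where g': "g' \<in> alg_hom K R ?B" "\<And>a. a \<in> carrier R \<Longrightarrow> p' (g' a) = f' a"
    by (elim bexE) (rule that, assumption, erule bspec)
  define g where "g = (\<lambda>a. inv_into D j (g' a))"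
  have g: "g a \<in> D \<and> g' a = j (g a)" if "a \<in> carrier R" for a
  proof -
    have "g' a \<in> j ` D" using g'(1) that by (auto simp: alg_hom_def hom_def JD.copy_carrier)
    then show ?thesis unfolding g_def
      using inv_into_into[of "g' a" j D] f_inv_into_f[of "g' a" j D] by metis
  qed
  have inj_g: "x = y" if "j x = j y" "x \<in> D" "y \<in> D" for x y
    using inj_onD[OF inj_j] that by blast
  have g_add: "g (a \<oplus>\<^bsub>R\<^esub> b) = g a \<oplus>\<^bsub>B\<^esub> g b" if ab: "a \<in> carrier R" "b \<in> carrier R" for a b
  proof (rule inj_g)
    have "j (g (a \<oplus>\<^bsub>R\<^esub> b)) = g' (a \<oplus>\<^bsub>R\<^esub> b)"
      using g[of "a \<oplus>\<^bsub>R\<^esub> b"] ab by simp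
    also have "\<dots> = g' a \<oplus>\<^bsub>?B\<^esub> g' b" using g'(1) ab by (simp add: alg_hom_def hom_def)
    also have "\<dots> = j (g a \<oplus>\<^bsub>B\<^esub> g b)" using g[OF ab(1)] g[OF ab(2)] by simp
    finally show "j (g (a \<oplus>\<^bsub>R\<^esub> b)) = j (g a \<oplus>\<^bsub>B\<^esub> g b)" .
  qed (use g[of "a \<oplus>\<^bsub>R\<^esub> b"] g[OF ab(1)] g[OF ab(2)] ab Dadd in simp_all)
  have g_mult: "g (a \<otimes>\<^bsub>R\<^esub> b) = g a \<otimes>\<^bsub>B\<^esub> g b" if ab: "a \<in> carrier R" "b \<in> carrier R" for a b
  proof (rule inj_g)
    have "j (g (a \<otimes>\<^bsub>R\<^esub> b)) = g' (a \<otimes>\<^bsub>R\<^esub> b)"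
      using g[of "a \<otimes>\<^bsub>R\<^esub> b"] ab R.nu_mult_closed by simp
    also have "\<dots> = g' a \<otimes>\<^bsub>?B\<^esub> g' b" using g'(1) ab by (simp add: alg_hom_def hom_def)
    also have "\<dots> = j (g a \<otimes>\<^bsub>B\<^esub> g b)" using g[OF ab(1)] g[OF ab(2)] by simp
    finally show "j (g (a \<otimes>\<^bsub>R\<^esub> b)) = j (g a \<otimes>\<^bsub>B\<^esub> g b)" .
  qed (use g[of "a \<otimes>\<^bsub>R\<^esub> b"] g[OF ab(1)] g[OF ab(2)] ab Dmult R.nu_mult_closed in simp_all)
  have g_smult: "g (c \<odot>\<^bsub>R\<^esub> a) = c \<odot>\<^bsub>B\<^esub> g a" if ca: "c \<in> carrier K" "a \<in> carrier R" for c a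
  proof (rule inj_g)
    have "j (g (c \<odot>\<^bsub>R\<^esub> a)) = g' (c \<odot>\<^bsub>R\<^esub> a)"
      using g[of "c \<odot>\<^bsub>R\<^esub> a"] ca by simp
    also have "\<dots> = c \<odot>\<^bsub>?B\<^esub> g' a" using g'(1) ca by (simp add: alg_hom_def)
    also have "\<dots> = j (c \<odot>\<^bsub>B\<^esub> g a)" using g[OF ca(2)] by simp
    finally show "j (g (c \<odot>\<^bsub>R\<^esub> a)) = j (c \<odot>\<^bsub>B\<^esub> g a)" .
  qed (use g[of "c \<odot>\<^bsub>R\<^esub> a"] g[OF ca(2)] ca Dsmult in simp_all)
  show "\<exists>g\<in>alg_hom K R B. \<forall>a\<in>carrier R. p (g a) = f a"
  proof (intro bexI[of _ g] ballI)
    show "g \<in> alg_hom K R B"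
      unfolding alg_hom_def hom_def
      by (simp add: g_add g_mult g_smult Pi_def) (use g Dmem in blast)
    fix a assume a: "a \<in> carrier R"
    have "l (p (g a)) = p' (g' a)" using g[OF a] p'_j[of "g a"] by simp
    also have "\<dots> = l (f a)" using g'(2)[OF a] by (simp add: f'_def)
    finally show "p (g a) = f a"
      by (rule inj_onD[OF inj_l]) (use g[OF a] fE[OF a] pE in simp_all)
  qed
qed

end

theory Submission
  imports Defs
begin

text \<open>
  A stratification and a flat connection carry the same information because the infinitesimal
  neighbourhoods \<open>Cyl\<^sup>1(R)\<^sub>n\<close> contain one copy of the forms in each degree \<open>q < n\<close>, while the cocycle
  condition leaves room for the form of degree 1 only.

  From a connection to a stratification. Let \<open>\<alpha>\<close> and \<open>\<beta>\<close> be homomorphisms from the augmented algebra to a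
  ring \<open>B\<close> which agree on the scalars. Then \<open>\<Psi>(e \<otimes> x dy) = e \<otimes> \<alpha>(x) (\<beta>(y) - \<alpha>(y))\<close> defines a map
  from \<open>E \<otimes> \<Omega>\<^sup>1\<close> to \<open>E \<otimes>\<^sub>\<alpha> B\<close>, and by the Leibniz rule \<open>s(e) = e \<otimes> 1 + \<Psi>(\<nabla> e)\<close> satisfies
  \<open>s(e a) = s(e) \<beta>(a)\<close>. Hence \<open>s\<close> extends to a linear map \<open>E \<otimes>\<^sub>\<beta> B \<rightarrow> E \<otimes>\<^sub>\<alpha> B\<close>, called
  \<open>transp\<close>. For three homomorphisms, the composite of two of these maps differs from the third by a term
  in \<open>\<nabla>\<^sup>2\<close> (\<open>transp_cocycle\<close>). So flatness yields the cocycle condition, and also invertibility. The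
  construction is natural in \<open>B\<close>; applied to the two copies of \<open>R\<close> in \<open>Cyl\<^sup>1(R)\<^sub>n\<close> it gives a stratification
  (\<open>strat_of_stratification\<close>).

  From a stratification to a connection. The \<open>\<theta> n\<close> are determined by the elements \<open>\<theta> n (e \<otimes> 1)\<close>. With
  \<open>\<delta>\<close> the difference of the two copies, every element of \<open>E \<otimes> Cyl\<^sup>1(R)\<^sub>n\<close> is a sum of elements
  \<open>e \<otimes> \<delta>(a\<^sub>1) \<dots> \<delta>(a\<^sub>q)\<close> with \<open>q < n\<close> (\<open>cyl1_words\<close>), hence of images of forms \<open>v\<^sub>q\<close> in \<open>E \<otimes> \<Omega>\<^sup>q\<close>. To see that the
  \<open>v\<^sub>q\<close> are determined, and to compute them, let the cylinders act on forms: if \<open>l\<close> is a sequence of scalars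
  with \<open>l\<^sub>p l\<^bsub>p+1\<^esub> = 0\<close>, then \<open>v \<mapsto> v a + l\<^sub>p v da\<close>, for \<open>v\<close> of degree \<open>p\<close>, is an action of \<open>R\<close> on the forms
  of degree less than \<open>n\<close> (\<open>act_alg_hom\<close>). A choice of \<open>m + 1\<close> sequences lets the coproduct \<open>Q\<^sup>m(R)\<close> act,
  and the action factors through \<open>Cyl\<^sup>m(R)\<^sub>n\<close> because differences of copies raise the degree. The resulting
  linear maps from \<open>E \<otimes> Cyl\<^sup>m(R)\<^sub>n\<close> to forms multiply \<open>v\<^sub>q\<close> by a product \<open>\<kappa>\<^sub>q\<close> of differences of entries of the
  sequences (\<open>det_PsiC\<close>). For the sequences \<open>(0, -1, 0, -1, \<dots>)\<close> and \<open>(1, 0, 1, 0, \<dots>)\<close> all these products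
  are 1, so that the \<open>v\<^sub>q\<close> are indeed determined. Applied to the cocycle condition in \<open>Cyl\<^sup>2(R)\<^sub>n\<close>, one choice of three
  sequences shows \<open>v\<^sub>q = 0\<close> for \<open>q \<ge> 2\<close> (\<open>comps_sec_high\<close>), and another one gives \<open>\<nabla>\<^sup>2 = 0\<close> for the connection
  \<open>\<nabla> e = v\<^sub>1\<close> (\<open>D_flat\<close>). As \<open>v\<^sub>0 = e\<close> by \<open>\<theta>\<^sub>1 = id\<close>, it follows that \<open>\<theta> n (e \<otimes> 1) = e \<otimes> 1 + \<Psi>(\<nabla> e)\<close>: the
  stratification is the one constructed from \<open>\<nabla>\<close>. The same formula shows that the two kinds of morphisms
  agree (\<open>conn_hom_iff_strat_hom\<close>).
\<close>

section \<open>Additive maps and presented abelian groups\<close>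

text \<open>The additive group of a ring record is a monoid record of its own, and additive maps are the homomorphisms
of these monoids.\<close>

abbreviation add_homs ::
 "('a, 'm) ring_scheme \<Rightarrow> ('b, 'n) ring_scheme \<Rightarrow> ('a \<Rightarrow> 'b) set" where
 "add_homs X Y \<equiv> hom (add_monoid X) (add_monoid Y)"

lemma add_homs_I:
 assumes "\<And>x. x \<in> carrier X ==> h x \<in> carrier Y"
  and "\<And>x y. [|x \<in> carrier X; y \<in> carrier X|] ==> h (x \<oplus>\<^bsub>X\<^esub> y) = h x \<oplus>\<^bsub>Y\<^esub> h y"
 shows "h \<in> add_homs X Y"
 using assms by (auto simp: hom_def)

lemma add_homs_closed: "[|h \<in> add_homs X Y; x \<in> carrier X|] ==> h x \<in> carrier Y"
 by (auto simp: hom_def)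

lemma add_homs_add:
 "[|h \<in> add_homs X Y; x \<in> carrier X; y \<in> carrier X|] ==> h (x \<oplus>\<^bsub>X\<^esub> y) = h x \<oplus>\<^bsub>Y\<^esub> h y"
 by (auto simp: hom_def)

lemma add_homs_group_hom:
 assumes "abelian_group X" "abelian_group Y" "h \<in> add_homs X Y"
 shows "group_hom (add_monoid X) (add_monoid Y) h"
 using assms by (simp add: group_hom_def group_hom_axioms_def abelian_group.a_group)

lemma add_homs_zero:
 assumes "abelian_group X" "abelian_group Y" "h \<in> add_homs X Y"
 shows "h \<zero>\<^bsub>X\<^esub> = \<zero>\<^bsub>Y\<^esub>"
 using group_hom.hom_one[OF add_homs_group_hom[OF assms]] by simp

lemma add_homs_neg:
 assumes "abelian_group X" "abelian_group Y" "h \<in> add_homs X Y" "x \<in> carrier X"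
 shows "h (\<ominus>\<^bsub>X\<^esub> x) = \<ominus>\<^bsub>Y\<^esub> h x"
 using group_hom.hom_inv[OF add_homs_group_hom[OF assms(1-3)], of x] assms(4)
 by (simp add: a_inv_def)

lemma add_homs_minus:
 assumes "abelian_group X" "abelian_group Y" "h \<in> add_homs X Y" "x \<in> carrier X" "y \<in> carrier X"
 shows "h (x \<ominus>\<^bsub>X\<^esub> y) = h x \<ominus>\<^bsub>Y\<^esub> h y"
 using assms by (simp add: a_minus_def add_homs_add add_homs_neg abelian_group.a_inv_closed)

lemma add_homs_comp: "[|h \<in> add_homs X Y; g \<in> add_homs Y Z|] ==> (\<lambda>x. g (h x)) \<in> add_homs X Z"
 by (rule add_homs_I) (auto simp: add_homs_closed add_homs_add)

lemma add_homs_pointwise_add: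
 assumes "abelian_group Y" "h \<in> add_homs X Y" "g \<in> add_homs X Y"
 shows "(\<lambda>x. h x \<oplus>\<^bsub>Y\<^esub> g x) \<in> add_homs X Y"
proof -
 interpret Y: abelian_group Y by fact
 show ?thesis
  by (rule add_homs_I) (use assms in \<open>auto simp: add_homs_closed add_homs_add Y.a_ac\<close>)
qed

lemma add_homs_pointwise_minus:
 assumes "abelian_group Y" "h \<in> add_homs X Y" "g \<in> add_homs X Y"
 shows "(\<lambda>x. h x \<ominus>\<^bsub>Y\<^esub> g x) \<in> add_homs X Y"
proof -
 interpret Y: abelian_group Y by fact
 show ?thesis
  by (rule add_homs_I)
   (use assms in \<open>auto simp: add_homs_closed add_homs_add Y.a_ac a_minus_def Y.minus_add\<close>)
qed

text \<open>In an abelian group, \<open>x + x = x\<close> only for zero: used to see that additive maps preserve it.\<close>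

lemma (in abelian_group) idem_zero: "[|x \<in> carrier G; x \<oplus> x = x|] ==> x = \<zero>"
 using add.l_cancel_one[of x x] by simp

lemma (in abelian_group) minus_eq_zero_iff:
 assumes "x \<in> carrier G" "y \<in> carrier G"
 shows "x \<ominus> y = \<zero> \<longleftrightarrow> x = y"
proof
 assume "x \<ominus> y = \<zero>"
 then have "x \<oplus> \<ominus> y \<oplus> y = y" using assms by (simp add: minus_eq)
 then show "x = y" using assms by (simp add: a_assoc l_neg)
qed (use assms in \<open>simp add: minus_eq r_neg\<close>)

lemma (in abelian_group) neg_zero: "\<ominus> \<zero> = \<zero>"
 using add.inv_equality[of \<zero> \<zero>] by simp

lemma frag_relators_closed:
 "[|a \<in> S; b \<in> S|] ==> Poly_Mapping.keys (frag_of a - frag_of b) \<subseteq> S"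
 "[|a \<in> S; b \<in> S; c \<in> S|] ==> Poly_Mapping.keys (frag_of a - frag_of b - frag_of c) \<subseteq> S"
 using keys_diff[of "frag_of a - frag_of b" "frag_of c"] keys_diff[of "frag_of a" "frag_of b"]
 by auto

text \<open>An abelian group presented by generators \<open>S\<close> and relators \<open>N\<close>: both the tensor products and the
groups of forms arise in this way.\<close>

locale presentation =
 fixes S :: "'x set" and N :: "('x \<Rightarrow>\<^sub>0 int) set"
 assumes rel_sub: "N \<subseteq> carrier (free_Abelian_group S)"
begin

abbreviation "F \<equiv> free_Abelian_group S"
abbreviation "H \<equiv> generate F N"

lemma H_normal: "normal H F"
 using group.generate_is_subgroup[OF group_free_Abelian_group rel_sub]
 by (simp add: abelian_free_Abelian_group comm_group.normal_iff_subgroup)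

lemma pres_comm_group: "comm_group (F Mod H)"
 using comm_group.abelian_FactGroup[OF abelian_free_Abelian_group]
  group.generate_is_subgroup[OF group_free_Abelian_group rel_sub] by blast

lemma pres_grp_sel:
 "carrier (pres_grp S N) = carrier (F Mod H)"
 "\<zero>\<^bsub>pres_grp S N\<^esub> = \<one>\<^bsub>F Mod H\<^esub>"
 "add (pres_grp S N) = monoid.mult (F Mod H)"
 by (simp_all add: pres_grp_def Let_def)

lemma pres_abelian_group: "abelian_group (pres_grp S N)"
proof -
 interpret G: comm_group "F Mod H" by (rule pres_comm_group)
 show ?thesis
  by (rule abelian_groupI)
   (use G.m_assoc G.m_comm G.l_inv_ex in \<open>auto simp: pres_grp_sel simp del: mult_FactGroup one_FactGroup\<close>)
qed

lemma pres_class_closed: "Poly_Mapping.keys c \<subseteq> S ==> pres_class S N c \<in> carrier (pres_grp S N)"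
 by (auto simp: pres_grp_sel pres_class_def carrier_FactGroup)

lemma pres_class_add:
 assumes "Poly_Mapping.keys c \<subseteq> S" "Poly_Mapping.keys d \<subseteq> S"
 shows "pres_class S N (c + d) = pres_class S N c \<oplus>\<^bsub>pres_grp S N\<^esub> pres_class S N d"
 using normal.rcos_sum[OF H_normal, of c d] assms by (simp add: pres_class_def pres_grp_sel)

lemma pres_class_hom: "pres_class S N \<in> hom F (add_monoid (pres_grp S N))"
 by (auto simp: hom_def pres_class_closed pres_class_add)

lemma pres_class_group_hom: "group_hom F (add_monoid (pres_grp S N)) (pres_class S N)"
 by (intro group_hom.intro group_hom_axioms.intro pres_class_hom group_free_Abelian_group
   abelian_group.a_group pres_abelian_group)

lemma pres_class_neg:
 assumes "Poly_Mapping.keys c \<subseteq> S"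
 shows "pres_class S N (- c) = \<ominus>\<^bsub>pres_grp S N\<^esub> pres_class S N c"
 using group_hom.hom_inv[OF pres_class_group_hom, of c] assms by (simp add: a_inv_def)

lemma pres_class_diff:
 assumes "Poly_Mapping.keys c \<subseteq> S" "Poly_Mapping.keys d \<subseteq> S"
 shows "pres_class S N (c - d) = pres_class S N c \<ominus>\<^bsub>pres_grp S N\<^esub> pres_class S N d"
 using pres_class_add[of c "- d"] assms by (simp add: pres_class_neg a_minus_def)

lemma pres_class_rel:
 assumes "r \<in> N"
 shows "pres_class S N r = \<zero>\<^bsub>pres_grp S N\<^esub>"
proof -
 have "r \<in> H" using assms by (simp add: generate.incl)
 then show ?thesis
  using group.coset_join2[OF group_free_Abelian_group, of r S H] rel_sub assms
   normal_imp_subgroup[OF H_normal]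
  by (auto simp: pres_class_def pres_grp_sel subset_iff)
qed

text \<open>The relators of all the presentations below have one of two shapes, \<open>x - y\<close> here and \<open>x - y - z\<close> in the
next lemma.\<close>

lemma pres_class_rel2:
 assumes "frag_of a - frag_of b \<in> N" and that: "a \<in> S" "b \<in> S"
 shows "pres_class S N (frag_of a) = pres_class S N (frag_of b)"
proof -
 interpret G: abelian_group "pres_grp S N" by (rule pres_abelian_group)
 show ?thesis
  using pres_class_rel[OF assms(1)] that pres_class_diff[of "frag_of a" "frag_of b"]
   pres_class_closed[of "frag_of a"] pres_class_closed[of "frag_of b"]
  by (simp add: G.minus_eq_zero_iff)
qed

lemma pres_class_rel3:
 assumes "frag_of a - frag_of b - frag_of c \<in> N" and "a \<in> S" "b \<in> S" "c \<in> S"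
 shows "pres_class S N (frag_of a) =
  pres_class S N (frag_of b) \<oplus>\<^bsub>pres_grp S N\<^esub> pres_class S N (frag_of c)"
proof -
 interpret G: abelian_group "pres_grp S N" by (rule pres_abelian_group)
 have eq: "frag_of a - frag_of b - frag_of c = frag_of a - (frag_of b + frag_of c)" by simp
 have k: "Poly_Mapping.keys (frag_of b + frag_of c) \<subseteq> S"
  using assms keys_add[of "frag_of b" "frag_of c"] by auto
 show ?thesis
  using pres_class_rel[OF assms(1)] assms k
  by (simp add: eq pres_class_diff pres_class_add pres_class_closed G.minus_eq_zero_iff del: keys_add)
qed

lemma pres_induct [consumes 1, case_names zero diff gen]:
 assumes t: "t \<in> carrier (pres_grp S N)"
  and "P \<zero>\<^bsub>pres_grp S N\<^esub>"
  and "\<And>x y. [|x \<in> carrier (pres_grp S N); y \<in> carrier (pres_grp S N); P x; P y|] ==>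
     P (x \<ominus>\<^bsub>pres_grp S N\<^esub> y)"
  and "\<And>s. s \<in> S ==> P (pres_class S N (frag_of s))"
 shows "P t"
proof -
 have z: "pres_class S N 0 = \<zero>\<^bsub>pres_grp S N\<^esub>"
  using group_hom.hom_one[OF pres_class_group_hom] by simp
 from t obtain c where c: "Poly_Mapping.keys c \<subseteq> S" "t = pres_class S N c"
  by (auto simp: pres_grp_sel carrier_FactGroup pres_class_def)
 have "P (pres_class S N c)"
  using c(1)
 proof (induction c rule: free_Abelian_group_induct[consumes 1, case_names zero diff gen])
  case (diff x y)
  then have "P (pres_class S N x \<ominus>\<^bsub>pres_grp S N\<^esub> pres_class S N y)"
   using assms(3) pres_class_closed by blast
  then show ?case using pres_class_diff diff by metis
 qed (use assms z in auto)
 with c show ?thesis by simp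
qed

lemma pres_hom_eqI:
 assumes "abelian_group M" "g \<in> add_homs (pres_grp S N) M" "h \<in> add_homs (pres_grp S N) M"
  and eq: "\<And>s. s \<in> S ==> g (pres_class S N (frag_of s)) = h (pres_class S N (frag_of s))"
  and t: "t \<in> carrier (pres_grp S N)"
 shows "g t = h t"
 using t
 by (induction rule: pres_induct)
  (use assms pres_abelian_group in \<open>auto simp: add_homs_zero add_homs_minus\<close>)

text \<open>The universal property; the relations are tested on an additive extension of \<open>\<phi>\<close>.\<close>

lemma pres_lift_works:
 assumes M: "abelian_group M" and \<phi>: "\<And>s. s \<in> S ==> \<phi> s \<in> carrier M"
  and rels: "\<forall>h\<in>hom F (add_monoid M). (\<forall>s\<in>S. h (frag_of s) = \<phi> s) \<longrightarrow> (\<forall>r\<in>N. h r = \<zero>\<^bsub>M\<^esub>)"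
 shows "pres_lift S N M \<phi> \<in> add_homs (pres_grp S N) M" (is ?g1)
  and "pres_lift S N M \<phi> \<in> extensional (carrier (pres_grp S N))"
  and "\<And>s. s \<in> S ==> pres_lift S N M \<phi> (pres_class S N (frag_of s)) = \<phi> s"
proof -
 interpret M: abelian_group M by fact
 have "\<phi> ` S \<subseteq> carrier (add_monoid M)" using \<phi> by auto
 then obtain h where h: "h \<in> hom F (add_monoid M)" "\<And>s. s \<in> S ==> h (frag_of s) = \<phi> s"
  using comm_group.free_Abelian_group_universal[OF M.a_comm_group] by metis
 interpret gh: group_hom F "add_monoid M" h
  using h(1) by (simp add: group_hom_def group_hom_axioms_def M.a_group)
 have HK: "H \<subseteq> kernel F (add_monoid M) h"
 proof (rule group.generate_subgroup_incl[OF group_free_Abelian_group _ gh.subgroup_kernel], rule subsetI)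
  show "r \<in> kernel F (add_monoid M) h" if "r \<in> N" for r
   using rel_sub[THEN subsetD, OF that] rels h that by (simp add: kernel_def)
 qed
 have hH: "h x = h y" if "x \<in> carrier F" "y \<in> carrier F" "H #>\<^bsub>F\<^esub> x = H #>\<^bsub>F\<^esub> y" for x y
 proof -
  have "x \<in> H #>\<^bsub>F\<^esub> y"
   using that group.rcos_self[OF group_free_Abelian_group _ normal_imp_subgroup[OF H_normal], of x]
   by metis
  then obtain z where "z \<in> H" "x = z + y" by (auto simp: r_coset_def)
  moreover from this have "Poly_Mapping.keys z \<subseteq> S" "h z = \<zero>\<^bsub>M\<^esub>"
   using HK by (auto simp: kernel_def)
  moreover have "h y \<in> carrier M" using gh.hom_closed[of y] that by simp
  ultimately show ?thesis using that gh.hom_mult[of z y] by simp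
 qed
 obtain g where g: "g \<in> hom (F Mod H) (add_monoid M)" "\<And>x. x \<in> carrier F ==> g (H #>\<^bsub>F\<^esub> x) = h x"
  using FactGroup_universal[OF h(1) H_normal hH] by metis
 define g' where "g' = restrict g (carrier (pres_grp S N))"
 have hom_eq: "hom (F Mod H) (add_monoid M) = add_homs (pres_grp S N) M"
  by (simp add: hom_def pres_grp_sel)
 have gh: "g \<in> add_homs (pres_grp S N) M" using g(1) unfolding hom_eq .
 interpret PG: abelian_group "pres_grp S N" by (rule pres_abelian_group)
 let ?Q = "\<lambda>h. h \<in> add_homs (pres_grp S N) M \<and> h \<in> extensional (carrier (pres_grp S N)) \<and>
  (\<forall>s\<in>S. h (pres_class S N (frag_of s)) = \<phi> s)"
 have g'h: "g' \<in> add_homs (pres_grp S N) M"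
  unfolding g'_def
  by (rule add_homs_I) (auto simp: add_homs_closed[OF gh] add_homs_add[OF gh])
 have Qg: "?Q g'"
  using g'h by (auto simp: g'_def pres_class_closed) (simp add: pres_class_def g(2) h(2))
 have "pres_lift S N M \<phi> = g'"
  unfolding pres_lift_def
 proof (rule the_equality)
  fix f assume f: "?Q f"
  show "f = g'"
  proof (rule extensionalityI)
   show "f x = g' x" if "x \<in> carrier (pres_grp S N)" for x
    by (rule pres_hom_eqI[OF M _ _ _ that]) (use f Qg in auto)
  qed (use f Qg in auto)
 qed (use Qg in simp)
 then show ?g1
  "pres_lift S N M \<phi> \<in> extensional (carrier (pres_grp S N))"
  "\<And>s. s \<in> S ==> pres_lift S N M \<phi> (pres_class S N (frag_of s)) = \<phi> s"
  using Qg by auto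
qed

end

lemma hom_frag_diff2:
 assumes "abelian_group M" "h \<in> hom (free_Abelian_group S) (add_monoid M)" "a \<in> S" "b \<in> S"
 shows "h (frag_of a - frag_of b) = h (frag_of a) \<ominus>\<^bsub>M\<^esub> h (frag_of b)"
proof -
 interpret M: abelian_group M by fact
 interpret gh: group_hom "free_Abelian_group S" "add_monoid M" h
  using assms(2) by (simp add: group_hom_def group_hom_axioms_def M.a_group)
 have "h (frag_of a + (- frag_of b)) = h (frag_of a) \<oplus>\<^bsub>M\<^esub> h (- frag_of b)"
  using gh.hom_mult[of "frag_of a" "- frag_of b"] assms by simp
 moreover have "h (- frag_of b) = \<ominus>\<^bsub>M\<^esub> h (frag_of b)"
  using gh.hom_inv[of "frag_of b"] assms by (simp add: a_inv_def)
 ultimately show ?thesis by (simp add: a_minus_def)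
qed

lemma hom_frag_diff3:
 assumes M: "abelian_group M" and h: "h \<in> hom (free_Abelian_group S) (add_monoid M)"
  and "a \<in> S" "b \<in> S" "c \<in> S"
 shows "h (frag_of a - frag_of b - frag_of c) =
  h (frag_of a) \<ominus>\<^bsub>M\<^esub> (h (frag_of b) \<oplus>\<^bsub>M\<^esub> h (frag_of c))"
proof -
 interpret M: abelian_group M by fact
 interpret gh: group_hom "free_Abelian_group S" "add_monoid M" h
  using h by (simp add: group_hom_def group_hom_axioms_def M.a_group)
 have k: "Poly_Mapping.keys (frag_of b + frag_of c) \<subseteq> S"
  using assms keys_add[of "frag_of b" "frag_of c"] by auto
 have "h (frag_of a + (- (frag_of b + frag_of c))) =
   h (frag_of a) \<oplus>\<^bsub>M\<^esub> h (- (frag_of b + frag_of c))"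
  using gh.hom_mult[of "frag_of a" "- (frag_of b + frag_of c)"] assms k
  by (simp del: minus_add_distrib)
 moreover have "h (- (frag_of b + frag_of c)) = \<ominus>\<^bsub>M\<^esub> (h (frag_of b + frag_of c))"
  using gh.hom_inv[of "frag_of b + frag_of c"] k by (simp add: a_inv_def del: minus_add_distrib)
 moreover have "h (frag_of b + frag_of c) = h (frag_of b) \<oplus>\<^bsub>M\<^esub> h (frag_of c)"
  using gh.hom_mult[of "frag_of b" "frag_of c"] assms by simp
 ultimately show ?thesis by (simp add: a_minus_def algebra_simps)
qed

section \<open>Tensor products\<close>

locale tensor_pair =
 E: abelian_group E + L: abelian_group L
 for E :: "('a, 'e, 'p) rmodule_scheme" and A :: "('a, 'm) ring_scheme"
  and L :: "('a, 'b, 'l) bimodule" +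
 assumes E_ract: "[|e \<in> carrier E; a \<in> carrier A|] ==> e \<lhd>\<^bsub>E\<^esub> a \<in> carrier E"
  and L_lact: "[|a \<in> carrier A; l \<in> carrier L|] ==> a \<rhd>\<^bsub>L\<^esub> l \<in> carrier L"
begin

sublocale presentation "carrier E \<times> carrier L" "tensor_rels E A L"
proof
 show "tensor_rels E A L \<subseteq> carrier (free_Abelian_group (carrier E \<times> carrier L))"
  unfolding tensor_rels_def
  by (rule subsetI, elim UnE CollectE exE conjE; hypsubst;
    rule carrier_free_Abelian_group_iff[THEN iffD2], intro frag_relators_closed)
   (auto simp: E_ract L_lact)
qed

lemma tensor_sel:
 "carrier (tensor E A L) = carrier (pres_grp (carrier E \<times> carrier L) (tensor_rels E A L))"
 "\<zero>\<^bsub>tensor E A L\<^esub> = \<zero>\<^bsub>pres_grp (carrier E \<times> carrier L) (tensor_rels E A L)\<^esub>"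
 "add (tensor E A L) = add (pres_grp (carrier E \<times> carrier L) (tensor_rels E A L))"
 by (simp_all add: tensor_def Let_def)

lemma add_homs_tensor:
 "add_homs (tensor E A L) M = add_homs (pres_grp (carrier E \<times> carrier L) (tensor_rels E A L)) M"
 by (simp add: hom_def tensor_sel)

lemma add_homs_tensor':
 "add_homs M (tensor E A L) = add_homs M (pres_grp (carrier E \<times> carrier L) (tensor_rels E A L))"
 by (simp add: hom_def tensor_sel)

lemma tensor_abelian_group: "abelian_group (tensor E A L)"
proof -
 interpret PG: abelian_group "pres_grp (carrier E \<times> carrier L) (tensor_rels E A L)"
  by (rule pres_abelian_group)
 show ?thesis
  by (rule abelian_groupI) (use PG.l_neg in \<open>auto simp: tensor_sel PG.a_ac\<close>)
qed

sublocale T: abelian_group "tensor E A L" by (rule tensor_abelian_group)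

lemma tens_closed: "[|e \<in> carrier E; l \<in> carrier L|] ==> tens E A L e l \<in> carrier (tensor E A L)"
 by (simp add: tens_def tensor_sel pres_class_closed)

lemma tens_add_l:
 "[|e \<in> carrier E; e' \<in> carrier E; l \<in> carrier L|] ==>
  tens E A L (e \<oplus>\<^bsub>E\<^esub> e') l = tens E A L e l \<oplus>\<^bsub>tensor E A L\<^esub> tens E A L e' l"
 unfolding tens_def tensor_sel
 by (rule pres_class_rel3) (auto simp: tensor_rels_def)

lemma tens_add_r:
 "[|e \<in> carrier E; l \<in> carrier L; l' \<in> carrier L|] ==>
  tens E A L e (l \<oplus>\<^bsub>L\<^esub> l') = tens E A L e l \<oplus>\<^bsub>tensor E A L\<^esub> tens E A L e l'"
 unfolding tens_def tensor_sel
 by (rule pres_class_rel3) (auto simp: tensor_rels_def)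

lemma tens_bal:
 "[|e \<in> carrier E; a \<in> carrier A; l \<in> carrier L|] ==>
  tens E A L (e \<lhd>\<^bsub>E\<^esub> a) l = tens E A L e (a \<rhd>\<^bsub>L\<^esub> l)"
 unfolding tens_def
 by (rule pres_class_rel2) (auto simp: tensor_rels_def E_ract L_lact)

lemma tens_hom_l: "l \<in> carrier L ==> (\<lambda>e. tens E A L e l) \<in> add_homs E (tensor E A L)"
 by (rule add_homs_I) (auto simp: tens_closed tens_add_l)

lemma tens_hom_r: "e \<in> carrier E ==> tens E A L e \<in> add_homs L (tensor E A L)"
 by (rule add_homs_I) (auto simp: tens_closed tens_add_r)

lemmas tens_zero_l = add_homs_zero[OF E.abelian_group_axioms tensor_abelian_group tens_hom_l]
lemmas tens_zero_r = add_homs_zero[OF L.abelian_group_axioms tensor_abelian_group tens_hom_r]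
lemmas tens_neg_l = add_homs_neg[OF E.abelian_group_axioms tensor_abelian_group tens_hom_l]
lemmas tens_minus_r = add_homs_minus[OF L.abelian_group_axioms tensor_abelian_group tens_hom_r]

text \<open>Sums of pure tensors exhaust the tensor product: a negative is absorbed by \<open>-(e \<otimes> l) = (-e) \<otimes> l\<close>.\<close>

lemma tensor_induct [consumes 1, case_names tens add]:
 assumes t: "t \<in> carrier (tensor E A L)"
  and gen: "\<And>e l. [|e \<in> carrier E; l \<in> carrier L|] ==> P (tens E A L e l)"
  and add: "\<And>x y. [|x \<in> carrier (tensor E A L); y \<in> carrier (tensor E A L); P x; P y|] ==>
     P (x \<oplus>\<^bsub>tensor E A L\<^esub> y)"
 shows "P t"
proof -
 have minus: "P (x \<ominus>\<^bsub>tensor E A L\<^esub> y)"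
  if "x \<in> carrier (tensor E A L)" "y \<in> carrier (tensor E A L)" "P x" "P (\<ominus>\<^bsub>tensor E A L\<^esub> y)" for x y
  using that add[of x "\<ominus>\<^bsub>tensor E A L\<^esub> y"] by (simp add: a_minus_def)
 have inv_eq: "\<ominus>\<^bsub>pres_grp (carrier E \<times> carrier L) (tensor_rels E A L)\<^esub> x = \<ominus>\<^bsub>tensor E A L\<^esub> x" for x
  by (simp add: a_inv_def m_inv_def tensor_sel)
 have minus_eq: "x \<ominus>\<^bsub>pres_grp (carrier E \<times> carrier L) (tensor_rels E A L)\<^esub> y = x \<ominus>\<^bsub>tensor E A L\<^esub> y" for x y
  by (simp add: a_minus_def inv_eq tensor_sel)
 have "t \<in> carrier (tensor E A L) \<and> P t \<and> P (\<ominus>\<^bsub>tensor E A L\<^esub> t)"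
  using t unfolding tensor_sel
 proof (induction rule: pres_induct)
  case zero
  then show ?case using gen[of "\<zero>\<^bsub>E\<^esub>" "\<zero>\<^bsub>L\<^esub>"] by (simp add: tens_zero_l T.neg_zero flip: tensor_sel)
 next
  case (diff x y)
  then have xy: "x \<in> carrier (tensor E A L)" "y \<in> carrier (tensor E A L)" by (simp_all add: tensor_sel)
  moreover have "\<ominus>\<^bsub>tensor E A L\<^esub> (x \<ominus>\<^bsub>tensor E A L\<^esub> y) = y \<ominus>\<^bsub>tensor E A L\<^esub> x"
   using xy by (simp add: a_minus_def T.minus_add T.a_comm)
  ultimately show ?case using diff minus[of x y] minus[of y x]
   by (simp add: minus_eq flip: tensor_sel)
 next
  case (gen s)
  then obtain e l where s: "s = (e, l)" "e \<in> carrier E" "l \<in> carrier L" by auto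
  then have "pres_class (carrier E \<times> carrier L) (tensor_rels E A L) (frag_of s) = tens E A L e l"
   by (simp add: tens_def)
  then show ?case
   using s assms(2)[of e l] assms(2)[of "\<ominus>\<^bsub>E\<^esub> e" l]
   by (simp add: tens_closed tens_neg_l flip: tensor_sel)
 qed
 then show ?thesis by simp
qed

lemma tensor_hom_eqI:
 assumes "g \<in> add_homs (tensor E A L) M" "h \<in> add_homs (tensor E A L) M"
  and "\<And>e l. [|e \<in> carrier E; l \<in> carrier L|] ==> g (tens E A L e l) = h (tens E A L e l)"
  and t: "t \<in> carrier (tensor E A L)"
 shows "g t = h t"
 using t by (induction rule: tensor_induct) (use assms in \<open>auto simp: add_homs_add\<close>)

lemma tensor_lift_works:
 assumes M: "abelian_group M"
  and cl: "\<And>e l. [|e \<in> carrier E; l \<in> carrier L|] ==> \<phi> e l \<in> carrier M"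
  and al: "\<And>e e' l. [|e \<in> carrier E; e' \<in> carrier E; l \<in> carrier L|] ==>
   \<phi> (e \<oplus>\<^bsub>E\<^esub> e') l = \<phi> e l \<oplus>\<^bsub>M\<^esub> \<phi> e' l"
  and ar: "\<And>e l l'. [|e \<in> carrier E; l \<in> carrier L; l' \<in> carrier L|] ==>
   \<phi> e (l \<oplus>\<^bsub>L\<^esub> l') = \<phi> e l \<oplus>\<^bsub>M\<^esub> \<phi> e l'"
  and bal: "\<And>e a l. [|e \<in> carrier E; a \<in> carrier A; l \<in> carrier L|] ==>
   \<phi> (e \<lhd>\<^bsub>E\<^esub> a) l = \<phi> e (a \<rhd>\<^bsub>L\<^esub> l)"
 shows "tensor_lift E A L M \<phi> \<in> add_homs (tensor E A L) M" (is ?g1)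
  and "tensor_lift E A L M \<phi> \<in> extensional (carrier (tensor E A L))" (is ?g2)
  and "\<And>e l. [|e \<in> carrier E; l \<in> carrier L|] ==> tensor_lift E A L M \<phi> (tens E A L e l) = \<phi> e l" (is "PROP ?g3")
proof -
 interpret M: abelian_group M by fact
 have key: "\<forall>h\<in>hom F (add_monoid M). (\<forall>s\<in>carrier E \<times> carrier L. h (frag_of s) = (\<lambda>(e, l). \<phi> e l) s) \<longrightarrow>
   (\<forall>r\<in>tensor_rels E A L. h r = \<zero>\<^bsub>M\<^esub>)"
 proof (intro ballI impI)
  fix h r
  assume h: "h \<in> hom F (add_monoid M)"
   "\<forall>s\<in>carrier E \<times> carrier L. h (frag_of s) = (\<lambda>(e, l). \<phi> e l) s"
   and r: "r \<in> tensor_rels E A L"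
  show "h r = \<zero>\<^bsub>M\<^esub>"
   using r unfolding tensor_rels_def
   by (elim UnE; clarsimp)
    (simp_all add: M.minus_eq_zero_iff hom_frag_diff3[OF M h(1)] hom_frag_diff2[OF M h(1)] h(2)
     E_ract L_lact al ar bal cl)
 qed
 have cl': "s \<in> carrier E \<times> carrier L ==> (\<lambda>(e, l). \<phi> e l) s \<in> carrier M" for s
  using cl by auto
 note * = pres_lift_works[OF M cl' key]
 show ?g1
  unfolding tensor_lift_def add_homs_tensor by (rule *(1))
 show ?g2
  unfolding tensor_lift_def tensor_sel by (rule *(2))
 show "PROP ?g3"
  unfolding tensor_lift_def tens_def using *(3) by simp
qed

end

text \<open>
 The right action on \<open>E \<otimes> L\<close> comes from the right action on \<open>L\<close>; its module axioms are
 inherited from those of \<open>L\<close>.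
\<close>

locale tensor_bimod = tensor_pair E A L + B: ring B
 for E :: "('a, 'e, 'p) rmodule_scheme" and A :: "('a, 'm) ring_scheme"
  and L :: "('a, 'b, 'l) bimodule" and B :: "('b, 'q) ring_scheme" +
 assumes L_ract: "[|l \<in> carrier L; b \<in> carrier B|] ==> l \<lhd>\<^bsub>L\<^esub> b \<in> carrier L"
  and L_ract_l_distr: "[|l \<in> carrier L; l' \<in> carrier L; b \<in> carrier B|] ==>
   (l \<oplus>\<^bsub>L\<^esub> l') \<lhd>\<^bsub>L\<^esub> b = l \<lhd>\<^bsub>L\<^esub> b \<oplus>\<^bsub>L\<^esub> l' \<lhd>\<^bsub>L\<^esub> b"
  and L_ract_r_distr: "[|l \<in> carrier L; b \<in> carrier B; b' \<in> carrier B|] ==>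
   l \<lhd>\<^bsub>L\<^esub> (b \<oplus>\<^bsub>B\<^esub> b') = l \<lhd>\<^bsub>L\<^esub> b \<oplus>\<^bsub>L\<^esub> l \<lhd>\<^bsub>L\<^esub> b'"
  and L_ract_assoc: "[|l \<in> carrier L; b \<in> carrier B; b' \<in> carrier B|] ==>
   l \<lhd>\<^bsub>L\<^esub> (b \<otimes>\<^bsub>B\<^esub> b') = (l \<lhd>\<^bsub>L\<^esub> b) \<lhd>\<^bsub>L\<^esub> b'"
  and L_ract_one: "l \<in> carrier L ==> l \<lhd>\<^bsub>L\<^esub> \<one>\<^bsub>B\<^esub> = l"
  and L_comm: "[|a \<in> carrier A; l \<in> carrier L; b \<in> carrier B|] ==>
   (a \<rhd>\<^bsub>L\<^esub> l) \<lhd>\<^bsub>L\<^esub> b = a \<rhd>\<^bsub>L\<^esub> (l \<lhd>\<^bsub>L\<^esub> b)"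
begin

lemma tensor_ract:
 assumes "b \<in> carrier B"
 shows "(\<lambda>t. t \<lhd>\<^bsub>tensor E A L\<^esub> b) \<in> add_homs (tensor E A L) (tensor E A L)" (is ?g1)
  and "\<And>e l. [|e \<in> carrier E; l \<in> carrier L|] ==>
   tens E A L e l \<lhd>\<^bsub>tensor E A L\<^esub> b = tens E A L e (l \<lhd>\<^bsub>L\<^esub> b)" (is "PROP ?g2")
proof -
 note * = tensor_lift_works[OF pres_abelian_group, where \<phi> = "\<lambda>e l. tens E A L e (l \<lhd>\<^bsub>L\<^esub> b)",
   folded tensor_sel add_homs_tensor']
 have **: "(\<lambda>t. t \<lhd>\<^bsub>tensor E A L\<^esub> b) = tensor_lift E A L
   (pres_grp (carrier E \<times> carrier L) (tensor_rels E A L)) (\<lambda>e l. tens E A L e (l \<lhd>\<^bsub>L\<^esub> b))"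
  by (simp add: tensor_def Let_def)
 show ?g1
  unfolding **
  by (rule *) (auto simp: assms tens_closed L_ract tens_add_l L_ract_l_distr tens_add_r tens_bal L_comm)
 show "PROP ?g2"
  using *(3) fun_cong[OF **]
  by (auto simp: assms tens_closed L_ract tens_add_l L_ract_l_distr tens_add_r tens_bal L_comm)
qed

lemma tensor_right_module: "right_module B (tensor E A L)"
proof (intro right_module.intro right_module_axioms.intro B.ring_axioms tensor_abelian_group)
 note cl = add_homs_closed[OF tensor_ract(1)] and ad = add_homs_add[OF tensor_ract(1)]
 fix x assume x: "x \<in> carrier (tensor E A L)"
 { fix a assume a: "a \<in> carrier B"
  from cl[OF a x] show "x \<lhd>\<^bsub>tensor E A L\<^esub> a \<in> carrier (tensor E A L)" .
  { fix y assume "y \<in> carrier (tensor E A L)"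
   from ad[OF a x this] show
    "(x \<oplus>\<^bsub>tensor E A L\<^esub> y) \<lhd>\<^bsub>tensor E A L\<^esub> a =
     x \<lhd>\<^bsub>tensor E A L\<^esub> a \<oplus>\<^bsub>tensor E A L\<^esub> y \<lhd>\<^bsub>tensor E A L\<^esub> a" . }
  fix b assume b: "b \<in> carrier B"
  show "x \<lhd>\<^bsub>tensor E A L\<^esub> (a \<oplus>\<^bsub>B\<^esub> b) = x \<lhd>\<^bsub>tensor E A L\<^esub> a \<oplus>\<^bsub>tensor E A L\<^esub> x \<lhd>\<^bsub>tensor E A L\<^esub> b"
   using x by (induction rule: tensor_induct)
    (use a b in \<open>auto simp: tensor_ract(2) L_ract_r_distr L_ract tens_add_r ad cl T.a_ac\<close>)
  show "x \<lhd>\<^bsub>tensor E A L\<^esub> (a \<otimes>\<^bsub>B\<^esub> b) = x \<lhd>\<^bsub>tensor E A L\<^esub> a \<lhd>\<^bsub>tensor E A L\<^esub> b"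
   using x by (induction rule: tensor_induct)
    (use a b in \<open>auto simp: tensor_ract(2) L_ract_assoc L_ract ad cl\<close>) }
 show "x \<lhd>\<^bsub>tensor E A L\<^esub> \<one>\<^bsub>B\<^esub> = x"
  using x by (induction rule: tensor_induct)
    (auto simp: tensor_ract(2) L_ract_one ad cl)
qed

end

section \<open>Augmented algebras\<close>

lemma aug_sel:
 "carrier (aug K A) = carrier A \<times> carrier K"
 "(a, c) \<otimes>\<^bsub>aug K A\<^esub> (b, d) = (a \<otimes>\<^bsub>A\<^esub> b \<oplus>\<^bsub>A\<^esub> d \<odot>\<^bsub>A\<^esub> a \<oplus>\<^bsub>A\<^esub> c \<odot>\<^bsub>A\<^esub> b, c \<otimes>\<^bsub>K\<^esub> d)"
 "\<one>\<^bsub>aug K A\<^esub> = (\<zero>\<^bsub>A\<^esub>, \<one>\<^bsub>K\<^esub>)" "\<zero>\<^bsub>aug K A\<^esub> = (\<zero>\<^bsub>A\<^esub>, \<zero>\<^bsub>K\<^esub>)"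
 "(a, c) \<oplus>\<^bsub>aug K A\<^esub> (b, d) = (a \<oplus>\<^bsub>A\<^esub> b, c \<oplus>\<^bsub>K\<^esub> d)"
 "x \<odot>\<^bsub>aug K A\<^esub> (a, c) = (x \<odot>\<^bsub>A\<^esub> a, x \<otimes>\<^bsub>K\<^esub> c)"
 by (simp_all add: aug_def)

text \<open>The locale \<^locale>\<open>nu_algebra\<close> at the record type on which \<^const>\<open>aug\<close> is defined.\<close>

locale k_algebra = nu_algebra K A
 for K :: "('k, 'n) ring_scheme" (structure) and A :: "('k, 'a) module" (structure)

lemma k_algebraI: "nu_algebra K A ==> k_algebra K A"
 by (simp add: k_algebra_def)

context k_algebra
begin

text \<open>\<open>A1\<close> is \<open>A\<close> with a unit adjoined, and \<open>emb\<close> embeds the scalars in it.\<close>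

abbreviation A1 where "A1 \<equiv> aug K A"
abbreviation emb :: "'k \<Rightarrow> 'a \<times> 'k" where "emb c \<equiv> (\<zero>\<^bsub>A\<^esub>, c)"
abbreviation Om where "Om \<equiv> Omega K A"

lemma K_ring: "ring K"
 using field_axioms by (simp add: field_def domain_def cring_def)

lemmas K_neg = abelian_group.l_neg[OF ring.is_abelian_group[OF K_ring]]
lemmas K_add_ac = ring.ring_simprules(7,10,22)[OF K_ring]

lemma nu_zero_l: "x \<in> carrier A ==> \<zero>\<^bsub>A\<^esub> \<otimes>\<^bsub>A\<^esub> x = \<zero>\<^bsub>A\<^esub>"
 using nu_l_distr[of "\<zero>\<^bsub>A\<^esub>" "\<zero>\<^bsub>A\<^esub>" x] nu_mult_closed[of "\<zero>\<^bsub>A\<^esub>" x]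
 by (intro M.idem_zero) simp_all

lemma nu_zero_r: "x \<in> carrier A ==> x \<otimes>\<^bsub>A\<^esub> \<zero>\<^bsub>A\<^esub> = \<zero>\<^bsub>A\<^esub>"
 using nu_r_distr[of "\<zero>\<^bsub>A\<^esub>" "\<zero>\<^bsub>A\<^esub>" x] nu_mult_closed[of x "\<zero>\<^bsub>A\<^esub>"]
 by (intro M.idem_zero) simp_all

lemma aug_ring: "ring A1"
proof (rule ringI)
 show "abelian_group A1"
 proof (rule abelian_groupI)
  fix x assume "x \<in> carrier A1"
  then obtain a c where x: "x = (a, c)" "a \<in> carrier A" "c \<in> carrier K" by (auto simp: aug_sel)
  show "\<exists>y\<in>carrier A1. y \<oplus>\<^bsub>A1\<^esub> x = \<zero>\<^bsub>A1\<^esub>"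
   by (rule bexI[of _ "(\<ominus>\<^bsub>A\<^esub> a, \<ominus> c)"]) (use x in \<open>auto simp: aug_sel K_neg M.l_neg\<close>)
 qed (auto simp: aug_sel K_add_ac M.a_ac)
 show "monoid A1"
 proof (rule monoidI)
  fix x y z assume "x \<in> carrier A1" "y \<in> carrier A1" "z \<in> carrier A1"
  then obtain a c b d e f where x: "x = (a, c)" "a \<in> carrier A" "c \<in> carrier K"
   and y: "y = (b, d)" "b \<in> carrier A" "d \<in> carrier K"
   and z: "z = (e, f)" "e \<in> carrier A" "f \<in> carrier K" by (auto simp: aug_sel)
  show "x \<otimes>\<^bsub>A1\<^esub> y \<otimes>\<^bsub>A1\<^esub> z = x \<otimes>\<^bsub>A1\<^esub> (y \<otimes>\<^bsub>A1\<^esub> z)"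
   using x y z
   by (simp add: aug_sel nu_mult_closed nu_l_distr nu_r_distr nu_mult_assoc nu_smult_l nu_smult_r
    smult_r_distr smult_assoc1[symmetric] m_ac M.a_ac)
 qed (auto simp: aug_sel nu_mult_closed nu_zero_l nu_zero_r)
 fix x y z assume "x \<in> carrier A1" "y \<in> carrier A1" "z \<in> carrier A1"
 then obtain a c b d e f where x: "x = (a, c)" "a \<in> carrier A" "c \<in> carrier K"
  and y: "y = (b, d)" "b \<in> carrier A" "d \<in> carrier K"
  and z: "z = (e, f)" "e \<in> carrier A" "f \<in> carrier K" by (auto simp: aug_sel)
 show "(x \<oplus>\<^bsub>A1\<^esub> y) \<otimes>\<^bsub>A1\<^esub> z = x \<otimes>\<^bsub>A1\<^esub> z \<oplus>\<^bsub>A1\<^esub> y \<otimes>\<^bsub>A1\<^esub> z"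
  using x y z
  by (simp add: aug_sel nu_mult_closed nu_l_distr smult_r_distr smult_l_distr l_distr M.a_ac)
 show "z \<otimes>\<^bsub>A1\<^esub> (x \<oplus>\<^bsub>A1\<^esub> y) = z \<otimes>\<^bsub>A1\<^esub> x \<oplus>\<^bsub>A1\<^esub> z \<otimes>\<^bsub>A1\<^esub> y"
  using x y z
  by (simp add: aug_sel nu_mult_closed nu_r_distr smult_r_distr smult_l_distr r_distr M.a_ac)
qed

sublocale Au: ring "A1" by (rule aug_ring)

lemma aug_scalar: "c \<in> carrier K ==> (emb c) \<in> carrier A1"
 and aug_elem: "a \<in> carrier A ==> (a, \<zero>) \<in> carrier A1"
 by (auto simp: aug_sel)

lemma aug_smult:
 "[|c \<in> carrier K; x \<in> carrier A1|] ==> c \<odot>\<^bsub>A1\<^esub> x = (emb c) \<otimes>\<^bsub>A1\<^esub> x"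
 by (cases x) (auto simp: aug_sel nu_zero_l)

lemma aug_smult_closed:
 "[|c \<in> carrier K; x \<in> carrier A1|] ==> c \<odot>\<^bsub>A1\<^esub> x \<in> carrier A1"
 by (cases x) (auto simp: aug_sel)

lemma aug_scalar_comm:
 "[|c \<in> carrier K; x \<in> carrier A1|] ==>
  x \<otimes>\<^bsub>A1\<^esub> (emb c) = (emb c) \<otimes>\<^bsub>A1\<^esub> x"
 by (cases x) (auto simp: aug_sel nu_zero_l nu_zero_r m_comm)

lemma aug_emb:
 "(a \<oplus>\<^bsub>A\<^esub> b, \<zero>) = (a, \<zero>) \<oplus>\<^bsub>A1\<^esub> (b, \<zero>)"
 "[|a \<in> carrier A; b \<in> carrier A|] ==> (a \<otimes>\<^bsub>A\<^esub> b, \<zero>) = (a, \<zero>) \<otimes>\<^bsub>A1\<^esub> (b, \<zero>)"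
 "[|a \<in> carrier A; c \<in> carrier K|] ==> (c \<odot>\<^bsub>A\<^esub> a, \<zero>) = (emb c) \<otimes>\<^bsub>A1\<^esub> (a, \<zero>)"
 "[|a \<in> carrier A; c \<in> carrier K|] ==> (c \<odot>\<^bsub>A\<^esub> a, \<zero>) = (a, \<zero>) \<otimes>\<^bsub>A1\<^esub> (emb c)"
 "(\<zero>\<^bsub>A\<^esub>, c \<oplus> d) = (emb c) \<oplus>\<^bsub>A1\<^esub> (emb d)"
 "[|c \<in> carrier K; d \<in> carrier K|] ==> (\<zero>\<^bsub>A\<^esub>, c \<otimes> d) = (emb c) \<otimes>\<^bsub>A1\<^esub> (emb d)"
 by (simp_all add: aug_sel nu_zero_l nu_zero_r nu_mult_closed)

lemma aug_split:
 "[|a \<in> carrier A; c \<in> carrier K|] ==> (a, c) = (a, \<zero>) \<oplus>\<^bsub>A1\<^esub> (emb c)"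
 by (simp add: aug_sel)

end

lemma abelian_group_of_module:
 "nu_algebra K A ==> abelian_group A" and module_of_nu_algebra: "nu_algebra K A ==> module K A"
 by (simp_all add: nu_algebra_def module_def)

section \<open>Noncommutative differential forms\<close>

text \<open>A function of \<open>x da\<^sub>1 \<dots> da\<^sub>n\<close> which respects the relations.\<close>

definition multiadd ::
 "('k, 'n) ring_scheme \<Rightarrow> ('k, 'r) module \<Rightarrow> nat \<Rightarrow> ('y, 'q) ring_scheme \<Rightarrow>
  ('r \<times> 'k \<Rightarrow> 'r list \<Rightarrow> 'y) \<Rightarrow> bool" where
 "multiadd K A n M \<phi> \<longleftrightarrow>
  (\<forall>x as. (x, as) \<in> form_gens K A n \<longrightarrow> \<phi> x as \<in> carrier M) \<and>
  (\<forall>x y as. (x, as) \<in> form_gens K A n \<longrightarrow> (y, as) \<in> form_gens K A n \<longrightarrow>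
   \<phi> (x \<oplus>\<^bsub>aug K A\<^esub> y) as = \<phi> x as \<oplus>\<^bsub>M\<^esub> \<phi> y as) \<and>
  (\<forall>x us a b vs. (x, us @ a # vs) \<in> form_gens K A n \<longrightarrow> (x, us @ b # vs) \<in> form_gens K A n \<longrightarrow>
   \<phi> x (us @ (a \<oplus>\<^bsub>A\<^esub> b) # vs) = \<phi> x (us @ a # vs) \<oplus>\<^bsub>M\<^esub> \<phi> x (us @ b # vs)) \<and>
  (\<forall>c x us a vs. c \<in> carrier K \<longrightarrow> (x, us @ a # vs) \<in> form_gens K A n \<longrightarrow>
   \<phi> (c \<odot>\<^bsub>aug K A\<^esub> x) (us @ a # vs) = \<phi> x (us @ (c \<odot>\<^bsub>A\<^esub> a) # vs))"

lemma form_gens_iff: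
 "(x, as) \<in> form_gens K A n \<longleftrightarrow> x \<in> carrier (aug K A) \<and> set as \<subseteq> carrier A \<and> length as = n"
 by (auto simp: form_gens_def)

lemma multiaddD:
 assumes "multiadd K A n M \<phi>"
 shows "[|x \<in> carrier (aug K A); set as \<subseteq> carrier A; length as = n|] ==> \<phi> x as \<in> carrier M"
  and "[|x \<in> carrier (aug K A); y \<in> carrier (aug K A); set as \<subseteq> carrier A; length as = n|] ==>
   \<phi> (x \<oplus>\<^bsub>aug K A\<^esub> y) as = \<phi> x as \<oplus>\<^bsub>M\<^esub> \<phi> y as"
  and "[|x \<in> carrier (aug K A); set us \<subseteq> carrier A; set vs \<subseteq> carrier A; a \<in> carrier A; b \<in> carrier A;
    length us + length vs + 1 = n|] ==>
   \<phi> x (us @ (a \<oplus>\<^bsub>A\<^esub> b) # vs) = \<phi> x (us @ a # vs) \<oplus>\<^bsub>M\<^esub> \<phi> x (us @ b # vs)"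
  and "[|x \<in> carrier (aug K A); set us \<subseteq> carrier A; set vs \<subseteq> carrier A; a \<in> carrier A; c \<in> carrier K;
    length us + length vs + 1 = n|] ==>
   \<phi> (c \<odot>\<^bsub>aug K A\<^esub> x) (us @ a # vs) = \<phi> x (us @ (c \<odot>\<^bsub>A\<^esub> a) # vs)"
 by (use assms[unfolded multiadd_def form_gens_iff] in
   \<open>elim conjE; simp del: split_paired_All\<close>)+

lemma multiaddI:
 assumes "\<And>x as. [|x \<in> carrier (aug K A); set as \<subseteq> carrier A; length as = n|] ==> \<phi> x as \<in> carrier M"
  and "\<And>x y as. [|x \<in> carrier (aug K A); y \<in> carrier (aug K A); set as \<subseteq> carrier A; length as = n|] ==>
   \<phi> (x \<oplus>\<^bsub>aug K A\<^esub> y) as = \<phi> x as \<oplus>\<^bsub>M\<^esub> \<phi> y as"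
  and "\<And>x us vs a b. [|x \<in> carrier (aug K A); set us \<subseteq> carrier A; set vs \<subseteq> carrier A; a \<in> carrier A; b \<in> carrier A;
    length us + length vs + 1 = n|] ==>
   \<phi> x (us @ (a \<oplus>\<^bsub>A\<^esub> b) # vs) = \<phi> x (us @ a # vs) \<oplus>\<^bsub>M\<^esub> \<phi> x (us @ b # vs)"
  and "\<And>x us vs a c. [|x \<in> carrier (aug K A); set us \<subseteq> carrier A; set vs \<subseteq> carrier A; a \<in> carrier A; c \<in> carrier K;
    length us + length vs + 1 = n|] ==>
   \<phi> (c \<odot>\<^bsub>aug K A\<^esub> x) (us @ a # vs) = \<phi> x (us @ (c \<odot>\<^bsub>A\<^esub> a) # vs)"
 shows "multiadd K A n M \<phi>"
 unfolding multiadd_def form_gens_iff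
 by (intro conjI allI impI; elim conjE; rule assms) auto

text \<open>
 Multiadditivity can be checked slot by slot from the right; this is what makes inductions on the
 degree possible.
\<close>

lemma multiadd_snocI:
 assumes fix_last: "\<And>a. a \<in> carrier A ==> multiadd K A n M (\<lambda>x as. \<phi> x (as @ [a]))"
  and add_last: "\<And>x as a b. [|x \<in> carrier (aug K A); set as \<subseteq> carrier A; length as = n;
   a \<in> carrier A; b \<in> carrier A|] ==>
   \<phi> x (as @ [a \<oplus>\<^bsub>A\<^esub> b]) = \<phi> x (as @ [a]) \<oplus>\<^bsub>M\<^esub> \<phi> x (as @ [b])"
  and scal_last: "\<And>x as a c. [|x \<in> carrier (aug K A); set as \<subseteq> carrier A; length as = n;
   a \<in> carrier A; c \<in> carrier K|] ==>
   \<phi> (c \<odot>\<^bsub>aug K A\<^esub> x) (as @ [a]) = \<phi> x (as @ [c \<odot>\<^bsub>A\<^esub> a])"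
 shows "multiadd K A (Suc n) M \<phi>"
proof (rule multiaddI)
 fix x as assume *: "x \<in> carrier (aug K A)" "set as \<subseteq> carrier A" "length as = Suc n"
 obtain bs b where as: "as = bs @ [b]" using *(3) by (cases as rule: rev_cases) auto
 then show "\<phi> x as \<in> carrier M" using multiaddD(1)[OF fix_last[of b], of x bs] * by auto
 fix y assume "y \<in> carrier (aug K A)"
 then show "\<phi> (x \<oplus>\<^bsub>aug K A\<^esub> y) as = \<phi> x as \<oplus>\<^bsub>M\<^esub> \<phi> y as"
  using multiaddD(2)[OF fix_last[of b], of x y bs] * as by auto
next
 fix x us vs a b
 assume *: "x \<in> carrier (aug K A)" "set us \<subseteq> carrier A" "set vs \<subseteq> carrier A" "a \<in> carrier A"
  "b \<in> carrier A" "length us + length vs + 1 = Suc n"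
 show "\<phi> x (us @ (a \<oplus>\<^bsub>A\<^esub> b) # vs) = \<phi> x (us @ a # vs) \<oplus>\<^bsub>M\<^esub> \<phi> x (us @ b # vs)"
 proof (cases vs rule: rev_cases)
  case Nil
  then show ?thesis using add_last[of x us a b] * by auto
 next
  case (snoc ws w)
  then show ?thesis using multiaddD(3)[OF fix_last[of w], of x us ws a b] * by auto
 qed
next
 fix x us vs a c
 assume *: "x \<in> carrier (aug K A)" "set us \<subseteq> carrier A" "set vs \<subseteq> carrier A" "a \<in> carrier A"
  "c \<in> carrier K" "length us + length vs + 1 = Suc n"
 show "\<phi> (c \<odot>\<^bsub>aug K A\<^esub> x) (us @ a # vs) = \<phi> x (us @ (c \<odot>\<^bsub>A\<^esub> a) # vs)"
 proof (cases vs rule: rev_cases)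
  case Nil
  then show ?thesis using scal_last[of x us a c] * by auto
 next
  case (snoc ws w)
  then show ?thesis using multiaddD(4)[OF fix_last[of w], of x us ws a c] * by auto
 qed
qed

lemma multiadd_minus:
 assumes M: "abelian_group M" and "multiadd K A n M \<phi>" "multiadd K A n M \<psi>"
 shows "multiadd K A n M (\<lambda>x as. \<phi> x as \<ominus>\<^bsub>M\<^esub> \<psi> x as)"
proof -
 interpret M: abelian_group M by fact
 have *: "(a \<oplus>\<^bsub>M\<^esub> b) \<ominus>\<^bsub>M\<^esub> (c \<oplus>\<^bsub>M\<^esub> d) = (a \<ominus>\<^bsub>M\<^esub> c) \<oplus>\<^bsub>M\<^esub> (b \<ominus>\<^bsub>M\<^esub> d)"
  if "a \<in> carrier M" "b \<in> carrier M" "c \<in> carrier M" "d \<in> carrier M" for a b c d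
  using that by (simp add: a_minus_def M.minus_add M.a_ac)
 show ?thesis
  by (rule multiaddI)
   (simp_all add: multiaddD[OF assms(2)] multiaddD[OF assms(3)] * )
qed

lemma multiadd_hom:
 assumes "multiadd K A n M \<phi>" "h \<in> add_homs M M'"
 shows "multiadd K A n M' (\<lambda>x as. h (\<phi> x as))"
 by (rule multiaddI)
  (simp_all add: multiaddD[OF assms(1)] add_homs_add[OF assms(2)] add_homs_closed[OF assms(2)])

lemma Omega_sel:
 "carrier (Omega K A n) = carrier (form_grp K A n)"
 "\<zero>\<^bsub>Omega K A n\<^esub> = \<zero>\<^bsub>form_grp K A n\<^esub>"
 "add (Omega K A n) = add (form_grp K A n)"
 by (simp_all add: Omega_def Let_def)

lemma add_homs_Omega:
 "add_homs (Omega K A n) M = add_homs (form_grp K A n) M"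
 "add_homs M (Omega K A n) = add_homs M (form_grp K A n)"
 by (simp_all add: hom_def Omega_sel)

text \<open>\<open>fm K A n x [a\<^sub>1, \<dots>, a\<^sub>n]\<close> is \<open>x da\<^sub>1 \<dots> da\<^sub>n\<close>.\<close>

abbreviation fm ::
 "('k, 'n) ring_scheme \<Rightarrow> ('k, 'r) module \<Rightarrow> nat \<Rightarrow> 'r \<times> 'k \<Rightarrow> 'r list \<Rightarrow> ('k, 'r) form" where
 "fm K A n x as \<equiv> form_class K A n (frag_of (x, as))"

context k_algebra
begin

lemma form_presentation: "presentation (form_gens K A n) (form_rels K A n)"
proof
 show "form_rels K A n \<subseteq> carrier (free_Abelian_group (form_gens K A n))"
  unfolding form_rels_def
  by (rule subsetI, elim UnE CollectE exE conjE; hypsubst;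
    rule carrier_free_Abelian_group_iff[THEN iffD2], intro frag_relators_closed)
   (auto simp: form_gens_iff aug_smult_closed)
qed

sublocale fp: presentation "form_gens K A n" "form_rels K A n" for n
 by (rule form_presentation)

lemma Omega_abelian_group: "abelian_group (Om n)"
proof -
 interpret PG: abelian_group "form_grp K A n" unfolding form_grp_def by (rule fp.pres_abelian_group)
 show ?thesis
  by (rule abelian_groupI) (use PG.l_neg in \<open>auto simp: Omega_sel PG.a_ac\<close>)
qed

sublocale Om: abelian_group "Om n" for n by (rule Omega_abelian_group)

lemma form_grp_abelian_group: "abelian_group (form_grp K A n)"
 unfolding form_grp_def by (rule fp.pres_abelian_group)

lemma fm_closed:
 "[|x \<in> carrier A1; set as \<subseteq> carrier A; length as = n|] ==> fm K A n x as \<in> carrier (Om n)"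
 by (auto simp: Omega_sel form_grp_def form_class_def form_gens_iff intro!: fp.pres_class_closed)

lemma fm_multiadd: "multiadd K A n (Om n) (fm K A n)"
proof (rule multiaddI)
 fix x as assume *: "x \<in> carrier A1" "set as \<subseteq> carrier A" "length as = n"
 show "fm K A n x as \<in> carrier (Om n)" by (rule fm_closed) (use * in auto)
 fix y assume y: "y \<in> carrier A1"
 have "frag_of (x \<oplus>\<^bsub>A1\<^esub> y, as) - frag_of (x, as) - frag_of (y, as) \<in> form_rels K A n"
  unfolding form_rels_def form_gens_iff by (rule UnI1, rule UnI1) (use * y in blast)
 then show "fm K A n (x \<oplus>\<^bsub>A1\<^esub> y) as = fm K A n x as \<oplus>\<^bsub>Om n\<^esub> fm K A n y as"
  unfolding Omega_sel form_grp_def form_class_def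
  by (rule fp.pres_class_rel3) (use * y in \<open>auto simp: form_gens_iff\<close>)
next
 fix x us vs a b
 assume *: "x \<in> carrier A1" "set us \<subseteq> carrier A" "set vs \<subseteq> carrier A" "a \<in> carrier A"
  "b \<in> carrier A" "length us + length vs + 1 = n"
 have "frag_of (x, us @ (a \<oplus>\<^bsub>A\<^esub> b) # vs) - frag_of (x, us @ a # vs) - frag_of (x, us @ b # vs)
   \<in> form_rels K A n"
 proof -
  have "(x, us @ a # vs) \<in> form_gens K A n" "(x, us @ b # vs) \<in> form_gens K A n"
   using * by (auto simp: form_gens_iff)
  then show ?thesis unfolding form_rels_def by blast
 qed
 then show "fm K A n x (us @ (a \<oplus>\<^bsub>A\<^esub> b) # vs) =
   fm K A n x (us @ a # vs) \<oplus>\<^bsub>Om n\<^esub> fm K A n x (us @ b # vs)"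
  unfolding Omega_sel form_grp_def form_class_def
  by (rule fp.pres_class_rel3) (use * in \<open>auto simp: form_gens_iff\<close>)
next
 fix x us vs a c
 assume *: "x \<in> carrier A1" "set us \<subseteq> carrier A" "set vs \<subseteq> carrier A" "a \<in> carrier A"
  "c \<in> carrier K" "length us + length vs + 1 = n"
 have "frag_of (c \<odot>\<^bsub>A1\<^esub> x, us @ a # vs) - frag_of (x, us @ (c \<odot>\<^bsub>A\<^esub> a) # vs) \<in> form_rels K A n"
 proof -
  have "(x, us @ a # vs) \<in> form_gens K A n" using * by (auto simp: form_gens_iff)
  then show ?thesis unfolding form_rels_def using *(5) by blast
 qed
 then show "fm K A n (c \<odot>\<^bsub>A1\<^esub> x) (us @ a # vs) = fm K A n x (us @ (c \<odot>\<^bsub>A\<^esub> a) # vs)"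
  unfolding Omega_sel form_grp_def form_class_def
  by (rule fp.pres_class_rel2) (use * in \<open>auto simp: form_gens_iff aug_smult_closed\<close>)
qed

lemmas fmD = multiaddD[OF fm_multiadd]

lemma fm_neg:
 assumes "x \<in> carrier A1" "set as \<subseteq> carrier A" "length as = n"
 shows "fm K A n (\<ominus>\<^bsub>A1\<^esub> x) as = \<ominus>\<^bsub>Om n\<^esub> fm K A n x as"
proof -
 have "(\<lambda>x. fm K A n x as) \<in> add_homs A1 (Om n)"
  by (rule add_homs_I) (use assms fmD in auto)
 from add_homs_neg[OF Au.abelian_group_axioms Omega_abelian_group this assms(1)] show ?thesis .
qed

text \<open>Negatives are absorbed in the first factor, so sums of words \<open>x da\<^sub>1 \<dots> da\<^sub>n\<close> exhaust the forms.\<close>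

lemma form_induct [consumes 1, case_names fm add]:
 assumes t: "t \<in> carrier (Om n)"
  and gen: "\<And>x as. [|x \<in> carrier A1; set as \<subseteq> carrier A; length as = n|] ==> P (fm K A n x as)"
  and add: "\<And>x y. [|x \<in> carrier (Om n); y \<in> carrier (Om n); P x; P y|] ==>
     P (x \<oplus>\<^bsub>Om n\<^esub> y)"
 shows "P t"
proof -
 have inv_eq: "\<ominus>\<^bsub>form_grp K A n\<^esub> x = \<ominus>\<^bsub>Om n\<^esub> x" for x
  by (simp add: a_inv_def m_inv_def Omega_sel)
 have minus_eq: "x \<ominus>\<^bsub>form_grp K A n\<^esub> y = x \<ominus>\<^bsub>Om n\<^esub> y" for x y
  by (simp add: a_minus_def inv_eq Omega_sel)
 have minus: "P (x \<ominus>\<^bsub>Om n\<^esub> y)"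
  if "x \<in> carrier (Om n)" "y \<in> carrier (Om n)" "P x" "P (\<ominus>\<^bsub>Om n\<^esub> y)" for x y
  using that add[of x "\<ominus>\<^bsub>Om n\<^esub> y"] by (simp add: a_minus_def)
 have z: "P \<zero>\<^bsub>Om n\<^esub>"
 proof -
  define w where "w = fm K A n \<zero>\<^bsub>A1\<^esub> (replicate n \<zero>\<^bsub>A\<^esub>)"
  have s: "set (replicate n \<zero>\<^bsub>A\<^esub>) \<subseteq> carrier A" by auto
  have "w \<oplus>\<^bsub>Om n\<^esub> w = w"
   using fmD(2)[OF Au.zero_closed Au.zero_closed s] by (simp add: w_def)
  moreover have "w \<in> carrier (Om n)" using fmD(1)[OF Au.zero_closed s] by (simp add: w_def)
  ultimately have "w = \<zero>\<^bsub>Om n\<^esub>" by (rule Om.idem_zero[rotated])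
  moreover have "P w" unfolding w_def by (rule gen) (use s in auto)
  ultimately show ?thesis by simp
 qed
 have "t \<in> carrier (Om n) \<and> P t \<and> P (\<ominus>\<^bsub>Om n\<^esub> t)"
  using t unfolding Omega_sel form_grp_def
 proof (induction rule: fp.pres_induct)
  case zero
  then show ?case using z by (simp add: Om.neg_zero flip: Omega_sel form_grp_def)
 next
  case (diff x y)
  then have xy: "x \<in> carrier (Om n)" "y \<in> carrier (Om n)"
   by (simp_all add: Omega_sel form_grp_def)
  moreover have "\<ominus>\<^bsub>Om n\<^esub> (x \<ominus>\<^bsub>Om n\<^esub> y) = y \<ominus>\<^bsub>Om n\<^esub> x"
   using xy by (simp add: a_minus_def Om.minus_add Om.a_comm)
  ultimately show ?case using diff minus[of x y] minus[of y x]
   by (simp add: minus_eq flip: Omega_sel form_grp_def)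
 next
  case (gen s)
  then obtain x as where s: "s = (x, as)" "x \<in> carrier A1" "set as \<subseteq> carrier A" "length as = n"
   by (auto simp: form_gens_def)
  have "pres_class (form_gens K A n) (form_rels K A n) (frag_of s) = fm K A n x as"
   by (simp add: form_class_def s)
  then show ?case
   using s assms(2)[of x as] assms(2)[of "\<ominus>\<^bsub>A1\<^esub> x" as]
   by (simp add: fm_closed fm_neg flip: Omega_sel form_grp_def)
 qed
 then show ?thesis by simp
qed

lemma form_hom_eqI:
 assumes "g \<in> add_homs (Om n) M" "h \<in> add_homs (Om n) M"
  and "\<And>x as. [|x \<in> carrier A1; set as \<subseteq> carrier A; length as = n|] ==>
   g (fm K A n x as) = h (fm K A n x as)"
  and t: "t \<in> carrier (Om n)"
 shows "g t = h t"
 using t by (induction rule: form_induct) (use assms in \<open>auto simp: add_homs_add\<close>)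

lemma form_lift_works:
 assumes M: "abelian_group M" and \<phi>: "multiadd K A n M \<phi>"
 shows "form_lift K A n M \<phi> \<in> add_homs (Om n) M" (is ?g1)
  and "\<And>x as. [|x \<in> carrier A1; set as \<subseteq> carrier A; length as = n|] ==>
   form_lift K A n M \<phi> (fm K A n x as) = \<phi> x as" (is "PROP ?g2")
proof -
 interpret M: abelian_group M by fact
 have key: "\<forall>h\<in>hom (free_Abelian_group (form_gens K A n)) (add_monoid M).
   (\<forall>s\<in>form_gens K A n. h (frag_of s) = (\<lambda>(x, as). \<phi> x as) s) \<longrightarrow>
   (\<forall>r\<in>form_rels K A n. h r = \<zero>\<^bsub>M\<^esub>)"
 proof (intro ballI impI)
  fix h r
  assume h: "h \<in> hom (free_Abelian_group (form_gens K A n)) (add_monoid M)"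
   "\<forall>s\<in>form_gens K A n. h (frag_of s) = (\<lambda>(x, as). \<phi> x as) s"
   and r: "r \<in> form_rels K A n"
  have h': "h (frag_of (x, as)) = \<phi> x as"
   if "x \<in> carrier A1" "set as \<subseteq> carrier A" "length as = n" for x as
   using h(2) that by (auto simp: form_gens_def)
  show "h r = \<zero>\<^bsub>M\<^esub>"
   using r unfolding form_rels_def form_gens_iff
  proof (elim UnE CollectE exE conjE)
   fix x y as
   assume "r = frag_of (x \<oplus>\<^bsub>A1\<^esub> y, as) - frag_of (x, as) - frag_of (y, as)"
    and *: "x \<in> carrier A1" "y \<in> carrier A1" "set as \<subseteq> carrier A" "length as = n"
   then show ?thesis
    by (simp add: M.minus_eq_zero_iff hom_frag_diff3[OF M h(1)] form_gens_iff h'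
     multiaddD(1,2)[OF \<phi>])
  next
   fix x us a b vs
   assume r: "r = frag_of (x, us @ (a \<oplus>\<^bsub>A\<^esub> b) # vs) - frag_of (x, us @ a # vs) - frag_of (x, us @ b # vs)"
    and *: "x \<in> carrier A1" "set (us @ a # vs) \<subseteq> carrier A" "set (us @ b # vs) \<subseteq> carrier A"
     "length (us @ a # vs) = n"
   then show ?thesis
    by (simp add: M.minus_eq_zero_iff hom_frag_diff3[OF M h(1)] form_gens_iff h'
     multiaddD(1,3)[OF \<phi>])
  next
   fix c x us a vs
   assume r: "r = frag_of (c \<odot>\<^bsub>A1\<^esub> x, us @ a # vs) - frag_of (x, us @ (c \<odot>\<^bsub>A\<^esub> a) # vs)"
    and *: "x \<in> carrier A1" "c \<in> carrier K" "set (us @ a # vs) \<subseteq> carrier A"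
     "length (us @ a # vs) = n"
   then show ?thesis
    by (simp add: M.minus_eq_zero_iff hom_frag_diff2[OF M h(1)] form_gens_iff h' aug_smult_closed
     multiaddD(1,4)[OF \<phi>])
  qed
 qed
 have cl': "s \<in> form_gens K A n ==> (\<lambda>(x, as). \<phi> x as) s \<in> carrier M" for s
  by (cases s) (simp add: form_gens_iff multiaddD[OF \<phi>])
 note * = fp.pres_lift_works[OF M cl' key]
 show ?g1
  unfolding form_lift_def add_homs_Omega form_grp_def by (rule *(1))
 show "PROP ?g2"
  unfolding form_lift_def form_class_def using *(3) by (simp add: form_gens_iff)
qed

text \<open>Right multiplication by \<open>db\<^sub>1 \<dots> db\<^sub>q\<close>.\<close>

definition cc :: "nat \<Rightarrow> 'a list \<Rightarrow> ('k, 'a) form \<Rightarrow> ('k, 'a) form" where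
 "cc n bs = form_lift K A n (Om (n + length bs)) (\<lambda>x as. fm K A (n + length bs) x (as @ bs))"

lemma cc_works:
 assumes bs: "set bs \<subseteq> carrier A"
 shows "cc n bs \<in> add_homs (Om n) (Om (n + length bs))" (is ?g1)
  and "[|x \<in> carrier A1; set as \<subseteq> carrier A; length as = n|] ==>
   cc n bs (fm K A n x as) = fm K A (n + length bs) x (as @ bs)" (is "PROP ?g2")
proof -
 have *: "multiadd K A n (Om (n + length bs)) (\<lambda>x as. fm K A (n + length bs) x (as @ bs))"
  by (rule multiaddI) (simp_all add: fmD bs)
 show ?g1
  unfolding cc_def by (rule form_lift_works[OF Omega_abelian_group *])
 show "PROP ?g2"
  unfolding cc_def by (rule form_lift_works[OF Omega_abelian_group *])
qed

lemmas cc_closed = add_homs_closed[OF cc_works(1)]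
lemmas cc_add = add_homs_add[OF cc_works(1)]
lemmas cc_minus = add_homs_minus[OF Omega_abelian_group Omega_abelian_group cc_works(1)]

lemma snoc_closed:
 "[|b \<in> carrier A; \<omega> \<in> carrier (Om n)|] ==> cc n [b] \<omega> \<in> carrier (Om (Suc n))"
 using cc_closed[of "[b]" \<omega> n] by simp

lemma snoc_hom: "b \<in> carrier A ==> cc n [b] \<in> add_homs (Om n) (Om (Suc n))"
 using cc_works(1)[of "[b]" n] by simp

lemmas snoc_add = add_homs_add[OF snoc_hom]
lemmas snoc_fm = cc_works(2)[of "[b]" for b, simplified]

lemma cc_Cons:
 assumes "b \<in> carrier A" "set bs \<subseteq> carrier A" "\<omega> \<in> carrier (Om n)"
 shows "cc (Suc n) bs (cc n [b] \<omega>) = cc n (b # bs) \<omega>"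
 using assms(3)
 by (induction rule: form_induct)
  (use assms cc_add[of "b # bs" _ n] cc_add[of bs _ "Suc n"] in
   \<open>simp_all add: cc_works(2) snoc_fm snoc_add snoc_closed\<close>)

lemma cc_add_slot:
 assumes "set us \<subseteq> carrier A" "set vs \<subseteq> carrier A" "a \<in> carrier A" "b \<in> carrier A"
  "\<omega> \<in> carrier (Om n)" and N: "N = n + length us + length vs + 1"
 shows "cc n (us @ (a \<oplus>\<^bsub>A\<^esub> b) # vs) \<omega> =
  cc n (us @ a # vs) \<omega> \<oplus>\<^bsub>Om N\<^esub> cc n (us @ b # vs) \<omega>"
proof (rule form_hom_eqI[OF _ _ _ assms(5)])
 have N': "N = n + length (us @ (a \<oplus>\<^bsub>A\<^esub> b) # vs)" "N = n + length (us @ a # vs)"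
  "N = n + length (us @ b # vs)" using N by auto
 show "cc n (us @ (a \<oplus>\<^bsub>A\<^esub> b) # vs) \<in> add_homs (Om n) (Om N)"
  unfolding N'(1) by (rule cc_works) (use assms in auto)
 show "(\<lambda>\<omega>. cc n (us @ a # vs) \<omega> \<oplus>\<^bsub>Om N\<^esub> cc n (us @ b # vs) \<omega>)
   \<in> add_homs (Om n) (Om N)"
  by (rule add_homs_pointwise_add[OF Omega_abelian_group])
   (unfold N'(2), rule cc_works, use assms in simp, fold N'(2), unfold N'(3), rule cc_works, use assms in simp)
next
 fix x as assume *: "x \<in> carrier A1" "set as \<subseteq> carrier A" "length as = n"
 show "cc n (us @ (a \<oplus>\<^bsub>A\<^esub> b) # vs) (fm K A n x as) =
  cc n (us @ a # vs) (fm K A n x as) \<oplus>\<^bsub>Om N\<^esub> cc n (us @ b # vs) (fm K A n x as)"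
  using fmD(3)[of x "as @ us" vs a b N] * assms by (simp add: cc_works(2) add.assoc)
qed

lemma lact_works:
 assumes y: "y \<in> carrier A1"
 shows "(\<lambda>\<omega>. y \<rhd>\<^bsub>Om n\<^esub> \<omega>) \<in> add_homs (Om n) (Om n)" (is ?g1)
  and "[|x \<in> carrier A1; set as \<subseteq> carrier A; length as = n|] ==>
   y \<rhd>\<^bsub>Om n\<^esub> fm K A n x as = fm K A n (y \<otimes>\<^bsub>A1\<^esub> x) as" (is "PROP ?g2")
proof -
 have sm: "y \<otimes>\<^bsub>A1\<^esub> (c \<odot>\<^bsub>A1\<^esub> x) = c \<odot>\<^bsub>A1\<^esub> (y \<otimes>\<^bsub>A1\<^esub> x)"
  if "c \<in> carrier K" "x \<in> carrier A1" for c x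
  using that y by (simp add: aug_smult aug_scalar aug_scalar_comm flip: Au.m_assoc)
 have *: "multiadd K A n (form_grp K A n) (\<lambda>x as. fm K A n (y \<otimes>\<^bsub>A1\<^esub> x) as)"
  by (rule multiaddI) (simp_all add: fmD y Au.r_distr sm flip: Omega_sel)
 have eq: "(\<lambda>\<omega>. y \<rhd>\<^bsub>Om n\<^esub> \<omega>) = form_lift K A n (form_grp K A n) (\<lambda>x as. fm K A n (y \<otimes>\<^bsub>A1\<^esub> x) as)"
  by (simp add: Omega_def Let_def)
 show ?g1
  unfolding eq add_homs_Omega(2) by (rule form_lift_works[OF form_grp_abelian_group *])
 show "PROP ?g2"
  unfolding fun_cong[OF eq] by (rule form_lift_works[OF form_grp_abelian_group *])
qed

lemmas lact_closed = add_homs_closed[OF lact_works(1)]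
lemmas lact_add = add_homs_add[OF lact_works(1)]
lemmas lact_minus = add_homs_minus[OF Omega_abelian_group Omega_abelian_group lact_works(1)]

lemma lact_assoc:
 assumes "y \<in> carrier A1" "z \<in> carrier A1" "\<omega> \<in> carrier (Om n)"
 shows "(y \<otimes>\<^bsub>A1\<^esub> z) \<rhd>\<^bsub>Om n\<^esub> \<omega> = y \<rhd>\<^bsub>Om n\<^esub> (z \<rhd>\<^bsub>Om n\<^esub> \<omega>)"
 using assms(3)
 by (induction rule: form_induct)
  (use assms in \<open>simp_all add: lact_works(2) lact_add lact_closed Au.m_assoc\<close>)

lemma lact_l_distr:
 assumes "y \<in> carrier A1" "z \<in> carrier A1" "\<omega> \<in> carrier (Om n)"
 shows "(y \<oplus>\<^bsub>A1\<^esub> z) \<rhd>\<^bsub>Om n\<^esub> \<omega> =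
  y \<rhd>\<^bsub>Om n\<^esub> \<omega> \<oplus>\<^bsub>Om n\<^esub> z \<rhd>\<^bsub>Om n\<^esub> \<omega>"
 using assms(3)
 by (induction rule: form_induct)
  (use assms in \<open>simp_all add: lact_works(2) lact_add lact_closed Au.l_distr fmD Om.a_ac\<close>)

lemma lact_one:
 "\<omega> \<in> carrier (Om n) ==> \<one>\<^bsub>A1\<^esub> \<rhd>\<^bsub>Om n\<^esub> \<omega> = \<omega>"
 by (induction rule: form_induct) (simp_all add: lact_works(2) lact_add)

lemma lact_zero:
 "\<omega> \<in> carrier (Om n) ==> \<zero>\<^bsub>A1\<^esub> \<rhd>\<^bsub>Om n\<^esub> \<omega> = \<zero>\<^bsub>Om n\<^esub>"
 using lact_l_distr[of "\<zero>\<^bsub>A1\<^esub>" "\<zero>\<^bsub>A1\<^esub>" \<omega> n]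
 by (intro Om.idem_zero) (auto simp: lact_closed)

lemma cc_lact:
 assumes "y \<in> carrier A1" "set bs \<subseteq> carrier A" "\<omega> \<in> carrier (Om n)"
 shows "cc n bs (y \<rhd>\<^bsub>Om n\<^esub> \<omega>) = y \<rhd>\<^bsub>Om (n + length bs)\<^esub> cc n bs \<omega>"
 using assms(3)
 by (induction rule: form_induct)
  (use assms in \<open>simp_all add: lact_works(2) cc_works(2) cc_add lact_add lact_closed cc_closed\<close>)

lemma cc_scal_slot:
 assumes "set us \<subseteq> carrier A" "set vs \<subseteq> carrier A" "a \<in> carrier A" "c \<in> carrier K"
  "\<omega> \<in> carrier (Om n)"
 shows "cc n (us @ (c \<odot>\<^bsub>A\<^esub> a) # vs) \<omega> = cc n (us @ a # vs) ((emb c) \<rhd>\<^bsub>Om n\<^esub> \<omega>)"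
proof -
 have eq: "cc n (us @ (c \<odot>\<^bsub>A\<^esub> a) # vs) (fm K A n x as) =
   cc n (us @ a # vs) (fm K A n ((emb c) \<otimes>\<^bsub>A1\<^esub> x) as)"
  if "x \<in> carrier A1" "set as \<subseteq> carrier A" "length as = n" for x as
  using fmD(4)[of x "as @ us" vs a c "n + Suc (length us + length vs)"] that assms
  by (simp add: cc_works(2) aug_scalar aug_smult)
 show ?thesis
  using assms(5)
  by (induction rule: form_induct)
   (use assms in \<open>simp_all add: lact_works(2) cc_add[of "us @ (c \<odot>\<^bsub>A\<^esub> a) # vs"] cc_add[of "us @ a # vs"]
    lact_add lact_closed cc_closed aug_scalar eq\<close>)
qed

text \<open>
 The right action of an element \<open>b\<close> of the algebra.  By the Leibniz rule it is determined
 recursively: \<open>(\<omega> da) b = \<omega> d(ab) - (\<omega> a) db\<close>.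
\<close>

definition mul_word :: "nat \<Rightarrow> 'a \<times> 'k \<Rightarrow> 'a list \<Rightarrow> 'a \<Rightarrow> ('k, 'a) form" where
 "mul_word n x as b = form_class K A n (form_mult_rev K A x (rev as) b [])"

lemma form_class_diff:
 assumes "Poly_Mapping.keys c \<subseteq> form_gens K A n" "Poly_Mapping.keys d \<subseteq> form_gens K A n"
 shows "form_class K A n (c - d) = form_class K A n c \<ominus>\<^bsub>Om n\<^esub> form_class K A n d"
proof -
 have "x \<ominus>\<^bsub>form_grp K A n\<^esub> y = x \<ominus>\<^bsub>Om n\<^esub> y" for x y
  by (simp add: a_minus_def a_inv_def m_inv_def Omega_sel)
 then show ?thesis
  unfolding form_class_def using fp.pres_class_diff[OF assms] by (simp add: form_grp_def)
qed

lemma form_class_add: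
 assumes "Poly_Mapping.keys c \<subseteq> form_gens K A n" "Poly_Mapping.keys d \<subseteq> form_gens K A n"
 shows "form_class K A n (c + d) = form_class K A n c \<oplus>\<^bsub>Om n\<^esub> form_class K A n d"
 unfolding form_class_def Omega_sel form_grp_def by (rule fp.pres_class_add[OF assms])

lemma form_mult_rev_keys:
 "[|x \<in> carrier A1; set ras \<subseteq> carrier A; b \<in> carrier A; set bs \<subseteq> carrier A;
  n = length ras + length bs|] ==>
  Poly_Mapping.keys (form_mult_rev K A x ras b bs) \<subseteq> form_gens K A n"
proof (induction ras arbitrary: b bs n)
 case Nil
 then show ?case by (simp add: form_gens_iff aug_elem)
next
 case (Cons a ras)
 have "Poly_Mapping.keys (form_mult_rev K A x ras a (b # bs)) \<subseteq> form_gens K A n"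
  by (rule Cons.IH) (use Cons.prems in auto)
 moreover have "(x, rev ras @ (a \<otimes>\<^bsub>A\<^esub> b) # bs) \<in> form_gens K A n"
  using Cons.prems by (auto simp: form_gens_iff nu_mult_closed)
 ultimately show ?case
  using keys_diff[of "frag_of (x, rev ras @ (a \<otimes>\<^bsub>A\<^esub> b) # bs)"
    "form_mult_rev K A x ras a (b # bs)"] by auto
qed

text \<open>The recursion for products in terms of \<open>cc\<close>: the trailing factors can be split off, so that only the
right action of single elements of the algebra has to be studied.\<close>

lemma form_mult_rev_cc:
 "[|x \<in> carrier A1; set as \<subseteq> carrier A; b \<in> carrier A; set bs \<subseteq> carrier A; length as = n|] ==>
  mul_word n x as b \<in> carrier (Om n) \<and>
  form_class K A (n + length bs) (form_mult_rev K A x (rev as) b bs) = cc n bs (mul_word n x as b)"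
proof (induction as arbitrary: b bs n rule: rev_induct)
 case Nil
 then show ?case by (auto simp: mul_word_def fm_closed aug_elem cc_works(2))
next
 case (snoc a as)
 let ?m = "length as"
 have n: "n = Suc ?m" using snoc.prems by simp
 have step: "form_class K A (n + length cs) (form_mult_rev K A x (rev (as @ [a])) b cs) =
   fm K A (n + length cs) x (as @ (a \<otimes>\<^bsub>A\<^esub> b) # cs) \<ominus>\<^bsub>Om (n + length cs)\<^esub>
   cc ?m (b # cs) (mul_word ?m x as a)"
  if cs: "set cs \<subseteq> carrier A" for cs
 proof -
  have "form_class K A (n + length cs) (form_mult_rev K A x (rev (as @ [a])) b cs) =
   fm K A (n + length cs) x (as @ (a \<otimes>\<^bsub>A\<^esub> b) # cs) \<ominus>\<^bsub>Om (n + length cs)\<^esub>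
   form_class K A (n + length cs) (form_mult_rev K A x (rev as) a (b # cs))"
   using form_class_diff[of "frag_of (x, as @ (a \<otimes>\<^bsub>A\<^esub> b) # cs)" "n + length cs"
     "form_mult_rev K A x (rev as) a (b # cs)"]
    form_mult_rev_keys[of x "rev as" a "b # cs" "n + length cs"] snoc.prems cs
   by (simp add: form_gens_iff nu_mult_closed n)
  also have "form_class K A (n + length cs) (form_mult_rev K A x (rev as) a (b # cs)) =
    cc ?m (b # cs) (mul_word ?m x as a)"
   using snoc.IH[of a "b # cs" ?m] snoc.prems cs by (simp add: n)
  finally show ?thesis .
 qed
 have ih: "mul_word ?m x as a \<in> carrier (Om ?m)"
  using snoc.IH[of a "[]" ?m] snoc.prems by simp
 have rec: "mul_word n x (as @ [a]) b =
   fm K A n x (as @ [a \<otimes>\<^bsub>A\<^esub> b]) \<ominus>\<^bsub>Om n\<^esub> cc ?m [b] (mul_word ?m x as a)"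
  using step[of "[]"] by (simp add: mul_word_def)
 have c1: "fm K A n x (as @ [a \<otimes>\<^bsub>A\<^esub> b]) \<in> carrier (Om n)"
  using snoc.prems by (intro fm_closed) (auto simp: nu_mult_closed)
 have c2: "cc ?m [b] (mul_word ?m x as a) \<in> carrier (Om n)"
  using cc_closed[of "[b]" "mul_word ?m x as a" ?m] ih snoc.prems by (simp add: n)
 have "cc n bs (mul_word n x (as @ [a]) b) =
   cc n bs (fm K A n x (as @ [a \<otimes>\<^bsub>A\<^esub> b])) \<ominus>\<^bsub>Om (n + length bs)\<^esub>
   cc n bs (cc ?m [b] (mul_word ?m x as a))"
  unfolding rec by (rule cc_minus) (use snoc.prems c1 c2 in auto)
 also have "cc n bs (cc ?m [b] (mul_word ?m x as a)) = cc ?m (b # bs) (mul_word ?m x as a)"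
  using cc_Cons[of b bs "mul_word ?m x as a" ?m] ih snoc.prems by (simp add: n)
 also have "cc n bs (fm K A n x (as @ [a \<otimes>\<^bsub>A\<^esub> b])) = fm K A (n + length bs) x (as @ (a \<otimes>\<^bsub>A\<^esub> b) # bs)"
  using cc_works(2)[of bs x "as @ [a \<otimes>\<^bsub>A\<^esub> b]" n] snoc.prems by (simp add: nu_mult_closed)
 finally show ?case
  using step[of bs] snoc.prems c1 c2 by (simp add: rec)
qed

lemma mul_word_closed:
 "[|x \<in> carrier A1; set as \<subseteq> carrier A; b \<in> carrier A; length as = n|] ==>
  mul_word n x as b \<in> carrier (Om n)"
 using form_mult_rev_cc[of x as b "[]" n] by simp

lemma mul_word_snoc:
 assumes "x \<in> carrier A1" "set as \<subseteq> carrier A" "a \<in> carrier A" "b \<in> carrier A" "length as = n"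
 shows "mul_word (Suc n) x (as @ [a]) b =
   fm K A (Suc n) x (as @ [a \<otimes>\<^bsub>A\<^esub> b]) \<ominus>\<^bsub>Om (Suc n)\<^esub> cc n [b] (mul_word n x as a)"
proof -
 have "mul_word (Suc n) x (as @ [a]) b =
   fm K A (Suc n) x (as @ [a \<otimes>\<^bsub>A\<^esub> b]) \<ominus>\<^bsub>Om (Suc n)\<^esub>
   form_class K A (Suc n) (form_mult_rev K A x (rev as) a [b])"
  unfolding mul_word_def
  using form_class_diff[of "frag_of (x, as @ [a \<otimes>\<^bsub>A\<^esub> b])" "Suc n" "form_mult_rev K A x (rev as) a [b]"]
   form_mult_rev_keys[of x "rev as" a "[b]" "Suc n"] assms
  by (simp add: form_gens_iff nu_mult_closed)
 then show ?thesis using form_mult_rev_cc[of x as a "[b]" n] assms by simp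
qed

lemma mul_word_Nil:
 "mul_word 0 x [] b = fm K A 0 (x \<otimes>\<^bsub>A1\<^esub> (b, \<zero>)) []"
 by (simp add: mul_word_def)

lemma snoc_add_r:
 "[|a \<in> carrier A; b \<in> carrier A; \<omega> \<in> carrier (Om n)|] ==>
  cc n [a \<oplus>\<^bsub>A\<^esub> b] \<omega> = cc n [a] \<omega> \<oplus>\<^bsub>Om (Suc n)\<^esub> cc n [b] \<omega>"
 using cc_add_slot[of "[]" "[]" a b \<omega> n "Suc n"] by simp

lemma snoc_scal:
 "[|a \<in> carrier A; c \<in> carrier K; \<omega> \<in> carrier (Om n)|] ==>
  cc n [c \<odot>\<^bsub>A\<^esub> a] \<omega> = cc n [a] ((emb c) \<rhd>\<^bsub>Om n\<^esub> \<omega>)"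
 using cc_scal_slot[of "[]" "[]" a c \<omega> n] by simp

lemma snoc_lact:
 "[|y \<in> carrier A1; b \<in> carrier A; \<omega> \<in> carrier (Om n)|] ==>
  cc n [b] (y \<rhd>\<^bsub>Om n\<^esub> \<omega>) = y \<rhd>\<^bsub>Om (Suc n)\<^esub> cc n [b] \<omega>"
 using cc_lact[of y "[b]" \<omega> n] by simp

text \<open>All the properties of the right action on words depend on each other in the induction on the degree,
because \<open>(\<omega> da) b = \<omega> d(ab) - (\<omega> a) db\<close> reduces \<open>b\<close> to \<open>a\<close> in lower degree.\<close>

lemma mul_word_props:
 "(\<forall>b\<in>carrier A. multiadd K A n (Om n) (\<lambda>x as. mul_word n x as b)) \<and>
  (\<forall>x\<in>carrier A1. \<forall>as. set as \<subseteq> carrier A \<and> length as = n \<longrightarrow>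
   (\<forall>b\<in>carrier A. \<forall>b'\<in>carrier A.
    mul_word n x as (b \<oplus>\<^bsub>A\<^esub> b') = mul_word n x as b \<oplus>\<^bsub>Om n\<^esub> mul_word n x as b') \<and>
   (\<forall>b\<in>carrier A. \<forall>c\<in>carrier K. mul_word n x as (c \<odot>\<^bsub>A\<^esub> b) = mul_word n (c \<odot>\<^bsub>A1\<^esub> x) as b) \<and>
   (\<forall>b\<in>carrier A. \<forall>y\<in>carrier A1.
    mul_word n (y \<otimes>\<^bsub>A1\<^esub> x) as b = y \<rhd>\<^bsub>Om n\<^esub> mul_word n x as b))"
proof (induction n)
 case 0
 have m: "multiadd K A 0 (Om 0) (\<lambda>x as. mul_word 0 x as b)" if "b \<in> carrier A" for b
  by (rule multiaddI) (use that in \<open>simp_all add: mul_word_Nil fmD Au.l_distr aug_elem\<close>)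
 note e1 = aug_emb(1)
 note e2 = aug_emb(3)
 show ?case
  by (intro conjI ballI allI impI m)
   (auto simp: mul_word_Nil e1 e2 Au.r_distr aug_elem fmD lact_works(2) Au.m_assoc aug_smult aug_scalar
    simp flip: aug_scalar_comm)
next
 case (Suc n)
 then have mu: "\<And>b. b \<in> carrier A ==> multiadd K A n (Om n) (\<lambda>x as. mul_word n x as b)"
  and ad: "\<And>x as b b'. [|x \<in> carrier A1; set as \<subseteq> carrier A; length as = n; b \<in> carrier A; b' \<in> carrier A|]
   ==> mul_word n x as (b \<oplus>\<^bsub>A\<^esub> b') = mul_word n x as b \<oplus>\<^bsub>Om n\<^esub> mul_word n x as b'"
  and sc: "\<And>x as b c. [|x \<in> carrier A1; set as \<subseteq> carrier A; length as = n; b \<in> carrier A; c \<in> carrier K|]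
   ==> mul_word n x as (c \<odot>\<^bsub>A\<^esub> b) = mul_word n (c \<odot>\<^bsub>A1\<^esub> x) as b"
  and ll: "\<And>x as b y. [|x \<in> carrier A1; set as \<subseteq> carrier A; length as = n; b \<in> carrier A;
    y \<in> carrier A1|]
   ==> mul_word n (y \<otimes>\<^bsub>A1\<^esub> x) as b = y \<rhd>\<^bsub>Om n\<^esub> mul_word n x as b"
  by auto
 have dist: "(p \<oplus>\<^bsub>Om (Suc n)\<^esub> q) \<ominus>\<^bsub>Om (Suc n)\<^esub> (r \<oplus>\<^bsub>Om (Suc n)\<^esub> s) =
   (p \<ominus>\<^bsub>Om (Suc n)\<^esub> r) \<oplus>\<^bsub>Om (Suc n)\<^esub> (q \<ominus>\<^bsub>Om (Suc n)\<^esub> s)"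
  if "p \<in> carrier (Om (Suc n))" "q \<in> carrier (Om (Suc n))"
   "r \<in> carrier (Om (Suc n))" "s \<in> carrier (Om (Suc n))" for p q r s
  using that by (simp add: a_minus_def Om.minus_add Om.a_ac)
 have snoc_fm_multi: "multiadd K A n (Om (Suc n)) (\<lambda>x as. fm K A (Suc n) x (as @ [a]))"
  if "a \<in> carrier A" for a
  by (rule multiaddI) (use that in \<open>simp_all add: fmD\<close>)
 have mult: "multiadd K A (Suc n) (Om (Suc n)) (\<lambda>x as. mul_word (Suc n) x as b)"
  if b: "b \<in> carrier A" for b
 proof (rule multiadd_snocI)
  fix a assume a: "a \<in> carrier A"
  have "multiadd K A n (Om (Suc n)) (\<lambda>x as. fm K A (Suc n) x (as @ [a \<otimes>\<^bsub>A\<^esub> b])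
    \<ominus>\<^bsub>Om (Suc n)\<^esub> cc n [b] (mul_word n x as a))" (is "multiadd _ _ _ _ ?\<phi>")
   by (intro multiadd_minus Omega_abelian_group snoc_fm_multi nu_mult_closed
     multiadd_hom[OF mu snoc_hom] a b)
  note * = multiaddD[OF this]
  show "multiadd K A n (Om (Suc n)) (\<lambda>x as. mul_word (Suc n) x (as @ [a]) b)"
  proof (rule multiaddI)
   fix x as assume x: "x \<in> carrier A1" and as: "set as \<subseteq> carrier A" "length as = n"
   show "mul_word (Suc n) x (as @ [a]) b \<in> carrier (Om (Suc n))"
    using *(1)[OF x as] mul_word_snoc[OF x as(1) a b as(2)] by simp
   fix y assume y: "y \<in> carrier A1"
   show "mul_word (Suc n) (x \<oplus>\<^bsub>A1\<^esub> y) (as @ [a]) b =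
     mul_word (Suc n) x (as @ [a]) b \<oplus>\<^bsub>Om (Suc n)\<^esub> mul_word (Suc n) y (as @ [a]) b"
    using *(2)[OF x y as] x y as a b by (simp add: mul_word_snoc)
  next
   fix x us vs p q assume H: "x \<in> carrier A1" "set us \<subseteq> carrier A" "set vs \<subseteq> carrier A"
    "p \<in> carrier A" "q \<in> carrier A" "length us + length vs + 1 = n"
   have w: "mul_word (Suc n) x ((us @ r # vs) @ [a]) b = ?\<phi> x (us @ r # vs)" if "r \<in> carrier A" for r
    by (rule mul_word_snoc) (use H that a b in auto)
   show "mul_word (Suc n) x ((us @ (p \<oplus>\<^bsub>A\<^esub> q) # vs) @ [a]) b =
     mul_word (Suc n) x ((us @ p # vs) @ [a]) b \<oplus>\<^bsub>Om (Suc n)\<^esub>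
     mul_word (Suc n) x ((us @ q # vs) @ [a]) b"
    using *(3)[OF H] H w[of p] w[of q] w[of "p \<oplus>\<^bsub>A\<^esub> q"] by simp
  next
   fix x us vs p c assume H: "x \<in> carrier A1" "set us \<subseteq> carrier A" "set vs \<subseteq> carrier A"
    "p \<in> carrier A" "c \<in> carrier K" "length us + length vs + 1 = n"
   have w: "mul_word (Suc n) y ((us @ r # vs) @ [a]) b = ?\<phi> y (us @ r # vs)"
    if "r \<in> carrier A" "y \<in> carrier A1" for r y
    by (rule mul_word_snoc) (use H that a b in auto)
   show "mul_word (Suc n) (c \<odot>\<^bsub>A1\<^esub> x) ((us @ p # vs) @ [a]) b =
     mul_word (Suc n) x ((us @ (c \<odot>\<^bsub>A\<^esub> p) # vs) @ [a]) b"
    using *(4)[OF H] H w[of p "c \<odot>\<^bsub>A1\<^esub> x"] w[of "c \<odot>\<^bsub>A\<^esub> p" x] by (simp add: aug_smult_closed)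
  qed
 next
  fix x as a a' assume H: "x \<in> carrier A1" "set as \<subseteq> carrier A" "length as = n"
   "a \<in> carrier A" "a' \<in> carrier A"
  show "mul_word (Suc n) x (as @ [a \<oplus>\<^bsub>A\<^esub> a']) b =
    mul_word (Suc n) x (as @ [a]) b \<oplus>\<^bsub>Om (Suc n)\<^esub> mul_word (Suc n) x (as @ [a']) b"
   using H b fmD(3)[of x as "[]" "a \<otimes>\<^bsub>A\<^esub> b" "a' \<otimes>\<^bsub>A\<^esub> b" "Suc n"]
   by (simp add: mul_word_snoc nu_l_distr nu_mult_closed ad snoc_add mul_word_closed dist snoc_closed fmD)
 next
  fix x as a c assume H: "x \<in> carrier A1" "set as \<subseteq> carrier A" "length as = n"
   "a \<in> carrier A" "c \<in> carrier K"
  show "mul_word (Suc n) (c \<odot>\<^bsub>A1\<^esub> x) (as @ [a]) b = mul_word (Suc n) x (as @ [c \<odot>\<^bsub>A\<^esub> a]) b"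
   using H b fmD(4)[of x as "[]" "a \<otimes>\<^bsub>A\<^esub> b" c "Suc n"]
   by (simp add: mul_word_snoc nu_smult_l nu_mult_closed sc aug_smult_closed)
 qed
 have rec: "as = [] \<longrightarrow> Suc n = 0" "\<exists>us u. as = us @ [u]" if "length as = Suc n" for as :: "'a list"
  using that by (auto, cases as rule: rev_cases) auto
 show ?case
 proof (intro conjI ballI allI impI, goal_cases)
  case (1 b)
  then show ?case by (rule mult)
 next
  case (2 x as b b')
  then obtain us u where as: "as = us @ [u]" using rec by blast
  show ?case
   using 2 as fmD(3)[of x us "[]" "u \<otimes>\<^bsub>A\<^esub> b" "u \<otimes>\<^bsub>A\<^esub> b'" "Suc n"]
   by (simp add: mul_word_snoc nu_r_distr nu_mult_closed snoc_add_r mul_word_closed dist snoc_closed fmD)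
 next
  case (3 x as b c)
  then obtain us u where as: "as = us @ [u]" using rec by blast
  have "cc n [c \<odot>\<^bsub>A\<^esub> b] (mul_word n x us u) = cc n [b] (mul_word n (c \<odot>\<^bsub>A1\<^esub> x) us u)"
   using 3 as by (simp add: snoc_scal mul_word_closed aug_smult ll aug_scalar)
  then show ?case
   using 3 as fmD(4)[of x us "[]" "u \<otimes>\<^bsub>A\<^esub> b" c "Suc n"]
   by (simp add: mul_word_snoc nu_smult_r nu_mult_closed aug_smult_closed)
 next
  case (4 x as b y)
  then obtain us u where as: "as = us @ [u]" using rec by blast
  show ?case
   using 4 as
   by (simp add: mul_word_snoc ll snoc_lact mul_word_closed lact_minus fmD snoc_closed lact_works(2)
     nu_mult_closed)
 qed
qed

definition rmul :: "nat \<Rightarrow> 'a \<Rightarrow> ('k, 'a) form \<Rightarrow> ('k, 'a) form" where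
 "rmul n b = form_lift K A n (Om n) (\<lambda>x as. mul_word n x as b)"

lemma rmul_works:
 assumes "b \<in> carrier A"
 shows "rmul n b \<in> add_homs (Om n) (Om n)"
  and "[|x \<in> carrier A1; set as \<subseteq> carrier A; length as = n|] ==>
   rmul n b (fm K A n x as) = mul_word n x as b"
 using form_lift_works[OF Omega_abelian_group mul_word_props[THEN conjunct1, rule_format, OF assms]]
 by (auto simp: rmul_def)

lemmas rmul_closed = add_homs_closed[OF rmul_works(1)]
lemmas rmul_add = add_homs_add[OF rmul_works(1)]
lemmas rmul_minus = add_homs_minus[OF Omega_abelian_group Omega_abelian_group rmul_works(1)]

lemma rmul_add_r:
 assumes "a \<in> carrier A" "b \<in> carrier A" "\<omega> \<in> carrier (Om n)"
 shows "rmul n (a \<oplus>\<^bsub>A\<^esub> b) \<omega> = rmul n a \<omega> \<oplus>\<^bsub>Om n\<^esub> rmul n b \<omega>"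
 using assms(3)
 by (induction rule: form_induct)
  (use assms mul_word_props[of n] in \<open>simp_all add: rmul_works(2) rmul_add rmul_closed Om.a_ac\<close>)

lemma rmul_lact:
 assumes "a \<in> carrier A" "y \<in> carrier A1" "\<omega> \<in> carrier (Om n)"
 shows "rmul n a (y \<rhd>\<^bsub>Om n\<^esub> \<omega>) = y \<rhd>\<^bsub>Om n\<^esub> rmul n a \<omega>"
 using assms(3)
 by (induction rule: form_induct)
  (use assms mul_word_props[of n] in \<open>simp_all add: rmul_works(2) rmul_add rmul_closed lact_works(2) lact_add lact_closed\<close>)

lemma rmul_scal:
 assumes "a \<in> carrier A" "c \<in> carrier K" "\<omega> \<in> carrier (Om n)"
 shows "rmul n (c \<odot>\<^bsub>A\<^esub> a) \<omega> = (emb c) \<rhd>\<^bsub>Om n\<^esub> rmul n a \<omega>"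
 using assms(3)
 by (induction rule: form_induct)
  (use assms mul_word_props[of n] in \<open>simp_all add: rmul_works(2) rmul_add rmul_closed lact_add lact_closed aug_scalar aug_smult\<close>)

lemma rmul_snoc:
 assumes "a \<in> carrier A" "b \<in> carrier A" "\<omega> \<in> carrier (Om n)"
 shows "rmul (Suc n) b (cc n [a] \<omega>) =
  cc n [a \<otimes>\<^bsub>A\<^esub> b] \<omega> \<ominus>\<^bsub>Om (Suc n)\<^esub> cc n [b] (rmul n a \<omega>)"
proof (rule form_hom_eqI[OF _ _ _ assms(3)])
 show "(\<lambda>\<omega>. rmul (Suc n) b (cc n [a] \<omega>)) \<in> add_homs (Om n) (Om (Suc n))"
  using assms by (intro add_homs_comp[OF snoc_hom rmul_works(1)])
 show "(\<lambda>\<omega>. cc n [a \<otimes>\<^bsub>A\<^esub> b] \<omega> \<ominus>\<^bsub>Om (Suc n)\<^esub> cc n [b] (rmul n a \<omega>))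
   \<in> add_homs (Om n) (Om (Suc n))"
  using assms by (intro add_homs_pointwise_minus Omega_abelian_group snoc_hom nu_mult_closed
    add_homs_comp[OF rmul_works(1) snoc_hom])
next
 fix x as assume "x \<in> carrier A1" "set as \<subseteq> carrier A" "length as = n"
 then show "rmul (Suc n) b (cc n [a] (fm K A n x as)) =
  cc n [a \<otimes>\<^bsub>A\<^esub> b] (fm K A n x as) \<ominus>\<^bsub>Om (Suc n)\<^esub> cc n [b] (rmul n a (fm K A n x as))"
  using assms by (simp add: snoc_fm rmul_works(2) mul_word_snoc nu_mult_closed)
qed

text \<open>In \<open>((\<omega> du) a) b = \<omega> d(uab) - (\<omega> (ua)) db - (\<omega> u) d(ab) + ((\<omega> u) a) db\<close> the second and the last
term cancel by associativity in lower degree.\<close>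

lemma rmul_assoc:
 assumes "a \<in> carrier A" "b \<in> carrier A" "\<omega> \<in> carrier (Om n)"
 shows "rmul n b (rmul n a \<omega>) = rmul n (a \<otimes>\<^bsub>A\<^esub> b) \<omega>"
 using assms
proof (induction n arbitrary: a b \<omega>)
 case 0
 note el = aug_emb(2)
 show ?case
  using 0(3)
  by (induction rule: form_induct)
   (use 0 in \<open>simp_all add: rmul_works(2) rmul_add rmul_closed mul_word_Nil nu_mult_closed el
     Au.m_assoc aug_elem\<close>)
next
 case (Suc n)
 have word: "rmul (Suc n) b (rmul (Suc n) a (fm K A (Suc n) x as)) = rmul (Suc n) (a \<otimes>\<^bsub>A\<^esub> b) (fm K A (Suc n) x as)"
  if x: "x \<in> carrier A1" "set as \<subseteq> carrier A" "length as = Suc n" for x as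
 proof -
  obtain us u where as: "as = us @ [u]" using x by (cases as rule: rev_cases) auto
  define w where "w = fm K A n x us"
  have w: "w \<in> carrier (Om n)" unfolding w_def by (rule fm_closed) (use x as in auto)
  have u: "u \<in> carrier A" using x as by simp
  have fw: "fm K A (Suc n) x as = cc n [u] w" unfolding w_def using x as by (simp add: snoc_fm)
  have canc: "(p \<ominus>\<^bsub>Om (Suc n)\<^esub> q) \<ominus>\<^bsub>Om (Suc n)\<^esub> (r \<ominus>\<^bsub>Om (Suc n)\<^esub> q) =
    p \<ominus>\<^bsub>Om (Suc n)\<^esub> r"
   if "p \<in> carrier (Om (Suc n))" "q \<in> carrier (Om (Suc n))"
    "r \<in> carrier (Om (Suc n))" for p q r
  proof -
   have "(p \<oplus>\<^bsub>Om (Suc n)\<^esub> \<ominus>\<^bsub>Om (Suc n)\<^esub> q) \<oplus>\<^bsub>Om (Suc n)\<^esub>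
     (\<ominus>\<^bsub>Om (Suc n)\<^esub> r \<oplus>\<^bsub>Om (Suc n)\<^esub> q) =
     (p \<oplus>\<^bsub>Om (Suc n)\<^esub> \<ominus>\<^bsub>Om (Suc n)\<^esub> r) \<oplus>\<^bsub>Om (Suc n)\<^esub>
     (\<ominus>\<^bsub>Om (Suc n)\<^esub> q \<oplus>\<^bsub>Om (Suc n)\<^esub> q)"
    using that by (simp add: Om.a_ac)
   then show ?thesis using that by (simp add: a_minus_def Om.minus_add Om.l_neg)
  qed
  have "rmul (Suc n) b (rmul (Suc n) a (cc n [u] w)) =
    (cc n [u \<otimes>\<^bsub>A\<^esub> a \<otimes>\<^bsub>A\<^esub> b] w \<ominus>\<^bsub>Om (Suc n)\<^esub> cc n [b] (rmul n (u \<otimes>\<^bsub>A\<^esub> a) w))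
    \<ominus>\<^bsub>Om (Suc n)\<^esub>
    (cc n [a \<otimes>\<^bsub>A\<^esub> b] (rmul n u w) \<ominus>\<^bsub>Om (Suc n)\<^esub> cc n [b] (rmul n a (rmul n u w)))"
   using u w Suc.prems
   by (simp add: rmul_snoc rmul_minus rmul_closed snoc_closed nu_mult_closed)
  also have "rmul n a (rmul n u w) = rmul n (u \<otimes>\<^bsub>A\<^esub> a) w"
   using Suc.IH u w Suc.prems by simp
  also have "(cc n [u \<otimes>\<^bsub>A\<^esub> a \<otimes>\<^bsub>A\<^esub> b] w \<ominus>\<^bsub>Om (Suc n)\<^esub> cc n [b] (rmul n (u \<otimes>\<^bsub>A\<^esub> a) w))
    \<ominus>\<^bsub>Om (Suc n)\<^esub>
    (cc n [a \<otimes>\<^bsub>A\<^esub> b] (rmul n u w) \<ominus>\<^bsub>Om (Suc n)\<^esub> cc n [b] (rmul n (u \<otimes>\<^bsub>A\<^esub> a) w)) =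
    cc n [u \<otimes>\<^bsub>A\<^esub> (a \<otimes>\<^bsub>A\<^esub> b)] w \<ominus>\<^bsub>Om (Suc n)\<^esub> cc n [a \<otimes>\<^bsub>A\<^esub> b] (rmul n u w)"
   using u w Suc.prems
   by (simp add: canc snoc_closed rmul_closed nu_mult_closed nu_mult_assoc)
  also have "\<dots> = rmul (Suc n) (a \<otimes>\<^bsub>A\<^esub> b) (cc n [u] w)"
   using u w Suc.prems by (simp add: rmul_snoc nu_mult_closed)
  finally show ?thesis by (simp add: fw)
 qed
 show ?case
  using Suc.prems(3)
  by (induction rule: form_induct) (use word Suc.prems in \<open>simp_all add: rmul_add rmul_closed nu_mult_closed\<close>)
qed

end

lemma multiadd_cong:
 assumes "multiadd K A n M \<phi>"
  and "\<And>x as. [|x \<in> carrier (aug K A); set as \<subseteq> carrier A; length as = n|] ==> \<psi> x as = \<phi> x as"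
  and "ring (aug K A)" "abelian_group A" "\<And>c x. [|c \<in> carrier K; x \<in> carrier (aug K A)|] ==>
   c \<odot>\<^bsub>aug K A\<^esub> x \<in> carrier (aug K A)"
   "\<And>c a. [|c \<in> carrier K; a \<in> carrier A|] ==> c \<odot>\<^bsub>A\<^esub> a \<in> carrier A"
 shows "multiadd K A n M \<psi>"
proof -
 interpret ring "aug K A" by fact
 interpret Ab: abelian_group A by fact
 show ?thesis
  by (rule multiaddI) (simp_all add: assms(2,5,6) multiaddD[OF assms(1)])
qed

lemma add_homs_cong:
 assumes "abelian_group X" "h \<in> add_homs X Y" "\<And>x. x \<in> carrier X ==> g x = h x"
 shows "g \<in> add_homs X Y"
proof -
 interpret X: abelian_group X by fact
 show ?thesis
  by (rule add_homs_I) (simp_all add: assms(3) add_homs_closed[OF assms(2)] add_homs_add[OF assms(2)])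
qed

context k_algebra
begin

lemma form_mult_gen_class:
 assumes "x \<in> carrier A1" "set as \<subseteq> carrier A" "y \<in> carrier A1" "set bs \<subseteq> carrier A"
  "length as = p" "length bs = q"
 shows "form_class K A (p + q) (form_mult_gen K A x as y bs) =
  cc p bs ((\<zero>\<^bsub>A\<^esub>, snd y) \<rhd>\<^bsub>Om p\<^esub> fm K A p x as \<oplus>\<^bsub>Om p\<^esub> rmul p (fst y) (fm K A p x as))"
proof -
 obtain b d where y: "y = (b, d)" "b \<in> carrier A" "d \<in> carrier K"
  using assms(3) by (auto simp: aug_sel)
 have "form_class K A (p + q) (form_mult_gen K A x as y bs) =
   fm K A (p + q) (d \<odot>\<^bsub>A1\<^esub> x) (as @ bs) \<oplus>\<^bsub>Om (p + q)\<^esub>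
   form_class K A (p + q) (form_mult_rev K A x (rev as) b bs)"
  unfolding form_mult_gen_def y fst_conv snd_conv
  by (rule form_class_add)
   (use assms y form_mult_rev_keys[of x "rev as" b bs "p + q"] in
    \<open>auto simp: form_gens_iff aug_smult_closed\<close>)
 also have "form_class K A (p + q) (form_mult_rev K A x (rev as) b bs) = cc p bs (mul_word p x as b)"
  using form_mult_rev_cc[of x as b bs p] assms y by simp
 also have "fm K A (p + q) (d \<odot>\<^bsub>A1\<^esub> x) (as @ bs) = cc p bs (fm K A p (d \<odot>\<^bsub>A1\<^esub> x) as)"
  using assms y by (simp add: cc_works(2) aug_smult_closed)
 finally show ?thesis
  using assms y cc_add[of bs "fm K A p (d \<odot>\<^bsub>A1\<^esub> x) as" p "mul_word p x as b"]
  by (simp add: rmul_works(2) lact_works(2) aug_scalar aug_smult fm_closed mul_word_closed)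
qed

lemma lact_rmul_hom:
 assumes "y \<in> carrier A1"
 shows "(\<lambda>\<omega>. (\<zero>\<^bsub>A\<^esub>, snd y) \<rhd>\<^bsub>Om n\<^esub> \<omega> \<oplus>\<^bsub>Om n\<^esub> rmul n (fst y) \<omega>)
  \<in> add_homs (Om n) (Om n)"
 using assms
 by (intro add_homs_pointwise_add Omega_abelian_group lact_works rmul_works) (auto simp: aug_sel)

lemmas multiadd_cong' =
 multiadd_cong[OF _ _ aug_ring M.abelian_group_axioms aug_smult_closed smult_closed]

lemma ract_eq:
 assumes y: "y \<in> carrier A1" and \<omega>: "\<omega> \<in> carrier (Om n)"
 shows "\<omega> \<lhd>\<^bsub>Om n\<^esub> y =
  (\<zero>\<^bsub>A\<^esub>, snd y) \<rhd>\<^bsub>Om n\<^esub> \<omega> \<oplus>\<^bsub>Om n\<^esub> rmul n (fst y) \<omega>"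
proof -
 let ?h = "\<lambda>\<omega>. (\<zero>\<^bsub>A\<^esub>, snd y) \<rhd>\<^bsub>Om n\<^esub> \<omega> \<oplus>\<^bsub>Om n\<^esub> rmul n (fst y) \<omega>"
 let ?\<phi> = "\<lambda>x as. form_class K A n (form_mult_gen K A x as y [])"
 have cc0: "cc n [] \<omega> = \<omega>" if "\<omega> \<in> carrier (Om n)" for \<omega>
  using that by (induction rule: form_induct)
   (use cc_works(2)[of "[]"] cc_add[of "[]" _ n] in simp_all)
 have \<phi>: "?\<phi> x as = ?h (fm K A n x as)"
  if "x \<in> carrier A1" "set as \<subseteq> carrier A" "length as = n" for x as
  using form_mult_gen_class[of x as y "[]" n 0] y that
   add_homs_closed[OF lact_rmul_hom[OF y, of n] fm_closed[OF that]]
  by (simp add: cc0)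
 have "multiadd K A n (Om n) ?\<phi>"
  by (rule multiadd_cong'[OF multiadd_hom[OF fm_multiadd lact_rmul_hom[OF y]] \<phi>])
 then have m: "multiadd K A n (form_grp K A n) ?\<phi>"
  unfolding multiadd_def Omega_sel .
 have "\<omega> \<lhd>\<^bsub>Om n\<^esub> y = form_lift K A n (form_grp K A n) ?\<phi> \<omega>"
  by (simp add: Omega_def Let_def)
 also have "\<dots> = ?h \<omega>"
  by (rule form_hom_eqI[OF form_lift_works(1)[OF form_grp_abelian_group m, folded add_homs_Omega(2)]
     lact_rmul_hom[OF y] _ \<omega>])
   (simp add: form_lift_works(2)[OF form_grp_abelian_group m] \<phi>)
 finally show ?thesis .
qed

lemma ract_hom:
 assumes y: "y \<in> carrier A1"
 shows "(\<lambda>\<omega>. \<omega> \<lhd>\<^bsub>Om n\<^esub> y) \<in> add_homs (Om n) (Om n)"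
 by (rule add_homs_cong[OF Omega_abelian_group lact_rmul_hom[OF y]]) (rule ract_eq[OF y])

lemmas ract_closed = add_homs_closed[OF ract_hom]
lemmas ract_add = add_homs_add[OF ract_hom]

lemma ract_elem:
 assumes "a \<in> carrier A" "\<omega> \<in> carrier (Om n)"
 shows "\<omega> \<lhd>\<^bsub>Om n\<^esub> (a, \<zero>) = rmul n a \<omega>"
 using ract_eq[OF aug_elem, of a \<omega> n] assms lact_zero[of \<omega> n]
 by (simp add: aug_sel rmul_closed)

lemma rmul_zero:
 assumes "\<omega> \<in> carrier (Om n)"
 shows "rmul n \<zero>\<^bsub>A\<^esub> \<omega> = \<zero>\<^bsub>Om n\<^esub>"
 using rmul_add_r[of "\<zero>\<^bsub>A\<^esub>" "\<zero>\<^bsub>A\<^esub>" \<omega> n] assms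
 by (intro Om.idem_zero) (simp_all add: rmul_closed)

lemma ract_scalar:
 assumes "c \<in> carrier K" "\<omega> \<in> carrier (Om n)"
 shows "\<omega> \<lhd>\<^bsub>Om n\<^esub> (emb c) = (emb c) \<rhd>\<^bsub>Om n\<^esub> \<omega>"
 using ract_eq[OF aug_scalar, of c \<omega> n] assms
 by (simp add: rmul_zero lact_closed aug_scalar)

lemma ract_r_distr:
 assumes "y \<in> carrier A1" "z \<in> carrier A1" "\<omega> \<in> carrier (Om n)"
 shows "\<omega> \<lhd>\<^bsub>Om n\<^esub> (y \<oplus>\<^bsub>A1\<^esub> z) =
  \<omega> \<lhd>\<^bsub>Om n\<^esub> y \<oplus>\<^bsub>Om n\<^esub> \<omega> \<lhd>\<^bsub>Om n\<^esub> z"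
proof -
 obtain a c b d where yz: "y = (a, c)" "z = (b, d)" "a \<in> carrier A" "b \<in> carrier A"
  "c \<in> carrier K" "d \<in> carrier K" using assms by (auto simp: aug_sel)
 have e: "(\<zero>\<^bsub>A\<^esub>, c \<oplus> d) \<rhd>\<^bsub>Om n\<^esub> \<omega> =
   (emb c) \<rhd>\<^bsub>Om n\<^esub> \<omega> \<oplus>\<^bsub>Om n\<^esub> (emb d) \<rhd>\<^bsub>Om n\<^esub> \<omega>"
  using lact_l_distr[OF aug_scalar aug_scalar assms(3), of c d] yz by (simp add: aug_sel)
 show ?thesis
  using assms yz Au.add.m_closed[OF assms(1,2)]
  by (simp add: ract_eq aug_sel(5) e rmul_add_r aug_scalar lact_closed rmul_closed Om.a_ac)
qed

lemma ract_assoc: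
 assumes "y \<in> carrier A1" "z \<in> carrier A1" "\<omega> \<in> carrier (Om n)"
 shows "\<omega> \<lhd>\<^bsub>Om n\<^esub> (y \<otimes>\<^bsub>A1\<^esub> z) = \<omega> \<lhd>\<^bsub>Om n\<^esub> y \<lhd>\<^bsub>Om n\<^esub> z"
proof -
 obtain a c b d where yz: "y = (a, c)" "z = (b, d)" "a \<in> carrier A" "b \<in> carrier A"
  "c \<in> carrier K" "d \<in> carrier K" using assms by (auto simp: aug_sel)
 have e: "(\<zero>\<^bsub>A\<^esub>, c \<otimes> d) \<rhd>\<^bsub>Om n\<^esub> \<omega> =
   (emb d) \<rhd>\<^bsub>Om n\<^esub> ((emb c) \<rhd>\<^bsub>Om n\<^esub> \<omega>)"
  using lact_assoc[OF aug_scalar aug_scalar assms(3), of d c] yz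
  by (simp add: aug_sel nu_zero_l m_comm)
 show ?thesis
  using assms yz Au.m_closed[OF assms(1,2)]
  by (simp add: ract_eq aug_sel(2) e lact_add lact_closed rmul_add rmul_closed rmul_add_r
    rmul_scal rmul_lact rmul_assoc aug_scalar nu_mult_closed Om.a_ac)
qed

lemma ract_one:
 assumes "\<omega> \<in> carrier (Om n)"
 shows "\<omega> \<lhd>\<^bsub>Om n\<^esub> \<one>\<^bsub>A1\<^esub> = \<omega>"
 using ract_scalar[of \<one> \<omega> n] assms lact_one[of \<omega> n] by (simp add: aug_sel)

lemma ract_lact:
 assumes "a \<in> carrier A1" "y \<in> carrier A1" "\<omega> \<in> carrier (Om n)"
 shows "(a \<rhd>\<^bsub>Om n\<^esub> \<omega>) \<lhd>\<^bsub>Om n\<^esub> y = a \<rhd>\<^bsub>Om n\<^esub> (\<omega> \<lhd>\<^bsub>Om n\<^esub> y)"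
proof -
 obtain b d where y: "y = (b, d)" "b \<in> carrier A" "d \<in> carrier K" using assms by (auto simp: aug_sel)
 show ?thesis
  using assms y
  by (simp add: ract_eq lact_add lact_closed rmul_closed rmul_lact aug_scalar aug_scalar_comm
    flip: lact_assoc)
qed

text \<open>The product of forms: \<open>\<omega> (y db\<^sub>1 \<dots> db\<^sub>q) = (\<omega> y) db\<^sub>1 \<dots> db\<^sub>q\<close>.\<close>

definition wedge :: "nat \<Rightarrow> nat \<Rightarrow> ('k, 'a) form \<Rightarrow> ('k, 'a) form \<Rightarrow> ('k, 'a) form" where
 "wedge p q \<omega> = form_lift K A q (Om (p + q)) (\<lambda>y bs. cc p bs (\<omega> \<lhd>\<^bsub>Om p\<^esub> y))"

lemma wedge_works:
 assumes "\<omega> \<in> carrier (Om p)"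
 shows "wedge p q \<omega> \<in> add_homs (Om q) (Om (p + q))" (is ?g1)
  and "[|y \<in> carrier A1; set bs \<subseteq> carrier A; length bs = q|] ==>
   wedge p q \<omega> (fm K A q y bs) = cc p bs (\<omega> \<lhd>\<^bsub>Om p\<^esub> y)"
proof -
 have m: "multiadd K A q (Om (p + q)) (\<lambda>y bs. cc p bs (\<omega> \<lhd>\<^bsub>Om p\<^esub> y))"
 proof (rule multiaddI)
  fix x bs assume *: "x \<in> carrier A1" "set bs \<subseteq> carrier A" "length bs = q"
  then show "cc p bs (\<omega> \<lhd>\<^bsub>Om p\<^esub> x) \<in> carrier (Om (p + q))"
   using cc_closed[of bs "\<omega> \<lhd>\<^bsub>Om p\<^esub> x" p] assms by (simp add: ract_closed)
  fix y assume "y \<in> carrier A1"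
  then show "cc p bs (\<omega> \<lhd>\<^bsub>Om p\<^esub> (x \<oplus>\<^bsub>A1\<^esub> y)) =
    cc p bs (\<omega> \<lhd>\<^bsub>Om p\<^esub> x) \<oplus>\<^bsub>Om (p + q)\<^esub> cc p bs (\<omega> \<lhd>\<^bsub>Om p\<^esub> y)"
   using * cc_add[of bs "\<omega> \<lhd>\<^bsub>Om p\<^esub> x" p "\<omega> \<lhd>\<^bsub>Om p\<^esub> y"] assms
   by (simp add: ract_closed ract_r_distr)
 next
  fix x us vs a b
  assume *: "x \<in> carrier A1" "set us \<subseteq> carrier A" "set vs \<subseteq> carrier A" "a \<in> carrier A"
   "b \<in> carrier A" "length us + length vs + 1 = q"
  show "cc p (us @ (a \<oplus>\<^bsub>A\<^esub> b) # vs) (\<omega> \<lhd>\<^bsub>Om p\<^esub> x) =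
    cc p (us @ a # vs) (\<omega> \<lhd>\<^bsub>Om p\<^esub> x) \<oplus>\<^bsub>Om (p + q)\<^esub> cc p (us @ b # vs) (\<omega> \<lhd>\<^bsub>Om p\<^esub> x)"
   by (rule cc_add_slot) (use * assms in \<open>auto simp: ract_closed\<close>)
 next
  fix x us vs a c
  assume *: "x \<in> carrier A1" "set us \<subseteq> carrier A" "set vs \<subseteq> carrier A" "a \<in> carrier A"
   "c \<in> carrier K" "length us + length vs + 1 = q"
  have "\<omega> \<lhd>\<^bsub>Om p\<^esub> (c \<odot>\<^bsub>A1\<^esub> x) = (emb c) \<rhd>\<^bsub>Om p\<^esub> (\<omega> \<lhd>\<^bsub>Om p\<^esub> x)"
   using * assms by (simp add: aug_smult aug_scalar ract_assoc ract_scalar ract_lact)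
  then show "cc p (us @ a # vs) (\<omega> \<lhd>\<^bsub>Om p\<^esub> (c \<odot>\<^bsub>A1\<^esub> x)) =
    cc p (us @ (c \<odot>\<^bsub>A\<^esub> a) # vs) (\<omega> \<lhd>\<^bsub>Om p\<^esub> x)"
   using * assms by (simp add: cc_scal_slot ract_closed)
 qed
 show ?g1
  and "[|y \<in> carrier A1; set bs \<subseteq> carrier A; length bs = q|] ==>
   wedge p q \<omega> (fm K A q y bs) = cc p bs (\<omega> \<lhd>\<^bsub>Om p\<^esub> y)"
  unfolding wedge_def by (rule form_lift_works[OF Omega_abelian_group m], assumption?)+
qed

lemmas wedge_closed = add_homs_closed[OF wedge_works(1)]
lemmas wedge_add_r = add_homs_add[OF wedge_works(1)]

lemma wedge_hom_l:
 assumes "\<eta> \<in> carrier (Om q)"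
 shows "(\<lambda>\<omega>. wedge p q \<omega> \<eta>) \<in> add_homs (Om p) (Om (p + q))"
proof (rule add_homs_I)
 fix \<omega> \<omega>' assume *: "\<omega> \<in> carrier (Om p)" "\<omega>' \<in> carrier (Om p)"
 then show "wedge p q \<omega> \<eta> \<in> carrier (Om (p + q))" using assms by (simp add: wedge_closed)
 show "wedge p q (\<omega> \<oplus>\<^bsub>Om p\<^esub> \<omega>') \<eta> = wedge p q \<omega> \<eta> \<oplus>\<^bsub>Om (p + q)\<^esub> wedge p q \<omega>' \<eta>"
  using assms
 proof (induction rule: form_induct)
  case (fm y bs)
  then show ?case
   using * cc_add[of bs "\<omega> \<lhd>\<^bsub>Om p\<^esub> y" p "\<omega>' \<lhd>\<^bsub>Om p\<^esub> y"]
   by (simp add: wedge_works(2) ract_add ract_closed)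
 next
  case (add \<eta> \<eta>')
  then show ?case using * by (simp add: wedge_add_r wedge_closed Om.a_ac)
 qed
qed

lemmas wedge_add_l = add_homs_add[OF wedge_hom_l]

lemma form_mult_eq:
 assumes \<omega>: "\<omega> \<in> carrier (Om p)" and \<eta>: "\<eta> \<in> carrier (Om q)"
 shows "form_mult K A p q \<omega> \<eta> = wedge p q \<omega> \<eta>"
proof -
 let ?G = "form_grp K A (p + q)"
 have inner: "form_lift K A q ?G (\<lambda>y bs. form_class K A (p + q) (form_mult_gen K A x as y bs)) \<eta> =
   wedge p q (fm K A p x as) \<eta>"
  if x: "x \<in> carrier A1" "set as \<subseteq> carrier A" "length as = p" for x as
 proof -
  let ?\<phi> = "\<lambda>y bs. form_class K A (p + q) (form_mult_gen K A x as y bs)"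
  note fc = fm_closed[OF x]
  have \<phi>: "?\<phi> y bs = wedge p q (fm K A p x as) (fm K A q y bs)"
   if "y \<in> carrier A1" "set bs \<subseteq> carrier A" "length bs = q" for y bs
   using form_mult_gen_class[of x as y bs p q] x that fc by (simp add: wedge_works(2) ract_eq)
  have "multiadd K A q (Om (p + q)) ?\<phi>"
   by (rule multiadd_cong'[OF multiadd_hom[OF fm_multiadd wedge_works(1)[OF fc]] \<phi>])
  then have m: "multiadd K A q ?G ?\<phi>"
   unfolding multiadd_def Omega_sel .
  show ?thesis
   by (rule form_hom_eqI[OF form_lift_works(1)[OF form_grp_abelian_group m, folded add_homs_Omega(2)]
      wedge_works(1)[OF fc] _ \<eta>])
    (simp add: form_lift_works(2)[OF form_grp_abelian_group m] \<phi>)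
 qed
 let ?\<psi> = "\<lambda>x as. form_lift K A q ?G (\<lambda>y bs. form_class K A (p + q) (form_mult_gen K A x as y bs)) \<eta>"
 have "multiadd K A p (Om (p + q)) ?\<psi>"
  by (rule multiadd_cong'[OF multiadd_hom[OF fm_multiadd wedge_hom_l[OF \<eta>]] inner])
 then have m: "multiadd K A p ?G ?\<psi>"
  unfolding multiadd_def Omega_sel .
 show ?thesis
  unfolding form_mult_def
  by (rule form_hom_eqI[OF form_lift_works(1)[OF form_grp_abelian_group m, folded add_homs_Omega(2)]
     wedge_hom_l[OF \<eta>] _ \<omega>])
   (simp add: form_lift_works(2)[OF form_grp_abelian_group m] inner)
qed

lemma wedge_bal:
 assumes "\<omega> \<in> carrier (Om p)" "\<eta> \<in> carrier (Om q)" "a \<in> carrier A1"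
 shows "wedge p q (\<omega> \<lhd>\<^bsub>Om p\<^esub> a) \<eta> = wedge p q \<omega> (a \<rhd>\<^bsub>Om q\<^esub> \<eta>)"
 using assms(2)
 by (induction rule: form_induct)
  (use assms in \<open>simp_all add: wedge_works(2) wedge_add_r ract_closed lact_works(2) lact_add lact_closed
   ract_assoc\<close>)

lemma wedge_lact:
 assumes "\<omega> \<in> carrier (Om p)" "\<eta> \<in> carrier (Om q)" "a \<in> carrier A1"
 shows "wedge p q (a \<rhd>\<^bsub>Om p\<^esub> \<omega>) \<eta> = a \<rhd>\<^bsub>Om (p + q)\<^esub> wedge p q \<omega> \<eta>"
 using assms(2)
proof (induction rule: form_induct)
 case (fm y bs)
 then show ?case
  using assms cc_lact[of a bs "\<omega> \<lhd>\<^bsub>Om p\<^esub> y" p]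
  by (simp add: wedge_works(2) lact_closed ract_lact ract_closed)
qed (use assms in \<open>simp_all add: wedge_add_r lact_closed lact_add wedge_closed\<close>)

lemma form_d_works:
 shows "form_d K A n \<in> add_homs (Om n) (Om (Suc n))" (is ?g1)
  and "[|x \<in> carrier A1; set as \<subseteq> carrier A; length as = n|] ==>
   form_d K A n (fm K A n x as) = fm K A (Suc n) \<one>\<^bsub>A1\<^esub> (fst x # as)" (is "PROP ?g2")
proof -
 have f: "fst x \<in> carrier A" if "x \<in> carrier A1" for x using that by (auto simp: aug_sel)
 have f2: "fst (x \<oplus>\<^bsub>A1\<^esub> y) = fst x \<oplus>\<^bsub>A\<^esub> fst y" "fst (c \<odot>\<^bsub>A1\<^esub> x) = c \<odot>\<^bsub>A\<^esub> fst x" for x y c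
  by (cases x, cases y, simp add: aug_sel)+
 have m: "multiadd K A n (form_grp K A (Suc n)) (\<lambda>x as. fm K A (Suc n) \<one>\<^bsub>A1\<^esub> (fst x # as))"
 proof (rule multiaddI, goal_cases)
  case (1 x as)
  then show ?case using f[of x] by (simp add: fmD flip: Omega_sel)
 next
  case (2 x y as)
  then show ?case
   using f[of x] f[of y] fmD(3)[of "\<one>\<^bsub>A1\<^esub>" "[]" as "fst x" "fst y" "Suc n"]
   by (simp add: f2 flip: Omega_sel)
 next
  case (3 x us vs a b)
  then show ?case
   using f[of x] fmD(3)[of "\<one>\<^bsub>A1\<^esub>" "fst x # us" vs a b "Suc n"]
   by (simp flip: Omega_sel)
 next
  case (4 x us vs a c)
  then show ?case
   using f[of x] fmD(4)[of "\<one>\<^bsub>A1\<^esub>" "fst x # us" vs a c "Suc n"]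
    fmD(4)[of "\<one>\<^bsub>A1\<^esub>" "[]" "us @ a # vs" "fst x" c "Suc n"]
   by (simp add: f2)
 qed
 show ?g1
  unfolding form_d_def add_homs_Omega(2) by (rule form_lift_works[OF form_grp_abelian_group m])
 show "PROP ?g2"
  unfolding form_d_def by (rule form_lift_works[OF form_grp_abelian_group m])
qed

lemmas form_d_closed = add_homs_closed[OF form_d_works(1)]
lemmas form_d_add = add_homs_add[OF form_d_works(1)]

lemma d_elem_closed: "a \<in> carrier A ==> d_elem K A a \<in> carrier (Om 1)"
 unfolding d_elem_def by (rule fm_closed) simp_all

lemma rmul_fm1:
 assumes "x \<in> carrier A1" "a \<in> carrier A" "b \<in> carrier A"
 shows "fm K A 1 x [a] \<lhd>\<^bsub>Om 1\<^esub> (b, \<zero>) =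
  fm K A 1 x [a \<otimes>\<^bsub>A\<^esub> b] \<ominus>\<^bsub>Om 1\<^esub> fm K A 1 (x \<otimes>\<^bsub>A1\<^esub> (a, \<zero>)) [b]"
 using assms fm_closed[of x "[a]" 1] mul_word_snoc[of x "[]" a b 0]
 by (simp add: ract_elem rmul_works(2) mul_word_Nil snoc_fm aug_elem)

text \<open>This rule makes the extension of a connection well defined on \<open>E \<otimes> \<Omega>\<^sup>n\<close>. On words \<open>x db\<^sub>1 \<dots> db\<^sub>n\<close> it
amounts to \<open>d(ax) = da x + a dx\<close> in the augmented algebra.\<close>

lemma d_leibniz:
 assumes a: "a \<in> carrier A1" and \<omega>: "\<omega> \<in> carrier (Om n)"
 shows "form_d K A n (a \<rhd>\<^bsub>Om n\<^esub> \<omega>) =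
  wedge 1 n (d_elem K A (fst a)) \<omega> \<oplus>\<^bsub>Om (Suc n)\<^esub> a \<rhd>\<^bsub>Om (Suc n)\<^esub> form_d K A n \<omega>"
proof (rule form_hom_eqI[OF _ _ _ \<omega>])
 obtain r c where ar: "a = (r, c)" "r \<in> carrier A" "c \<in> carrier K" using a by (auto simp: aug_sel)
 have dr: "d_elem K A (fst a) \<in> carrier (Om 1)" using ar d_elem_closed by simp
 show "(\<lambda>\<omega>. form_d K A n (a \<rhd>\<^bsub>Om n\<^esub> \<omega>)) \<in> add_homs (Om n) (Om (Suc n))"
  by (rule add_homs_comp[OF lact_works(1)[OF a] form_d_works(1)])
 have w: "wedge 1 n (d_elem K A (fst a)) \<in> add_homs (Om n) (Om (Suc n))"
  using wedge_works(1)[OF dr, of n] by simp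
 show "(\<lambda>\<omega>. wedge 1 n (d_elem K A (fst a)) \<omega> \<oplus>\<^bsub>Om (Suc n)\<^esub> a \<rhd>\<^bsub>Om (Suc n)\<^esub> form_d K A n \<omega>)
   \<in> add_homs (Om n) (Om (Suc n))"
  by (intro add_homs_pointwise_add Omega_abelian_group w add_homs_comp[OF form_d_works(1) lact_works(1)] a)
 fix x bs assume x: "x \<in> carrier A1" "set bs \<subseteq> carrier A" "length bs = n"
 obtain s d where xs: "x = (s, d)" "s \<in> carrier A" "d \<in> carrier K" using x by (auto simp: aug_sel)
 let ?O = "Om (Suc n)"
 let ?f = "\<lambda>y u. fm K A (Suc n) y (u # bs)"
 have fcl: "?f y u \<in> carrier ?O" if "y \<in> carrier A1" "u \<in> carrier A" for y u
  by (rule fm_closed) (use that x in auto)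
 have one: "\<one>\<^bsub>A1\<^esub> \<in> carrier A1" by simp
 have cc1: "cc 1 bs (fm K A 1 y [u]) = ?f y u" if "y \<in> carrier A1" "u \<in> carrier A" for y u
  using cc_works(2)[of bs y "[u]" 1] that x by simp
 have sl: "?f \<one>\<^bsub>A1\<^esub> (u \<oplus>\<^bsub>A\<^esub> v) = ?f \<one>\<^bsub>A1\<^esub> u \<oplus>\<^bsub>?O\<^esub> ?f \<one>\<^bsub>A1\<^esub> v"
  if "u \<in> carrier A" "v \<in> carrier A" for u v
  using fmD(3)[of "\<one>\<^bsub>A1\<^esub>" "[]" bs u v "Suc n"] that x by simp
 have sc: "?f \<one>\<^bsub>A1\<^esub> (k \<odot>\<^bsub>A\<^esub> u) = ?f (emb k) u" if "u \<in> carrier A" "k \<in> carrier K" for u k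
  using fmD(4)[of "\<one>\<^bsub>A1\<^esub>" "[]" bs u k "Suc n"] that x by (simp add: aug_smult aug_scalar)
 have "form_d K A n (a \<rhd>\<^bsub>Om n\<^esub> fm K A n x bs) =
   ?f \<one>\<^bsub>A1\<^esub> (r \<otimes>\<^bsub>A\<^esub> s \<oplus>\<^bsub>A\<^esub> d \<odot>\<^bsub>A\<^esub> r \<oplus>\<^bsub>A\<^esub> c \<odot>\<^bsub>A\<^esub> s)"
  using a x by (simp add: lact_works(2) form_d_works(2)) (simp add: ar xs aug_sel)
 also have "\<dots> = ?f \<one>\<^bsub>A1\<^esub> (r \<otimes>\<^bsub>A\<^esub> s) \<oplus>\<^bsub>?O\<^esub> ?f (emb d) r \<oplus>\<^bsub>?O\<^esub> ?f (emb c) s"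
  using ar xs by (simp add: sl sc nu_mult_closed)
 finally have 1: "form_d K A n (a \<rhd>\<^bsub>Om n\<^esub> fm K A n x bs) = \<dots>" .
 have "fm K A 1 \<one>\<^bsub>A1\<^esub> [r] \<lhd>\<^bsub>Om 1\<^esub> x =
   (emb d) \<rhd>\<^bsub>Om 1\<^esub> fm K A 1 \<one>\<^bsub>A1\<^esub> [r] \<oplus>\<^bsub>Om 1\<^esub>
   (fm K A 1 \<one>\<^bsub>A1\<^esub> [r] \<lhd>\<^bsub>Om 1\<^esub> (s, \<zero>))"
  using ract_eq[of x "fm K A 1 \<one>\<^bsub>A1\<^esub> [r]" 1] fm_closed[OF one, of "[r]" 1] x ar xs
  by (simp add: ract_elem)
 also have "\<dots> = fm K A 1 (emb d) [r] \<oplus>\<^bsub>Om 1\<^esub>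
   (fm K A 1 \<one>\<^bsub>A1\<^esub> [r \<otimes>\<^bsub>A\<^esub> s] \<ominus>\<^bsub>Om 1\<^esub> fm K A 1 (r, \<zero>) [s])"
  using rmul_fm1[OF one, of r s] lact_works(2)[OF aug_scalar one, of d "[r]" 1] ar xs
  by (simp add: aug_scalar aug_elem)
 finally have ra: "fm K A 1 \<one>\<^bsub>A1\<^esub> [r] \<lhd>\<^bsub>Om 1\<^esub> x = \<dots>" .
 have cl1: "fm K A 1 y [u] \<in> carrier (Om 1)" if "y \<in> carrier A1" "u \<in> carrier A" for y u
  by (rule fm_closed) (use that in auto)
 have "wedge 1 n (d_elem K A (fst a)) (fm K A n x bs) = cc 1 bs (fm K A 1 \<one>\<^bsub>A1\<^esub> [r] \<lhd>\<^bsub>Om 1\<^esub> x)"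
  using wedge_works(2)[OF dr x] by (simp add: d_elem_def ar)
 also have "\<dots> = ?f (emb d) r \<oplus>\<^bsub>?O\<^esub> (?f \<one>\<^bsub>A1\<^esub> (r \<otimes>\<^bsub>A\<^esub> s) \<ominus>\<^bsub>?O\<^esub> ?f (r, \<zero>) s)"
  unfolding ra using cc_add[of bs _ 1] cc_minus[of bs _ 1] x(2,3) ar(2,3) xs(2,3)
  by (simp add: cl1 aug_scalar aug_elem nu_mult_closed cc1 plus_1_eq_Suc del: One_nat_def)
 finally have 2: "wedge 1 n (d_elem K A (fst a)) (fm K A n x bs) = \<dots>" .
 have "a \<rhd>\<^bsub>?O\<^esub> form_d K A n (fm K A n x bs) = ?f ((r, \<zero>) \<oplus>\<^bsub>A1\<^esub> (emb c)) s"
  using lact_works(2)[OF a one, of "s # bs" "Suc n"] x a xs ar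
  by (simp add: form_d_works(2) aug_split[symmetric])
 also have "\<dots> = ?f (r, \<zero>) s \<oplus>\<^bsub>?O\<^esub> ?f (emb c) s"
  using fmD(2)[OF aug_elem aug_scalar, of r c "s # bs" "Suc n"] x xs ar by simp
 finally have 3: "a \<rhd>\<^bsub>?O\<^esub> form_d K A n (fm K A n x bs) = \<dots>" .
 have "(p \<oplus>\<^bsub>?O\<^esub> (q \<ominus>\<^bsub>?O\<^esub> t)) \<oplus>\<^bsub>?O\<^esub> (t \<oplus>\<^bsub>?O\<^esub> v) = q \<oplus>\<^bsub>?O\<^esub> p \<oplus>\<^bsub>?O\<^esub> v"
  if "p \<in> carrier ?O" "q \<in> carrier ?O" "t \<in> carrier ?O" "v \<in> carrier ?O" for p q t v
 proof -
  have "(p \<oplus>\<^bsub>?O\<^esub> (q \<oplus>\<^bsub>?O\<^esub> \<ominus>\<^bsub>?O\<^esub> t)) \<oplus>\<^bsub>?O\<^esub> (t \<oplus>\<^bsub>?O\<^esub> v) = (\<ominus>\<^bsub>?O\<^esub> t \<oplus>\<^bsub>?O\<^esub> t) \<oplus>\<^bsub>?O\<^esub> (q \<oplus>\<^bsub>?O\<^esub> p \<oplus>\<^bsub>?O\<^esub> v)"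
   using that by (simp add: Om.a_ac)
  then show ?thesis using that by (simp add: a_minus_def Om.l_neg)
 qed
 then show "form_d K A n (a \<rhd>\<^bsub>Om n\<^esub> fm K A n x bs) =
   wedge 1 n (d_elem K A (fst a)) (fm K A n x bs) \<oplus>\<^bsub>?O\<^esub> a \<rhd>\<^bsub>?O\<^esub> form_d K A n (fm K A n x bs)"
  unfolding 1 2 3 using ar xs by (simp add: fcl aug_scalar aug_elem nu_mult_closed)
qed

end

declare One_nat_def [simp del] \<comment> \<open>keeps the degree 1 a numeral, as in the definitions of connections\<close>

section \<open>Forms with coefficients in a module, and connections\<close>

locale form_module = k_algebra K A + E: right_module "aug K A" E
 for K :: "('k, 'n) ring_scheme" (structure) and A :: "('k, 'a) module" (structure)
  and E :: "('a \<times> 'k, 'e) rmodule"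
begin

abbreviation MF where "MF \<equiv> mod_forms K A E"
abbreviation ftn where "ftn \<equiv> form_tens K A E"

lemma mf_tensor: "tensor_bimod E A1 (Om n) A1"
 by (intro tensor_bimod.intro tensor_pair.intro tensor_pair_axioms.intro tensor_bimod_axioms.intro
   E.abelian_group_axioms Omega_abelian_group aug_ring)
  (auto simp: E.ract_closed lact_closed ract_closed ract_add ract_r_distr ract_assoc ract_one ract_lact)

sublocale mf: tensor_bimod E "A1" "Om n" "A1" for n
 by (rule mf_tensor)

lemma mf_right_module: "right_module A1 (MF n)"
 unfolding mod_forms_def by (rule mf.tensor_right_module)

sublocale MF: right_module "A1" "MF n" for n
 by (rule mf_right_module)

lemmas ft_closed = mf.tens_closed[folded mod_forms_def form_tens_def]
lemmas ft_add_l = mf.tens_add_l[folded mod_forms_def form_tens_def]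
lemmas ft_add_r = mf.tens_add_r[folded mod_forms_def form_tens_def]
lemmas ft_bal = mf.tens_bal[folded mod_forms_def form_tens_def]
lemmas ft_zero_r = mf.tens_zero_r[folded mod_forms_def form_tens_def]
lemmas ft_minus_r = mf.tens_minus_r[folded mod_forms_def form_tens_def]
lemmas ft_ract = mf.tensor_ract(2)[folded mod_forms_def form_tens_def]
lemmas mf_ract_hom = mf.tensor_ract(1)[folded mod_forms_def form_tens_def]
lemmas mf_lift = mf.tensor_lift_works[folded mod_forms_def form_tens_def]
lemmas mf_hom_eqI = mf.tensor_hom_eqI[folded mod_forms_def form_tens_def]

text \<open>Since \<open>e \<otimes> x da\<^sub>1 \<dots> da\<^sub>n = e x \<otimes> da\<^sub>1 \<dots> da\<^sub>n\<close>, the forms \<open>e \<otimes> da\<^sub>1 \<dots> da\<^sub>n\<close> generate.\<close>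

lemma mf_induct [consumes 1, case_names word add]:
 assumes t: "t \<in> carrier (MF n)"
  and word: "\<And>e as. [|e \<in> carrier E; set as \<subseteq> carrier A; length as = n|] ==>
   P (ftn n e (fm K A n \<one>\<^bsub>A1\<^esub> as))"
  and add: "\<And>x y. [|x \<in> carrier (MF n); y \<in> carrier (MF n); P x; P y|] ==>
     P (x \<oplus>\<^bsub>MF n\<^esub> y)"
 shows "P t"
 using t unfolding mod_forms_def
proof (induction rule: mf.tensor_induct)
 case (tens e \<omega>)
 from tens(2) show ?case
 proof (induction rule: form_induct)
  case (fm x as)
  have "ftn n e (fm K A n x as) = ftn n (e \<lhd>\<^bsub>E\<^esub> x) (fm K A n \<one>\<^bsub>A1\<^esub> as)"
   using fm tens by (simp add: ft_bal lact_works(2) fm_closed)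
  then show ?case
   using word[of "e \<lhd>\<^bsub>E\<^esub> x" as] fm tens by (simp add: E.ract_closed form_tens_def)
 next
  case (add \<omega> \<omega>')
  then show ?case
   using tens assms(3) by (simp add: mf.tens_add_r mf.tens_closed mod_forms_def)
 qed
next
 case (add x y)
 then show ?case using assms(3) by (simp add: mod_forms_def)
qed

lemma mf_word_eqI:
 assumes "g \<in> add_homs (MF n) M" "h \<in> add_homs (MF n) M"
  and "\<And>e as. [|e \<in> carrier E; set as \<subseteq> carrier A; length as = n|] ==>
   g (ftn n e (fm K A n \<one>\<^bsub>A1\<^esub> as)) = h (ftn n e (fm K A n \<one>\<^bsub>A1\<^esub> as))"
  and t: "t \<in> carrier (MF n)"
 shows "g t = h t"
 using t by (induction rule: mf_induct) (use assms in \<open>simp_all add: add_homs_add\<close>)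

text \<open>Right multiplication by a form, and in particular by \<open>db\<^sub>1 \<dots> db\<^sub>q\<close>.\<close>

lemma mod_forms_mult_works:
 assumes \<eta>: "\<eta> \<in> carrier (Om q)"
 shows "(\<lambda>t. mod_forms_mult K A E p q t \<eta>) \<in> add_homs (MF p) (MF (p + q))" (is ?g1)
  and "[|e \<in> carrier E; \<omega> \<in> carrier (Om p)|] ==>
   mod_forms_mult K A E p q (ftn p e \<omega>) \<eta> = ftn (p + q) e (wedge p q \<omega> \<eta>)" (is "PROP ?g2")
proof -
 let ?\<phi> = "\<lambda>e \<omega>. ftn (p + q) e (form_mult K A p q \<omega> \<eta>)"
 have *: "?\<phi> e \<omega> \<in> carrier (MF (p + q))"
  "[|e' \<in> carrier E|] ==> ?\<phi> (e \<oplus>\<^bsub>E\<^esub> e') \<omega> = ?\<phi> e \<omega> \<oplus>\<^bsub>MF (p + q)\<^esub> ?\<phi> e' \<omega>"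
  "[|\<omega>' \<in> carrier (Om p)|] ==>
   ?\<phi> e (\<omega> \<oplus>\<^bsub>Om p\<^esub> \<omega>') = ?\<phi> e \<omega> \<oplus>\<^bsub>MF (p + q)\<^esub> ?\<phi> e \<omega>'"
  "[|a \<in> carrier A1|] ==> ?\<phi> (e \<lhd>\<^bsub>E\<^esub> a) \<omega> = ?\<phi> e (a \<rhd>\<^bsub>Om p\<^esub> \<omega>)"
  if "e \<in> carrier E" "\<omega> \<in> carrier (Om p)" for e \<omega> e' \<omega>' a
  using that \<eta> wedge_closed[of \<omega> p \<eta> q]
  by (simp_all add: form_mult_eq ft_closed ft_add_l ft_add_r wedge_closed wedge_add_l lact_closed
    wedge_lact ft_bal)
 note lift = mf_lift[where n = p and \<phi> = ?\<phi> and M = "MF (p + q)", OF MF.abelian_group_axioms *]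
 show ?g1
  unfolding mod_forms_mult_def by (rule lift(1))
 show "PROP ?g2"
  unfolding mod_forms_mult_def using lift(3) \<eta> by (simp add: form_mult_eq)
qed

lemmas mod_forms_mult_closed = add_homs_closed[OF mod_forms_mult_works(1)]
lemmas mod_forms_mult_add_l = add_homs_add[OF mod_forms_mult_works(1)]

lemma mod_forms_mult_add_r:
 assumes "t \<in> carrier (MF p)" "\<eta> \<in> carrier (Om q)" "\<eta>' \<in> carrier (Om q)"
 shows "mod_forms_mult K A E p q t (\<eta> \<oplus>\<^bsub>Om q\<^esub> \<eta>') =
  mod_forms_mult K A E p q t \<eta> \<oplus>\<^bsub>MF (p + q)\<^esub> mod_forms_mult K A E p q t \<eta>'"
 using assms(1)
proof (induction rule: mf_induct)
 case (word e as)
 then have "fm K A p \<one>\<^bsub>A1\<^esub> as \<in> carrier (Om p)" by (simp add: fm_closed)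
 then show ?case
  using word assms by (simp add: mod_forms_mult_works(2) wedge_add_r ft_add_r wedge_closed)
next
 case (add x y)
 then show ?case
  using assms by (simp add: mod_forms_mult_add_l mod_forms_mult_closed MF.a_ac)
qed

lemma mod_forms_mult_bal:
 assumes "t \<in> carrier (MF p)" "\<eta> \<in> carrier (Om q)" "a \<in> carrier A1"
 shows "mod_forms_mult K A E p q (t \<lhd>\<^bsub>MF p\<^esub> a) \<eta> =
  mod_forms_mult K A E p q t (a \<rhd>\<^bsub>Om q\<^esub> \<eta>)"
 using assms(1)
proof (induction rule: mf_induct)
 case (word e as)
 then have "fm K A p \<one>\<^bsub>A1\<^esub> as \<in> carrier (Om p)" by (simp add: fm_closed)
 then show ?case
  using word assms
  by (simp add: mod_forms_mult_works(2) ft_ract wedge_bal lact_closed ract_closed)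
next
 case (add x y)
 then show ?case
  using assms by (simp add: mod_forms_mult_add_l MF.ract_l_distr MF.ract_closed lact_closed)
qed

definition mcc :: "nat \<Rightarrow> 'a list \<Rightarrow> ('k, 'a, 'e) form_ext \<Rightarrow> ('k, 'a, 'e) form_ext" where
 "mcc n bs t = mod_forms_mult K A E n (length bs) t (fm K A (length bs) \<one>\<^bsub>A1\<^esub> bs)"

lemma mcc_works:
 assumes bs: "set bs \<subseteq> carrier A"
 shows "mcc n bs \<in> add_homs (MF n) (MF (n + length bs))" (is ?g1)
  and "[|e \<in> carrier E; \<omega> \<in> carrier (Om n)|] ==>
   mcc n bs (ftn n e \<omega>) = ftn (n + length bs) e (cc n bs \<omega>)" (is "PROP ?g2")
proof -
 have f: "fm K A (length bs) \<one>\<^bsub>A1\<^esub> bs \<in> carrier (Om (length bs))"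
  using bs by (simp add: fm_closed)
 show ?g1
  using mod_forms_mult_works(1)[OF f, of n] unfolding mcc_def[abs_def] .
 show "PROP ?g2"
  using mod_forms_mult_works(2)[OF f] bs by (simp add: mcc_def wedge_works(2) ract_one)
qed

lemma msnoc_hom:
 "b \<in> carrier A ==> mcc n [b] \<in> add_homs (MF n) (MF (Suc n))"
 using mcc_works(1)[of "[b]" n] by simp

lemmas msnoc_closed = add_homs_closed[OF msnoc_hom]
lemmas msnoc_add = add_homs_add[OF msnoc_hom]
lemmas msnoc_ft = mcc_works(2)[of "[b]" for b, simplified]

lemma mcc_Cons:
 assumes b: "b \<in> carrier A" "set bs \<subseteq> carrier A" and t: "t \<in> carrier (MF n)"
 shows "mcc (Suc n) bs (mcc n [b] t) = mcc n (b # bs) t"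
proof (rule mf_hom_eqI[OF _ _ _ t])
 show "(\<lambda>t. mcc (Suc n) bs (mcc n [b] t)) \<in> add_homs (MF n) (MF (Suc n + length bs))"
  using b by (intro add_homs_comp[OF msnoc_hom mcc_works(1)])
 show "mcc n (b # bs) \<in> add_homs (MF n) (MF (Suc n + length bs))"
  using b mcc_works(1)[of "b # bs" n] by simp
 fix e \<omega> assume "e \<in> carrier E" "\<omega> \<in> carrier (Om n)"
 then show "mcc (Suc n) bs (mcc n [b] (ftn n e \<omega>)) = mcc n (b # bs) (ftn n e \<omega>)"
  using b mcc_works(2)[of "b # bs" e \<omega> n] by (simp add: msnoc_ft mcc_works(2) snoc_closed cc_Cons)
qed

lemma msnoc_ract:
 assumes "a \<in> carrier A" "b \<in> carrier A" and t: "t \<in> carrier (MF n)"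
 shows "mcc n [a] t \<lhd>\<^bsub>MF (Suc n)\<^esub> (b, \<zero>) =
  mcc n [a \<otimes>\<^bsub>A\<^esub> b] t \<ominus>\<^bsub>MF (Suc n)\<^esub> mcc n [b] (t \<lhd>\<^bsub>MF n\<^esub> (a, \<zero>))"
proof (rule mf_hom_eqI[OF _ _ _ t])
 show "(\<lambda>t. mcc n [a] t \<lhd>\<^bsub>MF (Suc n)\<^esub> (b, \<zero>)) \<in> add_homs (MF n) (MF (Suc n))"
  by (rule add_homs_comp[OF msnoc_hom mf_ract_hom]) (use assms aug_elem in auto)
 show "(\<lambda>t. mcc n [a \<otimes>\<^bsub>A\<^esub> b] t \<ominus>\<^bsub>MF (Suc n)\<^esub> mcc n [b] (t \<lhd>\<^bsub>MF n\<^esub> (a, \<zero>)))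
   \<in> add_homs (MF n) (MF (Suc n))"
  by (intro add_homs_pointwise_minus MF.abelian_group_axioms msnoc_hom
    add_homs_comp[OF mf_ract_hom msnoc_hom] nu_mult_closed aug_elem assms)
 fix e \<omega> assume "e \<in> carrier E" "\<omega> \<in> carrier (Om n)"
 then show "mcc n [a] (ftn n e \<omega>) \<lhd>\<^bsub>MF (Suc n)\<^esub> (b, \<zero>) =
  mcc n [a \<otimes>\<^bsub>A\<^esub> b] (ftn n e \<omega>) \<ominus>\<^bsub>MF (Suc n)\<^esub>
  mcc n [b] (ftn n e \<omega> \<lhd>\<^bsub>MF n\<^esub> (a, \<zero>))"
  using assms(1,2)
  by (simp add: msnoc_ft ft_ract aug_elem ract_elem snoc_closed rmul_snoc rmul_closed nu_mult_closed
    ft_minus_r)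
qed

lemma msnoc_add_r:
 assumes "a \<in> carrier A" "b \<in> carrier A" and t: "t \<in> carrier (MF n)"
 shows "mcc n [a \<oplus>\<^bsub>A\<^esub> b] t = mcc n [a] t \<oplus>\<^bsub>MF (Suc n)\<^esub> mcc n [b] t"
proof (rule mf_hom_eqI[OF _ _ _ t])
 show "mcc n [a \<oplus>\<^bsub>A\<^esub> b] \<in> add_homs (MF n) (MF (Suc n))"
  using assms by (intro msnoc_hom) auto
 show "(\<lambda>t. mcc n [a] t \<oplus>\<^bsub>MF (Suc n)\<^esub> mcc n [b] t)
   \<in> add_homs (MF n) (MF (Suc n))"
  by (intro add_homs_pointwise_add MF.abelian_group_axioms msnoc_hom assms)
 fix e \<omega> assume "e \<in> carrier E" "\<omega> \<in> carrier (Om n)"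
 then show "mcc n [a \<oplus>\<^bsub>A\<^esub> b] (ftn n e \<omega>) =
   mcc n [a] (ftn n e \<omega>) \<oplus>\<^bsub>MF (Suc n)\<^esub> mcc n [b] (ftn n e \<omega>)"
  using assms(1,2) by (simp add: msnoc_ft snoc_closed snoc_add_r ft_add_r)
qed

lemma msnoc_scal:
 assumes "a \<in> carrier A" "c \<in> carrier K" and t: "t \<in> carrier (MF n)"
 shows "mcc n [c \<odot>\<^bsub>A\<^esub> a] t = mcc n [a] (t \<lhd>\<^bsub>MF n\<^esub> (emb c))" (is ?g1)
  and "mcc n [c \<odot>\<^bsub>A\<^esub> a] t = mcc n [a] t \<lhd>\<^bsub>MF (Suc n)\<^esub> (emb c)" (is ?g2)
proof -
 have h: "mcc n [c \<odot>\<^bsub>A\<^esub> a] \<in> add_homs (MF n) (MF (Suc n))"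
  using assms by (intro msnoc_hom) auto
 show ?g1
  by (rule mf_hom_eqI[OF h add_homs_comp[OF mf_ract_hom msnoc_hom] _ t])
   (use assms in \<open>simp_all add: msnoc_ft ft_ract aug_scalar lact_closed ract_scalar snoc_scal\<close>)
 show ?g2
  by (rule mf_hom_eqI[OF h add_homs_comp[OF msnoc_hom mf_ract_hom] _ t])
   (use assms in \<open>simp_all add: msnoc_ft ft_ract aug_scalar snoc_closed ract_scalar snoc_scal snoc_lact\<close>)
qed

text \<open>The two rules for scalars and for elements of \<open>R\<close> are one rule over the augmented algebra, where \<open>d\<close> kills
the scalars.\<close>

lemma connectionD:
 assumes "connection K A E D"
 shows "D \<in> add_homs E (MF 1)"
  and "[|e \<in> carrier E; a \<in> carrier A1|] ==>
   D (e \<lhd>\<^bsub>E\<^esub> a) = D e \<lhd>\<^bsub>MF 1\<^esub> a \<oplus>\<^bsub>MF 1\<^esub> ftn 1 e (d_elem K A (fst a))"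
proof -
 note D = assms[unfolded connection_def]
 show h: "D \<in> add_homs E (MF 1)" using D by blast
 assume e: "e \<in> carrier E" and "a \<in> carrier A1"
 then obtain r c where a: "a = (r, c)" "r \<in> carrier A" "c \<in> carrier K" by (auto simp: aug_sel)
 have De: "D e \<in> carrier (MF 1)" using add_homs_closed[OF h e] .
 have ds: "x \<lhd>\<^bsub>M\<^esub> a = x \<lhd>\<^bsub>M\<^esub> (r, \<zero>) \<oplus>\<^bsub>M\<^esub> x \<lhd>\<^bsub>M\<^esub> (emb c)"
  if "right_module A1 M" "x \<in> carrier M" for M :: "('a \<times> 'k, 'z) rmodule" and x
  using right_module.ract_r_distr[OF that aug_elem[OF a(2)] aug_scalar[OF a(3)]]
   aug_split[OF a(2,3)] a(1) by simp
 have "D (e \<lhd>\<^bsub>E\<^esub> a) = D (e \<lhd>\<^bsub>E\<^esub> (r, \<zero>)) \<oplus>\<^bsub>MF 1\<^esub> D (e \<lhd>\<^bsub>E\<^esub> (emb c))"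
  using ds[OF E.right_module_axioms e] a e
  by (simp add: add_homs_add[OF h] E.ract_closed aug_elem aug_scalar)
 also have "\<dots> = (D e \<lhd>\<^bsub>MF 1\<^esub> (r, \<zero>) \<oplus>\<^bsub>MF 1\<^esub> ftn 1 e (d_elem K A r))
   \<oplus>\<^bsub>MF 1\<^esub> D e \<lhd>\<^bsub>MF 1\<^esub> (emb c)"
 proof -
  have "D (e \<lhd>\<^bsub>E\<^esub> (r, \<zero>)) = D e \<lhd>\<^bsub>MF 1\<^esub> (r, \<zero>) \<oplus>\<^bsub>MF 1\<^esub>
    ftn 1 e (d_elem K A r)"
   and "D (e \<lhd>\<^bsub>E\<^esub> (emb c)) = D e \<lhd>\<^bsub>MF 1\<^esub> (emb c)"
   using D e a by blast+
  then show ?thesis by simp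
 qed
 also have "\<dots> = (D e \<lhd>\<^bsub>MF 1\<^esub> (r, \<zero>) \<oplus>\<^bsub>MF 1\<^esub> D e \<lhd>\<^bsub>MF 1\<^esub> (emb c))
   \<oplus>\<^bsub>MF 1\<^esub> ftn 1 e (d_elem K A r)"
  using De e a
  by (simp add: MF.a_ac MF.ract_closed aug_elem aug_scalar ft_closed d_elem_closed)
 finally show "D (e \<lhd>\<^bsub>E\<^esub> a) = D e \<lhd>\<^bsub>MF 1\<^esub> a \<oplus>\<^bsub>MF 1\<^esub>
   ftn 1 e (d_elem K A (fst a))"
  using ds[OF MF.right_module_axioms De] a by simp
qed

text \<open>The sum \<open>\<nabla>(e) \<omega> + e \<otimes> d\<omega>\<close> is balanced although neither summand is: the defects cancel by the Leibniz
rules of \<open>\<nabla>\<close> and of \<open>d\<close>.\<close>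

lemma connection_ext_works:
 assumes D: "connection K A E D"
 shows "connection_ext K A E D n \<in> add_homs (MF n) (MF (Suc n))" (is ?g1)
  and "[|e \<in> carrier E; \<omega> \<in> carrier (Om n)|] ==>
   connection_ext K A E D n (ftn n e \<omega>) =
   mod_forms_mult K A E 1 n (D e) \<omega> \<oplus>\<^bsub>MF (Suc n)\<^esub>
   ftn (Suc n) e (form_d K A n \<omega>)"
proof -
 note Dh = connectionD(1)[OF D] and DL = connectionD(2)[OF D]
 note Dc = add_homs_closed[OF Dh] and Da = add_homs_add[OF Dh]
 let ?M = "MF (Suc n)"
 let ?\<phi> = "\<lambda>e \<omega>. mod_forms_mult K A E 1 n (D e) \<omega> \<oplus>\<^bsub>?M\<^esub> ftn (Suc n) e (form_d K A n \<omega>)"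
 note mm = mod_forms_mult_closed[where p = 1 and q = n, unfolded plus_1_eq_Suc]
  mod_forms_mult_add_l[where p = 1 and q = n, unfolded plus_1_eq_Suc]
  mod_forms_mult_add_r[where p = 1 and q = n, unfolded plus_1_eq_Suc]
  mod_forms_mult_bal[where p = 1 and q = n, unfolded plus_1_eq_Suc]
  mod_forms_mult_works(2)[where p = 1 and q = n, unfolded plus_1_eq_Suc]
 note wc = wedge_closed[where p = 1 and q = n, unfolded plus_1_eq_Suc]
 have *: "?\<phi> e \<omega> \<in> carrier ?M"
  "[|e' \<in> carrier E|] ==> ?\<phi> (e \<oplus>\<^bsub>E\<^esub> e') \<omega> = ?\<phi> e \<omega> \<oplus>\<^bsub>?M\<^esub> ?\<phi> e' \<omega>"
  "[|\<omega>' \<in> carrier (Om n)|] ==> ?\<phi> e (\<omega> \<oplus>\<^bsub>Om n\<^esub> \<omega>') = ?\<phi> e \<omega> \<oplus>\<^bsub>?M\<^esub> ?\<phi> e \<omega>'"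
  "[|a \<in> carrier A1|] ==> ?\<phi> (e \<lhd>\<^bsub>E\<^esub> a) \<omega> = ?\<phi> e (a \<rhd>\<^bsub>Om n\<^esub> \<omega>)"
  if e: "e \<in> carrier E" and \<omega>: "\<omega> \<in> carrier (Om n)" for e \<omega> e' \<omega>' a
 proof -
  show "?\<phi> e \<omega> \<in> carrier ?M"
   using e \<omega> by (simp add: mm Dc ft_closed form_d_closed)
  show "?\<phi> (e \<oplus>\<^bsub>E\<^esub> e') \<omega> = ?\<phi> e \<omega> \<oplus>\<^bsub>?M\<^esub> ?\<phi> e' \<omega>" if "e' \<in> carrier E"
   using e \<omega> that
   by (simp add: mm Dc Da ft_closed ft_add_l form_d_closed MF.a_ac)
  show "?\<phi> e (\<omega> \<oplus>\<^bsub>Om n\<^esub> \<omega>') = ?\<phi> e \<omega> \<oplus>\<^bsub>?M\<^esub> ?\<phi> e \<omega>'" if "\<omega>' \<in> carrier (Om n)"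
   using e \<omega> that
   by (simp add: mm Dc ft_closed ft_add_r form_d_closed form_d_add MF.a_ac)
  show "?\<phi> (e \<lhd>\<^bsub>E\<^esub> a) \<omega> = ?\<phi> e (a \<rhd>\<^bsub>Om n\<^esub> \<omega>)" if a: "a \<in> carrier A1"
  proof -
   have fa: "fst a \<in> carrier A" using a by (auto simp: aug_sel)
   note dc = d_elem_closed[OF fa]
   have "?\<phi> (e \<lhd>\<^bsub>E\<^esub> a) \<omega> =
     (mod_forms_mult K A E 1 n (D e \<lhd>\<^bsub>MF 1\<^esub> a) \<omega> \<oplus>\<^bsub>?M\<^esub>
      mod_forms_mult K A E 1 n (ftn 1 e (d_elem K A (fst a))) \<omega>) \<oplus>\<^bsub>?M\<^esub>
     ftn (Suc n) e (a \<rhd>\<^bsub>Om (Suc n)\<^esub> form_d K A n \<omega>)"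
    using e \<omega> a dc
    by (simp add: DL mm Dc ft_closed MF.ract_closed ft_bal form_d_closed)
   also have "\<dots> = mod_forms_mult K A E 1 n (D e) (a \<rhd>\<^bsub>Om n\<^esub> \<omega>) \<oplus>\<^bsub>?M\<^esub>
     (ftn (Suc n) e (wedge 1 n (d_elem K A (fst a)) \<omega>) \<oplus>\<^bsub>?M\<^esub>
     ftn (Suc n) e (a \<rhd>\<^bsub>Om (Suc n)\<^esub> form_d K A n \<omega>))"
    using e \<omega> a dc
    by (simp add: mm Dc ft_closed form_d_closed wc lact_closed MF.a_assoc)
   also have "\<dots> = ?\<phi> e (a \<rhd>\<^bsub>Om n\<^esub> \<omega>)"
    using e \<omega> a dc by (simp add: d_leibniz ft_add_r form_d_closed wc lact_closed)
   finally show ?thesis .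
  qed
 qed
 note lift = mf_lift[where n = n and \<phi> = ?\<phi> and M = ?M, OF MF.abelian_group_axioms *]
 show ?g1
  unfolding connection_ext_def by (rule lift(1))
 show "[|e \<in> carrier E; \<omega> \<in> carrier (Om n)|] ==>
   connection_ext K A E D n (ftn n e \<omega>) = ?\<phi> e \<omega>"
  unfolding connection_ext_def by (rule lift(3))
qed

lemmas connection_ext_closed = add_homs_closed[OF connection_ext_works(1)]
lemmas connection_ext_add = add_homs_add[OF connection_ext_works(1)]
text \<open>Because \<open>d(da\<^sub>1 \<dots> da\<^sub>n) = 0\<close>, only the first summand survives on the generators.\<close>

lemma connection_ext_word:
 assumes D: "connection K A E D" and "e \<in> carrier E" "set as \<subseteq> carrier A"
 shows "connection_ext K A E D (length as) (ftn (length as) e (fm K A (length as) \<one>\<^bsub>A1\<^esub> as)) =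
  mcc 1 as (D e)"
proof -
 let ?n = "length as"
 have f: "fm K A ?n \<one>\<^bsub>A1\<^esub> as \<in> carrier (Om ?n)" using assms by (simp add: fm_closed)
 have f2: "fm K A (Suc ?n) \<one>\<^bsub>A1\<^esub> (\<zero>\<^bsub>A\<^esub> # as) \<in> carrier (Om (Suc ?n))"
  using assms by (intro fm_closed) auto
 then have z: "fm K A (Suc ?n) \<one>\<^bsub>A1\<^esub> (\<zero>\<^bsub>A\<^esub> # as) = \<zero>\<^bsub>Om (Suc ?n)\<^esub>"
  using fmD(3)[of "\<one>\<^bsub>A1\<^esub>" "[]" as "\<zero>\<^bsub>A\<^esub>" "\<zero>\<^bsub>A\<^esub>" "Suc ?n"] assms
  by (intro Om.idem_zero) simp_all
 have "form_d K A ?n (fm K A ?n \<one>\<^bsub>A1\<^esub> as) = \<zero>\<^bsub>Om (Suc ?n)\<^esub>"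
  using form_d_works(2)[of "\<one>\<^bsub>A1\<^esub>" as ?n] assms z by (simp add: aug_sel)
 then show ?thesis
  using connection_ext_works(2)[OF D assms(2) f] assms
   mod_forms_mult_closed[OF f add_homs_closed[OF connectionD(1)[OF D] assms(2)]]
  by (simp add: ft_zero_r mcc_def plus_1_eq_Suc)
qed

text \<open>
 The extension of a connection is right linear over forms with constant coefficients, so its
 square vanishes in all degrees as soon as it vanishes on \<open>E\<close>.
\<close>

lemma connection_ext_mcc:
 assumes D: "connection K A E D" and u: "u \<in> carrier (MF 1)" and as: "set as \<subseteq> carrier A"
 shows "connection_ext K A E D (Suc (length as)) (mcc 1 as u) = mcc 2 as (connection_ext K A E D 1 u)"
proof (rule mf_word_eqI[OF _ _ _ u])
 have m1: "mcc 1 as \<in> add_homs (MF 1) (MF (Suc (length as)))"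
  using mcc_works(1)[OF as, of 1] by (simp add: plus_1_eq_Suc)
 have m2: "mcc 2 as \<in> add_homs (MF (Suc 1)) (MF (Suc (Suc (length as))))"
  using mcc_works(1)[OF as, of 2] by (simp add: numeral_2_eq_2)
 show "(\<lambda>u. connection_ext K A E D (Suc (length as)) (mcc 1 as u))
   \<in> add_homs (MF 1) (MF (Suc (Suc (length as))))"
  by (rule add_homs_comp[OF m1 connection_ext_works(1)[OF D]])
 show "(\<lambda>u. mcc 2 as (connection_ext K A E D 1 u))
   \<in> add_homs (MF 1) (MF (Suc (Suc (length as))))"
  by (rule add_homs_comp[OF connection_ext_works(1)[OF D] m2])
 fix e xs assume e: "e \<in> carrier E" and "set xs \<subseteq> carrier A" "length xs = 1"
 then obtain x where x: "xs = [x]" "x \<in> carrier A" by (cases xs) auto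
 have De: "D e \<in> carrier (MF 1)" using add_homs_closed[OF connectionD(1)[OF D] e] .
 have f: "fm K A 1 \<one>\<^bsub>A1\<^esub> [x] \<in> carrier (Om 1)" using x by (simp add: fm_closed)
 have "mcc 1 as (ftn 1 e (fm K A 1 \<one>\<^bsub>A1\<^esub> [x])) =
   ftn (Suc (length as)) e (fm K A (Suc (length as)) \<one>\<^bsub>A1\<^esub> (x # as))"
  using mcc_works(2)[OF as e f] cc_works(2)[OF as, of "\<one>\<^bsub>A1\<^esub>" "[x]" 1] x
  by (simp add: plus_1_eq_Suc)
 then have "connection_ext K A E D (Suc (length as)) (mcc 1 as (ftn 1 e (fm K A 1 \<one>\<^bsub>A1\<^esub> [x]))) =
   mcc 1 (x # as) (D e)"
  using connection_ext_word[OF D e, of "x # as"] x as by simp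
 also have "\<dots> = mcc 2 as (mcc 1 [x] (D e))"
  using mcc_Cons[OF x(2) as De] by (simp add: numeral_2_eq_2)
 also have "mcc 1 [x] (D e) = connection_ext K A E D 1 (ftn 1 e (fm K A 1 \<one>\<^bsub>A1\<^esub> [x]))"
  using connection_ext_word[OF D e, of "[x]"] x by (simp add: One_nat_def)
 finally show "connection_ext K A E D (Suc (length as)) (mcc 1 as (ftn 1 e (fm K A 1 \<one>\<^bsub>A1\<^esub> xs))) =
   mcc 2 as (connection_ext K A E D 1 (ftn 1 e (fm K A 1 \<one>\<^bsub>A1\<^esub> xs)))"
  by (simp add: x)
qed

lemma flat_connectionI:
 assumes D: "connection K A E D"
  and flat: "\<And>e. e \<in> carrier E ==> connection_ext K A E D 1 (D e) = \<zero>\<^bsub>MF 2\<^esub>"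
 shows "flat_connection K A E D"
 unfolding flat_connection_def
proof (intro conjI ballI allI impI D flat)
 fix n :: nat and t assume t: "t \<in> carrier (MF n)"
 let ?M = "MF (Suc (Suc n))"
 show "connection_ext K A E D (Suc n) (connection_ext K A E D n t) = \<zero>\<^bsub>?M\<^esub>"
  using t
 proof (induction rule: mf_induct)
  case (word e as)
  have De: "D e \<in> carrier (MF 1)"
   using add_homs_closed[OF connectionD(1)[OF D] word(1)] .
  have m2: "mcc 2 as \<in> add_homs (MF 2) ?M"
   using mcc_works(1)[OF word(2), of 2] word by (simp add: numeral_2_eq_2)
  show ?case
   using connection_ext_word[OF D word(1,2)] connection_ext_mcc[OF D De word(2)] flat[OF word(1)]
    add_homs_zero[OF MF.abelian_group_axioms MF.abelian_group_axioms m2] word(3)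
   by simp
 next
  case (add x y)
  then show ?case
   by (simp add: connection_ext_add[OF D] connection_ext_closed[OF D])
 qed
qed

end

section \<open>Ideals and quotients of algebras\<close>

lemma alg_homD:
 assumes "h \<in> alg_hom K A B"
 shows "x \<in> carrier A ==> h x \<in> carrier B"
  and "[|x \<in> carrier A; y \<in> carrier A|] ==> h (x \<oplus>\<^bsub>A\<^esub> y) = h x \<oplus>\<^bsub>B\<^esub> h y"
  and "[|x \<in> carrier A; y \<in> carrier A|] ==> h (x \<otimes>\<^bsub>A\<^esub> y) = h x \<otimes>\<^bsub>B\<^esub> h y"
  and "[|c \<in> carrier K; x \<in> carrier A|] ==> h (c \<odot>\<^bsub>A\<^esub> x) = c \<odot>\<^bsub>B\<^esub> h x"
  and "h \<in> add_homs A B"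
 using assms by (auto simp: alg_hom_def hom_def)

lemma alg_homI:
 assumes "\<And>x. x \<in> carrier A ==> h x \<in> carrier B"
  and "\<And>x y. [|x \<in> carrier A; y \<in> carrier A|] ==> h (x \<oplus>\<^bsub>A\<^esub> y) = h x \<oplus>\<^bsub>B\<^esub> h y"
  and "\<And>x y. [|x \<in> carrier A; y \<in> carrier A|] ==> h (x \<otimes>\<^bsub>A\<^esub> y) = h x \<otimes>\<^bsub>B\<^esub> h y"
  and "\<And>c x. [|c \<in> carrier K; x \<in> carrier A|] ==> h (c \<odot>\<^bsub>A\<^esub> x) = c \<odot>\<^bsub>B\<^esub> h x"
 shows "h \<in> alg_hom K A B"
 using assms by (auto simp: alg_hom_def hom_def)

lemma alg_hom_comp: "[|h \<in> alg_hom K A B; g \<in> alg_hom K B C|] ==> (\<lambda>x. g (h x)) \<in> alg_hom K A C"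
 by (rule alg_homI) (simp_all add: alg_homD)

lemma alg_hom_zero: "[|nu_algebra K A; nu_algebra K B; h \<in> alg_hom K A B|] ==> h \<zero>\<^bsub>A\<^esub> = \<zero>\<^bsub>B\<^esub>"
 by (rule add_homs_zero[OF abelian_group_of_module abelian_group_of_module alg_homD(5)])

lemma alg_hom_minus:
 "[|nu_algebra K A; nu_algebra K B; h \<in> alg_hom K A B; x \<in> carrier A; y \<in> carrier A|] ==>
  h (x \<ominus>\<^bsub>A\<^esub> y) = h x \<ominus>\<^bsub>B\<^esub> h y"
 by (rule add_homs_minus[OF abelian_group_of_module abelian_group_of_module alg_homD(5)])

definition nu_ideal :: "('k, 'n) ring_scheme \<Rightarrow> ('k, 'a) module \<Rightarrow> 'a set \<Rightarrow> bool" where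
 "nu_ideal K A I \<longleftrightarrow> I \<subseteq> carrier A \<and> \<zero>\<^bsub>A\<^esub> \<in> I \<and>
  (\<forall>x\<in>I. \<forall>y\<in>I. x \<oplus>\<^bsub>A\<^esub> y \<in> I) \<and> (\<forall>c\<in>carrier K. \<forall>x\<in>I. c \<odot>\<^bsub>A\<^esub> x \<in> I) \<and>
  (\<forall>x\<in>I. \<forall>a\<in>carrier A. a \<otimes>\<^bsub>A\<^esub> x \<in> I \<and> x \<otimes>\<^bsub>A\<^esub> a \<in> I)"

lemma nu_idealD:
 assumes "nu_ideal K A I"
 shows "x \<in> I ==> x \<in> carrier A" and "\<zero>\<^bsub>A\<^esub> \<in> I" and "[|x \<in> I; y \<in> I|] ==> x \<oplus>\<^bsub>A\<^esub> y \<in> I"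
  and "[|c \<in> carrier K; x \<in> I|] ==> c \<odot>\<^bsub>A\<^esub> x \<in> I"
  and "[|x \<in> I; a \<in> carrier A|] ==> a \<otimes>\<^bsub>A\<^esub> x \<in> I" and "[|x \<in> I; a \<in> carrier A|] ==> x \<otimes>\<^bsub>A\<^esub> a \<in> I"
 using assms by (auto simp: nu_ideal_def)

lemma ideal_prod_closed:
 assumes "x \<in> ideal_prod A I J" and "nu_algebra K A" "I \<subseteq> carrier A" "J \<subseteq> carrier A"
 shows "x \<in> carrier A"
proof -
 interpret nu_algebra K A by fact
 show ?thesis using assms(1) by induction (use assms(3,4) in \<open>auto intro!: nu_mult_closed\<close>)
qed

locale nu_alg = nu_algebra K A
 for K :: "('k, 'n) ring_scheme" (structure) and A :: "('k, 'a) module" (structure)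

context nu_alg
begin

lemma smult_minus_one: "x \<in> carrier A ==> (\<ominus> \<one>) \<odot>\<^bsub>A\<^esub> x = \<ominus>\<^bsub>A\<^esub> x"
 using smult_l_minus[of \<one> x] smult_one[of x] by simp

lemma zero_mult: "x \<in> carrier A ==> \<zero>\<^bsub>A\<^esub> \<otimes>\<^bsub>A\<^esub> x = \<zero>\<^bsub>A\<^esub>" "x \<in> carrier A ==> x \<otimes>\<^bsub>A\<^esub> \<zero>\<^bsub>A\<^esub> = \<zero>\<^bsub>A\<^esub>"
 using nu_smult_l[of "\<zero>" "\<zero>\<^bsub>A\<^esub>" x] nu_smult_r[of "\<zero>" x "\<zero>\<^bsub>A\<^esub>"] nu_mult_closed[of "\<zero>\<^bsub>A\<^esub>" x]
  nu_mult_closed[of x "\<zero>\<^bsub>A\<^esub>"] by simp_all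

lemma neg_mult_l: "[|x \<in> carrier A; y \<in> carrier A|] ==> (\<ominus>\<^bsub>A\<^esub> x) \<otimes>\<^bsub>A\<^esub> y = \<ominus>\<^bsub>A\<^esub> (x \<otimes>\<^bsub>A\<^esub> y)"
 using nu_smult_l[of "\<ominus> \<one>" x y] by (simp add: smult_minus_one nu_mult_closed)

lemma neg_mult_r: "[|x \<in> carrier A; y \<in> carrier A|] ==> x \<otimes>\<^bsub>A\<^esub> (\<ominus>\<^bsub>A\<^esub> y) = \<ominus>\<^bsub>A\<^esub> (x \<otimes>\<^bsub>A\<^esub> y)"
 using nu_smult_r[of "\<ominus> \<one>" x y] by (simp add: smult_minus_one nu_mult_closed)

lemma nu_ideal_neg:
 assumes "nu_ideal K A I" "x \<in> I"
 shows "\<ominus>\<^bsub>A\<^esub> x \<in> I"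
 using nu_idealD(4)[OF assms(1) _ assms(2), of "\<ominus> \<one>"] nu_idealD(1)[OF assms] smult_minus_one by simp

lemma nu_ideal_prod:
 assumes I: "nu_ideal K A I" and J: "nu_ideal K A J"
 shows "nu_ideal K A (ideal_prod A I J)"
proof -
 note cl = nu_idealD(1)[OF I] nu_idealD(1)[OF J]
 have pc: "x \<in> carrier A" if "x \<in> ideal_prod A I J" for x
  using ideal_prod_closed[OF that nu_algebra_axioms] cl by blast
 have z: "\<zero>\<^bsub>A\<^esub> \<in> ideal_prod A I J"
  using ideal_prod.prod[OF nu_idealD(2)[OF I] nu_idealD(2)[OF J], of A] by (simp add: zero_mult)
 have s: "c \<odot>\<^bsub>A\<^esub> x \<in> ideal_prod A I J" if "c \<in> carrier K" "x \<in> ideal_prod A I J" for c x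
  using that(2)
 proof induction
  case (prod i j)
  then show ?case
   using ideal_prod.prod[OF nu_idealD(4)[OF I that(1) prod(1)] prod(2), of A] that cl
   by (simp add: nu_smult_l)
 next
  case (sum u v)
  then show ?case using that pc by (simp add: smult_r_distr ideal_prod.sum)
 qed
 have m: "a \<otimes>\<^bsub>A\<^esub> x \<in> ideal_prod A I J \<and> x \<otimes>\<^bsub>A\<^esub> a \<in> ideal_prod A I J"
  if "a \<in> carrier A" "x \<in> ideal_prod A I J" for a x
  using that(2)
 proof induction
  case (prod i j)
  then show ?case
   using ideal_prod.prod[OF nu_idealD(5)[OF I prod(1) that(1)] prod(2), of A]
    ideal_prod.prod[OF prod(1) nu_idealD(6)[OF J prod(2) that(1)], of A] that cl
   by (simp add: nu_mult_assoc)
 next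
  case (sum u v)
  then show ?case using that pc by (simp add: nu_l_distr nu_r_distr ideal_prod.sum)
 qed
 show ?thesis
  unfolding nu_ideal_def using pc z s m by (auto intro: ideal_prod.sum)
qed

lemma nu_ideal_pow:
 assumes "nu_ideal K A I"
 shows "nu_ideal K A (ideal_pow A I n)"
proof (induction n)
 case 0
 then show ?case by (auto simp: nu_ideal_def nu_mult_closed)
next
 case (Suc n)
 then show ?case using assms nu_ideal_prod by (cases n) auto
qed

lemma ideal_pow_Suc_subset:
 assumes I: "nu_ideal K A I"
 shows "ideal_pow A I (Suc n) \<subseteq> ideal_pow A I n"
proof (cases n)
 case 0
 then show ?thesis using nu_idealD(1)[OF I] by auto
next
 case (Suc m)
 note P = nu_ideal_pow[OF I, of "Suc m"]
 have "x \<in> ideal_pow A I (Suc m)" if "x \<in> ideal_prod A (ideal_pow A I (Suc m)) I" for x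
  using that by induction (use nu_idealD[OF P] nu_idealD(1)[OF I] in auto)
 then show ?thesis by (auto simp: Suc)
qed

end

lemma ideal_pow_hom:
 assumes h: "h \<in> alg_hom K A B" and "nu_algebra K A" and IJ: "h ` I \<subseteq> J" "I \<subseteq> carrier A"
  and I: "nu_ideal K A I"
 shows "h ` ideal_pow A I n \<subseteq> ideal_pow B J n"
proof (induction n)
 case 0
 then show ?case using alg_homD(1)[OF h] by auto
next
 case (Suc k)
 show ?case
 proof (cases k)
  case 0
  then show ?thesis using IJ by simp
 next
 case k: (Suc n)
 interpret nu_alg K A unfolding nu_alg_def by fact
 note P = nu_ideal_pow[OF I, of "Suc n"]
 have pc: "x \<in> carrier A" if "x \<in> ideal_prod A (ideal_pow A I (Suc n)) I" for x
  using ideal_prod_closed[OF that nu_algebra_axioms] nu_idealD(1)[OF P] IJ by blast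
 have "h x \<in> ideal_prod B (ideal_pow B J (Suc n)) J"
  if "x \<in> ideal_prod A (ideal_pow A I (Suc n)) I" for x
  using that
 proof induction
  case (prod i j)
  then have "h i \<in> ideal_pow B J (Suc n)" "h j \<in> J" using Suc k IJ by auto
  moreover have "i \<in> carrier A" "j \<in> carrier A" using prod nu_idealD(1)[OF P] IJ(2) by blast+
  ultimately show ?case by (simp add: alg_homD(3)[OF h] ideal_prod.prod)
 next
  case (sum u v)
  then show ?case using pc by (simp add: alg_homD(2)[OF h] ideal_prod.sum)
 qed
 then show ?thesis by (auto simp: k)
 qed
qed

text \<open>Quotients by two-sided ideals, without units.\<close>

locale alg_quotient = nu_alg K A
 for K :: "('k, 'n) ring_scheme" (structure) and A :: "('k, 'a) module" (structure)
  and I :: "'a set" +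
 assumes ideal: "nu_ideal K A I"
begin

lemma ideal_subgroup: "abelian_subgroup I A"
proof (rule abelian_subgroupI3)
 show "additive_subgroup I A"
  by (intro additive_subgroup.intro subgroup.intro)
   (use nu_idealD[OF ideal] nu_ideal_neg[OF ideal] in \<open>auto simp: a_inv_def\<close>)
qed (rule M.abelian_group_axioms)

sublocale S: abelian_subgroup I A by (rule ideal_subgroup)

abbreviation cls :: "'a \<Rightarrow> 'a set" where "cls x \<equiv> I +>\<^bsub>A\<^esub> x"

lemma cls_eq_iff:
 assumes "x \<in> carrier A" "y \<in> carrier A"
 shows "cls x = cls y \<longleftrightarrow> x \<ominus>\<^bsub>A\<^esub> y \<in> I"
proof
 assume "cls x = cls y"
 then have "x \<in> cls y" using S.a_rcos_self[OF assms(1)] by simp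
 then show "x \<ominus>\<^bsub>A\<^esub> y \<in> I" using S.a_rcos_module_imp[OF assms(2)] assms by (simp add: a_minus_def)
next
 assume "x \<ominus>\<^bsub>A\<^esub> y \<in> I"
 then have "x \<in> cls y" using S.a_rcos_module_rev[OF assms(2,1)] by (simp add: a_minus_def)
 then show "cls x = cls y" using M.a_repr_independence[OF _ _ S.a_subgroup] assms by metis
qed

lemma cls_mem:
 assumes "x \<in> carrier A" "y \<in> cls x"
 shows "y \<in> carrier A" "cls y = cls x"
proof -
 show "y \<in> carrier A" using assms by (meson S.a_elemrcos_carrier)
 show "cls y = cls x" using M.a_repr_independence[OF _ _ S.a_subgroup] assms by metis
qed

lemma cls_self: "x \<in> carrier A ==> x \<in> cls x"
 by (rule S.a_rcos_self)

lemma cls_UN: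
 assumes "x \<in> carrier A" "\<And>y. y \<in> cls x ==> F y = F x"
 shows "(\<Union>y\<in>cls x. F y) = F x"
 using assms(2) cls_self[OF assms(1)] by blast

lemma cls_the_elem:
 assumes "x \<in> carrier A" "\<And>y. [|y \<in> carrier A; y \<ominus>\<^bsub>A\<^esub> x \<in> I|] ==> F y = F x"
 shows "the_elem (F ` cls x) = F x"
proof -
 have "F y = F x" if "y \<in> cls x" for y
  using assms(2)[OF cls_mem(1)[OF assms(1) that]] cls_mem[OF assms(1) that] assms(1)
   cls_eq_iff[of y x] by simp
 then have "F ` cls x \<subseteq> {F x}" by blast
 then have "F ` cls x = {F x}" using cls_self[OF assms(1)] by blast
 then show ?thesis by simp
qed

lemma quot_sel:
 "carrier (quot_alg A I) = cls ` carrier A" (is ?g1)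
 "\<zero>\<^bsub>quot_alg A I\<^esub> = cls \<zero>\<^bsub>A\<^esub>" (is ?g2)
 "[|x \<in> carrier A; y \<in> carrier A|] ==> cls x \<oplus>\<^bsub>quot_alg A I\<^esub> cls y = cls (x \<oplus>\<^bsub>A\<^esub> y)"
 "[|x \<in> carrier A; y \<in> carrier A|] ==> cls x \<otimes>\<^bsub>quot_alg A I\<^esub> cls y = cls (x \<otimes>\<^bsub>A\<^esub> y)"
 "[|c \<in> carrier K; x \<in> carrier A|] ==> c \<odot>\<^bsub>quot_alg A I\<^esub> cls x = cls (c \<odot>\<^bsub>A\<^esub> x)"
proof -
 show ?g1
  by (auto simp: quot_alg_def FactRing_def A_RCOSETS_def')
 have sub: "I \<subseteq> carrier A" using nu_idealD(1)[OF ideal] by auto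
 show ?g2
  using M.a_coset_add_zero[OF sub] by (simp add: quot_alg_def FactRing_def)
 show "cls x \<oplus>\<^bsub>quot_alg A I\<^esub> cls y = cls (x \<oplus>\<^bsub>A\<^esub> y)" if "x \<in> carrier A" "y \<in> carrier A"
  using S.a_rcos_sum[OF that] by (simp add: quot_alg_def FactRing_def)
 show "cls x \<otimes>\<^bsub>quot_alg A I\<^esub> cls y = cls (x \<otimes>\<^bsub>A\<^esub> y)" if x: "x \<in> carrier A" and y: "y \<in> carrier A"
 proof -
  have eq: "cls (u \<otimes>\<^bsub>A\<^esub> v) = cls (x \<otimes>\<^bsub>A\<^esub> y)" if u: "u \<in> cls x" and v: "v \<in> cls y" for u v
  proof -
   have uv: "u \<in> carrier A" "v \<in> carrier A" "u \<ominus>\<^bsub>A\<^esub> x \<in> I" "v \<ominus>\<^bsub>A\<^esub> y \<in> I"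
    using cls_mem[OF x u] cls_mem[OF y v] cls_eq_iff x y by blast+
   have "(u \<ominus>\<^bsub>A\<^esub> x) \<otimes>\<^bsub>A\<^esub> v \<oplus>\<^bsub>A\<^esub> x \<otimes>\<^bsub>A\<^esub> (v \<ominus>\<^bsub>A\<^esub> y) \<in> I"
    by (intro nu_idealD(3)[OF ideal] nu_idealD(5)[OF ideal] nu_idealD(6)[OF ideal] uv x)
   also have "(u \<ominus>\<^bsub>A\<^esub> x) \<otimes>\<^bsub>A\<^esub> v \<oplus>\<^bsub>A\<^esub> x \<otimes>\<^bsub>A\<^esub> (v \<ominus>\<^bsub>A\<^esub> y) =
     (u \<otimes>\<^bsub>A\<^esub> v \<oplus>\<^bsub>A\<^esub> \<ominus>\<^bsub>A\<^esub> (x \<otimes>\<^bsub>A\<^esub> y)) \<oplus>\<^bsub>A\<^esub> (\<ominus>\<^bsub>A\<^esub> (x \<otimes>\<^bsub>A\<^esub> v) \<oplus>\<^bsub>A\<^esub> x \<otimes>\<^bsub>A\<^esub> v)"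
    using uv x y
    by (simp add: a_minus_def nu_l_distr nu_r_distr neg_mult_l neg_mult_r nu_mult_closed M.a_ac)
   also have "\<dots> = u \<otimes>\<^bsub>A\<^esub> v \<ominus>\<^bsub>A\<^esub> x \<otimes>\<^bsub>A\<^esub> y"
    using uv x y by (simp add: M.l_neg nu_mult_closed a_minus_def)
   finally show ?thesis using uv x y by (simp add: cls_eq_iff nu_mult_closed)
  qed
  have "cls x \<otimes>\<^bsub>quot_alg A I\<^esub> cls y = (\<Union>u\<in>cls x. \<Union>v\<in>cls y. cls (u \<otimes>\<^bsub>A\<^esub> v))"
   by (simp add: quot_alg_def FactRing_def rcoset_mult_def)
  also have "\<dots> = (\<Union>u\<in>cls x. \<Union>v\<in>cls y. cls (x \<otimes>\<^bsub>A\<^esub> y))"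
   using eq by simp
  also have "\<dots> = cls (x \<otimes>\<^bsub>A\<^esub> y)" using cls_self x y by blast
  finally show ?thesis .
 qed
 show "c \<odot>\<^bsub>quot_alg A I\<^esub> cls x = cls (c \<odot>\<^bsub>A\<^esub> x)" if c: "c \<in> carrier K" and x: "x \<in> carrier A"
 proof -
  have "cls (c \<odot>\<^bsub>A\<^esub> u) = cls (c \<odot>\<^bsub>A\<^esub> x)" if u: "u \<in> cls x" for u
  proof -
   have u': "u \<in> carrier A" "u \<ominus>\<^bsub>A\<^esub> x \<in> I" using cls_mem[OF x u] cls_eq_iff x by blast+
   have "c \<odot>\<^bsub>A\<^esub> (u \<ominus>\<^bsub>A\<^esub> x) \<in> I" by (rule nu_idealD(4)[OF ideal c u'(2)])
   then show ?thesis using u' x c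
    by (simp add: cls_eq_iff a_minus_def smult_r_distr smult_r_minus)
  qed
  then have "(\<Union>u\<in>cls x. cls (c \<odot>\<^bsub>A\<^esub> u)) = cls (c \<odot>\<^bsub>A\<^esub> x)" by (rule cls_UN[OF x])
  then show ?thesis by (simp only: quot_alg_def module.simps)
 qed
qed

lemma quot_nu_algebra: "nu_algebra K (quot_alg A I)"
proof -
 let ?Q = "quot_alg A I"
 have ab: "abelian_group ?Q"
 proof (rule abelian_groupI)
  fix X assume "X \<in> carrier ?Q"
  then obtain x where x: "x \<in> carrier A" "X = cls x" by (auto simp: quot_sel(1))
  show "\<exists>Y\<in>carrier ?Q. Y \<oplus>\<^bsub>?Q\<^esub> X = \<zero>\<^bsub>?Q\<^esub>"
   by (rule bexI[of _ "cls (\<ominus>\<^bsub>A\<^esub> x)"]) (use x in \<open>auto simp: quot_sel M.l_neg\<close>)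
 qed (auto simp: quot_sel M.a_ac)
 have md: "module K ?Q"
  by (rule moduleI[OF cring_axioms ab])
   (auto simp: quot_sel smult_l_distr smult_r_distr smult_assoc1)
 show ?thesis
  by (intro nu_algebra.intro nu_algebra_axioms.intro md field_axioms)
   (auto simp: quot_sel nu_mult_closed nu_mult_assoc nu_l_distr nu_r_distr nu_smult_l nu_smult_r)
qed

lemma cls_alg_hom: "cls \<in> alg_hom K A (quot_alg A I)"
 by (rule alg_homI) (auto simp: quot_sel)

lemma quot_factor:
 assumes B: "nu_algebra K B" and h: "h \<in> alg_hom K A B" and kill: "\<And>x. x \<in> I ==> h x = \<zero>\<^bsub>B\<^esub>"
 shows "(\<lambda>X. the_elem (h ` X)) \<in> alg_hom K (quot_alg A I) B" (is ?g1)
  and "x \<in> carrier A ==> the_elem (h ` cls x) = h x" (is "PROP ?g2")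
proof -
 interpret B: nu_algebra K B by fact
 have el: "the_elem (h ` cls x) = h x" if x: "x \<in> carrier A" for x
 proof (rule cls_the_elem[OF x])
  fix y assume y: "y \<in> carrier A" "y \<ominus>\<^bsub>A\<^esub> x \<in> I"
  then have "h y \<ominus>\<^bsub>B\<^esub> h x = \<zero>\<^bsub>B\<^esub>"
   using kill alg_hom_minus[OF nu_algebra_axioms B h y(1) x] by simp
  then show "h y = h x" using y x alg_homD(1)[OF h] by (simp add: B.M.minus_eq_zero_iff)
 qed
 then show "PROP ?g2" .
 show ?g1
  by (rule alg_homI) (auto simp: quot_sel el alg_homD[OF h] nu_mult_closed)
qed

end

section \<open>The coproduct of copies of an algebra\<close>

context k_algebra
begin

lemma ccong_cterms:
 assumes "(s, t) \<in> ccong K A m"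
 shows "s \<in> cterms K A m \<and> t \<in> cterms K A m"
proof -
 have m1: "\<ominus> \<one> \<in> carrier K" by simp
 show ?thesis
  using assms
  by (induction rule: ccong.induct) (use m1 in \<open>simp_all add: cterms.intros nu_mult_closed\<close>)
qed

lemma ccong_equiv: "equiv (cterms K A m) (ccong K A m)"
 by (rule equivI)
  (auto simp: refl_on_def sym_def trans_def dest: ccong_cterms intro: crefl csym ctrans)

abbreviation qc :: "nat \<Rightarrow> ('k, 'a) cterm \<Rightarrow> ('k, 'a) cterm set" where
 "qc m t \<equiv> ccong K A m `` {t}"

lemma qc_eq: "(s, t) \<in> ccong K A m ==> qc m s = qc m t"
 by (rule equiv_class_eq[OF ccong_equiv])

lemma Q_sel:
 "carrier (Q_alg K A m) = qc m ` cterms K A m" (is ?g1)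
 "\<zero>\<^bsub>Q_alg K A m\<^esub> = qc m CZero" (is ?g2)
 "[|s \<in> cterms K A m; t \<in> cterms K A m|] ==> qc m s \<oplus>\<^bsub>Q_alg K A m\<^esub> qc m t = qc m (CAdd s t)"
 "[|s \<in> cterms K A m; t \<in> cterms K A m|] ==> qc m s \<otimes>\<^bsub>Q_alg K A m\<^esub> qc m t = qc m (CMult s t)"
 "[|c \<in> carrier K; t \<in> cterms K A m|] ==> c \<odot>\<^bsub>Q_alg K A m\<^esub> qc m t = qc m (CScal c t)"
proof -
 show ?g1 by (auto simp: Q_alg_def quotient_def)
 show ?g2 by (simp add: Q_alg_def)
 show "qc m s \<oplus>\<^bsub>Q_alg K A m\<^esub> qc m t = qc m (CAdd s t)" if "s \<in> cterms K A m" "t \<in> cterms K A m"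
  unfolding Q_alg_def ring.simps
  by (rule UN_equiv_class2[OF ccong_equiv ccong_equiv _ that])
   (auto simp: congruent2_def intro!: qc_eq cong_add)
 show "qc m s \<otimes>\<^bsub>Q_alg K A m\<^esub> qc m t = qc m (CMult s t)" if "s \<in> cterms K A m" "t \<in> cterms K A m"
  unfolding Q_alg_def monoid.simps
  by (rule UN_equiv_class2[OF ccong_equiv ccong_equiv _ that])
   (auto simp: congruent2_def intro!: qc_eq cong_mult)
 show "c \<odot>\<^bsub>Q_alg K A m\<^esub> qc m t = qc m (CScal c t)" if "c \<in> carrier K" "t \<in> cterms K A m"
  unfolding Q_alg_def module.simps
  by (rule UN_equiv_class[OF ccong_equiv _ that(2)])
   (use that in \<open>auto simp: congruent_def intro!: qc_eq cong_scal\<close>)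
qed

lemma Q_nu_algebra: "nu_algebra K (Q_alg K A m)"
proof -
 let ?Q = "Q_alg K A m"
 note ct = cterms.intros
 have m1: "\<ominus> \<one> \<in> carrier K" by simp
 have ab: "abelian_group ?Q"
 proof (rule abelian_groupI)
  fix X assume "X \<in> carrier ?Q"
  then obtain t where t: "t \<in> cterms K A m" "X = qc m t" by (auto simp: Q_sel(1))
  show "\<exists>Y\<in>carrier ?Q. Y \<oplus>\<^bsub>?Q\<^esub> X = \<zero>\<^bsub>?Q\<^esub>"
   by (rule bexI[of _ "qc m (CScal (\<ominus> \<one>) t)"])
    (use t m1 in \<open>auto simp: Q_sel ct ccong.add_neg[THEN qc_eq]\<close>)
  fix Y assume "Y \<in> carrier ?Q"
  then obtain s where "s \<in> cterms K A m" "Y = qc m s" by (auto simp: Q_sel(1))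
  with t show "X \<oplus>\<^bsub>?Q\<^esub> Y = Y \<oplus>\<^bsub>?Q\<^esub> X"
   by (simp add: Q_sel ccong.add_comm[THEN qc_eq])
 qed (auto simp: Q_sel ct ccong.add_assoc[THEN qc_eq] ccong.add_zero[THEN qc_eq])
 have md: "module K ?Q"
  by (rule moduleI[OF cring_axioms ab])
   (auto simp: Q_sel ct ccong.scal_l_distr[THEN qc_eq] ccong.scal_r_distr[THEN qc_eq]
    ccong.scal_scal[THEN qc_eq] ccong.scal_one[THEN qc_eq])
 show ?thesis
  by (intro nu_algebra.intro nu_algebra_axioms.intro md field_axioms)
   (auto simp: Q_sel ct ccong.mult_assoc[THEN qc_eq] ccong.mult_l_distr[THEN qc_eq]
    ccong.mult_r_distr[THEN qc_eq] ccong.mult_scal_l[THEN qc_eq] ccong.mult_scal_r[THEN qc_eq])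
qed

lemma Q_inj_alg_hom: "i \<le> m ==> Q_inj K A m i \<in> alg_hom K A (Q_alg K A m)"
 by (rule alg_homI)
  (auto simp: Q_inj_def Q_sel cterms.intros ccong.gen_add[THEN qc_eq] ccong.gen_mult[THEN qc_eq]
   ccong.gen_scal[THEN qc_eq])

lemma Q_induct [consumes 1, case_names gen zero add mult scal]:
 assumes X: "X \<in> carrier (Q_alg K A m)"
  and "\<And>i a. [|i \<le> m; a \<in> carrier A|] ==> P (Q_inj K A m i a)"
  and "P \<zero>\<^bsub>Q_alg K A m\<^esub>"
  and "\<And>x y. [|x \<in> carrier (Q_alg K A m); y \<in> carrier (Q_alg K A m); P x; P y|] ==> P (x \<oplus>\<^bsub>Q_alg K A m\<^esub> y)"
  and "\<And>x y. [|x \<in> carrier (Q_alg K A m); y \<in> carrier (Q_alg K A m); P x; P y|] ==> P (x \<otimes>\<^bsub>Q_alg K A m\<^esub> y)"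
  and "\<And>c x. [|c \<in> carrier K; x \<in> carrier (Q_alg K A m); P x|] ==> P (c \<odot>\<^bsub>Q_alg K A m\<^esub> x)"
 shows "P X"
proof -
 from X obtain t where t: "t \<in> cterms K A m" "X = qc m t" by (auto simp: Q_sel(1))
 have "P (qc m t)" using t(1)
 proof induction
  case (1 i a)
  then show ?case using assms(2)[of i a] by (simp add: Q_inj_def)
 next
  case 2
  then show ?case using assms(3) by (simp add: Q_sel)
 next
  case (3 s t)
  then show ?case using assms(4)[of "qc m s" "qc m t"] by (simp add: Q_sel)
 next
  case (4 s t)
  then show ?case using assms(5)[of "qc m s" "qc m t"] by (simp add: Q_sel)
 next
  case (5 c t)
  then show ?case using assms(6)[of c "qc m t"] by (simp add: Q_sel)
 qed
 with t show ?thesis by simp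
qed

text \<open>The universal property of the coproduct.\<close>

lemma copair_works:
 assumes nB: "nu_algebra K B" and f: "\<forall>i\<le>m. f i \<in> alg_hom K A B"
 shows "copair B f \<in> alg_hom K (Q_alg K A m) B" (is ?g1)
  and "[|i \<le> m; a \<in> carrier A|] ==> copair B f (Q_inj K A m i a) = f i a" (is "PROP ?g2")
proof -
 interpret B: nu_alg K B unfolding nu_alg_def by fact
 note f = f[rule_format]
 have cl: "ceval B f t \<in> carrier B" if "t \<in> cterms K A m" for t
  using that by induction (auto simp: alg_homD[OF f] B.nu_mult_closed)
 have m1: "\<ominus> \<one> \<in> carrier K" by simp
 have eq: "(s, t) \<in> ccong K A m ==> ceval B f s = ceval B f t" for s t
 proof (induction rule: ccong.induct)
  case (add_neg t)
  then show ?case using cl[of t] B.smult_minus_one[of "ceval B f t"] by (simp add: B.M.l_neg)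
 qed (auto simp: cl alg_homD[OF f] B.nu_mult_closed B.nu_mult_assoc B.nu_l_distr B.nu_r_distr
   B.nu_smult_l B.nu_smult_r B.M.a_ac B.smult_l_distr B.smult_r_distr B.smult_assoc1)
 have cp: "copair B f (qc m t) = ceval B f t" if t: "t \<in> cterms K A m" for t
 proof -
  have "t \<in> qc m t" using t by (auto intro: crefl)
  moreover have "ceval B f s = ceval B f t" if "s \<in> qc m t" for s using eq[of t s] that by simp
  ultimately have "ceval B f ` qc m t = {ceval B f t}" by blast
  then show ?thesis by (simp add: copair_def)
 qed
 show ?g1
 proof (rule alg_homI)
  fix X assume "X \<in> carrier (Q_alg K A m)"
  then obtain s where s: "s \<in> cterms K A m" "X = qc m s" by (auto simp: Q_sel(1))
  then show "copair B f X \<in> carrier B" by (simp add: cp cl)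
  show "copair B f (c \<odot>\<^bsub>Q_alg K A m\<^esub> X) = c \<odot>\<^bsub>B\<^esub> copair B f X" if "c \<in> carrier K" for c
   using s that by (simp add: Q_sel cp cterms.intros)
  fix Y assume "Y \<in> carrier (Q_alg K A m)"
  then obtain t where t: "t \<in> cterms K A m" "Y = qc m t" by (auto simp: Q_sel(1))
  show "copair B f (X \<oplus>\<^bsub>Q_alg K A m\<^esub> Y) = copair B f X \<oplus>\<^bsub>B\<^esub> copair B f Y"
   "copair B f (X \<otimes>\<^bsub>Q_alg K A m\<^esub> Y) = copair B f X \<otimes>\<^bsub>B\<^esub> copair B f Y"
   using s t by (simp_all add: Q_sel cp cterms.intros)
 qed
 show "PROP ?g2"
  by (simp add: Q_inj_def cp cterms.intros)
qed

lemma Q_hom_eqI: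
 assumes "nu_algebra K B" "g \<in> alg_hom K (Q_alg K A m) B" "h \<in> alg_hom K (Q_alg K A m) B"
  and "\<And>i a. [|i \<le> m; a \<in> carrier A|] ==> g (Q_inj K A m i a) = h (Q_inj K A m i a)"
  and X: "X \<in> carrier (Q_alg K A m)"
 shows "g X = h X"
 using X
 by (induction rule: Q_induct)
  (simp_all add: assms(4) alg_hom_zero[OF Q_nu_algebra assms(1,2)]
   alg_hom_zero[OF Q_nu_algebra assms(1,3)] alg_homD[OF assms(2)] alg_homD[OF assms(3)])

end

section \<open>The cylinders\<close>

lemma aug_map_ring_hom:
 assumes A: "nu_algebra K A" and B: "nu_algebra K B" and h: "h \<in> alg_hom K A B"
 shows "aug_map h \<in> ring_hom (aug K A) (aug K B)"
proof -
 interpret A: nu_algebra K A by fact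
 show ?thesis
  by (rule ring_hom_memI)
   (use alg_hom_zero[OF A B h] in
    \<open>auto simp: aug_map_def aug_sel alg_homD[OF h] A.nu_mult_closed\<close>)
qed

lemma id_alg_hom: "(\<lambda>x. x) \<in> alg_hom K A A"
 by (rule alg_homI) auto

context k_algebra
begin

abbreviation fold_map :: "('k, 'a) cterm set \<Rightarrow> 'a" where
 "fold_map \<equiv> copair A (\<lambda>_ a. a)"

lemma fold_works:
 "fold_map \<in> alg_hom K (Q_alg K A m) A"
 "[|i \<le> m; a \<in> carrier A|] ==> fold_map (Q_inj K A m i a) = a"
 using copair_works[where m = m and f = "\<lambda>_ a. a", OF nu_algebra_axioms] by (simp_all add: id_alg_hom)

lemma q_ideal_iff:
 "x \<in> q_ideal K A m \<longleftrightarrow> x \<in> carrier (Q_alg K A m) \<and> fold_map x = \<zero>\<^bsub>A\<^esub>"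
 by (auto simp: q_ideal_def a_kernel_def')

lemma q_nu_ideal: "nu_ideal K (Q_alg K A m) (q_ideal K A m)"
proof -
 interpret Q: nu_alg K "Q_alg K A m" unfolding nu_alg_def by (rule Q_nu_algebra)
 interpret A: nu_alg K A unfolding nu_alg_def by (rule nu_algebra_axioms)
 note f = alg_homD[OF fold_works(1)]
 show ?thesis
  unfolding nu_ideal_def
  using alg_hom_zero[OF Q_nu_algebra nu_algebra_axioms fold_works(1), of m]
  by (auto simp: q_ideal_iff f Q.nu_mult_closed A.zero_mult)
qed

lemma cyl_nu_ideal: "nu_ideal K (Q_alg K A m) (cyl_ideal K A m n)"
proof -
 interpret Q: nu_alg K "Q_alg K A m" unfolding nu_alg_def by (rule Q_nu_algebra)
 show ?thesis unfolding cyl_ideal_def by (rule Q.nu_ideal_pow[OF q_nu_ideal])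
qed

lemma cyl_quotient: "alg_quotient K (Q_alg K A m) (cyl_ideal K A m n)"
 by (intro alg_quotient.intro alg_quotient_axioms.intro nu_alg.intro Q_nu_algebra cyl_nu_ideal)

lemma Cyl_nu_algebra: "nu_algebra K (Cyl K A m n)"
 unfolding Cyl_def by (rule alg_quotient.quot_nu_algebra[OF cyl_quotient])

lemma Cyl_carrier: "carrier (Cyl K A m n) = cyl_class K A m n ` carrier (Q_alg K A m)"
 unfolding Cyl_def cyl_class_def by (rule alg_quotient.quot_sel(1)[OF cyl_quotient])

lemma cyl_class_alg_hom: "cyl_class K A m n \<in> alg_hom K (Q_alg K A m) (Cyl K A m n)"
 unfolding Cyl_def cyl_class_def[abs_def] by (rule alg_quotient.cls_alg_hom[OF cyl_quotient])

lemma cyl_class_zero: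
 assumes "x \<in> cyl_ideal K A m n"
 shows "cyl_class K A m n x = \<zero>\<^bsub>Cyl K A m n\<^esub>"
proof -
 interpret Q: alg_quotient K "Q_alg K A m" "cyl_ideal K A m n" by (rule cyl_quotient)
 have "x \<in> carrier (Q_alg K A m)" using nu_idealD(1)[OF cyl_nu_ideal assms] .
 then show ?thesis
  using Q.cls_eq_iff[of x "\<zero>\<^bsub>Q_alg K A m\<^esub>"] assms
  by (simp add: Cyl_def cyl_class_def Q.quot_sel(2) a_minus_def Q.M.neg_zero)
qed

text \<open>\<open>cg m n i a\<close> is the class of the copy with index \<open>i\<close> of \<open>a\<close>.\<close>

definition cg :: "nat \<Rightarrow> nat \<Rightarrow> nat \<Rightarrow> 'a \<Rightarrow> ('k, 'a) cterm set set" where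
 "cg m n i a = cyl_class K A m n (Q_inj K A m i a)"

lemma cg_alg_hom: "i \<le> m ==> cg m n i \<in> alg_hom K A (Cyl K A m n)"
 unfolding cg_def[abs_def] by (rule alg_hom_comp[OF Q_inj_alg_hom cyl_class_alg_hom])

lemma Cyl_induct [consumes 1, case_names gen zero add mult scal]:
 assumes X: "X \<in> carrier (Cyl K A m n)"
  and "\<And>i a. [|i \<le> m; a \<in> carrier A|] ==> P (cg m n i a)"
  and "P \<zero>\<^bsub>Cyl K A m n\<^esub>"
  and "\<And>x y. [|x \<in> carrier (Cyl K A m n); y \<in> carrier (Cyl K A m n); P x; P y|] ==> P (x \<oplus>\<^bsub>Cyl K A m n\<^esub> y)"
  and "\<And>x y. [|x \<in> carrier (Cyl K A m n); y \<in> carrier (Cyl K A m n); P x; P y|] ==> P (x \<otimes>\<^bsub>Cyl K A m n\<^esub> y)"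
  and "\<And>c x. [|c \<in> carrier K; x \<in> carrier (Cyl K A m n); P x|] ==> P (c \<odot>\<^bsub>Cyl K A m n\<^esub> x)"
 shows "P X"
proof -
 note c = alg_homD[OF cyl_class_alg_hom]
 from X obtain x where x: "x \<in> carrier (Q_alg K A m)" "X = cyl_class K A m n x"
  by (auto simp: Cyl_carrier)
 have "P (cyl_class K A m n x)"
  using x(1)
 proof (induction rule: Q_induct)
  case (gen i a)
  then show ?case using assms(2)[of i a] by (simp add: cg_def)
 next
  case zero
  then show ?case
   using assms(3) alg_hom_zero[OF Q_nu_algebra Cyl_nu_algebra cyl_class_alg_hom] by metis
 qed (use assms(4-6) in \<open>simp_all add: c\<close>)
 with x show ?thesis by simp
qed

lemma Cyl_hom_eqI:
 assumes "nu_algebra K B" "g \<in> alg_hom K (Cyl K A m n) B" "h \<in> alg_hom K (Cyl K A m n) B"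
  and "\<And>i a. [|i \<le> m; a \<in> carrier A|] ==> g (cg m n i a) = h (cg m n i a)"
  and X: "X \<in> carrier (Cyl K A m n)"
 shows "g X = h X"
 using X
 by (induction rule: Cyl_induct)
  (simp_all add: assms(4) alg_hom_zero[OF Cyl_nu_algebra assms(1,2)]
   alg_hom_zero[OF Cyl_nu_algebra assms(1,3)] alg_homD[OF assms(2)] alg_homD[OF assms(3)])

lemma cyl_factor:
 assumes B: "nu_algebra K B" and h: "h \<in> alg_hom K (Q_alg K A m) B"
  and kill: "\<And>x. x \<in> cyl_ideal K A m n ==> h x = \<zero>\<^bsub>B\<^esub>"
 shows "(\<lambda>X. the_elem (h ` X)) \<in> alg_hom K (Cyl K A m n) B" (is ?g1)
  and "[|i \<le> m; a \<in> carrier A|] ==> the_elem (h ` cg m n i a) = h (Q_inj K A m i a)" (is "PROP ?g2")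
proof -
 note qf = alg_quotient.quot_factor[OF cyl_quotient[of m n] B h kill]
 show ?g1
  unfolding Cyl_def by (rule qf(1))
 show "PROP ?g2"
  using qf(2) alg_homD(1)[OF Q_inj_alg_hom] by (simp add: cg_def cyl_class_def)
qed

text \<open>
 The universal property of the cylinders: homomorphisms \<open>f i : R \<rightarrow> B\<close> which agree modulo a
 nilpotent ideal.  Modulo the ideal, their joint extension factors through the folding map.
\<close>

lemma cyl_pair_works:
 assumes B: "nu_algebra K B" and f: "\<forall>i\<le>m. f i \<in> alg_hom K A B"
  and J: "nu_ideal K B J" and diff: "\<forall>i\<le>m. \<forall>a\<in>carrier A. f i a \<ominus>\<^bsub>B\<^esub> f 0 a \<in> J"
  and nil: "ideal_pow B J n \<subseteq> {\<zero>\<^bsub>B\<^esub>}"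
 shows "(\<lambda>X. the_elem (copair B f ` X)) \<in> alg_hom K (Cyl K A m n) B" (is ?g1)
  and "[|i \<le> m; a \<in> carrier A|] ==> the_elem (copair B f ` cg m n i a) = f i a" (is "PROP ?g2")
proof -
 interpret B: nu_alg K B unfolding nu_alg_def by fact
 interpret Q: nu_alg K "Q_alg K A m" unfolding nu_alg_def by (rule Q_nu_algebra)
 note h = copair_works[where m = m and f = f, OF B f]
 note hD = alg_homD[OF h(1)] and F = alg_homD[OF fold_works(1)] and f0 = alg_homD[OF f[rule_format, OF le0]]
 have d: "copair B f X \<ominus>\<^bsub>B\<^esub> f 0 (fold_map X) \<in> J" if "X \<in> carrier (Q_alg K A m)" for X
  using that
 proof (induction rule: Q_induct)
  case (gen i a)
  then show ?case using diff by (simp add: h(2) fold_works(2))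
 next
  case zero
  then show ?case
   using alg_hom_zero[OF Q_nu_algebra B h(1)] alg_hom_zero[OF nu_algebra_axioms B f[rule_format, OF le0]]
    alg_hom_zero[OF Q_nu_algebra nu_algebra_axioms fold_works(1), of m] nu_idealD(2)[OF J]
   by (simp add: a_minus_def B.M.neg_zero)
 next
  case (add x y)
  have "(copair B f x \<ominus>\<^bsub>B\<^esub> f 0 (fold_map x)) \<oplus>\<^bsub>B\<^esub> (copair B f y \<ominus>\<^bsub>B\<^esub> f 0 (fold_map y)) \<in> J"
   by (rule nu_idealD(3)[OF J add(3,4)])
  then show ?case using add by (simp add: hD F f0 a_minus_def B.M.minus_add B.M.a_ac)
 next
  case (mult x y)
  let ?u = "copair B f x" and ?v = "copair B f y"
  let ?w = "f 0 (fold_map x)" and ?z = "f 0 (fold_map y)"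
  have cl: "?u \<in> carrier B" "?v \<in> carrier B" "?w \<in> carrier B" "?z \<in> carrier B"
   using mult by (simp_all add: hD F f0)
  have "?u \<otimes>\<^bsub>B\<^esub> (?v \<ominus>\<^bsub>B\<^esub> ?z) \<oplus>\<^bsub>B\<^esub> (?u \<ominus>\<^bsub>B\<^esub> ?w) \<otimes>\<^bsub>B\<^esub> ?z \<in> J"
   using mult cl by (intro nu_idealD(3)[OF J] nu_idealD(5)[OF J] nu_idealD(6)[OF J])
  also have "?u \<otimes>\<^bsub>B\<^esub> (?v \<ominus>\<^bsub>B\<^esub> ?z) \<oplus>\<^bsub>B\<^esub> (?u \<ominus>\<^bsub>B\<^esub> ?w) \<otimes>\<^bsub>B\<^esub> ?z =
    (?u \<otimes>\<^bsub>B\<^esub> ?v \<oplus>\<^bsub>B\<^esub> \<ominus>\<^bsub>B\<^esub> (?w \<otimes>\<^bsub>B\<^esub> ?z)) \<oplus>\<^bsub>B\<^esub> (\<ominus>\<^bsub>B\<^esub> (?u \<otimes>\<^bsub>B\<^esub> ?z) \<oplus>\<^bsub>B\<^esub> ?u \<otimes>\<^bsub>B\<^esub> ?z)"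
   using cl by (simp add: a_minus_def B.nu_l_distr B.nu_r_distr B.neg_mult_l B.neg_mult_r
     B.nu_mult_closed B.M.a_ac)
  also have "\<dots> = ?u \<otimes>\<^bsub>B\<^esub> ?v \<ominus>\<^bsub>B\<^esub> ?w \<otimes>\<^bsub>B\<^esub> ?z"
   using cl by (simp add: a_minus_def B.M.l_neg B.nu_mult_closed)
  finally show ?case using mult by (simp add: hD F f0)
 next
  case (scal c x)
  have "c \<odot>\<^bsub>B\<^esub> (copair B f x \<ominus>\<^bsub>B\<^esub> f 0 (fold_map x)) \<in> J"
   by (rule nu_idealD(4)[OF J scal(1,3)])
  then show ?case
   using scal by (simp add: hD F f0 a_minus_def B.smult_r_distr B.smult_r_minus)
 qed
 have qJ: "copair B f ` q_ideal K A m \<subseteq> J"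
 proof
  fix y assume "y \<in> copair B f ` q_ideal K A m"
  then obtain x where x: "x \<in> carrier (Q_alg K A m)" "fold_map x = \<zero>\<^bsub>A\<^esub>" "y = copair B f x"
   by (auto simp: q_ideal_iff)
  then show "y \<in> J"
   using d[OF x(1)] alg_hom_zero[OF nu_algebra_axioms B f[rule_format, OF le0]] hD(1)[OF x(1)]
   by (simp add: a_minus_def B.M.neg_zero)
 qed
 have "copair B f ` cyl_ideal K A m n \<subseteq> ideal_pow B J n"
  unfolding cyl_ideal_def
  by (rule ideal_pow_hom[OF h(1) Q_nu_algebra qJ _ q_nu_ideal]) (auto simp: q_ideal_iff)
 then have kill: "copair B f x = \<zero>\<^bsub>B\<^esub>" if "x \<in> cyl_ideal K A m n" for x using that nil by blast
 show ?g1
  by (rule cyl_factor(1)[OF B h(1) kill])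
 show "PROP ?g2"
  using cyl_factor(2)[OF B h(1) kill] h(2) by simp
qed

abbreviation face_index :: "nat \<Rightarrow> nat \<Rightarrow> nat" where
 "face_index j i \<equiv> if i < j then i else Suc i"

lemma cyl_coface_works:
 shows "cyl_coface K A j m n \<in> alg_hom K (Cyl K A m n) (Cyl K A (Suc m) n)" (is ?g1)
  and "[|i \<le> m; a \<in> carrier A|] ==> cyl_coface K A j m n (cg m n i a) = cg (Suc m) n (face_index j i) a" (is "PROP ?g2")
proof -
 let ?f = "\<lambda>i. Q_inj K A (Suc m) (face_index j i)"
 have f: "\<forall>i\<le>m. ?f i \<in> alg_hom K A (Q_alg K A (Suc m))"
  by (auto intro!: Q_inj_alg_hom)
 note c = copair_works[where m = m and f = ?f, OF Q_nu_algebra f, folded Q_coface_def]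
 have idx: "face_index j i \<le> Suc m" if "i \<le> m" for i using that by simp
 have fold: "fold_map (Q_coface K A j m x) = fold_map x" if x: "x \<in> carrier (Q_alg K A m)" for x
  by (rule Q_hom_eqI[OF nu_algebra_axioms alg_hom_comp[OF c(1) fold_works(1)] fold_works(1) _ x])
   (simp add: c(2) fold_works(2)[where m = m] fold_works(2)[OF idx])
 have q: "Q_coface K A j m ` q_ideal K A m \<subseteq> q_ideal K A (Suc m)"
  using alg_homD(1)[OF c(1)] fold by (auto simp: q_ideal_iff)
 have "Q_coface K A j m ` cyl_ideal K A m n \<subseteq> cyl_ideal K A (Suc m) n"
  unfolding cyl_ideal_def
  by (rule ideal_pow_hom[OF c(1) Q_nu_algebra q _ q_nu_ideal]) (auto simp: q_ideal_iff)
 then have kill: "cyl_class K A (Suc m) n (Q_coface K A j m x) = \<zero>\<^bsub>Cyl K A (Suc m) n\<^esub>"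
  if "x \<in> cyl_ideal K A m n" for x
  using that by (intro cyl_class_zero) auto
 note cf = cyl_factor[OF Cyl_nu_algebra alg_hom_comp[OF c(1) cyl_class_alg_hom] kill]
 show ?g1
  unfolding cyl_coface_def[abs_def] by (rule cf(1))
 show "PROP ?g2"
  unfolding cyl_coface_def using cf(2) c(2) by (simp add: cg_def)
qed

lemma cyl_coface0_eq:
 "a \<in> carrier A ==> cyl_coface0 K A j n a = cg 1 n (face_index j 0) a"
 using cyl_coface_works(2)[of 0 0 a j n] by (simp add: cyl_coface0_def cg_def One_nat_def)

lemma cyl_proj_works:
 shows "cyl_proj K A m n \<in> alg_hom K (Cyl K A m (Suc n)) (Cyl K A m n)" (is ?g1)
  and "[|i \<le> m; a \<in> carrier A|] ==> cyl_proj K A m n (cg m (Suc n) i a) = cg m n i a" (is "PROP ?g2")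
proof -
 interpret Q: nu_alg K "Q_alg K A m" unfolding nu_alg_def by (rule Q_nu_algebra)
 have kill: "cyl_class K A m n x = \<zero>\<^bsub>Cyl K A m n\<^esub>" if "x \<in> cyl_ideal K A m (Suc n)" for x
  using that Q.ideal_pow_Suc_subset[OF q_nu_ideal, of n]
  by (intro cyl_class_zero) (auto simp: cyl_ideal_def)
 note cf = cyl_factor[OF Cyl_nu_algebra cyl_class_alg_hom kill]
 show ?g1
  unfolding cyl_proj_def[abs_def] by (rule cf(1))
 show "PROP ?g2"
  unfolding cyl_proj_def using cf(2) by (simp add: cg_def)
qed

lemma cg_diff_in:
 assumes "i \<le> m" "j \<le> m" "a \<in> carrier A"
 shows "\<exists>x\<in>q_ideal K A m. cg m n i a \<ominus>\<^bsub>Cyl K A m n\<^esub> cg m n j a = cyl_class K A m n x"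
proof -
 interpret Q: nu_alg K "Q_alg K A m" unfolding nu_alg_def by (rule Q_nu_algebra)
 let ?x = "Q_inj K A m i a \<ominus>\<^bsub>Q_alg K A m\<^esub> Q_inj K A m j a"
 have cl: "Q_inj K A m i a \<in> carrier (Q_alg K A m)" "Q_inj K A m j a \<in> carrier (Q_alg K A m)"
  using assms alg_homD(1)[OF Q_inj_alg_hom] by auto
 have "?x \<in> q_ideal K A m"
  using cl assms alg_hom_minus[OF Q_nu_algebra nu_algebra_axioms fold_works(1) cl]
  by (simp add: q_ideal_iff fold_works(2) M.minus_eq_zero_iff)
 moreover have "cg m n i a \<ominus>\<^bsub>Cyl K A m n\<^esub> cg m n j a = cyl_class K A m n ?x"
  unfolding cg_def by (rule alg_hom_minus[OF Q_nu_algebra Cyl_nu_algebra cyl_class_alg_hom cl, symmetric])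
 ultimately show ?thesis by blast
qed

section \<open>The square-zero extension\<close>

lemma sq_zero_sel:
 "carrier (sq_zero_ext K A) = carrier A \<times> carrier (Om 1)"
 "(a, \<omega>) \<otimes>\<^bsub>sq_zero_ext K A\<^esub> (b, \<eta>) = (a \<otimes>\<^bsub>A\<^esub> b, ((a, \<zero>) \<rhd>\<^bsub>Om 1\<^esub> \<eta>) \<oplus>\<^bsub>Om 1\<^esub> (\<omega> \<lhd>\<^bsub>Om 1\<^esub> (b, \<zero>)))"
 "\<zero>\<^bsub>sq_zero_ext K A\<^esub> = (\<zero>\<^bsub>A\<^esub>, \<zero>\<^bsub>Om 1\<^esub>)"
 "(a, \<omega>) \<oplus>\<^bsub>sq_zero_ext K A\<^esub> (b, \<eta>) = (a \<oplus>\<^bsub>A\<^esub> b, \<omega> \<oplus>\<^bsub>Om 1\<^esub> \<eta>)"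
 "c \<odot>\<^bsub>sq_zero_ext K A\<^esub> (a, \<omega>) = (c \<odot>\<^bsub>A\<^esub> a, (emb c) \<rhd>\<^bsub>Om 1\<^esub> \<omega>)"
 by (simp_all add: sq_zero_ext_def Let_def)

lemma sq_zero_nu_algebra: "nu_algebra K (sq_zero_ext K A)"
proof -
 let ?S = "sq_zero_ext K A" and ?O = "Om 1"
 note cl = lact_closed ract_closed aug_elem aug_scalar nu_mult_closed
 note e1 = aug_emb(2)
 note e2 = aug_emb(1)
 note e3 = aug_emb(5)
 note e4 = aug_emb(6)
 note e5 = aug_emb(3)
 have l1: "(emb \<one>) \<rhd>\<^bsub>?O\<^esub> \<omega> = \<omega>" if "\<omega> \<in> carrier ?O" for \<omega>
  using lact_one[OF that] by (simp add: aug_sel)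
 have ab: "abelian_group ?S"
 proof (rule abelian_groupI)
  fix x assume "x \<in> carrier ?S"
  then obtain a \<omega> where x: "x = (a, \<omega>)" "a \<in> carrier A" "\<omega> \<in> carrier ?O" by (auto simp: sq_zero_sel)
  show "\<exists>y\<in>carrier ?S. y \<oplus>\<^bsub>?S\<^esub> x = \<zero>\<^bsub>?S\<^esub>"
   by (rule bexI[of _ "(\<ominus>\<^bsub>A\<^esub> a, \<ominus>\<^bsub>?O\<^esub> \<omega>)"])
    (use x in \<open>simp_all add: sq_zero_sel M.l_neg Om.l_neg\<close>)
 qed (simp_all add: sq_zero_sel M.a_ac Om.a_ac split_paired_all)
 have md: "module K ?S"
  by (rule moduleI[OF cring_axioms ab])
   (simp_all add: sq_zero_sel split_paired_all smult_l_distr smult_r_distr smult_assoc1 cl lact_add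
    e3 e4 lact_l_distr lact_assoc l1)
 show ?thesis
 proof (intro nu_algebra.intro nu_algebra_axioms.intro md field_axioms)
  fix x y z assume "x \<in> carrier ?S" "y \<in> carrier ?S" "z \<in> carrier ?S"
  then obtain a b c \<alpha> \<beta> \<gamma> where xyz: "x = (a, \<alpha>)" "y = (b, \<beta>)" "z = (c, \<gamma>)"
   "a \<in> carrier A" "b \<in> carrier A" "c \<in> carrier A"
   "\<alpha> \<in> carrier ?O" "\<beta> \<in> carrier ?O" "\<gamma> \<in> carrier ?O" by (auto simp: sq_zero_sel)
  show "x \<otimes>\<^bsub>?S\<^esub> y \<otimes>\<^bsub>?S\<^esub> z = x \<otimes>\<^bsub>?S\<^esub> (y \<otimes>\<^bsub>?S\<^esub> z)"
   using xyz by (simp add: sq_zero_sel nu_mult_assoc e1 cl lact_add ract_add lact_assoc ract_assoc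
     ract_lact Om.a_ac)
  show "(x \<oplus>\<^bsub>?S\<^esub> y) \<otimes>\<^bsub>?S\<^esub> z = x \<otimes>\<^bsub>?S\<^esub> z \<oplus>\<^bsub>?S\<^esub> y \<otimes>\<^bsub>?S\<^esub> z"
   using xyz by (simp add: sq_zero_sel nu_l_distr e2 cl ract_add lact_l_distr Om.a_ac)
  show "z \<otimes>\<^bsub>?S\<^esub> (x \<oplus>\<^bsub>?S\<^esub> y) = z \<otimes>\<^bsub>?S\<^esub> x \<oplus>\<^bsub>?S\<^esub> z \<otimes>\<^bsub>?S\<^esub> y"
   using xyz by (simp add: sq_zero_sel nu_r_distr e2 cl lact_add ract_r_distr Om.a_ac)
 next
  fix c x y assume "c \<in> carrier K" "x \<in> carrier ?S" "y \<in> carrier ?S"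
  then obtain a b \<alpha> \<beta> where xy: "x = (a, \<alpha>)" "y = (b, \<beta>)"
   "a \<in> carrier A" "b \<in> carrier A" "c \<in> carrier K"
   "\<alpha> \<in> carrier ?O" "\<beta> \<in> carrier ?O" by (auto simp: sq_zero_sel)
  show "(c \<odot>\<^bsub>?S\<^esub> x) \<otimes>\<^bsub>?S\<^esub> y = c \<odot>\<^bsub>?S\<^esub> (x \<otimes>\<^bsub>?S\<^esub> y)"
   using xy by (simp add: sq_zero_sel nu_smult_l e5 cl lact_add lact_assoc ract_lact)
  have "\<alpha> \<lhd>\<^bsub>?O\<^esub> (c \<odot>\<^bsub>A\<^esub> b, \<zero>) = (emb c) \<rhd>\<^bsub>?O\<^esub> (\<alpha> \<lhd>\<^bsub>?O\<^esub> (b, \<zero>))"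
   using xy by (simp add: e5 ract_assoc ract_scalar ract_lact cl)
  moreover have "(a, \<zero>) \<rhd>\<^bsub>?O\<^esub> ((emb c) \<rhd>\<^bsub>?O\<^esub> \<beta>) = (emb c) \<rhd>\<^bsub>?O\<^esub> ((a, \<zero>) \<rhd>\<^bsub>?O\<^esub> \<beta>)"
   using xy by (simp add: cl aug_scalar_comm flip: lact_assoc)
  ultimately show "x \<otimes>\<^bsub>?S\<^esub> (c \<odot>\<^bsub>?S\<^esub> y) = c \<odot>\<^bsub>?S\<^esub> (x \<otimes>\<^bsub>?S\<^esub> y)"
   using xy by (simp add: sq_zero_sel nu_smult_r cl lact_add)
 next
  fix x y assume "x \<in> carrier ?S" "y \<in> carrier ?S"
  then show "x \<otimes>\<^bsub>?S\<^esub> y \<in> carrier ?S"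
   by (cases x, cases y) (simp add: sq_zero_sel cl)
 qed
qed

lemma d_elem_props:
 assumes "a \<in> carrier A" "b \<in> carrier A"
 shows "d_elem K A (a \<oplus>\<^bsub>A\<^esub> b) = d_elem K A a \<oplus>\<^bsub>Om 1\<^esub> d_elem K A b"
  and "d_elem K A (a \<otimes>\<^bsub>A\<^esub> b) =
   (a, \<zero>) \<rhd>\<^bsub>Om 1\<^esub> d_elem K A b \<oplus>\<^bsub>Om 1\<^esub> d_elem K A a \<lhd>\<^bsub>Om 1\<^esub> (b, \<zero>)"
  and "c \<in> carrier K ==> d_elem K A (c \<odot>\<^bsub>A\<^esub> a) = (emb c) \<rhd>\<^bsub>Om 1\<^esub> d_elem K A a"
proof -
 let ?O = "Om 1"
 have one: "\<one>\<^bsub>A1\<^esub> \<in> carrier A1" by simp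
 show "d_elem K A (a \<oplus>\<^bsub>A\<^esub> b) = d_elem K A a \<oplus>\<^bsub>?O\<^esub> d_elem K A b"
  using fmD(3)[OF one, of "[]" "[]" a b 1] assms by (simp add: d_elem_def)
 show "d_elem K A (c \<odot>\<^bsub>A\<^esub> a) = (emb c) \<rhd>\<^bsub>?O\<^esub> d_elem K A a" if "c \<in> carrier K"
  using fmD(4)[OF one, of "[]" "[]" a c 1] lact_works(2)[OF aug_scalar one, of c "[a]" 1] assms that
  by (simp add: d_elem_def aug_smult aug_scalar)
 have c1: "fm K A 1 x [y] \<in> carrier ?O" if "x \<in> carrier A1" "y \<in> carrier A" for x y
  by (rule fm_closed) (use that in auto)
 let ?p = "fm K A 1 \<one>\<^bsub>A1\<^esub> [a \<otimes>\<^bsub>A\<^esub> b]" and ?q = "fm K A 1 (a, \<zero>) [b]"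
 have p: "?p \<in> carrier ?O" "?q \<in> carrier ?O" using assms c1 aug_elem nu_mult_closed by auto
 have "(a, \<zero>) \<rhd>\<^bsub>?O\<^esub> d_elem K A b \<oplus>\<^bsub>?O\<^esub> d_elem K A a \<lhd>\<^bsub>?O\<^esub> (b, \<zero>) = ?q \<oplus>\<^bsub>?O\<^esub> (?p \<ominus>\<^bsub>?O\<^esub> ?q)"
  unfolding d_elem_def
  using rmul_fm1[OF one assms] lact_works(2)[OF aug_elem one, of a "[b]" 1] assms by (simp add: aug_elem)
 also have "\<dots> = (\<ominus>\<^bsub>?O\<^esub> ?q \<oplus>\<^bsub>?O\<^esub> ?q) \<oplus>\<^bsub>?O\<^esub> ?p"
  using p by (simp add: a_minus_def Om.a_ac)
 also have "\<dots> = ?p" using p by (simp add: Om.l_neg)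
 finally show "d_elem K A (a \<otimes>\<^bsub>A\<^esub> b) = (a, \<zero>) \<rhd>\<^bsub>?O\<^esub> d_elem K A b \<oplus>\<^bsub>?O\<^esub> d_elem K A a \<lhd>\<^bsub>?O\<^esub> (b, \<zero>)"
  by (simp add: d_elem_def)
qed

text \<open>Both copies of \<open>R\<close> agree modulo \<open>\<Omega>\<^sup>1(R)\<close>, whose square is zero; that \<open>a \<mapsto> (a, da)\<close> is multiplicative is the
Leibniz rule.\<close>

lemma cyl_sq_zero_works:
 shows "cyl_sq_zero K A \<in> alg_hom K (Cyl K A 1 2) (sq_zero_ext K A)" (is ?g1)
  and "a \<in> carrier A ==> cyl_sq_zero K A (cg 1 2 0 a) = (a, \<zero>\<^bsub>Om 1\<^esub>)" (is "PROP ?g2")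
  and "a \<in> carrier A ==> cyl_sq_zero K A (cg 1 2 1 a) = (a, d_elem K A a)"
proof -
 let ?S = "sq_zero_ext K A" and ?O = "Om 1"
 let ?f = "\<lambda>(i::nat) a. if i = 0 then (a, \<zero>\<^bsub>?O\<^esub>) else (a, d_elem K A a)"
 let ?J = "{\<zero>\<^bsub>A\<^esub>} \<times> carrier ?O"
 interpret S: nu_alg K ?S unfolding nu_alg_def by (rule sq_zero_nu_algebra)
 interpret A: nu_alg K A unfolding nu_alg_def by (rule nu_algebra_axioms)
 have lz: "x \<rhd>\<^bsub>?O\<^esub> \<zero>\<^bsub>?O\<^esub> = \<zero>\<^bsub>?O\<^esub>" and rz: "\<zero>\<^bsub>?O\<^esub> \<lhd>\<^bsub>?O\<^esub> x = \<zero>\<^bsub>?O\<^esub>" if "x \<in> carrier A1" for x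
  using add_homs_zero[OF Omega_abelian_group Omega_abelian_group lact_works(1)[OF that]]
   add_homs_zero[OF Omega_abelian_group Omega_abelian_group ract_hom[OF that]] by blast+
 have z0: "(emb \<zero>) \<rhd>\<^bsub>?O\<^esub> \<omega> = \<zero>\<^bsub>?O\<^esub>" "\<omega> \<lhd>\<^bsub>?O\<^esub> (emb \<zero>) = \<zero>\<^bsub>?O\<^esub>" if "\<omega> \<in> carrier ?O" for \<omega>
  using lact_zero[OF that] ract_elem[of "\<zero>\<^bsub>A\<^esub>" \<omega> 1] rmul_zero[OF that] that by (simp_all add: aug_sel)
 have f: "\<forall>i\<le>1. ?f i \<in> alg_hom K A ?S"
  by (intro allI impI alg_homI)
   (auto simp: sq_zero_sel d_elem_closed d_elem_props lz rz aug_elem aug_scalar)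
 have J: "nu_ideal K ?S ?J"
  unfolding nu_ideal_def
  by (auto simp: sq_zero_sel lact_closed ract_closed aug_elem aug_scalar A.zero_mult z0)
 have diff: "\<forall>i\<le>1. \<forall>a\<in>carrier A. ?f i a \<ominus>\<^bsub>?S\<^esub> ?f 0 a \<in> ?J"
 proof (intro allI impI ballI)
  fix i :: nat and a assume that: "a \<in> carrier A"
  have "\<ominus>\<^bsub>?S\<^esub> (a, \<zero>\<^bsub>?O\<^esub>) = (\<ominus>\<^bsub>A\<^esub> a, \<zero>\<^bsub>?O\<^esub>)"
   using that by (intro S.M.minus_equality) (simp_all add: sq_zero_sel M.l_neg)
  then show "?f i a \<ominus>\<^bsub>?S\<^esub> ?f 0 a \<in> ?J"
   using that by (auto simp: a_minus_def sq_zero_sel M.r_neg d_elem_closed)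
 qed
 have "x = \<zero>\<^bsub>?S\<^esub>" if "x \<in> ideal_prod ?S ?J ?J" for x
  using that by induction (auto simp: sq_zero_sel A.zero_mult z0)
 then have nil: "ideal_pow ?S ?J 2 \<subseteq> {\<zero>\<^bsub>?S\<^esub>}" by (auto simp: numeral_2_eq_2)
 note cp = cyl_pair_works[where m = 1 and f = ?f and n = 2, OF sq_zero_nu_algebra f J diff nil]
 show ?g1
  unfolding cyl_sq_zero_def[abs_def] by (rule cp(1))
 show "PROP ?g2"
  and "a \<in> carrier A ==> cyl_sq_zero K A (cg 1 2 1 a) = (a, d_elem K A a)"
  unfolding cyl_sq_zero_def using cp(2)[of 0 a] cp(2)[of 1 a] by simp_all
qed

end

section \<open>Extension of scalars\<close>

lemma rmod_homD:
 assumes "h \<in> rmod_hom B M N"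
 shows "h \<in> add_homs M N" and "h \<in> extensional (carrier M)"
  and "[|x \<in> carrier M; b \<in> carrier B|] ==> h (x \<lhd>\<^bsub>M\<^esub> b) = h x \<lhd>\<^bsub>N\<^esub> b"
  and "x \<in> carrier M ==> h x \<in> carrier N"
  and "[|x \<in> carrier M; y \<in> carrier M|] ==> h (x \<oplus>\<^bsub>M\<^esub> y) = h x \<oplus>\<^bsub>N\<^esub> h y"
 using assms by (auto simp: rmod_hom_def hom_def)

lemma rmod_homI:
 assumes "h \<in> add_homs M N" "h \<in> extensional (carrier M)"
  and "\<And>x b. [|x \<in> carrier M; b \<in> carrier B|] ==> h (x \<lhd>\<^bsub>M\<^esub> b) = h x \<lhd>\<^bsub>N\<^esub> b"
 shows "h \<in> rmod_hom B M N"
 using assms by (simp add: rmod_hom_def)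

lemma ring_bimodule_sel:
 "carrier (ring_bimodule \<phi> B) = carrier B" "\<zero>\<^bsub>ring_bimodule \<phi> B\<^esub> = \<zero>\<^bsub>B\<^esub>"
 "add (ring_bimodule \<phi> B) = add B" "ract (ring_bimodule \<phi> B) = monoid.mult B"
 "a \<rhd>\<^bsub>ring_bimodule \<phi> B\<^esub> b = \<phi> a \<otimes>\<^bsub>B\<^esub> b"
 by (simp_all add: ring_bimodule_def)

lemma ring_bimodule_cong:
 assumes "\<And>a. a \<in> carrier A ==> \<phi> a = \<phi>' a"
 shows "tensor_rels E A (ring_bimodule \<phi> B) = tensor_rels E A (ring_bimodule \<phi>' B)"
  and "tensor_lift E A (ring_bimodule \<phi> B) = tensor_lift E A (ring_bimodule \<phi>' B)" (is ?g1)
proof -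
 have "(\<exists>e a l. r = frag_of (e \<lhd>\<^bsub>E\<^esub> a, l) - frag_of (e, \<phi> a \<otimes>\<^bsub>B\<^esub> l) \<and>
   e \<in> carrier E \<and> a \<in> carrier A \<and> l \<in> carrier B) \<longleftrightarrow>
  (\<exists>e a l. r = frag_of (e \<lhd>\<^bsub>E\<^esub> a, l) - frag_of (e, \<phi>' a \<otimes>\<^bsub>B\<^esub> l) \<and>
   e \<in> carrier E \<and> a \<in> carrier A \<and> l \<in> carrier B)" for r
  using assms by metis
 then show rels: "tensor_rels E A (ring_bimodule \<phi> B) = tensor_rels E A (ring_bimodule \<phi>' B)"
  unfolding tensor_rels_def ring_bimodule_sel by simp
 show ?g1
  by (intro ext) (simp add: tensor_lift_def rels ring_bimodule_sel)
qed

lemma ext_scal_cong: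
 assumes "\<And>a. a \<in> carrier A ==> \<phi> a = \<phi>' a"
 shows "ext_scal E A \<phi> B = ext_scal E A \<phi>' B" (is ?g1) and "ext_tens E A \<phi> B = ext_tens E A \<phi>' B" (is ?g2)
proof -
 note tr = ring_bimodule_cong(1)[of A \<phi> \<phi>', OF assms]
 show ?g2
  by (intro ext) (simp add: ext_tens_def tens_def tr ring_bimodule_sel)
 show ?g1
  by (simp add: ext_scal_def tensor_def tensor_lift_def tens_def tr ring_bimodule_sel)
qed

locale scalar_ext = E: right_module A E + B: ring B
 for A :: "('a, 'm) ring_scheme" and E :: "('a, 'e, 'p) rmodule_scheme"
  and \<phi> :: "'a \<Rightarrow> 'b" and B :: "('b, 'q) ring_scheme" +
 assumes \<phi>: "\<phi> \<in> ring_hom A B"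
begin

lemma \<phi>D:
 "a \<in> carrier A ==> \<phi> a \<in> carrier B"
 "[|a \<in> carrier A; b \<in> carrier A|] ==> \<phi> (a \<otimes>\<^bsub>A\<^esub> b) = \<phi> a \<otimes>\<^bsub>B\<^esub> \<phi> b"
 "[|a \<in> carrier A; b \<in> carrier A|] ==> \<phi> (a \<oplus>\<^bsub>A\<^esub> b) = \<phi> a \<oplus>\<^bsub>B\<^esub> \<phi> b"
 "\<phi> \<one>\<^bsub>A\<^esub> = \<one>\<^bsub>B\<^esub>"
 using \<phi> by (auto simp: ring_hom_def)

lemma ext_tensor: "tensor_bimod E A (ring_bimodule \<phi> B) B"
proof -
 have "abelian_group (ring_bimodule \<phi> B)"
  by (rule abelian_groupI)
   (auto simp: ring_bimodule_sel B.a_ac intro: bexI[of _ "\<ominus>\<^bsub>B\<^esub> x" for x] B.l_neg)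
 then show ?thesis
  by (intro tensor_bimod.intro tensor_pair.intro tensor_pair_axioms.intro tensor_bimod_axioms.intro
    E.abelian_group_axioms B.ring_axioms)
   (auto simp: ring_bimodule_sel \<phi>D E.ract_closed B.l_distr B.r_distr B.m_assoc)
qed

sublocale T: tensor_bimod E A "ring_bimodule \<phi> B" B by (rule ext_tensor)

abbreviation X where "X \<equiv> ext_scal E A \<phi> B"
abbreviation et where "et \<equiv> ext_tens E A \<phi> B"

lemma ext_right_module: "right_module B X"
 unfolding ext_scal_def by (rule T.tensor_right_module)

sublocale X: right_module B X by (rule ext_right_module)

lemmas et_closed = T.tens_closed[folded ext_scal_def ext_tens_def, unfolded ring_bimodule_sel]
lemmas et_add_l = T.tens_add_l[folded ext_scal_def ext_tens_def, unfolded ring_bimodule_sel]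
lemmas et_add_r = T.tens_add_r[folded ext_scal_def ext_tens_def, unfolded ring_bimodule_sel]
lemmas et_hom_l = T.tens_hom_l[folded ext_scal_def ext_tens_def, unfolded ring_bimodule_sel]
lemmas et_bal = T.tens_bal[folded ext_scal_def ext_tens_def, unfolded ring_bimodule_sel]
lemmas et_ract = T.tensor_ract(2)[folded ext_scal_def ext_tens_def, unfolded ring_bimodule_sel]
lemmas ext_ract_hom = T.tensor_ract(1)[folded ext_scal_def ext_tens_def, unfolded ring_bimodule_sel]
lemmas ext_hom_eqI = T.tensor_hom_eqI[folded ext_scal_def ext_tens_def, unfolded ring_bimodule_sel]
lemmas ext_tensor_lift = T.tensor_lift_works[folded ext_scal_def ext_tens_def, unfolded ring_bimodule_sel]
lemmas ext_induct [consumes 1, case_names tens add] =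
 T.tensor_induct[folded ext_scal_def ext_tens_def, unfolded ring_bimodule_sel]

lemma et_unit: "[|e \<in> carrier E; b \<in> carrier B|] ==> et e b = et e \<one>\<^bsub>B\<^esub> \<lhd>\<^bsub>X\<^esub> b"
 by (simp add: et_ract)

lemma et_minus_r:
 "[|e \<in> carrier E; b \<in> carrier B; b' \<in> carrier B|] ==> et e (b \<ominus>\<^bsub>B\<^esub> b') = et e b \<ominus>\<^bsub>X\<^esub> et e b'"
 using add_homs_minus[OF B.abelian_group_axioms X.abelian_group_axioms, of "et e" b b']
 by (simp add: add_homs_I et_closed et_add_r)

lemma et_zero_r: "e \<in> carrier E ==> et e \<zero>\<^bsub>B\<^esub> = \<zero>\<^bsub>X\<^esub>"
 using add_homs_zero[OF B.abelian_group_axioms X.abelian_group_axioms, of "et e"]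
 by (simp add: add_homs_I et_closed et_add_r)

text \<open>The universal property: semilinear maps out of \<open>E\<close> extend uniquely to linear maps.\<close>

definition ext_lift :: "('b, 'f, 'r) rmodule_scheme \<Rightarrow> ('e \<Rightarrow> 'f) \<Rightarrow> (('e \<times> 'b) \<Rightarrow>\<^sub>0 int) set \<Rightarrow> 'f" where
 "ext_lift M f = tensor_lift E A (ring_bimodule \<phi> B) M (\<lambda>e b. f e \<lhd>\<^bsub>M\<^esub> b)"

lemma ext_lift_works:
 assumes M: "right_module B M" and f: "f \<in> add_homs E M"
  and semi: "\<And>e a. [|e \<in> carrier E; a \<in> carrier A|] ==> f (e \<lhd>\<^bsub>E\<^esub> a) = f e \<lhd>\<^bsub>M\<^esub> \<phi> a"
 shows "ext_lift M f \<in> rmod_hom B X M"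
  and "[|e \<in> carrier E; b \<in> carrier B|] ==> ext_lift M f (et e b) = f e \<lhd>\<^bsub>M\<^esub> b"
proof -
 interpret M: right_module B M by fact
 note fD = add_homs_closed[OF f] add_homs_add[OF f]
 have *: "f e \<lhd>\<^bsub>M\<^esub> l \<in> carrier M"
  "e' \<in> carrier E ==> f (e \<oplus>\<^bsub>E\<^esub> e') \<lhd>\<^bsub>M\<^esub> l = f e \<lhd>\<^bsub>M\<^esub> l \<oplus>\<^bsub>M\<^esub> f e' \<lhd>\<^bsub>M\<^esub> l"
  "l' \<in> carrier B ==> f e \<lhd>\<^bsub>M\<^esub> (l \<oplus>\<^bsub>B\<^esub> l') = f e \<lhd>\<^bsub>M\<^esub> l \<oplus>\<^bsub>M\<^esub> f e \<lhd>\<^bsub>M\<^esub> l'"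
  "a \<in> carrier A ==> f (e \<lhd>\<^bsub>E\<^esub> a) \<lhd>\<^bsub>M\<^esub> l = f e \<lhd>\<^bsub>M\<^esub> (\<phi> a \<otimes>\<^bsub>B\<^esub> l)"
  if "e \<in> carrier E" "l \<in> carrier B" for e l e' l' a
  using that by (simp_all add: fD M.ract_closed M.ract_l_distr M.ract_r_distr semi M.ract_assoc \<phi>D)
 note l = ext_tensor_lift[where \<phi> = "\<lambda>e b. f e \<lhd>\<^bsub>M\<^esub> b", OF M.abelian_group_axioms *, folded ext_lift_def]
 show v: "ext_lift M f (et e b) = f e \<lhd>\<^bsub>M\<^esub> b" if "e \<in> carrier E" "b \<in> carrier B" for e b
  using l(3) that by blast
 have h: "ext_lift M f \<in> add_homs X M" by (rule l(1))
 show "ext_lift M f \<in> rmod_hom B X M"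
 proof (rule rmod_homI[OF h])
  show "ext_lift M f \<in> extensional (carrier X)" by (rule l(2))
  fix x b assume x: "x \<in> carrier X" and b: "b \<in> carrier B"
  show "ext_lift M f (x \<lhd>\<^bsub>X\<^esub> b) = ext_lift M f x \<lhd>\<^bsub>M\<^esub> b"
   using x by (induction rule: ext_induct)
    (use b in \<open>simp_all add: v et_ract M.ract_assoc fD X.ract_l_distr X.ract_closed M.ract_l_distr
     add_homs_add[OF h] add_homs_closed[OF h]\<close>)
 qed
qed

lemma ext_lin_eqI:
 assumes M: "right_module B M" and g: "g \<in> add_homs X M" "h \<in> add_homs X M"
  and lin: "\<And>x b. [|x \<in> carrier X; b \<in> carrier B|] ==> g (x \<lhd>\<^bsub>X\<^esub> b) = g x \<lhd>\<^bsub>M\<^esub> b"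
   "\<And>x b. [|x \<in> carrier X; b \<in> carrier B|] ==> h (x \<lhd>\<^bsub>X\<^esub> b) = h x \<lhd>\<^bsub>M\<^esub> b"
  and eq: "\<And>e. e \<in> carrier E ==> g (et e \<one>\<^bsub>B\<^esub>) = h (et e \<one>\<^bsub>B\<^esub>)"
  and t: "t \<in> carrier X"
 shows "g t = h t"
proof (rule ext_hom_eqI[OF g _ t])
 fix e b assume "e \<in> carrier E" "b \<in> carrier B"
 then show "g (et e b) = h (et e b)"
  using lin[of "et e \<one>\<^bsub>B\<^esub>" b] eq by (simp add: et_closed flip: et_unit)
qed

lemma rmod_hom_eqI:
 assumes M: "right_module B M" and g: "g \<in> rmod_hom B X M" "h \<in> rmod_hom B X M"
  and eq: "\<And>e. e \<in> carrier E ==> g (et e \<one>\<^bsub>B\<^esub>) = h (et e \<one>\<^bsub>B\<^esub>)"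
 shows "g = h"
 by (rule extensionalityI[OF rmod_homD(2)[OF g(1)] rmod_homD(2)[OF g(2)]],
   rule ext_lin_eqI[OF M rmod_homD(1)[OF g(1)] rmod_homD(1)[OF g(2)]
    rmod_homD(3)[OF g(1)] rmod_homD(3)[OF g(2)] eq])

end

lemma ext_map_works:
 assumes "scalar_ext A E \<phi> B" "scalar_ext A E' \<phi> B" and f: "f \<in> rmod_hom A E E'"
 shows "ext_map E E' A \<phi> B f \<in> rmod_hom B (ext_scal E A \<phi> B) (ext_scal E' A \<phi> B)"
  and "[|e \<in> carrier E; b \<in> carrier B|] ==>
   ext_map E E' A \<phi> B f (ext_tens E A \<phi> B e b) = ext_tens E' A \<phi> B (f e) b"
proof -
 interpret E: scalar_ext A E \<phi> B by fact
 interpret F: scalar_ext A E' \<phi> B by fact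
 note fD = rmod_homD[OF f]
 have *: "F.et (f e) l \<in> carrier F.X"
  "e' \<in> carrier E ==> F.et (f (e \<oplus>\<^bsub>E\<^esub> e')) l = F.et (f e) l \<oplus>\<^bsub>F.X\<^esub> F.et (f e') l"
  "l' \<in> carrier B ==> F.et (f e) (l \<oplus>\<^bsub>B\<^esub> l') = F.et (f e) l \<oplus>\<^bsub>F.X\<^esub> F.et (f e) l'"
  "a \<in> carrier A ==> F.et (f (e \<lhd>\<^bsub>E\<^esub> a)) l = F.et (f e) (\<phi> a \<otimes>\<^bsub>B\<^esub> l)"
  if "e \<in> carrier E" "l \<in> carrier B" for e l e' l' a
  using that by (simp_all add: fD F.et_closed F.et_add_l F.et_add_r F.et_bal)
 note l = E.ext_tensor_lift[where \<phi> = "\<lambda>e b. F.et (f e) b", OF F.X.abelian_group_axioms *,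
   folded ext_map_def]
 show v: "ext_map E E' A \<phi> B f (E.et e b) = F.et (f e) b" if "e \<in> carrier E" "b \<in> carrier B" for e b
  using l(3) that by blast
 have h: "ext_map E E' A \<phi> B f \<in> add_homs E.X F.X" by (rule l(1))
 show "ext_map E E' A \<phi> B f \<in> rmod_hom B E.X F.X"
 proof (rule rmod_homI[OF h])
  show "ext_map E E' A \<phi> B f \<in> extensional (carrier E.X)" by (rule l(2))
  fix x b assume x: "x \<in> carrier E.X" and b: "b \<in> carrier B"
  show "ext_map E E' A \<phi> B f (x \<lhd>\<^bsub>E.X\<^esub> b) = ext_map E E' A \<phi> B f x \<lhd>\<^bsub>F.X\<^esub> b"
   using x by (induction rule: E.ext_induct)
    (use b in \<open>simp_all add: v E.et_ract F.et_ract fD E.X.ract_l_distr E.X.ract_closed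
     F.X.ract_l_distr add_homs_add[OF h] add_homs_closed[OF h]\<close>)
 qed
qed

locale scalar_ext2 = P: scalar_ext A E \<phi> B + R: scalar_ext A E \<chi> C
 for A :: "('a, 'm) ring_scheme" and E :: "('a, 'e, 'p) rmodule_scheme"
  and \<phi> :: "'a \<Rightarrow> 'b" and B :: "('b, 'q) ring_scheme" and \<psi> :: "'b \<Rightarrow> 'c" and \<chi> :: "'a \<Rightarrow> 'c"
  and C :: "('c, 's) ring_scheme" +
 assumes \<psi>: "\<psi> \<in> ring_hom B C" and comp: "a \<in> carrier A ==> \<chi> a = \<psi> (\<phi> a)"
begin

lemma \<psi>D:
 "a \<in> carrier B ==> \<psi> a \<in> carrier C"
 "[|a \<in> carrier B; b \<in> carrier B|] ==> \<psi> (a \<otimes>\<^bsub>B\<^esub> b) = \<psi> a \<otimes>\<^bsub>C\<^esub> \<psi> b"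
 "[|a \<in> carrier B; b \<in> carrier B|] ==> \<psi> (a \<oplus>\<^bsub>B\<^esub> b) = \<psi> a \<oplus>\<^bsub>C\<^esub> \<psi> b"
 "\<psi> \<one>\<^bsub>B\<^esub> = \<one>\<^bsub>C\<^esub>"
 using \<psi> by (auto simp: ring_hom_def)

abbreviation ch where "ch \<equiv> ext_change E A \<phi> B \<psi> \<chi> C"

lemma ch_works:
 shows "ch \<in> add_homs P.X R.X"
  and "[|e \<in> carrier E; b \<in> carrier B|] ==> ch (P.et e b) = R.et e (\<psi> b)"
proof -
 have *: "R.et e (\<psi> l) \<in> carrier R.X"
  "e' \<in> carrier E ==> R.et (e \<oplus>\<^bsub>E\<^esub> e') (\<psi> l) = R.et e (\<psi> l) \<oplus>\<^bsub>R.X\<^esub> R.et e' (\<psi> l)"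
  "l' \<in> carrier B ==> R.et e (\<psi> (l \<oplus>\<^bsub>B\<^esub> l')) = R.et e (\<psi> l) \<oplus>\<^bsub>R.X\<^esub> R.et e (\<psi> l')"
  "a \<in> carrier A ==> R.et (e \<lhd>\<^bsub>E\<^esub> a) (\<psi> l) = R.et e (\<psi> (\<phi> a \<otimes>\<^bsub>B\<^esub> l))"
  if "e \<in> carrier E" "l \<in> carrier B" for e l e' l' a
  using that by (simp_all add: R.et_closed R.et_add_l R.et_add_r R.et_bal comp P.\<phi>D \<psi>D)
 note l = P.ext_tensor_lift[where \<phi> = "\<lambda>e b. R.et e (\<psi> b)", OF R.X.abelian_group_axioms *,
   folded ext_change_def]
 show "ch (P.et e b) = R.et e (\<psi> b)" if "e \<in> carrier E" "b \<in> carrier B" for e b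
  using l(3) that by blast
 show "ch \<in> add_homs P.X R.X" by (rule l(1))
qed

lemmas ch_closed = add_homs_closed[OF ch_works(1)]
lemmas ch_add = add_homs_add[OF ch_works(1)]

lemma ch_ract:
 assumes "x \<in> carrier P.X" "b \<in> carrier B"
 shows "ch (x \<lhd>\<^bsub>P.X\<^esub> b) = ch x \<lhd>\<^bsub>R.X\<^esub> \<psi> b"
 using assms(1)
 by (induction rule: P.ext_induct)
  (use assms(2) in \<open>simp_all add: ch_works(2) P.et_ract R.et_ract \<psi>D P.X.ract_l_distr P.X.ract_closed
   R.X.ract_l_distr ch_add ch_closed\<close>)

sublocale PC: scalar_ext B P.X \<psi> C
 by (intro scalar_ext.intro scalar_ext_axioms.intro P.ext_right_module R.B.ring_axioms \<psi>)

abbreviation tr where "tr \<equiv> ext_trans E A \<phi> B \<psi> \<chi> C"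

lemma tr_works:
 shows "tr \<in> rmod_hom C PC.X R.X"
  and "[|t \<in> carrier P.X; c \<in> carrier C|] ==> tr (PC.et t c) = ch t \<lhd>\<^bsub>R.X\<^esub> c" (is "PROP ?g1")
proof -
 have eq: "tr = PC.ext_lift R.X ch" by (simp add: ext_trans_def PC.ext_lift_def)
 show "tr \<in> rmod_hom C PC.X R.X"
  unfolding eq by (rule PC.ext_lift_works(1)[OF R.ext_right_module ch_works(1) ch_ract])
 show "PROP ?g1"
  unfolding eq by (rule PC.ext_lift_works(2)[OF R.ext_right_module ch_works(1) ch_ract])
qed

definition rt where "rt = R.ext_lift PC.X (\<lambda>e. PC.et (P.et e \<one>\<^bsub>B\<^esub>) \<one>\<^bsub>C\<^esub>)"

lemma rt_works:
 shows "rt \<in> rmod_hom C R.X PC.X"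
  and "[|e \<in> carrier E; c \<in> carrier C|] ==> rt (R.et e c) = PC.et (P.et e \<one>\<^bsub>B\<^esub>) c" (is "PROP ?g1")
proof -
 have 1: "(\<lambda>e. PC.et (P.et e \<one>\<^bsub>B\<^esub>) \<one>\<^bsub>C\<^esub>) \<in> add_homs E PC.X"
  by (rule add_homs_I) (simp_all add: PC.et_closed P.et_closed P.et_add_l PC.et_add_l)
 have 2: "PC.et (P.et (e \<lhd>\<^bsub>E\<^esub> a) \<one>\<^bsub>B\<^esub>) \<one>\<^bsub>C\<^esub> = PC.et (P.et e \<one>\<^bsub>B\<^esub>) \<one>\<^bsub>C\<^esub> \<lhd>\<^bsub>PC.X\<^esub> \<chi> a"
  if "e \<in> carrier E" "a \<in> carrier A" for e a
 proof -
  have "P.et (e \<lhd>\<^bsub>E\<^esub> a) \<one>\<^bsub>B\<^esub> = P.et e \<one>\<^bsub>B\<^esub> \<lhd>\<^bsub>P.X\<^esub> \<phi> a"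
   using that by (simp add: P.et_bal P.et_ract P.\<phi>D)
  then show ?thesis
   using that by (simp add: PC.et_bal PC.et_ract P.et_closed P.\<phi>D comp \<psi>D)
 qed
 show "rt \<in> rmod_hom C R.X PC.X"
  unfolding rt_def by (rule R.ext_lift_works(1)[OF PC.ext_right_module 1 2])
 show "PROP ?g1"
  unfolding rt_def using R.ext_lift_works(2)[OF PC.ext_right_module 1 2, of e c]
  by (simp add: PC.et_ract P.et_closed)
qed

lemma tr_rt: "t \<in> carrier R.X ==> tr (rt t) = t"
proof (induction rule: R.ext_induct)
 case (tens e c)
 then show ?case by (simp add: rt_works(2) tr_works(2) P.et_closed ch_works(2) \<psi>D R.et_ract)
qed (simp_all add: rmod_homD(4,5)[OF rt_works(1)] rmod_homD(5)[OF tr_works(1)])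

lemma rt_tr: "u \<in> carrier PC.X ==> rt (tr u) = u"
proof (induction rule: PC.ext_induct)
 case (tens t c)
 have "rt (ch t \<lhd>\<^bsub>R.X\<^esub> c) = PC.et t c"
  using tens(1)
 proof (induction rule: P.ext_induct)
  case (tens e b)
  have "rt (ch (P.et e b) \<lhd>\<^bsub>R.X\<^esub> c) = PC.et (P.et e \<one>\<^bsub>B\<^esub>) (\<psi> b \<otimes>\<^bsub>C\<^esub> c)"
   using tens \<open>c \<in> carrier C\<close> by (simp add: ch_works(2) R.et_ract \<psi>D rt_works(2))
  also have "\<dots> = PC.et (P.et e \<one>\<^bsub>B\<^esub> \<lhd>\<^bsub>P.X\<^esub> b) c"
   using tens \<open>c \<in> carrier C\<close> by (simp add: PC.et_bal P.et_closed)
  finally show ?case using tens by (simp add: P.et_ract)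
 next
  case (add x y)
  then show ?case
   using \<open>c \<in> carrier C\<close>
   by (simp add: ch_add R.X.ract_l_distr ch_closed rmod_homD(5)[OF rt_works(1)] R.X.ract_closed
     PC.et_add_l)
 qed
 then show ?case using tens by (simp add: tr_works(2))
qed (simp_all add: rmod_homD(4,5)[OF tr_works(1)] rmod_homD(5)[OF rt_works(1)])

lemma tr_inv:
 assumes "t \<in> carrier R.X"
 shows "inv_into (carrier PC.X) tr t = rt t"
proof (rule inv_into_f_eq)
 show "inj_on tr (carrier PC.X)" by (rule inj_on_inverseI[of _ rt]) (rule rt_tr)
 show "rt t \<in> carrier PC.X" by (rule rmod_homD(4)[OF rt_works(1) assms])
 show "tr (rt t) = t" by (rule tr_rt[OF assms])
qed

end

text \<open>
 The base change of a linear map \<open>h\<close> between extended modules along \<open>\<psi>\<close>, in terms of the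
 canonical identifications: it is the linear map with \<open>e \<otimes> 1 \<mapsto> \<psi>\<^sub>*(h(e \<otimes> 1))\<close>.
\<close>

lemma base_change_works:
 assumes 1: "scalar_ext2 A E \<phi> B \<psi> \<chi> C" and 2: "scalar_ext2 A E \<phi>' B \<psi> \<chi>' C"
  and h: "h \<in> rmod_hom B (ext_scal E A \<phi> B) (ext_scal E A \<phi>' B)"
 defines "F \<equiv> \<lambda>t. ext_trans E A \<phi>' B \<psi> \<chi>' C
    (ext_map (ext_scal E A \<phi> B) (ext_scal E A \<phi>' B) B \<psi> C h
     (inv_into (carrier (ext_scal (ext_scal E A \<phi> B) B \<psi> C)) (ext_trans E A \<phi> B \<psi> \<chi> C) t))"
 shows "F \<in> add_homs (ext_scal E A \<chi> C) (ext_scal E A \<chi>' C)"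
  and "[|t \<in> carrier (ext_scal E A \<chi> C); c \<in> carrier C|] ==>
   F (t \<lhd>\<^bsub>ext_scal E A \<chi> C\<^esub> c) = F t \<lhd>\<^bsub>ext_scal E A \<chi>' C\<^esub> c"
  and "e \<in> carrier E ==> F (ext_tens E A \<chi> C e \<one>\<^bsub>C\<^esub>) =
   ext_change E A \<phi>' B \<psi> \<chi>' C (h (ext_tens E A \<phi> B e \<one>\<^bsub>B\<^esub>))"
proof -
 interpret S: scalar_ext2 A E \<phi> B \<psi> \<chi> C by fact
 interpret T: scalar_ext2 A E \<phi>' B \<psi> \<chi>' C by fact
 note m = ext_map_works[OF S.PC.scalar_ext_axioms T.PC.scalar_ext_axioms h]
 let ?m = "ext_map S.P.X T.P.X B \<psi> C h"
 have F: "F t = T.tr (?m (S.rt t))" if "t \<in> carrier S.R.X" for t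
  using S.tr_inv[OF that] by (simp add: F_def)
 show "F \<in> add_homs S.R.X T.R.X"
  by (rule add_homs_I)
   (simp_all add: F rmod_homD[OF m(1)] rmod_homD[OF S.rt_works(1)] rmod_homD[OF T.tr_works(1)])
 show "[|t \<in> carrier S.R.X; c \<in> carrier C|] ==> F (t \<lhd>\<^bsub>S.R.X\<^esub> c) = F t \<lhd>\<^bsub>T.R.X\<^esub> c"
  by (simp add: F S.R.X.ract_closed rmod_homD[OF m(1)] rmod_homD[OF S.rt_works(1)]
    rmod_homD[OF T.tr_works(1)])
 show "F (S.R.et e \<one>\<^bsub>C\<^esub>) = T.ch (h (S.P.et e \<one>\<^bsub>B\<^esub>))" if "e \<in> carrier E"
  using that rmod_homD(4)[OF h]
  by (simp add: F S.R.et_closed S.rt_works(2) m(2) S.P.et_closed T.tr_works(2) T.R.X.ract_one T.ch_closed)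
qed

section \<open>From a flat connection to a descent datum\<close>

definition hdiff ::
 "('k, 'n) ring_scheme \<Rightarrow> ('b, 'q) ring_scheme \<Rightarrow> ('a \<times> 'k \<Rightarrow> 'b) \<Rightarrow> ('a \<times> 'k \<Rightarrow> 'b) \<Rightarrow> 'a \<Rightarrow> 'b" where
 "hdiff K B \<alpha> \<beta> a = \<beta> (a, \<zero>\<^bsub>K\<^esub>) \<ominus>\<^bsub>B\<^esub> \<alpha> (a, \<zero>\<^bsub>K\<^esub>)"

definition scalar_agree ::
 "('k, 'n) ring_scheme \<Rightarrow> ('k, 'a) module \<Rightarrow> ('a \<times> 'k \<Rightarrow> 'b) \<Rightarrow> ('a \<times> 'k \<Rightarrow> 'b) \<Rightarrow> bool" where
 "scalar_agree K A \<alpha> \<beta> \<longleftrightarrow> (\<forall>c\<in>carrier K. \<alpha> (\<zero>\<^bsub>A\<^esub>, c) = \<beta> (\<zero>\<^bsub>A\<^esub>, c))"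

fun word_prod :: "('b, 'q) ring_scheme \<Rightarrow> ('a \<Rightarrow> 'b) list \<Rightarrow> 'a list \<Rightarrow> 'b" where
 "word_prod B (d # ds) (a # as) = d a \<otimes>\<^bsub>B\<^esub> word_prod B ds as"
| "word_prod B _ _ = \<one>\<^bsub>B\<^esub>"

locale scalar_form = form_module K A E + S: scalar_ext "aug K A" E \<alpha> B
 for K :: "('k, 'n) ring_scheme" (structure) and A :: "('k, 'a) module" (structure)
  and E :: "('a \<times> 'k, 'e) rmodule" and \<alpha> :: "'a \<times> 'k \<Rightarrow> 'b" and B :: "('b, 'q) ring_scheme"
begin

text \<open>For these maps, \<open>x da\<^sub>1 \<dots> da\<^sub>n \<mapsto> \<alpha>(x) d\<^sub>1(a\<^sub>1) \<dots> d\<^sub>n(a\<^sub>n)\<close> is well defined on forms.\<close>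

definition kder :: "('a \<Rightarrow> 'b) \<Rightarrow> bool" where
 "kder d \<longleftrightarrow> (\<forall>a\<in>carrier A. d a \<in> carrier B) \<and>
  (\<forall>a\<in>carrier A. \<forall>b\<in>carrier A. d (a \<oplus>\<^bsub>A\<^esub> b) = d a \<oplus>\<^bsub>B\<^esub> d b) \<and>
  (\<forall>a\<in>carrier A. \<forall>c\<in>carrier K. d (c \<odot>\<^bsub>A\<^esub> a) = \<alpha> (emb c) \<otimes>\<^bsub>B\<^esub> d a \<and>
   d (c \<odot>\<^bsub>A\<^esub> a) = d a \<otimes>\<^bsub>B\<^esub> \<alpha> (emb c))"

lemma kderD:
 assumes "kder d"
 shows "a \<in> carrier A ==> d a \<in> carrier B" (is "PROP ?g1")
  and "[|a \<in> carrier A; b \<in> carrier A|] ==> d (a \<oplus>\<^bsub>A\<^esub> b) = d a \<oplus>\<^bsub>B\<^esub> d b" (is "PROP ?g2")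
  and "[|a \<in> carrier A; c \<in> carrier K|] ==> d (c \<odot>\<^bsub>A\<^esub> a) = \<alpha> (emb c) \<otimes>\<^bsub>B\<^esub> d a" (is "PROP ?g3")
  and "[|a \<in> carrier A; c \<in> carrier K|] ==> d a \<otimes>\<^bsub>B\<^esub> \<alpha> (emb c) = \<alpha> (emb c) \<otimes>\<^bsub>B\<^esub> d a" (is "PROP ?g4")
proof -
 note k = assms[unfolded kder_def]
 show "PROP ?g1" using k by blast
 show "PROP ?g2" using k by blast
 show "PROP ?g3" using k by blast
 show "PROP ?g4"
  using k by metis
qed

lemma word_prod_closed:
 "[|\<forall>d\<in>set ds. kder d; set as \<subseteq> carrier A|] ==> word_prod B ds as \<in> carrier B"
proof (induction ds arbitrary: as)
 case (Cons d ds)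
 then show ?case by (cases as) (auto simp: kderD)
qed simp

lemma word_prod_add:
 "[|\<forall>d\<in>set ds. kder d; set us \<subseteq> carrier A; set vs \<subseteq> carrier A; a \<in> carrier A; b \<in> carrier A;
  length us < length ds|] ==>
  word_prod B ds (us @ (a \<oplus>\<^bsub>A\<^esub> b) # vs) =
  word_prod B ds (us @ a # vs) \<oplus>\<^bsub>B\<^esub> word_prod B ds (us @ b # vs)"
proof (induction ds arbitrary: us)
 case (Cons d ds)
 then show ?case
  by (cases us) (auto simp: kderD word_prod_closed S.B.l_distr S.B.r_distr)
qed simp

lemma word_prod_scal:
 "[|\<forall>d\<in>set ds. kder d; set us \<subseteq> carrier A; set vs \<subseteq> carrier A; a \<in> carrier A; c \<in> carrier K;
  length us < length ds|] ==>
  word_prod B ds (us @ (c \<odot>\<^bsub>A\<^esub> a) # vs) = \<alpha> (emb c) \<otimes>\<^bsub>B\<^esub> word_prod B ds (us @ a # vs)"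
proof (induction ds arbitrary: us)
 case (Cons d ds)
 have k: "\<alpha> (emb c) \<in> carrier B" using Cons.prems by (simp add: S.\<phi>D aug_scalar)
 show ?case
 proof (cases us)
  case Nil
  then show ?thesis using Cons.prems k by (auto simp: kderD(1,3) word_prod_closed S.B.m_assoc)
 next
  case (Cons u us')
  have u: "d u \<in> carrier B" "word_prod B ds (us' @ a # vs) \<in> carrier B"
   using Cons.prems Cons by (auto simp: kderD(1) word_prod_closed)
  have "d u \<otimes>\<^bsub>B\<^esub> (\<alpha> (emb c) \<otimes>\<^bsub>B\<^esub> word_prod B ds (us' @ a # vs)) =
    \<alpha> (emb c) \<otimes>\<^bsub>B\<^esub> (d u \<otimes>\<^bsub>B\<^esub> word_prod B ds (us' @ a # vs))"
   using Cons.prems Cons k u kderD(4)[of d u c] by (simp flip: S.B.m_assoc)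
  then show ?thesis using Cons Cons.prems Cons.IH[of us'] by simp
 qed
qed simp

definition fword :: "('a \<Rightarrow> 'b) list \<Rightarrow> ('k, 'a) form \<Rightarrow> 'b" where
 "fword ds = form_lift K A (length ds) B (\<lambda>x as. \<alpha> x \<otimes>\<^bsub>B\<^esub> word_prod B ds as)"

lemma fword_works:
 assumes ds: "\<forall>d\<in>set ds. kder d"
 shows "fword ds \<in> add_homs (Om (length ds)) B" (is ?g1)
  and "[|x \<in> carrier A1; set as \<subseteq> carrier A; length as = length ds|] ==>
   fword ds (fm K A (length ds) x as) = \<alpha> x \<otimes>\<^bsub>B\<^esub> word_prod B ds as" (is "PROP ?g2")
proof -
 have m: "multiadd K A (length ds) B (\<lambda>x as. \<alpha> x \<otimes>\<^bsub>B\<^esub> word_prod B ds as)"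
 proof (rule multiaddI, goal_cases)
  case (1 x as)
  then show ?case by (simp add: S.\<phi>D word_prod_closed ds)
 next
  case (2 x y as)
  then show ?case by (simp add: S.\<phi>D word_prod_closed ds S.B.l_distr)
 next
  case (3 x us vs a b)
  then show ?case
   using word_prod_closed[of ds "us @ a # vs"] word_prod_closed[of ds "us @ b # vs"]
   by (simp add: S.\<phi>D word_prod_add ds S.B.r_distr)
 next
  case (4 x us vs a c)
  have "\<alpha> (c \<odot>\<^bsub>A1\<^esub> x) = \<alpha> x \<otimes>\<^bsub>B\<^esub> \<alpha> (emb c)"
   using 4 by (simp add: aug_smult aug_scalar S.\<phi>D flip: aug_scalar_comm)
  then show ?case
   using 4 word_prod_closed[of ds "us @ a # vs"]
   by (simp add: S.\<phi>D word_prod_scal ds S.B.m_assoc aug_scalar)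
 qed
 show ?g1
  unfolding fword_def by (rule form_lift_works[OF S.B.abelian_group_axioms m])
 show "PROP ?g2"
  unfolding fword_def by (rule form_lift_works[OF S.B.abelian_group_axioms m])
qed

lemmas fword_closed = add_homs_closed[OF fword_works(1)]
lemmas fword_add = add_homs_add[OF fword_works(1)]
lemma fword_lact:
 assumes "\<forall>d\<in>set ds. kder d" "y \<in> carrier A1" "\<omega> \<in> carrier (Om (length ds))"
 shows "fword ds (y \<rhd>\<^bsub>Om (length ds)\<^esub> \<omega>) = \<alpha> y \<otimes>\<^bsub>B\<^esub> fword ds \<omega>"
 using assms(3)
 by (induction rule: form_induct)
  (use assms in \<open>simp_all add: fword_works(2) fword_add lact_works(2) lact_add lact_closed S.\<phi>D
   S.B.m_assoc word_prod_closed fword_closed S.B.r_distr\<close>)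

text \<open>The map \<open>e \<otimes> x da\<^sub>1 \<dots> da\<^sub>n \<mapsto> e \<otimes> \<alpha>(x) d\<^sub>1(a\<^sub>1) \<dots> d\<^sub>n(a\<^sub>n)\<close>.\<close>

definition Psi :: "('a \<Rightarrow> 'b) list \<Rightarrow> ('k, 'a, 'e) form_ext \<Rightarrow> (('e \<times> 'b) \<Rightarrow>\<^sub>0 int) set" where
 "Psi ds = tensor_lift E A1 (Om (length ds)) S.X (\<lambda>e \<omega>. S.et e (fword ds \<omega>))"

lemma Psi_works:
 assumes ds: "\<forall>d\<in>set ds. kder d"
 shows "Psi ds \<in> add_homs (MF (length ds)) S.X"
  and "[|e \<in> carrier E; \<omega> \<in> carrier (Om (length ds))|] ==>
   Psi ds (ftn (length ds) e \<omega>) = S.et e (fword ds \<omega>)"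
proof -
 let ?n = "length ds"
 have *: "S.et e (fword ds l) \<in> carrier S.X"
  "e' \<in> carrier E ==> S.et (e \<oplus>\<^bsub>E\<^esub> e') (fword ds l) = S.et e (fword ds l) \<oplus>\<^bsub>S.X\<^esub> S.et e' (fword ds l)"
  "l' \<in> carrier (Om ?n) ==>
   S.et e (fword ds (l \<oplus>\<^bsub>Om ?n\<^esub> l')) = S.et e (fword ds l) \<oplus>\<^bsub>S.X\<^esub> S.et e (fword ds l')"
  "a \<in> carrier A1 ==> S.et (e \<lhd>\<^bsub>E\<^esub> a) (fword ds l) = S.et e (fword ds (a \<rhd>\<^bsub>Om ?n\<^esub> l))"
  if "e \<in> carrier E" "l \<in> carrier (Om ?n)" for e l e' l' a
  using that by (simp_all add: ds S.et_closed S.et_add_l S.et_add_r S.et_bal fword_closed fword_add fword_lact)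
 note l = mf_lift[where n = ?n and \<phi> = "\<lambda>e \<omega>. S.et e (fword ds \<omega>)" and M = S.X, OF S.X.abelian_group_axioms *]
 show "Psi ds \<in> add_homs (MF ?n) S.X"
  unfolding Psi_def by (rule l(1))
 show "[|e \<in> carrier E; \<omega> \<in> carrier (Om ?n)|] ==>
   Psi ds (ftn ?n e \<omega>) = S.et e (fword ds \<omega>)"
  unfolding Psi_def by (rule l(3))
qed

lemmas Psi_zero = add_homs_zero[OF MF.abelian_group_axioms S.X.abelian_group_axioms Psi_works(1)]

lemma Psi_word:
 assumes "\<forall>d\<in>set ds. kder d" "e \<in> carrier E" "set as \<subseteq> carrier A" "length as = length ds"
 shows "Psi ds (ftn (length ds) e (fm K A (length ds) \<one>\<^bsub>A1\<^esub> as)) = S.et e (word_prod B ds as)"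
 using assms by (simp add: Psi_works(2) fm_closed fword_works(2) S.\<phi>D word_prod_closed)

lemma word_prod_snoc:
 "[|\<forall>d\<in>set ds. kder d; kder d'; set as \<subseteq> carrier A; y \<in> carrier A; length as = length ds|] ==>
  word_prod B (ds @ [d']) (as @ [y]) = word_prod B ds as \<otimes>\<^bsub>B\<^esub> d' y"
 by (induction ds arbitrary: as)
  (auto simp: kderD(1) length_Suc_conv word_prod_closed S.B.m_assoc)

lemma Psi_mcc:
 assumes ds: "\<forall>d\<in>set ds. kder d" "kder d'" and y: "y \<in> carrier A"
  and t: "t \<in> carrier (MF (length ds))"
 shows "Psi (ds @ [d']) (mcc (length ds) [y] t) = Psi ds t \<lhd>\<^bsub>S.X\<^esub> d' y"
proof -
 let ?n = "length ds"
 have ds': "\<forall>d\<in>set (ds @ [d']). kder d" using ds by auto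
 have wp: "word_prod B (ds @ [d']) (as @ [y]) = word_prod B ds as \<otimes>\<^bsub>B\<^esub> d' y"
  if "set as \<subseteq> carrier A" "length as = ?n" for as
  by (rule word_prod_snoc) (use that ds y in auto)
 show ?thesis
 proof (rule mf_word_eqI[OF _ _ _ t])
  show "(\<lambda>t. Psi (ds @ [d']) (mcc ?n [y] t)) \<in> add_homs (MF ?n) S.X"
   using Psi_works(1)[OF ds'] by (intro add_homs_comp[OF msnoc_hom[OF y]]) simp
  show "(\<lambda>t. Psi ds t \<lhd>\<^bsub>S.X\<^esub> d' y) \<in> add_homs (MF ?n) S.X"
   by (rule add_homs_comp[OF Psi_works(1)[OF ds(1)] S.ext_ract_hom]) (use ds y kderD in auto)
  fix e as assume *: "e \<in> carrier E" "set as \<subseteq> carrier A" "length as = ?n"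
  then have "mcc ?n [y] (ftn ?n e (fm K A ?n \<one>\<^bsub>A1\<^esub> as)) =
    ftn (Suc ?n) e (fm K A (Suc ?n) \<one>\<^bsub>A1\<^esub> (as @ [y]))"
   using y by (simp add: msnoc_ft fm_closed snoc_fm)
  then show "Psi (ds @ [d']) (mcc ?n [y] (ftn ?n e (fm K A ?n \<one>\<^bsub>A1\<^esub> as))) =
    Psi ds (ftn ?n e (fm K A ?n \<one>\<^bsub>A1\<^esub> as)) \<lhd>\<^bsub>S.X\<^esub> d' y"
   using Psi_word[OF ds', of e "as @ [y]"] Psi_word[OF ds(1) *] * y ds wp[OF *(2,3)]
   by (simp add: S.et_ract word_prod_closed kderD(1))
 qed
qed

lemma kder_hom:
 assumes "\<beta> \<in> ring_hom A1 B" "scalar_agree K A \<alpha> \<beta>"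
 shows "kder (\<lambda>a. \<beta> (a, \<zero>))"
proof -
 note h = ring_hom_closed[OF assms(1)] ring_hom_add[OF assms(1)] ring_hom_mult[OF assms(1)]
 have "\<beta> (c \<odot>\<^bsub>A\<^esub> a, \<zero>) = \<alpha> (emb c) \<otimes>\<^bsub>B\<^esub> \<beta> (a, \<zero>)" "\<beta> (c \<odot>\<^bsub>A\<^esub> a, \<zero>) = \<beta> (a, \<zero>) \<otimes>\<^bsub>B\<^esub> \<alpha> (emb c)"
  if "a \<in> carrier A" "c \<in> carrier K" for a c
  using that assms(2) h(3)[of "(emb c)" "(a, \<zero>)"] h(3)[of "(a, \<zero>)" "(emb c)"]
  by (simp_all add: aug_emb(3)[symmetric] aug_emb(4)[symmetric] aug_elem aug_scalar scalar_agree_def)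
 then show ?thesis by (simp add: kder_def h aug_emb(1) aug_elem)
qed

lemma kder_diff:
 assumes "kder d" "kder d'"
 shows "kder (\<lambda>a. d' a \<ominus>\<^bsub>B\<^esub> d a)"
proof -
 have "d (c \<odot>\<^bsub>A\<^esub> a) = d a \<otimes>\<^bsub>B\<^esub> \<alpha> (emb c)" "d' (c \<odot>\<^bsub>A\<^esub> a) = d' a \<otimes>\<^bsub>B\<^esub> \<alpha> (emb c)"
  if "a \<in> carrier A" "c \<in> carrier K" for a c
  using that by (simp_all add: kderD(3,4)[OF assms(1)] kderD(3,4)[OF assms(2)])
 note r = this and l = kderD(3)[OF assms(1)] kderD(3)[OF assms(2)]
 have "d' (c \<odot>\<^bsub>A\<^esub> a) \<ominus>\<^bsub>B\<^esub> d (c \<odot>\<^bsub>A\<^esub> a) = (d' a \<ominus>\<^bsub>B\<^esub> d a) \<otimes>\<^bsub>B\<^esub> \<alpha> (emb c)"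
  if "a \<in> carrier A" "c \<in> carrier K" for a c
  using that by (simp add: r kderD(1)[OF assms(1)] kderD(1)[OF assms(2)] a_minus_def S.B.l_distr S.B.l_minus S.\<phi>D aug_scalar)
 then show ?thesis
  by (simp add: kder_def kderD(1,2)[OF assms(1)] kderD(1,2)[OF assms(2)] l a_minus_def S.B.minus_add S.B.a_ac
    S.B.r_distr S.B.r_minus S.\<phi>D aug_scalar)
qed

lemma kder_hdiff:
 assumes "\<beta> \<in> ring_hom A1 B" "\<gamma> \<in> ring_hom A1 B"
  and "scalar_agree K A \<alpha> \<beta>" "scalar_agree K A \<alpha> \<gamma>"
 shows "kder (hdiff K B \<beta> \<gamma>)"
 using kder_diff[OF kder_hom[OF assms(1,3)] kder_hom[OF assms(2,4)]] by (simp add: hdiff_def[abs_def])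

end

text \<open>
 Two homomorphisms \<open>\<alpha>, \<beta> : \<tilde>R \<rightarrow> B\<close> and a connection give a semilinear map from \<open>E\<close> to
 \<open>E \<otimes>\<^sub>\<alpha> B\<close>, for the \<open>\<tilde>R\<close>-module structure of the target by \<open>\<beta>\<close>: if \<open>\<nabla> e = \<Sum> e\<^sub>j \<otimes> dx\<^sub>j\<close>, the
 image of \<open>e\<close> is \<open>e \<otimes> 1 + \<Sum> e\<^sub>j \<otimes> (\<beta>(x\<^sub>j) - \<alpha>(x\<^sub>j))\<close>.  This formula needs only the Leibniz rule.
\<close>

locale two_homs = scalar_form K A E \<alpha> B
 for K :: "('k, 'n) ring_scheme" (structure) and A :: "('k, 'a) module" (structure)
  and E :: "('a \<times> 'k, 'e) rmodule" and \<alpha> :: "'a \<times> 'k \<Rightarrow> 'b" and B :: "('b, 'q) ring_scheme"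
  and \<beta> :: "'a \<times> 'k \<Rightarrow> 'b" +
 assumes \<beta>: "\<beta> \<in> ring_hom (aug K A) B" and agree: "scalar_agree K A \<alpha> \<beta>"
begin

abbreviation dl where "dl \<equiv> hdiff K B \<alpha> \<beta>"

lemma \<beta>D:
 "a \<in> carrier A1 ==> \<beta> a \<in> carrier B"
 "[|a \<in> carrier A1; b \<in> carrier A1|] ==> \<beta> (a \<otimes>\<^bsub>A1\<^esub> b) = \<beta> a \<otimes>\<^bsub>B\<^esub> \<beta> b"
 "[|a \<in> carrier A1; b \<in> carrier A1|] ==> \<beta> (a \<oplus>\<^bsub>A1\<^esub> b) = \<beta> a \<oplus>\<^bsub>B\<^esub> \<beta> b"
 "\<beta> \<one>\<^bsub>A1\<^esub> = \<one>\<^bsub>B\<^esub>"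
 by (fact ring_hom_closed[OF \<beta>] ring_hom_mult[OF \<beta>] ring_hom_add[OF \<beta>] ring_hom_one[OF \<beta>])+

lemma dl_kder: "kder dl"
 by (rule kder_hdiff[OF S.\<phi> \<beta> _ agree]) (simp add: scalar_agree_def)

lemma dl_closed: "a \<in> carrier A ==> dl a \<in> carrier B"
 by (rule kderD(1)[OF dl_kder])

text \<open>The difference of two homomorphisms is a twisted derivation.\<close>

lemma dl_mult:
 assumes "a \<in> carrier A" "b \<in> carrier A"
 shows "dl (a \<otimes>\<^bsub>A\<^esub> b) = \<alpha> (a, \<zero>) \<otimes>\<^bsub>B\<^esub> dl b \<oplus>\<^bsub>B\<^esub> dl a \<otimes>\<^bsub>B\<^esub> \<beta> (b, \<zero>)"
proof -
 note e = aug_emb(2)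
 have cl: "\<alpha> (a, \<zero>) \<in> carrier B" "\<alpha> (b, \<zero>) \<in> carrier B" "\<beta> (a, \<zero>) \<in> carrier B" "\<beta> (b, \<zero>) \<in> carrier B"
  using assms by (auto simp: S.\<phi>D \<beta>D aug_elem)
 have "\<alpha> (a, \<zero>) \<otimes>\<^bsub>B\<^esub> dl b \<oplus>\<^bsub>B\<^esub> dl a \<otimes>\<^bsub>B\<^esub> \<beta> (b, \<zero>) =
  (\<alpha> (a, \<zero>) \<otimes>\<^bsub>B\<^esub> \<beta> (b, \<zero>) \<oplus>\<^bsub>B\<^esub> \<ominus>\<^bsub>B\<^esub> (\<alpha> (a, \<zero>) \<otimes>\<^bsub>B\<^esub> \<beta> (b, \<zero>))) \<oplus>\<^bsub>B\<^esub>
  (\<beta> (a, \<zero>) \<otimes>\<^bsub>B\<^esub> \<beta> (b, \<zero>) \<ominus>\<^bsub>B\<^esub> \<alpha> (a, \<zero>) \<otimes>\<^bsub>B\<^esub> \<alpha> (b, \<zero>))"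
  using cl by (simp add: hdiff_def a_minus_def S.B.l_distr S.B.r_distr S.B.l_minus S.B.r_minus S.B.a_ac)
 also have "\<dots> = \<beta> (a, \<zero>) \<otimes>\<^bsub>B\<^esub> \<beta> (b, \<zero>) \<ominus>\<^bsub>B\<^esub> \<alpha> (a, \<zero>) \<otimes>\<^bsub>B\<^esub> \<alpha> (b, \<zero>)"
  using cl by (simp add: S.B.r_neg)
 finally show ?thesis using assms by (simp add: hdiff_def e S.\<phi>D \<beta>D aug_elem)
qed

abbreviation Psi1 where "Psi1 \<equiv> Psi [dl]"

lemma Psi1_hom: "Psi1 \<in> add_homs (MF 1) S.X"
 using Psi_works(1)[of "[dl]"] dl_kder by (simp add: One_nat_def)

lemmas Psi1_closed = add_homs_closed[OF Psi1_hom]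
lemmas Psi1_add = add_homs_add[OF Psi1_hom]

lemma Psi1_ft:
 "[|e \<in> carrier E; \<omega> \<in> carrier (Om 1)|] ==> Psi1 (ftn 1 e \<omega>) = S.et e (fword [dl] \<omega>)"
 using Psi_works(2)[of "[dl]" e \<omega>] dl_kder by (simp add: One_nat_def)

lemma fword1_fm:
 "[|x \<in> carrier A1; a \<in> carrier A|] ==> fword [dl] (fm K A 1 x [a]) = \<alpha> x \<otimes>\<^bsub>B\<^esub> dl a"
 using fword_works(2)[of "[dl]" x "[a]"] dl_kder dl_closed by (simp add: One_nat_def)

lemma fword1_hom: "fword [dl] \<in> add_homs (Om 1) B"
 using fword_works(1)[of "[dl]"] dl_kder by (simp add: One_nat_def)

text \<open>The bimodule structure of \<open>\<Omega>\<^sup>1\<close> corresponds to \<open>\<alpha>\<close> on the left and \<open>\<beta>\<close> on the right, because \<open>\<beta> - \<alpha>\<close> is a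
derivation with respect to this pair.\<close>

lemma fword1_ract:
 assumes a: "a \<in> carrier A1" and y: "y \<in> carrier A"
 shows "fword [dl] (fm K A 1 \<one>\<^bsub>A1\<^esub> [y] \<lhd>\<^bsub>Om 1\<^esub> a) = dl y \<otimes>\<^bsub>B\<^esub> \<beta> a"
proof -
 obtain r c where rc: "a = (r, c)" "r \<in> carrier A" "c \<in> carrier K" using a by (auto simp: aug_sel)
 have one: "\<one>\<^bsub>A1\<^esub> \<in> carrier A1" by simp
 have c1: "fm K A 1 x [z] \<in> carrier (Om 1)" if "x \<in> carrier A1" "z \<in> carrier A" for x z
  by (rule fm_closed) (use that in auto)
 let ?w = "fm K A 1 \<one>\<^bsub>A1\<^esub> [y]"
 have cl: "\<alpha> (y, \<zero>) \<in> carrier B" "\<beta> (r, \<zero>) \<in> carrier B" "\<alpha> (emb c) \<in> carrier B"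
  "\<beta> (emb c) = \<alpha> (emb c)"
  using rc y agree by (auto simp: S.\<phi>D \<beta>D aug_elem aug_scalar scalar_agree_def)
 have "?w \<lhd>\<^bsub>Om 1\<^esub> a = fm K A 1 (emb c) [y] \<oplus>\<^bsub>Om 1\<^esub>
   (fm K A 1 \<one>\<^bsub>A1\<^esub> [y \<otimes>\<^bsub>A\<^esub> r] \<ominus>\<^bsub>Om 1\<^esub> fm K A 1 (y, \<zero>) [r])"
  using ract_eq[OF a c1[OF one y]] rmul_fm1[OF one y rc(2)] c1[OF one y] rc y
   lact_works(2)[OF aug_scalar one, of c "[y]" 1]
  by (simp add: ract_elem aug_scalar aug_elem)
 then have "fword [dl] (?w \<lhd>\<^bsub>Om 1\<^esub> a) =
   \<alpha> (emb c) \<otimes>\<^bsub>B\<^esub> dl y \<oplus>\<^bsub>B\<^esub> (dl (y \<otimes>\<^bsub>A\<^esub> r) \<ominus>\<^bsub>B\<^esub> \<alpha> (y, \<zero>) \<otimes>\<^bsub>B\<^esub> dl r)"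
  using rc y
  by (simp add: add_homs_add[OF fword1_hom] c1 aug_scalar aug_elem nu_mult_closed fword1_fm S.\<phi>D dl_closed
    add_homs_minus[OF Omega_abelian_group S.B.abelian_group_axioms fword1_hom])
 also have "dl (y \<otimes>\<^bsub>A\<^esub> r) \<ominus>\<^bsub>B\<^esub> \<alpha> (y, \<zero>) \<otimes>\<^bsub>B\<^esub> dl r = dl y \<otimes>\<^bsub>B\<^esub> \<beta> (r, \<zero>)"
 proof -
  have "dl (y \<otimes>\<^bsub>A\<^esub> r) \<ominus>\<^bsub>B\<^esub> \<alpha> (y, \<zero>) \<otimes>\<^bsub>B\<^esub> dl r =
    dl y \<otimes>\<^bsub>B\<^esub> \<beta> (r, \<zero>) \<oplus>\<^bsub>B\<^esub> (\<alpha> (y, \<zero>) \<otimes>\<^bsub>B\<^esub> dl r \<oplus>\<^bsub>B\<^esub> \<ominus>\<^bsub>B\<^esub> (\<alpha> (y, \<zero>) \<otimes>\<^bsub>B\<^esub> dl r))"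
   using rc y cl by (simp add: dl_mult dl_closed a_minus_def S.B.a_ac)
  then show ?thesis using rc y cl by (simp add: dl_closed S.B.r_neg)
 qed
 also have "\<alpha> (emb c) \<otimes>\<^bsub>B\<^esub> dl y \<oplus>\<^bsub>B\<^esub> dl y \<otimes>\<^bsub>B\<^esub> \<beta> (r, \<zero>) = dl y \<otimes>\<^bsub>B\<^esub> \<beta> a"
 proof -
  have "\<beta> a = \<beta> (r, \<zero>) \<oplus>\<^bsub>B\<^esub> \<beta> (emb c)"
   using aug_split[OF rc(2,3)] rc \<beta>D(3)[OF aug_elem aug_scalar, of r c] by simp
  then show ?thesis
   using cl y rc kderD(4)[OF dl_kder y rc(3)] by (simp add: S.B.r_distr dl_closed S.B.a_ac)
 qed
 finally show ?thesis .
qed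

lemma Psi1_ract:
 assumes t: "t \<in> carrier (MF 1)" and a: "a \<in> carrier A1"
 shows "Psi1 (t \<lhd>\<^bsub>MF 1\<^esub> a) = Psi1 t \<lhd>\<^bsub>S.X\<^esub> \<beta> a"
 using t
proof (induction rule: mf_induct)
 case (word e as)
 then obtain y where y: "as = [y]" "y \<in> carrier A" by (cases as) auto
 have w: "fm K A 1 \<one>\<^bsub>A1\<^esub> [y] \<in> carrier (Om 1)" by (rule fm_closed) (use y in auto)
 show ?case
  using word y w a fword1_fm[of "\<one>\<^bsub>A1\<^esub>" y]
  by (simp add: ft_ract Psi1_ft ract_closed fword1_ract S.et_ract dl_closed \<beta>D S.\<phi>D)
next
 case (add x y)
 then show ?case
  using a by (simp add: MF.ract_l_distr Psi1_add MF.ract_closed S.X.ract_l_distr Psi1_closed \<beta>D)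
qed

definition semi :: "('e \<Rightarrow> ('k, 'a, 'e) form_ext) \<Rightarrow> 'e \<Rightarrow> (('e \<times> 'b) \<Rightarrow>\<^sub>0 int) set" where
 "semi D e = S.et e \<one>\<^bsub>B\<^esub> \<oplus>\<^bsub>S.X\<^esub> Psi1 (D e)"

text \<open>In \<open>s(e a) = e a \<otimes> 1 + \<Psi>(\<nabla>(e) a + e \<otimes> da)\<close> the terms \<open>e \<otimes> \<alpha>(a)\<close> and \<open>\<Psi>(e \<otimes> da) = e \<otimes> (\<beta>(a) - \<alpha>(a))\<close> add up
to \<open>e \<otimes> \<beta>(a)\<close>.\<close>

lemma semi_works:
 assumes D: "connection K A E D"
 shows "semi D \<in> add_homs E S.X"
  and "[|e \<in> carrier E; a \<in> carrier A1|] ==> semi D (e \<lhd>\<^bsub>E\<^esub> a) = semi D e \<lhd>\<^bsub>S.X\<^esub> \<beta> a"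
proof -
 note Dh = connectionD(1)[OF D]
 show "semi D \<in> add_homs E S.X"
  unfolding semi_def[abs_def]
  by (intro add_homs_pointwise_add S.X.abelian_group_axioms S.et_hom_l add_homs_comp[OF Dh Psi1_hom]) simp
 assume e: "e \<in> carrier E" and a: "a \<in> carrier A1"
 then obtain r c where rc: "a = (r, c)" "r \<in> carrier A" "c \<in> carrier K" by (auto simp: aug_sel)
 have De: "D e \<in> carrier (MF 1)" by (rule add_homs_closed[OF Dh e])
 have dr: "d_elem K A r \<in> carrier (Om 1)" by (rule d_elem_closed[OF rc(2)])
 have fa: "fst a = r" using rc by simp
 have ab: "\<beta> a = \<alpha> a \<oplus>\<^bsub>B\<^esub> dl r"
 proof -
  have cl: "\<alpha> (r, \<zero>) \<in> carrier B" "\<beta> (r, \<zero>) \<in> carrier B" "\<alpha> (emb c) \<in> carrier B"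
   using rc by (auto simp: S.\<phi>D \<beta>D aug_elem aug_scalar)
  have "\<alpha> a \<oplus>\<^bsub>B\<^esub> dl r = (\<alpha> (r, \<zero>) \<oplus>\<^bsub>B\<^esub> \<ominus>\<^bsub>B\<^esub> \<alpha> (r, \<zero>)) \<oplus>\<^bsub>B\<^esub> (\<beta> (r, \<zero>) \<oplus>\<^bsub>B\<^esub> \<alpha> (emb c))"
   using aug_split[OF rc(2,3)] rc S.\<phi>D(3)[OF aug_elem aug_scalar, of r c] cl
   by (simp add: hdiff_def a_minus_def S.B.a_ac)
  also have "\<dots> = \<beta> a"
   using aug_split[OF rc(2,3)] rc \<beta>D(3)[OF aug_elem aug_scalar, of r c] cl agree
   by (simp add: S.B.r_neg scalar_agree_def)
  finally show ?thesis by simp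
 qed
 have "semi D (e \<lhd>\<^bsub>E\<^esub> a) = S.et e (\<alpha> a) \<oplus>\<^bsub>S.X\<^esub>
   (Psi1 (D e) \<lhd>\<^bsub>S.X\<^esub> \<beta> a \<oplus>\<^bsub>S.X\<^esub> Psi1 (ftn 1 e (d_elem K A r)))"
  using e a De dr connectionD(2)[OF D e a]
  by (simp add: semi_def S.et_bal S.\<phi>D Psi1_add MF.ract_closed ft_closed Psi1_ract fa)
 also have "Psi1 (ftn 1 e (d_elem K A r)) = S.et e (dl r)"
  using e dr rc fword1_fm[of "\<one>\<^bsub>A1\<^esub>" r]
  by (simp add: Psi1_ft d_elem_def S.\<phi>D dl_closed)
 also have "S.et e (\<alpha> a) \<oplus>\<^bsub>S.X\<^esub> (Psi1 (D e) \<lhd>\<^bsub>S.X\<^esub> \<beta> a \<oplus>\<^bsub>S.X\<^esub> S.et e (dl r)) =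
   S.et e (\<beta> a) \<oplus>\<^bsub>S.X\<^esub> Psi1 (D e) \<lhd>\<^bsub>S.X\<^esub> \<beta> a"
 proof -
  have "S.et e (\<beta> a) = S.et e (\<alpha> a) \<oplus>\<^bsub>S.X\<^esub> S.et e (dl r)"
   using e a rc(2) by (simp add: ab S.et_add_r S.\<phi>D dl_closed)
  then show ?thesis
   using e a De rc(2) \<beta>D(1)[OF a]
   by (simp add: S.\<phi>D dl_closed S.et_closed S.X.ract_closed Psi1_closed S.X.a_ac)
 qed
 also have "\<dots> = semi D e \<lhd>\<^bsub>S.X\<^esub> \<beta> a"
  using e a De by (simp add: semi_def S.X.ract_l_distr S.et_closed Psi1_closed \<beta>D S.et_ract)
 finally show "semi D (e \<lhd>\<^bsub>E\<^esub> a) = semi D e \<lhd>\<^bsub>S.X\<^esub> \<beta> a" .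
qed

lemmas semi_closed = add_homs_closed[OF semi_works(1)]

text \<open>
 The additive span of the elements \<open>e \<otimes> \<delta>(a\<^sub>1) \<dots> \<delta>(a\<^sub>m)\<close> is stable under the
 right action of the subalgebra generated by both homomorphisms: move \<open>\<alpha>(r)\<close> to the left with
 \<open>\<delta>(y) \<alpha>(r) = \<delta>(y r) - \<alpha>(y) \<delta>(r) - \<delta>(y) \<delta>(r)\<close>.
\<close>

inductive_set words :: "(('e \<times> 'b) \<Rightarrow>\<^sub>0 int) set set" where
 words_gen: "[|e \<in> carrier E; set ys \<subseteq> carrier A|] ==>
  S.et e (word_prod B (replicate (length ys) dl) ys) \<in> words"
| words_add: "[|s \<in> words; t \<in> words|] ==> s \<oplus>\<^bsub>S.X\<^esub> t \<in> words"

lemma dl_word_closed: "set ys \<subseteq> carrier A ==> word_prod B (replicate n dl) ys \<in> carrier B"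
 by (rule word_prod_closed) (simp_all add: dl_kder)

lemma words_closed: "t \<in> words ==> t \<in> carrier S.X"
 by (induction rule: words.induct) (simp_all add: S.et_closed dl_word_closed)

lemma words_neg: "t \<in> words ==> \<ominus>\<^bsub>S.X\<^esub> t \<in> words"
proof (induction rule: words.induct)
 case (words_gen e ys)
 have "\<ominus>\<^bsub>S.X\<^esub> S.et e (word_prod B (replicate (length ys) dl) ys) =
   S.et (\<ominus>\<^bsub>E\<^esub> e) (word_prod B (replicate (length ys) dl) ys)"
  using words_gen add_homs_neg[OF E.abelian_group_axioms S.X.abelian_group_axioms S.et_hom_l]
  by (simp add: dl_word_closed)
 then show ?case using words_gen words.words_gen[of "\<ominus>\<^bsub>E\<^esub> e" ys] by simp
next
 case (words_add s t)
 then show ?case by (simp add: S.X.minus_add words_closed words.words_add)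
qed

lemma words_minus: "[|s \<in> words; t \<in> words|] ==> s \<ominus>\<^bsub>S.X\<^esub> t \<in> words"
 by (simp add: a_minus_def words_add words_neg)

lemma dl_word_snoc:
 assumes "set ys \<subseteq> carrier A" "y \<in> carrier A"
 shows "word_prod B (replicate (Suc (length ys)) dl) (ys @ [y]) =
  word_prod B (replicate (length ys) dl) ys \<otimes>\<^bsub>B\<^esub> dl y"
 using word_prod_snoc[of "replicate (length ys) dl" dl ys y] assms dl_kder
 by (simp add: replicate_append_same)

lemma words_dl:
 assumes "t \<in> words" "y \<in> carrier A"
 shows "t \<lhd>\<^bsub>S.X\<^esub> dl y \<in> words"
 using assms(1)
proof (induction rule: words.induct)
 case (words_gen e ys)
 then show ?case
  using assms(2) words.words_gen[of e "ys @ [y]"] dl_word_snoc[of ys y]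
  by (simp add: S.et_ract dl_word_closed dl_closed del: replicate_Suc)
next
 case (words_add s t)
 then show ?case using assms(2) by (simp add: S.X.ract_l_distr words_closed dl_closed words.words_add)
qed

lemma words_alpha_elem:
 assumes "t \<in> words" "r \<in> carrier A"
 shows "t \<lhd>\<^bsub>S.X\<^esub> \<alpha> (r, \<zero>) \<in> words"
 using assms(1)
proof (induction rule: words.induct)
 case (words_gen e ys)
 then show ?case
  using assms(2)
 proof (induction ys arbitrary: r rule: rev_induct)
  case Nil
  then show ?case
   using words.words_gen[of "e \<lhd>\<^bsub>E\<^esub> (r, \<zero>)" "[]"]
   by (simp add: S.et_ract S.et_bal S.\<phi>D aug_elem E.ract_closed)
 next
  case (snoc y ys)
  let ?w = "word_prod B (replicate (length ys) dl) ys"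
  let ?t = "S.et e ?w"
  have ys: "set ys \<subseteq> carrier A" "y \<in> carrier A" and r: "r \<in> carrier A" and e: "e \<in> carrier E"
   using snoc.prems by auto
  have w: "?w \<in> carrier B" by (rule dl_word_closed[OF ys(1)])
  have tw: "?t \<in> words" by (rule words.words_gen[OF e ys(1)])
  have cl: "\<alpha> (y, \<zero>) \<in> carrier B" "\<alpha> (r, \<zero>) \<in> carrier B" "\<beta> (r, \<zero>) \<in> carrier B"
   using ys r by (auto simp: S.\<phi>D \<beta>D aug_elem)
  have "dl y \<otimes>\<^bsub>B\<^esub> \<alpha> (r, \<zero>) =
    dl (y \<otimes>\<^bsub>A\<^esub> r) \<ominus>\<^bsub>B\<^esub> \<alpha> (y, \<zero>) \<otimes>\<^bsub>B\<^esub> dl r \<ominus>\<^bsub>B\<^esub> dl y \<otimes>\<^bsub>B\<^esub> dl r"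
  proof -
   let ?p = "\<alpha> (y, \<zero>) \<otimes>\<^bsub>B\<^esub> dl r" and ?q = "dl y \<otimes>\<^bsub>B\<^esub> \<beta> (r, \<zero>)" and ?s = "dl y \<otimes>\<^bsub>B\<^esub> \<alpha> (r, \<zero>)"
   have pq: "?p \<in> carrier B" "?q \<in> carrier B" "?s \<in> carrier B" using cl ys r by (simp_all add: dl_closed)
   have "dl y \<otimes>\<^bsub>B\<^esub> dl r = ?q \<ominus>\<^bsub>B\<^esub> ?s"
    using cl ys r dl_closed[OF ys(2)]
    by (simp add: hdiff_def[of K B \<alpha> \<beta> r] a_minus_def S.B.r_distr S.B.r_minus)
   then have "dl (y \<otimes>\<^bsub>A\<^esub> r) \<ominus>\<^bsub>B\<^esub> ?p \<ominus>\<^bsub>B\<^esub> dl y \<otimes>\<^bsub>B\<^esub> dl r =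
     (?p \<oplus>\<^bsub>B\<^esub> \<ominus>\<^bsub>B\<^esub> ?p) \<oplus>\<^bsub>B\<^esub> ((?q \<oplus>\<^bsub>B\<^esub> \<ominus>\<^bsub>B\<^esub> ?q) \<oplus>\<^bsub>B\<^esub> ?s)"
    using pq ys r by (simp add: dl_mult a_minus_def S.B.minus_add S.B.a_ac)
   then show ?thesis using pq by (simp add: S.B.r_neg)
  qed
  then have "S.et e (word_prod B (replicate (Suc (length ys)) dl) (ys @ [y])) \<lhd>\<^bsub>S.X\<^esub> \<alpha> (r, \<zero>) =
    ?t \<lhd>\<^bsub>S.X\<^esub> dl (y \<otimes>\<^bsub>A\<^esub> r) \<ominus>\<^bsub>S.X\<^esub> (?t \<lhd>\<^bsub>S.X\<^esub> \<alpha> (y, \<zero>)) \<lhd>\<^bsub>S.X\<^esub> dl r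
    \<ominus>\<^bsub>S.X\<^esub> (?t \<lhd>\<^bsub>S.X\<^esub> dl y) \<lhd>\<^bsub>S.X\<^esub> dl r"
   using e w cl ys r
   by (simp add: dl_word_snoc S.et_ract dl_closed S.B.m_assoc nu_mult_closed S.B.r_distr S.B.r_minus
     a_minus_def S.et_minus_r[unfolded a_minus_def] del: replicate_Suc)
  moreover have "?t \<lhd>\<^bsub>S.X\<^esub> \<alpha> (y, \<zero>) \<in> words" by (rule snoc.IH[OF e ys])
  ultimately show ?case
   using tw ys r by (simp add: words_minus words_dl nu_mult_closed)
 qed
next
 case (words_add s t)
 then show ?case
  using assms(2) by (simp add: S.X.ract_l_distr words_closed S.\<phi>D aug_elem words.words_add)
qed

lemma words_scalar:
 assumes "t \<in> words" "c \<in> carrier K"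
 shows "t \<lhd>\<^bsub>S.X\<^esub> \<alpha> (emb c) \<in> words"
 using assms(1)
proof (induction rule: words.induct)
 case (words_gen e ys)
 have k: "\<alpha> (emb c) \<in> carrier B" using assms by (simp add: S.\<phi>D aug_scalar)
 have "word_prod B (replicate m dl) ys \<otimes>\<^bsub>B\<^esub> \<alpha> (emb c) = \<alpha> (emb c) \<otimes>\<^bsub>B\<^esub> word_prod B (replicate m dl) ys"
  if "set ys \<subseteq> carrier A" for m ys
  using that
 proof (induction m arbitrary: ys)
  case (Suc m)
  show ?case
  proof (cases ys)
   case (Cons z zs)
   then have z: "dl z \<in> carrier B" "word_prod B (replicate m dl) zs \<in> carrier B" "z \<in> carrier A" "set zs \<subseteq> carrier A"
    using Suc.prems dl_closed dl_word_closed by auto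
   have "dl z \<otimes>\<^bsub>B\<^esub> word_prod B (replicate m dl) zs \<otimes>\<^bsub>B\<^esub> \<alpha> (emb c) =
     (dl z \<otimes>\<^bsub>B\<^esub> \<alpha> (emb c)) \<otimes>\<^bsub>B\<^esub> word_prod B (replicate m dl) zs"
    using z k Suc.IH[OF z(4)] by (simp add: S.B.m_assoc)
   then show ?thesis using Cons z k kderD(4)[OF dl_kder z(3) assms(2)] by (simp add: S.B.m_assoc)
  qed (use k in simp)
 qed (use k in simp)
 then show ?case
  using words_gen assms(2) k words.words_gen[of "e \<lhd>\<^bsub>E\<^esub> (emb c)" ys]
  by (simp add: S.et_ract dl_word_closed S.et_bal aug_scalar E.ract_closed)
next
 case (words_add s t)
 then show ?case
  using assms(2) by (simp add: S.X.ract_l_distr words_closed S.\<phi>D aug_scalar words.words_add)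
qed

lemma words_beta_elem:
 assumes "t \<in> words" "r \<in> carrier A"
 shows "t \<lhd>\<^bsub>S.X\<^esub> \<beta> (r, \<zero>) \<in> words"
proof -
 have cl: "\<alpha> (r, \<zero>) \<in> carrier B" "\<beta> (r, \<zero>) \<in> carrier B" using assms by (auto simp: S.\<phi>D \<beta>D aug_elem)
 have "\<alpha> (r, \<zero>) \<oplus>\<^bsub>B\<^esub> dl r = (\<alpha> (r, \<zero>) \<oplus>\<^bsub>B\<^esub> \<ominus>\<^bsub>B\<^esub> \<alpha> (r, \<zero>)) \<oplus>\<^bsub>B\<^esub> \<beta> (r, \<zero>)"
  using cl by (simp add: hdiff_def a_minus_def S.B.a_ac)
 then have "\<beta> (r, \<zero>) = \<alpha> (r, \<zero>) \<oplus>\<^bsub>B\<^esub> dl r" using cl by (simp add: S.B.r_neg)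
 then show ?thesis
  using assms cl by (simp add: S.X.ract_r_distr words_closed dl_closed words_add words_alpha_elem words_dl)
qed

text \<open>The linear extension of \<open>semi D\<close> to \<open>E \<otimes>\<^sub>\<beta> B\<close>.\<close>

lemma \<beta>_ext: "scalar_ext A1 E \<beta> B"
 by (intro scalar_ext.intro scalar_ext_axioms.intro E.right_module_axioms S.B.ring_axioms \<beta>)

abbreviation X' where "X' \<equiv> ext_scal E A1 \<beta> B"
abbreviation et' where "et' \<equiv> ext_tens E A1 \<beta> B"

definition transp where "transp D = scalar_ext.ext_lift A1 E \<beta> B S.X (semi D)"

lemma transp_works:
 assumes D: "connection K A E D"
 shows "transp D \<in> rmod_hom B X' S.X"
  and "[|e \<in> carrier E; b \<in> carrier B|] ==> transp D (et' e b) = semi D e \<lhd>\<^bsub>S.X\<^esub> b"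
  and "e \<in> carrier E ==> transp D (et' e \<one>\<^bsub>B\<^esub>) = semi D e" (is "PROP ?g1")
proof -
 note l = scalar_ext.ext_lift_works[OF \<beta>_ext S.ext_right_module semi_works[OF D], folded transp_def]
 show "transp D \<in> rmod_hom B X' S.X" by (rule l(1))
 show v: "[|e \<in> carrier E; b \<in> carrier B|] ==> transp D (et' e b) = semi D e \<lhd>\<^bsub>S.X\<^esub> b" by (rule l(2))
 then show "PROP ?g1"
  using l(2)[of e "\<one>\<^bsub>B\<^esub>"] by (simp add: S.X.ract_one semi_closed[OF D])
qed

end

text \<open>For \<open>\<beta> = \<alpha>\<close> the correction term vanishes; this turns the cocycle condition into invertibility.\<close>

lemma two_homs_self:
 assumes "scalar_form K A E \<alpha> B" and e: "e \<in> carrier E" and De: "D e \<in> carrier (mod_forms K A E 1)"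
 shows "two_homs.semi K A E \<alpha> B \<alpha> D e = ext_tens E (aug K A) \<alpha> B e \<one>\<^bsub>B\<^esub>"
proof -
 interpret scalar_form K A E \<alpha> B by fact
 interpret T: two_homs K A E \<alpha> B \<alpha>
  by unfold_locales (simp_all add: S.\<phi> scalar_agree_def)
 have "T.Psi1 u = \<zero>\<^bsub>S.X\<^esub>" if "u \<in> carrier (mod_forms K A E 1)" for u
  using that
 proof (induction rule: mf_induct)
  case (word e as)
  then obtain y where y: "as = [y]" "y \<in> carrier A" by (cases as) auto
  have w: "fm K A 1 \<one>\<^bsub>aug K A\<^esub> [y] \<in> carrier (Omega K A 1)" by (rule fm_closed) (use y in auto)
  have "hdiff K B \<alpha> \<alpha> y = \<zero>\<^bsub>B\<^esub>"
   using y by (simp add: hdiff_def a_minus_def S.B.r_neg S.\<phi>D aug_elem)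
  then show ?case
   using word y w T.fword1_fm[of "\<one>\<^bsub>aug K A\<^esub>" y]
   by (simp add: T.Psi1_ft S.\<phi>D S.et_zero_r)
 qed (simp add: T.Psi1_add)
 then show ?thesis using e De by (simp add: T.semi_def S.et_closed)
qed

text \<open>
 The composite of two of these maps differs from the third by the curvature, so they satisfy a
 cocycle condition when the connection is flat.
\<close>

lemma transp_cocycle:
 assumes ab: "two_homs K A E \<alpha> B \<beta>" and bc: "two_homs K A E \<beta> B \<gamma>" and ac: "two_homs K A E \<alpha> B \<gamma>"
  and D: "connection K A E D" and e: "e \<in> carrier E"
  and flat: "connection_ext K A E D 1 (D e) = \<zero>\<^bsub>mod_forms K A E 2\<^esub>"
 shows "two_homs.transp K A E \<alpha> B \<beta> D (two_homs.semi K A E \<beta> B \<gamma> D e) = two_homs.semi K A E \<alpha> B \<gamma> D e"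
proof -
 interpret AB: two_homs K A E \<alpha> B \<beta> by fact
 interpret BC: two_homs K A E \<beta> B \<gamma> by fact
 interpret AC: two_homs K A E \<alpha> B \<gamma> by fact
 let ?X = "AB.S.X" and ?M = "mod_forms K A E 1" and ?d = "AB.dl" and ?d' = "BC.dl"
 have dd': "AB.kder ?d'"
  by (rule AB.kder_hdiff[OF BC.S.\<phi> BC.\<beta> AB.agree AC.agree])
 have ds: "\<forall>d\<in>set [?d, ?d']. AB.kder d" using dd' AB.dl_kder by simp
 have P2: "AB.Psi [?d, ?d'] \<in> add_homs (mod_forms K A E (Suc 1)) ?X"
  using AB.Psi_works(1)[OF ds] by (simp add: One_nat_def)
 note ce = AB.connection_ext_works(1)[OF D, of 1]
 note th = AB.transp_works[OF D]
 let ?err = "\<lambda>t. AB.Psi [?d, ?d'] (connection_ext K A E D 1 t)"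
 have errh: "?err \<in> add_homs ?M ?X" by (rule add_homs_comp[OF ce P2])
 have main: "AB.Psi1 t \<oplus>\<^bsub>?X\<^esub> AB.transp D (BC.Psi1 t) = AC.Psi1 t \<oplus>\<^bsub>?X\<^esub> ?err t"
  if t: "t \<in> carrier ?M" for t
 proof (rule AB.mf_word_eqI[OF _ _ _ t])
  show "(\<lambda>t. AB.Psi1 t \<oplus>\<^bsub>?X\<^esub> AB.transp D (BC.Psi1 t)) \<in> add_homs ?M ?X"
   by (intro add_homs_pointwise_add AB.S.X.abelian_group_axioms AB.Psi1_hom
     add_homs_comp[OF BC.Psi1_hom rmod_homD(1)[OF th(1)]])
  show "(\<lambda>t. AC.Psi1 t \<oplus>\<^bsub>?X\<^esub> ?err t) \<in> add_homs ?M ?X"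
   by (intro add_homs_pointwise_add AB.S.X.abelian_group_axioms AC.Psi1_hom errh)
  fix e as assume e: "e \<in> carrier E" and "set as \<subseteq> carrier A" "length as = 1"
  then obtain y where y: "as = [y]" "y \<in> carrier A" by (cases as) auto
  let ?w = "fm K A 1 \<one>\<^bsub>aug K A\<^esub> [y]"
  have w: "?w \<in> carrier (Omega K A 1)" by (rule AB.fm_closed) (use y in auto)
  have De: "D e \<in> carrier ?M" by (rule add_homs_closed[OF AB.connectionD(1)[OF D] e])
  have one: "\<one>\<^bsub>aug K A\<^esub> \<in> carrier (aug K A)" by simp
  have v: "AB.Psi1 (form_tens K A E 1 e ?w) = AB.S.et e (?d y)"
   "BC.Psi1 (form_tens K A E 1 e ?w) = BC.S.et e (?d' y)"
   "AC.Psi1 (form_tens K A E 1 e ?w) = AB.S.et e (AC.dl y)"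
   using e w y AB.fword1_fm[OF one y(2)] BC.fword1_fm[OF one y(2)] AC.fword1_fm[OF one y(2)]
    AB.dl_closed BC.dl_closed AC.dl_closed
   by (simp_all add: AB.Psi1_ft BC.Psi1_ft AC.Psi1_ft AB.S.\<phi>D BC.S.\<phi>D)
  have er: "?err (form_tens K A E 1 e ?w) = AB.Psi1 (D e) \<lhd>\<^bsub>?X\<^esub> ?d' y"
  proof -
   have "connection_ext K A E D 1 (form_tens K A E 1 e ?w) = AB.mcc 1 [y] (D e)"
    using AB.connection_ext_word[OF D e, of "[y]"] y by (simp add: One_nat_def)
   then show ?thesis
    using AB.Psi_mcc[of "[?d]" ?d' y "D e"] AB.dl_kder dd' y De by (simp add: One_nat_def)
  qed
  have cl: "?d y \<in> carrier B" "?d' y \<in> carrier B" "AC.dl y \<in> carrier B"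
   using y AB.dl_closed BC.dl_closed AC.dl_closed by auto
  have sum: "AC.dl y = ?d y \<oplus>\<^bsub>B\<^esub> ?d' y"
  proof -
   have cl: "\<alpha> (y, \<zero>\<^bsub>K\<^esub>) \<in> carrier B" "\<beta> (y, \<zero>\<^bsub>K\<^esub>) \<in> carrier B" "\<gamma> (y, \<zero>\<^bsub>K\<^esub>) \<in> carrier B"
    using y AB.S.\<phi>D AB.\<beta>D BC.\<beta>D AB.aug_elem by auto
   have "?d y \<oplus>\<^bsub>B\<^esub> ?d' y = (\<beta> (y, \<zero>\<^bsub>K\<^esub>) \<oplus>\<^bsub>B\<^esub> \<ominus>\<^bsub>B\<^esub> \<beta> (y, \<zero>\<^bsub>K\<^esub>)) \<oplus>\<^bsub>B\<^esub> AC.dl y"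
    using cl by (simp add: hdiff_def a_minus_def AB.S.B.a_ac)
   then show ?thesis using cl by (simp add: hdiff_def AB.S.B.r_neg)
  qed
  have "AB.transp D (BC.S.et e (?d' y)) = AB.S.et e (?d' y) \<oplus>\<^bsub>?X\<^esub> AB.Psi1 (D e) \<lhd>\<^bsub>?X\<^esub> ?d' y"
   using e cl De
   by (simp add: th(2) AB.semi_def AB.S.X.ract_l_distr AB.S.et_closed AB.Psi1_closed AB.S.et_ract)
  then show "AB.Psi1 (form_tens K A E 1 e (fm K A 1 \<one>\<^bsub>aug K A\<^esub> as)) \<oplus>\<^bsub>?X\<^esub>
    AB.transp D (BC.Psi1 (form_tens K A E 1 e (fm K A 1 \<one>\<^bsub>aug K A\<^esub> as))) =
    AC.Psi1 (form_tens K A E 1 e (fm K A 1 \<one>\<^bsub>aug K A\<^esub> as)) \<oplus>\<^bsub>?X\<^esub>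
    ?err (form_tens K A E 1 e (fm K A 1 \<one>\<^bsub>aug K A\<^esub> as))"
   unfolding y(1) v er using e cl De
   by (simp add: sum AB.S.et_add_r AB.S.et_closed AB.S.X.ract_closed AB.Psi1_closed AB.S.X.a_assoc)
 qed
 have De: "D e \<in> carrier ?M" by (rule add_homs_closed[OF AB.connectionD(1)[OF D] e])
 have "?err (D e) = \<zero>\<^bsub>?X\<^esub>"
  using flat AB.Psi_zero[OF ds] by (simp add: numeral_2_eq_2)
 then have m: "AB.Psi1 (D e) \<oplus>\<^bsub>?X\<^esub> AB.transp D (BC.Psi1 (D e)) = AC.Psi1 (D e)"
  using main[OF De] AC.Psi1_closed[OF De] by simp
 have "AB.transp D (BC.semi D e) = AB.semi D e \<oplus>\<^bsub>?X\<^esub> AB.transp D (BC.Psi1 (D e))"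
  using e De
  by (simp add: BC.semi_def rmod_homD(5)[OF th(1)] BC.S.et_closed BC.Psi1_closed th(3))
 also have "\<dots> = AB.S.et e \<one>\<^bsub>B\<^esub> \<oplus>\<^bsub>?X\<^esub> (AB.Psi1 (D e) \<oplus>\<^bsub>?X\<^esub> AB.transp D (BC.Psi1 (D e)))"
  using e De rmod_homD(4)[OF th(1) BC.Psi1_closed[OF De]]
  by (simp add: AB.semi_def AB.S.et_closed AB.Psi1_closed AB.S.X.a_assoc)
 finally show ?thesis by (simp add: m AC.semi_def)
qed

text \<open>The cocycle condition for \<open>\<alpha>, \<beta>, \<alpha>\<close> exhibits the inverse.\<close>

lemma transp_inverse:
 assumes ab: "two_homs K A E \<alpha> B \<beta>" and D: "flat_connection K A E D"
  and t: "t \<in> carrier (ext_scal E (aug K A) \<alpha> B)"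
 shows "two_homs.transp K A E \<alpha> B \<beta> D (two_homs.transp K A E \<beta> B \<alpha> D t) = t"
proof -
 interpret AB: two_homs K A E \<alpha> B \<beta> by fact
 interpret BA: two_homs K A E \<beta> B \<alpha>
  using AB.agree AB.\<beta> AB.S.\<phi> by unfold_locales (simp_all add: scalar_agree_def)
 interpret AA: two_homs K A E \<alpha> B \<alpha>
  by unfold_locales (simp_all add: AB.S.\<phi> scalar_agree_def)
 have c: "connection K A E D" using D by (simp add: flat_connection_def)
 note th = AB.transp_works[OF c] and th' = BA.transp_works[OF c]
 show ?thesis
 proof (rule AB.S.ext_lin_eqI[where g = "\<lambda>t. AB.transp D (BA.transp D t)" and h = "\<lambda>t. t", OF AB.S.ext_right_module _ _ _ _ _ t])
  show "(\<lambda>t. AB.transp D (BA.transp D t)) \<in> add_homs AB.S.X AB.S.X"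
   by (rule add_homs_comp[OF rmod_homD(1)[OF th'(1)] rmod_homD(1)[OF th(1)]])
  show "AB.transp D (BA.transp D (x \<lhd>\<^bsub>AB.S.X\<^esub> b)) = AB.transp D (BA.transp D x) \<lhd>\<^bsub>AB.S.X\<^esub> b"
   if "x \<in> carrier AB.S.X" "b \<in> carrier B" for x b
   using that by (simp add: rmod_homD(3,4)[OF th'(1)] rmod_homD(3)[OF th(1)])
  fix e assume e: "e \<in> carrier E"
  have "connection_ext K A E D 1 (D e) = \<zero>\<^bsub>mod_forms K A E 2\<^esub>"
   using D e by (simp add: flat_connection_def)
  then show "AB.transp D (BA.transp D (AB.S.et e \<one>\<^bsub>B\<^esub>)) = AB.S.et e \<one>\<^bsub>B\<^esub>"
   using transp_cocycle[OF ab BA.two_homs_axioms AA.two_homs_axioms c e]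
    two_homs_self[OF AB.scalar_form_axioms e, of D] add_homs_closed[OF AB.connectionD(1)[OF c] e]
   by (simp add: th'(3) e)
 qed (auto intro: add_homs_I)
qed

lemma transp_iso:
 assumes ab: "two_homs K A E \<alpha> B \<beta>" and D: "flat_connection K A E D"
 shows "two_homs.transp K A E \<alpha> B \<beta> D \<in> rmod_iso B (ext_scal E (aug K A) \<beta> B) (ext_scal E (aug K A) \<alpha> B)"
proof -
 interpret AB: two_homs K A E \<alpha> B \<beta> by fact
 interpret BA: two_homs K A E \<beta> B \<alpha>
  using AB.agree AB.\<beta> AB.S.\<phi> by unfold_locales (simp_all add: scalar_agree_def)
 have c: "connection K A E D" using D by (simp add: flat_connection_def)
 have "bij_betw (AB.transp D) (carrier AB.X') (carrier AB.S.X)"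
  by (rule bij_betwI[of _ _ _ "BA.transp D"])
   (use rmod_homD(4)[OF AB.transp_works(1)[OF c]] rmod_homD(4)[OF BA.transp_works(1)[OF c]]
    transp_inverse[OF ab D] transp_inverse[OF BA.two_homs_axioms D] in auto)
 then show ?thesis using AB.transp_works(1)[OF c] by (simp add: rmod_iso_def)
qed

text \<open>Naturality in \<open>B\<close>: the same formula defines the map for \<open>\<psi> \<circ> \<alpha>\<close> and \<open>\<psi> \<circ> \<beta>\<close>.\<close>

lemma semi_base_change:
 assumes ab: "two_homs K A E \<alpha> B \<beta>" and ab': "two_homs K A E \<alpha>' C \<beta>'"
  and sc: "scalar_ext2 (aug K A) E \<alpha> B \<psi> \<alpha>' C"
  and \<beta>': "\<And>a. a \<in> carrier (aug K A) ==> \<beta>' a = \<psi> (\<beta> a)"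
  and e: "e \<in> carrier E" and De: "D e \<in> carrier (mod_forms K A E 1)"
 shows "ext_change E (aug K A) \<alpha> B \<psi> \<alpha>' C (two_homs.semi K A E \<alpha> B \<beta> D e) = two_homs.semi K A E \<alpha>' C \<beta>' D e"
proof -
 interpret AB: two_homs K A E \<alpha> B \<beta> by fact
 interpret AC: two_homs K A E \<alpha>' C \<beta>' by fact
 interpret S: scalar_ext2 "aug K A" E \<alpha> B \<psi> \<alpha>' C by fact
 have "S.ch (AB.Psi1 u) = AC.Psi1 u" if u: "u \<in> carrier (mod_forms K A E 1)" for u
 proof (rule AB.mf_word_eqI[OF add_homs_comp[OF AB.Psi1_hom S.ch_works(1)] AC.Psi1_hom _ u])
  fix e as assume e: "e \<in> carrier E" and "set as \<subseteq> carrier A" "length as = 1"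
  then obtain y where y: "as = [y]" "y \<in> carrier A" by (cases as) auto
  let ?w = "fm K A 1 \<one>\<^bsub>aug K A\<^esub> [y]"
  have w: "?w \<in> carrier (Omega K A 1)" by (rule AB.fm_closed) (use y in auto)
  have one: "\<one>\<^bsub>aug K A\<^esub> \<in> carrier (aug K A)" by simp
  have "\<psi> (AB.dl y) = AC.dl y"
  proof -
   have h: "\<psi> \<in> add_homs B C" by (rule add_homs_I) (simp_all add: S.\<psi>D)
   show ?thesis
    using y add_homs_minus[OF AB.S.B.abelian_group_axioms AC.S.B.abelian_group_axioms h,
      of "\<beta> (y, \<zero>\<^bsub>K\<^esub>)" "\<alpha> (y, \<zero>\<^bsub>K\<^esub>)"]
    by (simp add: hdiff_def AB.\<beta>D AB.S.\<phi>D AB.aug_elem \<beta>' S.comp)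
  qed
  then show "S.ch (AB.Psi1 (form_tens K A E 1 e (fm K A 1 \<one>\<^bsub>aug K A\<^esub> as))) =
    AC.Psi1 (form_tens K A E 1 e (fm K A 1 \<one>\<^bsub>aug K A\<^esub> as))"
   using e w y AB.fword1_fm[OF one y(2)] AC.fword1_fm[OF one y(2)] AB.dl_closed AC.dl_closed
   by (simp add: AB.Psi1_ft AC.Psi1_ft AB.S.\<phi>D AC.S.\<phi>D S.ch_works(2))
 qed
 then show ?thesis
  using e De
  by (simp add: AB.semi_def AC.semi_def S.ch_add AB.S.et_closed AB.Psi1_closed S.ch_works(2) S.\<psi>D)
qed

section \<open>Endomorphisms of a filtered vector space\<close>

text \<open>
 The opposite of the algebra of filtered endomorphisms, so that modules are right modules.
\<close>

definition filt_end :: "('k, 'n) ring_scheme \<Rightarrow> ('k, 'v) module \<Rightarrow> (nat \<Rightarrow> 'v set) \<Rightarrow> ('k, 'v \<Rightarrow> 'v) module" where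
 "filt_end K V F = \<lparr>carrier = {h \<in> add_homs V V \<inter> extensional (carrier V).
    (\<forall>c\<in>carrier K. \<forall>v\<in>carrier V. h (c \<odot>\<^bsub>V\<^esub> v) = c \<odot>\<^bsub>V\<^esub> h v) \<and> (\<forall>p. \<forall>v\<in>F p. h v \<in> F p)},
   monoid.mult = (\<lambda>h g. \<lambda>v\<in>carrier V. g (h v)), one = undefined,
   ring.zero = (\<lambda>v\<in>carrier V. \<zero>\<^bsub>V\<^esub>), add = (\<lambda>h g. \<lambda>v\<in>carrier V. h v \<oplus>\<^bsub>V\<^esub> g v),
   smult = (\<lambda>c h. \<lambda>v\<in>carrier V. c \<odot>\<^bsub>V\<^esub> h v)\<rparr>"

locale filtered_module = field K + module K V
 for K :: "('k, 'n) ring_scheme" (structure) and V :: "('k, 'v) module" (structure)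
  and F :: "nat \<Rightarrow> 'v set" +
 assumes F_0: "F 0 = carrier V" and F_Suc: "F (Suc p) \<subseteq> F p" and F_zero: "\<zero>\<^bsub>V\<^esub> \<in> F p"
  and F_add: "[|v \<in> F p; w \<in> F p|] ==> v \<oplus>\<^bsub>V\<^esub> w \<in> F p"
  and F_smult: "[|c \<in> carrier K; v \<in> F p|] ==> c \<odot>\<^bsub>V\<^esub> v \<in> F p"
begin

abbreviation End where "End \<equiv> filt_end K V F"

lemma F_carrier: "v \<in> F p ==> v \<in> carrier V"
proof (induction p)
 case (Suc p)
 then show ?case using F_Suc by blast
qed (simp add: F_0)

lemma EndD:
 assumes "h \<in> carrier End"
 shows "v \<in> carrier V ==> h v \<in> carrier V"
  and "[|v \<in> carrier V; w \<in> carrier V|] ==> h (v \<oplus>\<^bsub>V\<^esub> w) = h v \<oplus>\<^bsub>V\<^esub> h w"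
  and "[|c \<in> carrier K; v \<in> carrier V|] ==> h (c \<odot>\<^bsub>V\<^esub> v) = c \<odot>\<^bsub>V\<^esub> h v"
  and "v \<in> F p ==> h v \<in> F p"
  and "h \<in> extensional (carrier V)"
 using assms by (auto simp: filt_end_def hom_def)

lemma EndI:
 assumes "\<And>v. v \<in> carrier V ==> h v \<in> carrier V"
  and "\<And>v w. [|v \<in> carrier V; w \<in> carrier V|] ==> h (v \<oplus>\<^bsub>V\<^esub> w) = h v \<oplus>\<^bsub>V\<^esub> h w"
  and "\<And>c v. [|c \<in> carrier K; v \<in> carrier V|] ==> h (c \<odot>\<^bsub>V\<^esub> v) = c \<odot>\<^bsub>V\<^esub> h v"
  and "\<And>v p. v \<in> F p ==> h v \<in> F p"
  and "h \<in> extensional (carrier V)"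
 shows "h \<in> carrier End"
 using assms by (auto simp: filt_end_def hom_def)

lemma End_sel:
 "h \<otimes>\<^bsub>End\<^esub> g = (\<lambda>v\<in>carrier V. g (h v))" "\<zero>\<^bsub>End\<^esub> = (\<lambda>v\<in>carrier V. \<zero>\<^bsub>V\<^esub>)"
 "h \<oplus>\<^bsub>End\<^esub> g = (\<lambda>v\<in>carrier V. h v \<oplus>\<^bsub>V\<^esub> g v)" "c \<odot>\<^bsub>End\<^esub> h = (\<lambda>v\<in>carrier V. c \<odot>\<^bsub>V\<^esub> h v)"
 by (simp_all add: filt_end_def)

lemma smult_comm: "[|c \<in> carrier K; d \<in> carrier K; v \<in> carrier V|] ==> c \<odot>\<^bsub>V\<^esub> (d \<odot>\<^bsub>V\<^esub> v) = d \<odot>\<^bsub>V\<^esub> (c \<odot>\<^bsub>V\<^esub> v)"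
 by (simp add: m_comm flip: smult_assoc1)

lemma End_eqI:
 assumes "h \<in> extensional (carrier V)" "g \<in> extensional (carrier V)" "\<And>v. v \<in> carrier V ==> h v = g v"
 shows "h = g"
 using assms by (rule extensionalityI)

lemma End_closed:
 "[|h \<in> carrier End; g \<in> carrier End|] ==> h \<otimes>\<^bsub>End\<^esub> g \<in> carrier End"
 "[|h \<in> carrier End; g \<in> carrier End|] ==> h \<oplus>\<^bsub>End\<^esub> g \<in> carrier End"
 "\<zero>\<^bsub>End\<^esub> \<in> carrier End"
 "[|c \<in> carrier K; h \<in> carrier End|] ==> c \<odot>\<^bsub>End\<^esub> h \<in> carrier End"
 by (rule EndI; simp add: End_sel EndD F_carrier F_add F_zero F_smult M.a_ac smult_r_distr smult_comm)+

definition End_neg where "End_neg h = (\<lambda>v\<in>carrier V. \<ominus>\<^bsub>V\<^esub> h v)"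

lemma End_neg: "h \<in> carrier End ==> End_neg h \<in> carrier End \<and> End_neg h \<oplus>\<^bsub>End\<^esub> h = \<zero>\<^bsub>End\<^esub>"
proof
 assume h: "h \<in> carrier End"
 have Fn: "\<ominus>\<^bsub>V\<^esub> v \<in> F p" if "v \<in> F p" for v p
  using F_smult[of "\<ominus> \<one>" v p] that F_carrier[OF that] smult_l_minus[of \<one> v] smult_one[of v] by simp
 show "End_neg h \<in> carrier End"
  by (rule EndI; simp add: End_neg_def EndD[OF h] F_carrier Fn M.minus_add smult_r_minus)
 show "End_neg h \<oplus>\<^bsub>End\<^esub> h = \<zero>\<^bsub>End\<^esub>"
  by (rule End_eqI) (simp_all add: End_neg_def End_sel EndD[OF h] M.l_neg)
qed

lemma End_nu_algebra: "nu_algebra K End"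
proof -
 have ab: "abelian_group End"
 proof (rule abelian_groupI)
  show "\<exists>y\<in>carrier End. y \<oplus>\<^bsub>End\<^esub> x = \<zero>\<^bsub>End\<^esub>" if "x \<in> carrier End" for x
   using End_neg[OF that] by blast
 qed (auto simp: End_closed intro!: End_eqI, auto simp: End_sel EndD M.a_ac)
 have md: "module K End"
  by (rule moduleI[OF cring_axioms ab])
   (auto simp: End_closed intro!: End_eqI,
    auto simp: End_sel EndD smult_l_distr smult_r_distr smult_assoc1)
 show ?thesis
  by (intro nu_algebra.intro nu_algebra_axioms.intro md field_axioms)
   (auto simp: End_closed intro!: End_eqI, auto simp: End_sel EndD)
qed

lemma End_minus:
 assumes "h \<in> carrier End" "g \<in> carrier End" "v \<in> carrier V"
 shows "(h \<ominus>\<^bsub>End\<^esub> g) v = h v \<ominus>\<^bsub>V\<^esub> g v"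
proof -
 interpret E: nu_algebra K End by (rule End_nu_algebra)
 have "\<ominus>\<^bsub>End\<^esub> g = End_neg g"
  using End_neg[OF assms(2)] assms(2) by (intro E.M.minus_equality) auto
 then show ?thesis using assms by (simp add: a_minus_def End_sel End_neg_def)
qed

text \<open>For \<open>k = 1\<close> these form a nilpotent ideal, which is what the universal property of the cylinders asks for.\<close>

definition shifts :: "nat \<Rightarrow> ('v \<Rightarrow> 'v) set" where
 "shifts k = {h \<in> carrier End. \<forall>p. \<forall>v\<in>F p. h v \<in> F (p + k)}"

lemma shifts_ideal: "nu_ideal K End (shifts 1)"
 unfolding nu_ideal_def shifts_def
 by (auto simp: End_closed F_zero F_add F_smult EndD(4)) (auto simp: End_sel F_carrier F_zero F_add F_smult EndD(4))

lemma shifts_pow: "ideal_pow End (shifts 1) (Suc k) \<subseteq> shifts (Suc k)"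
proof (induction k)
 case (Suc k)
 have "h \<in> shifts (Suc (Suc k))" if "h \<in> ideal_prod End (ideal_pow End (shifts 1) (Suc k)) (shifts 1)" for h
  using that
 proof induction
  case (prod i j)
  then have "i \<in> shifts (Suc k)" using Suc by auto
  then have i: "i \<in> carrier End" "\<And>p v. v \<in> F p ==> i v \<in> F (p + Suc k)" by (auto simp: shifts_def)
  have j: "j \<in> carrier End" "\<And>p v. v \<in> F p ==> j v \<in> F (Suc p)" using prod by (auto simp: shifts_def One_nat_def)
  have "j (i v) \<in> F (Suc (p + Suc k))" if "v \<in> F p" for v p by (intro j i that)
  moreover have "i \<otimes>\<^bsub>End\<^esub> j \<in> carrier End" by (rule End_closed(1)[OF i(1) j(1)])
  moreover have "(i \<otimes>\<^bsub>End\<^esub> j) v = j (i v)" if "v \<in> F p" for v p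
   using F_carrier[OF that] by (simp add: End_sel)
  ultimately show ?case by (simp add: shifts_def)
 next
  case (sum s1 s2)
  then show ?case by (auto simp: shifts_def End_closed) (auto simp: End_sel F_carrier F_add)
 qed
 then show ?case by auto
qed (simp add: One_nat_def)

lemma shifts_nilpotent:
 assumes "F n = {\<zero>\<^bsub>V\<^esub>}" "n \<ge> 1"
 shows "ideal_pow End (shifts 1) n \<subseteq> {\<zero>\<^bsub>End\<^esub>}"
proof
 fix h assume "h \<in> ideal_pow End (shifts 1) n"
 then have h: "h \<in> shifts n" using shifts_pow[of "n - 1"] assms(2) by auto
 have "h v = \<zero>\<^bsub>V\<^esub>" if "v \<in> carrier V" for v
 proof -
  have "h v \<in> F (0 + n)" using h that F_0 unfolding shifts_def by blast
  then show ?thesis using assms(1) by simp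
 qed
 then have "h = \<zero>\<^bsub>End\<^esub>"
  using h EndD(5) by (intro End_eqI) (auto simp: shifts_def End_sel)
 then show "h \<in> {\<zero>\<^bsub>End\<^esub>}" by simp
qed

definition End_module :: "('x \<Rightarrow> 'v \<Rightarrow> 'v) \<Rightarrow> ('x \<times> 'k, 'v) rmodule" where
 "End_module h = \<lparr>carrier = carrier V, monoid.mult = undefined, one = undefined,
   ring.zero = \<zero>\<^bsub>V\<^esub>, add = add V, ract = (\<lambda>v (x, c). h x v \<oplus>\<^bsub>V\<^esub> c \<odot>\<^bsub>V\<^esub> v)\<rparr>"

lemma End_module_sel:
 "carrier (End_module h) = carrier V" "\<zero>\<^bsub>End_module h\<^esub> = \<zero>\<^bsub>V\<^esub>" "add (End_module h) = add V"
 "v \<lhd>\<^bsub>End_module h\<^esub> (x, c) = h x v \<oplus>\<^bsub>V\<^esub> c \<odot>\<^bsub>V\<^esub> v"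
 by (simp_all add: End_module_def)

lemma End_module_abelian_group: "abelian_group (End_module h)"
 by (rule abelian_groupI)
  (auto simp: End_module_sel M.a_ac intro: bexI[of _ "\<ominus>\<^bsub>V\<^esub> x" for x] M.l_neg)

lemma End_module_minus: "v \<ominus>\<^bsub>End_module h\<^esub> w = v \<ominus>\<^bsub>V\<^esub> w"
 by (simp add: a_minus_def a_inv_def m_inv_def End_module_sel)

lemma End_module_right_module:
 assumes X: "nu_algebra K X" and h: "h \<in> alg_hom K X End"
 shows "right_module (aug K X) (End_module h)"
proof -
 interpret X: k_algebra K X by (rule k_algebraI[OF X])
 note hc = alg_homD(1)[OF h]
 have ev: "h (x \<oplus>\<^bsub>X\<^esub> y) v = h x v \<oplus>\<^bsub>V\<^esub> h y v" "h (x \<otimes>\<^bsub>X\<^esub> y) v = h y (h x v)"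
  "c \<in> carrier K ==> h (c \<odot>\<^bsub>X\<^esub> x) v = c \<odot>\<^bsub>V\<^esub> h x v"
  if "x \<in> carrier X" "y \<in> carrier X" "v \<in> carrier V" for x y v c
  using that by (simp_all add: alg_homD[OF h] End_sel)
 have z: "h \<zero>\<^bsub>X\<^esub> v = \<zero>\<^bsub>V\<^esub>" if "v \<in> carrier V" for v
  using alg_hom_zero[OF X End_nu_algebra h] that by (simp add: End_sel)
 note cl = EndD(1)[OF hc]
 show ?thesis
 proof (intro right_module.intro right_module_axioms.intro X.aug_ring End_module_abelian_group)
  fix v a assume v: "v \<in> carrier (End_module h)" and "a \<in> carrier (aug K X)"
  then obtain x c where a: "a = (x, c)" "x \<in> carrier X" "c \<in> carrier K" by (auto simp: aug_sel)
  have v: "v \<in> carrier V" using v by (simp add: End_module_sel)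
  show "v \<lhd>\<^bsub>End_module h\<^esub> a \<in> carrier (End_module h)"
   using a v by (simp add: End_module_sel cl)
  show "(v \<oplus>\<^bsub>End_module h\<^esub> w) \<lhd>\<^bsub>End_module h\<^esub> a =
    v \<lhd>\<^bsub>End_module h\<^esub> a \<oplus>\<^bsub>End_module h\<^esub> w \<lhd>\<^bsub>End_module h\<^esub> a" if "w \<in> carrier (End_module h)" for w
   using a v that by (simp add: End_module_sel EndD(2)[OF hc] cl smult_r_distr M.a_ac)
  fix b assume "b \<in> carrier (aug K X)"
  then obtain y d where b: "b = (y, d)" "y \<in> carrier X" "d \<in> carrier K" by (auto simp: aug_sel)
  show "v \<lhd>\<^bsub>End_module h\<^esub> (a \<oplus>\<^bsub>aug K X\<^esub> b) =
    v \<lhd>\<^bsub>End_module h\<^esub> a \<oplus>\<^bsub>End_module h\<^esub> v \<lhd>\<^bsub>End_module h\<^esub> b"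
   using a v b by (simp add: End_module_sel aug_sel ev cl smult_l_distr M.a_ac)
  show "v \<lhd>\<^bsub>End_module h\<^esub> (a \<otimes>\<^bsub>aug K X\<^esub> b) = v \<lhd>\<^bsub>End_module h\<^esub> a \<lhd>\<^bsub>End_module h\<^esub> b"
   using a v b
   by (simp add: End_module_sel aug_sel ev cl smult_r_distr smult_assoc1 X.nu_mult_closed
     EndD(2,3)[OF hc] M.a_ac smult_comm)
 next
  fix v assume "v \<in> carrier (End_module h)"
  then show "v \<lhd>\<^bsub>End_module h\<^esub> \<one>\<^bsub>aug K X\<^esub> = v" by (simp add: End_module_sel aug_sel z)
 qed
qed

end

lemma (in right_module) ract_minus:
 assumes "x \<in> carrier M" "a \<in> carrier A" "b \<in> carrier A"
 shows "x \<lhd>\<^bsub>M\<^esub> (a \<ominus>\<^bsub>A\<^esub> b) = x \<lhd>\<^bsub>M\<^esub> a \<ominus>\<^bsub>M\<^esub> x \<lhd>\<^bsub>M\<^esub> b"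
 by (rule add_homs_minus[OF A.abelian_group_axioms M.abelian_group_axioms, of "\<lambda>a. x \<lhd>\<^bsub>M\<^esub> a"])
  (use assms in \<open>auto intro!: add_homs_I simp: ract_closed ract_r_distr\<close>)

lemma (in right_module) ract_zero_l:
 assumes "a \<in> carrier A" shows "\<zero>\<^bsub>M\<^esub> \<lhd>\<^bsub>M\<^esub> a = \<zero>\<^bsub>M\<^esub>"
 by (rule add_homs_zero[OF M.abelian_group_axioms M.abelian_group_axioms, of "\<lambda>x. x \<lhd>\<^bsub>M\<^esub> a"])
  (use assms in \<open>auto intro!: add_homs_I simp: ract_closed ract_l_distr\<close>)

lemma (in right_module) ract_zero_r:
 assumes "x \<in> carrier M" shows "x \<lhd>\<^bsub>M\<^esub> \<zero>\<^bsub>A\<^esub> = \<zero>\<^bsub>M\<^esub>"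
 by (rule add_homs_zero[OF A.abelian_group_axioms M.abelian_group_axioms, of "\<lambda>a. x \<lhd>\<^bsub>M\<^esub> a"])
  (use assms in \<open>auto intro!: add_homs_I simp: ract_closed ract_r_distr\<close>)

section \<open>Cylinder modules built from forms\<close>

context form_module
begin

text \<open>The space \<open>\<Prod>\<^bsub>p<n\<^esub> E \<otimes> \<Omega>\<^sup>p\<close>, as sequences which vanish from \<open>n\<close> on.\<close>

definition Vn :: "nat \<Rightarrow> ('k, nat \<Rightarrow> ('k, 'a, 'e) form_ext) module" where
 "Vn n = \<lparr>carrier = {v. \<forall>m. v m \<in> carrier (MF m) \<and> (n \<le> m \<longrightarrow> v m = \<zero>\<^bsub>MF m\<^esub>)},
   monoid.mult = undefined, one = undefined, ring.zero = (\<lambda>m. \<zero>\<^bsub>MF m\<^esub>),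
   add = (\<lambda>v w m. v m \<oplus>\<^bsub>MF m\<^esub> w m),
   smult = (\<lambda>c v m. v m \<lhd>\<^bsub>MF m\<^esub> (emb c))\<rparr>"

definition Vfil :: "nat \<Rightarrow> nat \<Rightarrow> (nat \<Rightarrow> ('k, 'a, 'e) form_ext) set" where
 "Vfil n p = {v \<in> carrier (Vn n). \<forall>m<p. v m = \<zero>\<^bsub>MF m\<^esub>}"

lemma Vn_sel:
 "v \<in> carrier (Vn n) \<longleftrightarrow> (\<forall>m. v m \<in> carrier (MF m)) \<and> (\<forall>m\<ge>n. v m = \<zero>\<^bsub>MF m\<^esub>)"
 "\<zero>\<^bsub>Vn n\<^esub> = (\<lambda>m. \<zero>\<^bsub>MF m\<^esub>)"
 "v \<oplus>\<^bsub>Vn n\<^esub> w = (\<lambda>m. v m \<oplus>\<^bsub>MF m\<^esub> w m)"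
 "c \<odot>\<^bsub>Vn n\<^esub> v = (\<lambda>m. v m \<lhd>\<^bsub>MF m\<^esub> (emb c))"
 by (auto simp: Vn_def)

lemma Vn_neg:
 assumes "v \<in> carrier (Vn n)"
 shows "(\<lambda>m. \<ominus>\<^bsub>MF m\<^esub> v m) \<in> carrier (Vn n) \<and>
  (\<lambda>m. \<ominus>\<^bsub>MF m\<^esub> v m) \<oplus>\<^bsub>Vn n\<^esub> v = \<zero>\<^bsub>Vn n\<^esub>"
 using assms by (simp add: Vn_sel MF.neg_zero MF.l_neg)

lemma Vn_module: "module K (Vn n)"
proof (rule moduleI[OF cring_axioms])
 show "abelian_group (Vn n)"
 proof (rule abelian_groupI)
  show "\<exists>y\<in>carrier (Vn n). y \<oplus>\<^bsub>Vn n\<^esub> x = \<zero>\<^bsub>Vn n\<^esub>" if "x \<in> carrier (Vn n)" for x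
   using Vn_neg[OF that] by blast
 qed (auto simp: Vn_sel MF.a_ac)
 note s = aug_emb(5)
 have m: "(\<zero>\<^bsub>A\<^esub>, c \<otimes> d) = (emb d) \<otimes>\<^bsub>A1\<^esub> (emb c)" if "c \<in> carrier K" "d \<in> carrier K" for c d
  using that by (simp add: aug_sel nu_zero_l m_comm)
 have o: "(emb \<one>) = \<one>\<^bsub>A1\<^esub>" by (simp add: aug_sel)
 fix c d v w
 show "c \<odot>\<^bsub>Vn n\<^esub> v \<in> carrier (Vn n)" if "c \<in> carrier K" "v \<in> carrier (Vn n)"
  using that by (simp add: Vn_sel MF.ract_closed MF.ract_zero_l aug_scalar)
 show "(c \<oplus> d) \<odot>\<^bsub>Vn n\<^esub> v = c \<odot>\<^bsub>Vn n\<^esub> v \<oplus>\<^bsub>Vn n\<^esub> d \<odot>\<^bsub>Vn n\<^esub> v"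
  if "c \<in> carrier K" "d \<in> carrier K" "v \<in> carrier (Vn n)"
  using that by (simp add: Vn_sel s MF.ract_r_distr aug_scalar)
 show "c \<odot>\<^bsub>Vn n\<^esub> (v \<oplus>\<^bsub>Vn n\<^esub> w) = c \<odot>\<^bsub>Vn n\<^esub> v \<oplus>\<^bsub>Vn n\<^esub> c \<odot>\<^bsub>Vn n\<^esub> w"
  if "c \<in> carrier K" "v \<in> carrier (Vn n)" "w \<in> carrier (Vn n)"
  using that by (simp add: Vn_sel MF.ract_l_distr aug_scalar)
 show "(c \<otimes> d) \<odot>\<^bsub>Vn n\<^esub> v = c \<odot>\<^bsub>Vn n\<^esub> (d \<odot>\<^bsub>Vn n\<^esub> v)"
  if "c \<in> carrier K" "d \<in> carrier K" "v \<in> carrier (Vn n)"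
  using that by (simp add: Vn_sel m MF.ract_assoc aug_scalar)
 show "\<one> \<odot>\<^bsub>Vn n\<^esub> v = v" if "v \<in> carrier (Vn n)"
  using that by (simp add: Vn_sel o MF.ract_one)
qed

lemma Vn_filtered: "filtered_module K (Vn n) (Vfil n)"
proof (intro filtered_module.intro filtered_module_axioms.intro field_axioms Vn_module)
 interpret V: module K "Vn n" by (rule Vn_module)
 fix p c v w
 show "Vfil n 0 = carrier (Vn n)" "Vfil n (Suc p) \<subseteq> Vfil n p" "\<zero>\<^bsub>Vn n\<^esub> \<in> Vfil n p"
  by (auto simp: Vfil_def) (auto simp: Vn_sel)
 show "v \<oplus>\<^bsub>Vn n\<^esub> w \<in> Vfil n p" if "v \<in> Vfil n p" "w \<in> Vfil n p"
  using that by (auto simp: Vfil_def) (auto simp: Vn_sel)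
 show "c \<odot>\<^bsub>Vn n\<^esub> v \<in> Vfil n p" if "c \<in> carrier K" "v \<in> Vfil n p"
  using that by (auto simp: Vfil_def) (auto simp: Vn_sel MF.ract_zero_l aug_scalar)
qed

sublocale Vf: filtered_module K "Vn n" "Vfil n" for n
 by (rule Vn_filtered)

lemma Vn_minus:
 assumes "v \<in> carrier (Vn n)" "w \<in> carrier (Vn n)"
 shows "(v \<ominus>\<^bsub>Vn n\<^esub> w) m = v m \<ominus>\<^bsub>MF m\<^esub> w m"
proof -
 have "\<ominus>\<^bsub>Vn n\<^esub> w = (\<lambda>m. \<ominus>\<^bsub>MF m\<^esub> w m)"
  using Vn_neg[OF assms(2)] assms(2) by (intro Vf.M.minus_equality) auto
 then show ?thesis by (simp add: a_minus_def Vn_sel)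
qed

lemma Vfil_top: "Vfil n n = {\<zero>\<^bsub>Vn n\<^esub>}"
proof -
 have "v = \<zero>\<^bsub>Vn n\<^esub>" if "v \<in> Vfil n n" for v
 proof
  fix m
  show "v m = \<zero>\<^bsub>Vn n\<^esub> m"
   using that by (cases "m < n") (simp_all add: Vfil_def Vn_sel)
 qed
 then show ?thesis using Vf.F_zero by auto
qed

text \<open>
 For scalars \<open>l\<^sub>0, l\<^sub>1, \<dots>\<close> such that \<open>l\<^sub>p l\<^bsub>p+1\<^esub> = 0\<close>, an element \<open>a\<close> acts on a form \<open>v\<close> of degree
 \<open>p\<close> by \<open>v \<mapsto> v a + l\<^sub>p v da\<close>; the condition makes this multiplicative.
\<close>

definition act :: "nat \<Rightarrow> (nat \<Rightarrow> 'k) \<Rightarrow> 'a \<Rightarrow> (nat \<Rightarrow> ('k, 'a, 'e) form_ext) \<Rightarrow> nat \<Rightarrow> ('k, 'a, 'e) form_ext" where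
 "act n l a = (\<lambda>v\<in>carrier (Vn n). \<lambda>m. if n \<le> m then \<zero>\<^bsub>MF m\<^esub> else
   case m of 0 \<Rightarrow> v 0 \<lhd>\<^bsub>MF 0\<^esub> (a, \<zero>)
   | Suc p \<Rightarrow> v (Suc p) \<lhd>\<^bsub>MF (Suc p)\<^esub> (a, \<zero>) \<oplus>\<^bsub>MF (Suc p)\<^esub> mcc p [l p \<odot>\<^bsub>A\<^esub> a] (v p))"

definition isolated :: "(nat \<Rightarrow> 'k) \<Rightarrow> bool" where
 "isolated l \<longleftrightarrow> (\<forall>p. l p \<in> carrier K \<and> l p \<otimes> l (Suc p) = \<zero>)"

lemma msnoc_zero_r: "t \<in> carrier (MF p) ==> mcc p [\<zero>\<^bsub>A\<^esub>] t = \<zero>\<^bsub>MF (Suc p)\<^esub>"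
 using msnoc_add_r[of "\<zero>\<^bsub>A\<^esub>" "\<zero>\<^bsub>A\<^esub>" t p] by (intro MF.idem_zero) (simp_all add: msnoc_closed)

lemma msnoc_zero: "a \<in> carrier A ==> mcc p [a] \<zero>\<^bsub>MF p\<^esub> = \<zero>\<^bsub>MF (Suc p)\<^esub>"
 by (rule add_homs_zero[OF MF.abelian_group_axioms MF.abelian_group_axioms msnoc_hom])

lemma act_closed:
 assumes l: "isolated l" and a: "a \<in> carrier A"
 shows "act n l a \<in> carrier (Vf.End n)"
proof (rule Vf.EndI)
 have lp: "l p \<in> carrier K" for p using l by (simp add: isolated_def)
 fix v assume v: "v \<in> carrier (Vn n)"
 show "act n l a v \<in> carrier (Vn n)"
  using v a lp
  by (auto simp: Vn_sel act_def MF.ract_closed aug_elem msnoc_closed split: nat.split)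
 show "act n l a (v \<oplus>\<^bsub>Vn n\<^esub> w) = act n l a v \<oplus>\<^bsub>Vn n\<^esub> act n l a w" if w: "w \<in> carrier (Vn n)" for w
 proof -
  have vw: "v \<oplus>\<^bsub>Vn n\<^esub> w \<in> carrier (Vn n)" using v w by simp
  show ?thesis
   using v w vw a lp
   by (auto simp: act_def Vn_sel MF.ract_l_distr aug_elem msnoc_add MF.ract_closed msnoc_closed MF.a_ac
     split: nat.split intro!: ext)
 qed
 show "act n l a (c \<odot>\<^bsub>Vn n\<^esub> v) = c \<odot>\<^bsub>Vn n\<^esub> act n l a v" if c: "c \<in> carrier K" for c
 proof -
  have cv: "c \<odot>\<^bsub>Vn n\<^esub> v \<in> carrier (Vn n)" using v c by simp
  have 1: "t \<lhd>\<^bsub>MF m\<^esub> (emb c) \<lhd>\<^bsub>MF m\<^esub> (a, \<zero>) =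
    t \<lhd>\<^bsub>MF m\<^esub> (a, \<zero>) \<lhd>\<^bsub>MF m\<^esub> (emb c)"
   if "t \<in> carrier (MF m)" for t m
   using that a c aug_scalar_comm[of c "(a, \<zero>)"] by (simp add: aug_elem aug_scalar flip: MF.ract_assoc)
  have 2: "mcc p [l p \<odot>\<^bsub>A\<^esub> a] (t \<lhd>\<^bsub>MF p\<^esub> (emb c)) =
    mcc p [l p \<odot>\<^bsub>A\<^esub> a] t \<lhd>\<^bsub>MF (Suc p)\<^esub> (emb c)"
   if "t \<in> carrier (MF p)" for t p
   using msnoc_scal[of "l p \<odot>\<^bsub>A\<^esub> a" c t p] that a c lp by simp
  show ?thesis
   using v cv a lp c
   by (auto simp: act_def Vn_sel 1 2 MF.ract_l_distr MF.ract_closed msnoc_closed aug_scalar aug_elem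
     MF.ract_zero_l split: nat.split intro!: ext)
 qed
next
 have lp: "l p \<in> carrier K" for p using l by (simp add: isolated_def)
 fix v p assume v: "v \<in> Vfil n p"
 have "act n l a v \<in> carrier (Vn n)"
  using v a lp
  by (auto simp: Vfil_def Vn_sel act_def MF.ract_closed aug_elem msnoc_closed split: nat.split)
 moreover have "act n l a v m = \<zero>\<^bsub>MF m\<^esub>" if "m < p" for m
 proof -
  have "v m = \<zero>\<^bsub>MF m\<^esub>" "\<And>k. Suc k = m ==> v k = \<zero>\<^bsub>MF k\<^esub>"
   using v that by (auto simp: Vfil_def)
  then show ?thesis
   using v a lp by (auto simp: Vfil_def act_def MF.ract_zero_l aug_elem msnoc_zero split: nat.split)
 qed
 ultimately show "act n l a v \<in> Vfil n p" by (simp add: Vfil_def)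
next
 show "act n l a \<in> extensional (carrier (Vn n))" by (simp add: act_def)
qed

text \<open>The cross terms of \<open>(va + l\<^sub>p v da) b + l\<^sub>p (va) db\<close> combine to \<open>v ab + l\<^sub>p v d(ab)\<close>; the remaining term
\<open>l\<^sub>p l\<^bsub>p+1\<^esub> v da db\<close> vanishes by orthogonality.\<close>

lemma act_alg_hom:
 assumes l: "isolated l"
 shows "act n l \<in> alg_hom K A (Vf.End n)"
proof (rule alg_homI)
 have lp: "l p \<in> carrier K" "l p \<otimes> l (Suc p) = \<zero>" for p using l by (simp_all add: isolated_def)
 note ac = act_closed[OF l] and ex = Vf.EndD(5)[OF act_closed[OF l]] and cl = Vf.EndD(1)[OF act_closed[OF l]]
 fix a assume a: "a \<in> carrier A"
 show "act n l a \<in> carrier (Vf.End n)" by (rule ac[OF a])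
 show "act n l (c \<odot>\<^bsub>A\<^esub> a) = c \<odot>\<^bsub>Vf.End n\<^esub> act n l a" if c: "c \<in> carrier K" for c
 proof (rule Vf.End_eqI)
  fix v assume v: "v \<in> carrier (Vn n)"
  note e = aug_emb(4)
  have 2: "mcc p [l p \<odot>\<^bsub>A\<^esub> (c \<odot>\<^bsub>A\<^esub> a)] t = mcc p [l p \<odot>\<^bsub>A\<^esub> a] t \<lhd>\<^bsub>MF (Suc p)\<^esub> (emb c)"
   if "t \<in> carrier (MF p)" for t p
  proof -
   have "l p \<odot>\<^bsub>A\<^esub> (c \<odot>\<^bsub>A\<^esub> a) = c \<odot>\<^bsub>A\<^esub> (l p \<odot>\<^bsub>A\<^esub> a)"
    using a c lp by (simp add: m_comm flip: smult_assoc1)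
   then show ?thesis using msnoc_scal(2)[of "l p \<odot>\<^bsub>A\<^esub> a" c t p] that a c lp by simp
  qed
  show "act n l (c \<odot>\<^bsub>A\<^esub> a) v = (c \<odot>\<^bsub>Vf.End n\<^esub> act n l a) v"
   using v a c lp
   by (auto simp: Vf.End_sel Vn_sel(4) act_def split: nat.split intro!: ext)
    (auto simp: Vn_sel e 2 MF.ract_l_distr MF.ract_closed msnoc_closed aug_scalar aug_elem
     MF.ract_zero_l MF.ract_assoc)
 qed (use a c ex in \<open>auto simp: Vf.End_sel\<close>)
 fix b assume b: "b \<in> carrier A"
 show "act n l (a \<oplus>\<^bsub>A\<^esub> b) = act n l a \<oplus>\<^bsub>Vf.End n\<^esub> act n l b"
 proof (rule Vf.End_eqI)
  fix v assume v: "v \<in> carrier (Vn n)"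
  note e = aug_emb(1)
  show "act n l (a \<oplus>\<^bsub>A\<^esub> b) v = (act n l a \<oplus>\<^bsub>Vf.End n\<^esub> act n l b) v"
   using v a b lp
   by (auto simp: Vf.End_sel Vn_sel(3) act_def split: nat.split intro!: ext)
    (auto simp: Vn_sel e MF.ract_r_distr smult_r_distr msnoc_add_r MF.ract_closed msnoc_closed
     aug_elem MF.a_ac)
 qed (use a b ex in \<open>auto simp: Vf.End_sel\<close>)
 show "act n l (a \<otimes>\<^bsub>A\<^esub> b) = act n l a \<otimes>\<^bsub>Vf.End n\<^esub> act n l b"
 proof (rule Vf.End_eqI)
  fix v assume v: "v \<in> carrier (Vn n)"
  have av: "act n l a v \<in> carrier (Vn n)" by (rule cl[OF a v])
  have vm: "v m \<in> carrier (MF m)" for m using v by (simp add: Vn_sel)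
  note e = aug_emb(2)
  let ?M = "\<lambda>m. MF m"
  \<comment> \<open>the terms of second order cancel because the coefficients in adjacent degrees are orthogonal\<close>
  have sq: "mcc (Suc p) [l (Suc p) \<odot>\<^bsub>A\<^esub> b] (mcc p [l p \<odot>\<^bsub>A\<^esub> a] t) = \<zero>\<^bsub>?M (Suc (Suc p))\<^esub>"
   if t: "t \<in> carrier (?M p)" for t p
  proof -
   have "mcc (Suc p) [l (Suc p) \<odot>\<^bsub>A\<^esub> b] (mcc p [l p \<odot>\<^bsub>A\<^esub> a] t) =
     mcc (Suc p) [l p \<odot>\<^bsub>A\<^esub> (l (Suc p) \<odot>\<^bsub>A\<^esub> b)] (mcc p [a] t)"
    using t a b lp msnoc_scal(1)[of "l (Suc p) \<odot>\<^bsub>A\<^esub> b" "l p" "mcc p [a] t" "Suc p"]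
     msnoc_scal(2)[of a "l p" t p] by (simp add: msnoc_closed)
   also have "l p \<odot>\<^bsub>A\<^esub> (l (Suc p) \<odot>\<^bsub>A\<^esub> b) = \<zero>\<^bsub>A\<^esub>"
    using b lp by (simp flip: smult_assoc1)
   finally show ?thesis using t a by (simp add: msnoc_zero_r msnoc_closed)
  qed
  have cross: "mcc p [l p \<odot>\<^bsub>A\<^esub> (a \<otimes>\<^bsub>A\<^esub> b)] t =
    mcc p [l p \<odot>\<^bsub>A\<^esub> a] t \<lhd>\<^bsub>?M (Suc p)\<^esub> (b, \<zero>) \<oplus>\<^bsub>?M (Suc p)\<^esub> mcc p [l p \<odot>\<^bsub>A\<^esub> b] (t \<lhd>\<^bsub>?M p\<^esub> (a, \<zero>))"
   if t: "t \<in> carrier (?M p)" for t p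
  proof -
   let ?y = "mcc p [l p \<odot>\<^bsub>A\<^esub> b] (t \<lhd>\<^bsub>?M p\<^esub> (a, \<zero>))"
   have y: "?y \<in> carrier (?M (Suc p))" using t a b lp by (simp add: msnoc_closed MF.ract_closed aug_elem)
   have x: "mcc p [l p \<odot>\<^bsub>A\<^esub> (a \<otimes>\<^bsub>A\<^esub> b)] t \<in> carrier (?M (Suc p))"
    using t a b lp by (simp add: msnoc_closed nu_mult_closed)
   have s: "(l p \<odot>\<^bsub>A\<^esub> a, \<zero>) = (a, \<zero>) \<otimes>\<^bsub>A1\<^esub> (\<zero>\<^bsub>A\<^esub>, l p)"
    using a lp by (simp add: aug_sel nu_zero_r)
   have "mcc p [b] (t \<lhd>\<^bsub>?M p\<^esub> (l p \<odot>\<^bsub>A\<^esub> a, \<zero>)) = ?y"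
    using t a b lp msnoc_scal(1)[of b "l p" "t \<lhd>\<^bsub>?M p\<^esub> (a, \<zero>)" p]
    by (simp add: s MF.ract_assoc aug_elem aug_scalar MF.ract_closed)
   then have "mcc p [l p \<odot>\<^bsub>A\<^esub> a] t \<lhd>\<^bsub>?M (Suc p)\<^esub> (b, \<zero>) =
     mcc p [l p \<odot>\<^bsub>A\<^esub> (a \<otimes>\<^bsub>A\<^esub> b)] t \<ominus>\<^bsub>?M (Suc p)\<^esub> ?y"
    using msnoc_ract[of "l p \<odot>\<^bsub>A\<^esub> a" b t p] t a b lp by (simp add: nu_smult_l)
   then show ?thesis using x y by (simp add: a_minus_def MF.a_assoc MF.l_neg)
  qed
  show "act n l (a \<otimes>\<^bsub>A\<^esub> b) v = (act n l a \<otimes>\<^bsub>Vf.End n\<^esub> act n l b) v"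
  proof
   fix m
   have lhs: "(act n l a \<otimes>\<^bsub>Vf.End n\<^esub> act n l b) v m = act n l b (act n l a v) m"
    using v by (simp add: Vf.End_sel)
   show "act n l (a \<otimes>\<^bsub>A\<^esub> b) v m = (act n l a \<otimes>\<^bsub>Vf.End n\<^esub> act n l b) v m"
   proof (cases "n \<le> m")
    case True
    then show ?thesis unfolding lhs using v av by (simp add: act_def)
   next
    case False
    show ?thesis
    proof (cases m)
     case 0
     have "act n l b (act n l a v) 0 = act n l a v 0 \<lhd>\<^bsub>?M 0\<^esub> (b, \<zero>)"
      using av False 0 by (simp add: act_def[of n l b])
     also have "act n l a v 0 = v 0 \<lhd>\<^bsub>?M 0\<^esub> (a, \<zero>)" using v False 0 by (simp add: act_def)
     finally show ?thesis
      unfolding lhs using v False 0 a b vm by (simp add: act_def e MF.ract_assoc aug_elem)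
    next
     case (Suc p)
     have L: "act n l (a \<otimes>\<^bsub>A\<^esub> b) v m = v m \<lhd>\<^bsub>?M m\<^esub> (a, \<zero>) \<lhd>\<^bsub>?M m\<^esub> (b, \<zero>) \<oplus>\<^bsub>?M m\<^esub>
       mcc p [l p \<odot>\<^bsub>A\<^esub> (a \<otimes>\<^bsub>A\<^esub> b)] (v p)"
      using v False Suc a b vm by (simp add: act_def e MF.ract_assoc aug_elem)
     have R: "act n l b (act n l a v) m = act n l a v m \<lhd>\<^bsub>?M m\<^esub> (b, \<zero>) \<oplus>\<^bsub>?M m\<^esub>
       mcc p [l p \<odot>\<^bsub>A\<^esub> b] (act n l a v p)"
      using av False Suc by (simp add: act_def[of n l b])
     have am: "act n l a v m = v m \<lhd>\<^bsub>?M m\<^esub> (a, \<zero>) \<oplus>\<^bsub>?M m\<^esub> mcc p [l p \<odot>\<^bsub>A\<^esub> a] (v p)"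
      using v False Suc by (simp add: act_def)
     have "mcc p [l p \<odot>\<^bsub>A\<^esub> b] (act n l a v p) = mcc p [l p \<odot>\<^bsub>A\<^esub> b] (v p \<lhd>\<^bsub>?M p\<^esub> (a, \<zero>))"
     proof (cases p)
      case 0
      then show ?thesis using v False Suc by (simp add: act_def)
     next
      case p: (Suc q)
      have "act n l a v p = v p \<lhd>\<^bsub>?M p\<^esub> (a, \<zero>) \<oplus>\<^bsub>?M p\<^esub> mcc q [l q \<odot>\<^bsub>A\<^esub> a] (v q)"
       using v False Suc p by (simp add: act_def)
      then show ?thesis
       using a b lp vm p sq[of "v q" q]
       by (simp add: msnoc_add MF.ract_closed aug_elem msnoc_closed)
     qed
     then show ?thesis
      unfolding lhs L R am using a b lp vm Suc
      by (simp add: cross MF.ract_l_distr MF.ract_closed msnoc_closed aug_elem MF.a_assoc)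
    qed
   qed
  qed
 qed (use a b ex nu_mult_closed in \<open>auto simp: Vf.End_sel\<close>)
qed

end

section \<open>Linear maps from extended modules to forms\<close>

lemma (in abelian_group) add_diff_cancel:
 assumes "x \<in> carrier G" "y \<in> carrier G" "z \<in> carrier G"
 shows "(x \<oplus> y) \<ominus> (x \<oplus> z) = y \<ominus> z"
proof -
 have "(x \<oplus> y) \<ominus> (x \<oplus> z) = (x \<oplus> \<ominus> x) \<oplus> (y \<oplus> \<ominus> z)" using assms by (simp add: minus_eq minus_add a_ac)
 then show ?thesis using assms by (simp add: minus_eq r_neg)
qed

lemma (in k_algebra) aug_minus:
 assumes "a \<in> carrier A" "b \<in> carrier A" "c \<in> carrier K" "d \<in> carrier K"
 shows "(a, c) \<ominus>\<^bsub>aug K A\<^esub> (b, d) = (a \<ominus>\<^bsub>A\<^esub> b, c \<ominus> d)"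
proof -
 have "\<ominus>\<^bsub>aug K A\<^esub> (b, d) = (\<ominus>\<^bsub>A\<^esub> b, \<ominus> d)"
  using assms by (intro Au.minus_equality) (simp_all add: aug_sel M.l_neg K_neg)
 then show ?thesis by (simp add: a_minus_def aug_sel)
qed

context form_module
begin

text \<open>\<open>gk m n k\<close> is the inclusion of the copy with index \<open>k\<close>.\<close>

abbreviation cyl_aug where "cyl_aug m n \<equiv> aug K (Cyl K A m n)"
abbreviation gk where "gk m n k \<equiv> aug_map (cg m n k)"
abbreviation Ek where "Ek m n k \<equiv> ext_scal E A1 (gk m n k) (cyl_aug m n)"
abbreviation ek where "ek m n k \<equiv> ext_tens E A1 (gk m n k) (cyl_aug m n)"

lemma gk_ring_hom: "k \<le> m ==> gk m n k \<in> ring_hom A1 (cyl_aug m n)"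
 by (rule aug_map_ring_hom[OF nu_algebra_axioms Cyl_nu_algebra cg_alg_hom])

lemma cyl_aug_ring: "ring (cyl_aug m n)"
proof -
 interpret C: k_algebra K "Cyl K A m n" by (rule k_algebraI[OF Cyl_nu_algebra])
 show ?thesis by (rule C.aug_ring)
qed

lemma gk_ext: "k \<le> m ==> scalar_ext A1 E (gk m n k) (cyl_aug m n)"
 by (intro scalar_ext.intro scalar_ext_axioms.intro E.right_module_axioms cyl_aug_ring gk_ring_hom)

lemma gk_form: "k \<le> m ==> scalar_form K A E (gk m n k) (cyl_aug m n)"
 by (intro scalar_form.intro form_module_axioms gk_ext)

lemma gk_scalar: "k \<le> m ==> gk m n k (emb c) = (\<zero>\<^bsub>Cyl K A m n\<^esub>, c)"
 using alg_hom_zero[OF nu_algebra_axioms Cyl_nu_algebra cg_alg_hom] by (simp add: aug_map_def)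

lemma gk_agree: "[|k \<le> m; j \<le> m|] ==> scalar_agree K A (gk m n k) (gk m n j)"
 by (simp add: scalar_agree_def gk_scalar)

lemma gk_two: "[|k \<le> m; j \<le> m|] ==> two_homs K A E (gk m n k) (cyl_aug m n) (gk m n j)"
 by (intro two_homs.intro two_homs_axioms.intro gk_form gk_ring_hom gk_agree)

lemma hdiff_gk:
 assumes "k \<le> m" "j \<le> m" "y \<in> carrier A"
 shows "hdiff K (cyl_aug m n) (gk m n k) (gk m n j) y = (cg m n j y \<ominus>\<^bsub>Cyl K A m n\<^esub> cg m n k y, \<zero>)"
proof -
 interpret C: k_algebra K "Cyl K A m n" by (rule k_algebraI[OF Cyl_nu_algebra])
 have "cg m n j y \<in> carrier (Cyl K A m n)" "cg m n k y \<in> carrier (Cyl K A m n)"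
  using assms by (auto intro!: alg_homD(1)[OF cg_alg_hom])
 moreover have "\<zero> \<ominus> \<zero> = \<zero>"
  by (simp add: abelian_group.minus_eq_zero_iff[OF ring.is_abelian_group[OF K_ring]])
 ultimately show ?thesis by (simp add: hdiff_def aug_map_def C.aug_minus)
qed

text \<open>Each difference of two copies of \<open>a\<close> lies in the kernel of the folding map, whose \<open>n\<close>-th power is divided out.\<close>

lemma gk_word_zero:
 assumes kj: "k \<le> m" "j \<le> m" and n: "1 \<le> n" "n \<le> length ys" and ys: "set ys \<subseteq> carrier A"
 shows "word_prod (cyl_aug m n) (replicate (length ys) (hdiff K (cyl_aug m n) (gk m n k) (gk m n j))) ys =
  \<zero>\<^bsub>cyl_aug m n\<^esub>"
proof -
 interpret T: two_homs K A E "gk m n k" "cyl_aug m n" "gk m n j" by (rule gk_two[OF kj])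
 interpret C: k_algebra K "Cyl K A m n" by (rule k_algebraI[OF Cyl_nu_algebra])
 interpret Q: nu_alg K "Q_alg K A m" unfolding nu_alg_def by (rule Q_nu_algebra)
 note cc = alg_homD[OF cyl_class_alg_hom[of m n]]
 let ?P = "ideal_pow (Q_alg K A m) (q_ideal K A m)"
 have w: "\<exists>x\<in>?P (length zs). word_prod (cyl_aug m n) (replicate (length zs) T.dl) zs = (cyl_class K A m n x, \<zero>)"
  if "zs \<noteq> []" "set zs \<subseteq> carrier A" for zs
  using that
 proof (induction zs rule: rev_induct)
  case (snoc z zs)
  then obtain y where y: "y \<in> q_ideal K A m" "T.dl z = (cyl_class K A m n y, \<zero>)"
   using cg_diff_in[OF kj(2,1), of z n] hdiff_gk[OF kj, of z n] by auto
  have yc: "y \<in> carrier (Q_alg K A m)" using y by (simp add: q_ideal_iff)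
  show ?case
  proof (cases "zs = []")
   case True
   have "T.dl z \<otimes>\<^bsub>cyl_aug m n\<^esub> \<one>\<^bsub>cyl_aug m n\<^esub> = T.dl z" using T.dl_closed snoc.prems by simp
   then show ?thesis using True y by auto
  next
   case False
   then obtain x where x: "x \<in> ?P (length zs)"
    "word_prod (cyl_aug m n) (replicate (length zs) T.dl) zs = (cyl_class K A m n x, \<zero>)"
    using snoc by auto
   obtain l where l: "length zs = Suc l" using False by (cases "length zs") auto
   have xc: "x \<in> carrier (Q_alg K A m)" using nu_idealD(1)[OF Q.nu_ideal_pow[OF q_nu_ideal] x(1)] .
   have "x \<otimes>\<^bsub>Q_alg K A m\<^esub> y \<in> ?P (Suc (length zs))"
    using x(1) y(1) by (simp add: l ideal_prod.prod)
   moreover have "word_prod (cyl_aug m n) (replicate (length (zs @ [z])) T.dl) (zs @ [z]) =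
     (cyl_class K A m n (x \<otimes>\<^bsub>Q_alg K A m\<^esub> y), \<zero>)"
    using T.dl_word_snoc[of zs z] snoc.prems x(2) y(2) xc yc cc(1)
    by (simp add: aug_sel cc(3) C.nu_mult_closed del: replicate_Suc)
   ultimately show ?thesis by auto
  qed
 qed simp
 have sub: "?P (i + d) \<subseteq> ?P i" for i d
  by (induction d) (use Q.ideal_pow_Suc_subset[OF q_nu_ideal] in fastforce)+
 have "ys \<noteq> []" using n by auto
 then obtain x where x: "x \<in> ?P (length ys)"
  "word_prod (cyl_aug m n) (replicate (length ys) T.dl) ys = (cyl_class K A m n x, \<zero>)"
  using w ys by blast
 have "x \<in> cyl_ideal K A m n"
  using x(1) sub[of n "length ys - n"] n by (auto simp: cyl_ideal_def)
 then show ?thesis using x(2) cyl_class_zero by (simp add: aug_sel)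
qed

text \<open>The two copies of \<open>R\<close> generate \<open>Cyl\<^sup>1\<close>, and the span of the elements \<open>e \<otimes> \<delta>(a\<^sub>1) \<dots> \<delta>(a\<^sub>q)\<close> is stable under both.\<close>

lemma cyl1_words:
 assumes t: "t \<in> carrier (Ek 1 n 0)"
 shows "t \<in> two_homs.words K A E (gk 1 n 0) (cyl_aug 1 n) (gk 1 n 1)"
proof -
 interpret T: two_homs K A E "gk 1 n 0" "cyl_aug 1 n" "gk 1 n 1" by (rule gk_two) simp_all
 interpret C: k_algebra K "Cyl K A 1 n" by (rule k_algebraI[OF Cyl_nu_algebra])
 have el: "t \<lhd>\<^bsub>T.S.X\<^esub> (X, \<zero>) \<in> T.words" if "X \<in> carrier (Cyl K A 1 n)" "t \<in> T.words" for X t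
  using that
 proof (induction arbitrary: t rule: Cyl_induct)
  case (gen i a)
  then have "i = 0 \<or> i = 1" by auto
  then show ?case
   using T.words_alpha_elem[OF gen(3,2)] T.words_beta_elem[OF gen(3,2)] by (auto simp: aug_map_def)
 next
  case zero
  then show ?case
   using T.words_scalar[of t \<zero>] gk_scalar[of 0 1 n \<zero>] by simp
 next
  case (add x y)
  have "(x \<oplus>\<^bsub>Cyl K A 1 n\<^esub> y, \<zero>) = (x, \<zero>) \<oplus>\<^bsub>cyl_aug 1 n\<^esub> (y, \<zero>)" by (simp add: aug_sel)
  then show ?case
   using add by (simp add: T.S.X.ract_r_distr T.words_closed C.aug_elem T.words_add)
 next
  case (mult x y)
  have "(x \<otimes>\<^bsub>Cyl K A 1 n\<^esub> y, \<zero>) = (x, \<zero>) \<otimes>\<^bsub>cyl_aug 1 n\<^esub> (y, \<zero>)"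
   using mult by (simp add: aug_sel C.nu_mult_closed)
  then show ?case
   using mult by (simp add: T.S.X.ract_assoc T.words_closed C.aug_elem)
 next
  case (scal c x)
  have "(c \<odot>\<^bsub>Cyl K A 1 n\<^esub> x, \<zero>) = (x, \<zero>) \<otimes>\<^bsub>cyl_aug 1 n\<^esub> (\<zero>\<^bsub>Cyl K A 1 n\<^esub>, c)"
   using scal by (simp add: aug_sel C.nu_zero_r)
  then show ?case
   using scal T.words_scalar[of "t \<lhd>\<^bsub>T.S.X\<^esub> (x, \<zero>)" c] gk_scalar[of 0 1 n c]
   by (simp add: T.S.X.ract_assoc T.words_closed C.aug_elem C.aug_scalar)
 qed
 have all: "t \<lhd>\<^bsub>T.S.X\<^esub> b \<in> T.words" if b: "b \<in> carrier (cyl_aug 1 n)" and t: "t \<in> T.words" for b t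
 proof -
  obtain X c where X: "b = (X, c)" "X \<in> carrier (Cyl K A 1 n)" "c \<in> carrier K" using b by (auto simp: aug_sel)
  have "t \<lhd>\<^bsub>T.S.X\<^esub> b = t \<lhd>\<^bsub>T.S.X\<^esub> (X, \<zero>) \<oplus>\<^bsub>T.S.X\<^esub> t \<lhd>\<^bsub>T.S.X\<^esub> (\<zero>\<^bsub>Cyl K A 1 n\<^esub>, c)"
   using C.aug_split[OF X(2,3)] X t by (simp add: T.S.X.ract_r_distr T.words_closed C.aug_elem C.aug_scalar)
  then show ?thesis
   using el[OF X(2) t] T.words_scalar[OF t X(3)] gk_scalar[of 0 1 n c] by (simp add: T.words_add)
 qed
 show ?thesis
  using t
 proof (induction rule: T.S.ext_induct)
  case (tens e b)
  have "T.S.et e \<one>\<^bsub>cyl_aug 1 n\<^esub> \<in> T.words" using T.words_gen[of e "[]"] tens by simp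
  then show ?case using all[OF tens(2)] tens by (subst T.S.et_unit) auto
 next
  case (add x y)
  then show ?case by (simp add: T.words_add)
 qed
qed

text \<open>
 A family of coefficient sequences, one for each copy of \<open>R\<close>, makes the forms of degree less than
 \<open>n\<close> a module over the \<open>n\<close>-th cylinder: the copies act in the same way up to terms of higher
 degree.
\<close>

definition isolated_family :: "nat \<Rightarrow> (nat \<Rightarrow> nat \<Rightarrow> 'k) \<Rightarrow> bool" where
 "isolated_family m L \<longleftrightarrow> (\<forall>i\<le>m. isolated (L i))"

definition rho :: "nat \<Rightarrow> nat \<Rightarrow> (nat \<Rightarrow> nat \<Rightarrow> 'k) \<Rightarrow> ('k, 'a) cterm set set \<Rightarrow>
  (nat \<Rightarrow> ('k, 'a, 'e) form_ext) \<Rightarrow> nat \<Rightarrow> ('k, 'a, 'e) form_ext" where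
 "rho m n L X = the_elem (copair (Vf.End n) (\<lambda>i. act n (L i)) ` X)"

lemma act_diff_shifts:
 assumes l: "isolated l" "isolated l'" and a: "a \<in> carrier A"
 shows "act n l a \<ominus>\<^bsub>Vf.End n\<^esub> act n l' a \<in> Vf.shifts n 1"
proof -
 interpret E: nu_algebra K "Vf.End n" by (rule Vf.End_nu_algebra)
 let ?h = "act n l a" and ?g = "act n l' a"
 note h = act_closed[OF l(1) a, of n] and g = act_closed[OF l(2) a, of n]
 have c: "?h \<ominus>\<^bsub>Vf.End n\<^esub> ?g \<in> carrier (Vf.End n)" using h g by simp
 have "(?h \<ominus>\<^bsub>Vf.End n\<^esub> ?g) v \<in> Vfil n (p + 1)" if v: "v \<in> Vfil n p" for v p
 proof -
  have vc: "v \<in> carrier (Vn n)" using v by (simp add: Vfil_def)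
  have e: "(?h \<ominus>\<^bsub>Vf.End n\<^esub> ?g) v = ?h v \<ominus>\<^bsub>Vn n\<^esub> ?g v" by (rule Vf.End_minus[OF h g vc])
  have hv: "?h v \<in> carrier (Vn n)" "?g v \<in> carrier (Vn n)" using Vf.EndD(1)[OF h vc] Vf.EndD(1)[OF g vc] .
  have "?h v i = ?g v i" if "i < p + 1" for i
  proof -
   have "\<And>k. Suc k = i ==> v k = \<zero>\<^bsub>MF k\<^esub>" using v that by (auto simp: Vfil_def)
   then show ?thesis
    using vc l a by (auto simp: act_def msnoc_zero isolated_def split: nat.split)
  qed
  then have "(?h v \<ominus>\<^bsub>Vn n\<^esub> ?g v) i = \<zero>\<^bsub>MF i\<^esub>" if "i < p + 1" for i
   using that hv(2) by (simp add: Vn_minus[OF hv] MF.minus_eq_zero_iff Vn_sel)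
  then show ?thesis unfolding e using hv by (simp add: Vfil_def)
 qed
 then show ?thesis using c by (simp add: Vf.shifts_def)
qed

lemma rho_works:
 assumes L: "isolated_family m L" and n: "1 \<le> n"
 shows "rho m n L \<in> alg_hom K (Cyl K A m n) (Vf.End n)" (is ?g1)
  and "[|i \<le> m; a \<in> carrier A|] ==> rho m n L (cg m n i a) = act n (L i) a" (is "PROP ?g2")
proof -
 have f: "\<forall>i\<le>m. act n (L i) \<in> alg_hom K A (Vf.End n)"
  using L by (simp add: isolated_family_def act_alg_hom)
 have d: "\<forall>i\<le>m. \<forall>a\<in>carrier A. act n (L i) a \<ominus>\<^bsub>Vf.End n\<^esub> act n (L 0) a \<in> Vf.shifts n 1"
  using L by (simp add: isolated_family_def act_diff_shifts)
 note cp = cyl_pair_works[where f = "\<lambda>i. act n (L i)", OF Vf.End_nu_algebra f Vf.shifts_ideal d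
   Vf.shifts_nilpotent[OF Vfil_top n]]
 show ?g1 using cp(1) by (simp add: rho_def[abs_def])
 show "PROP ?g2" using cp(2) by (simp add: rho_def)
qed

text \<open>Restriction along a coface selects the sequences of the copies in its image.\<close>

lemma rho_coface:
 assumes L: "isolated_family (Suc m) L" and n: "1 \<le> n" and X: "X \<in> carrier (Cyl K A m n)"
 shows "rho (Suc m) n L (cyl_coface K A j m n X) = rho m n (\<lambda>i. L (face_index j i)) X"
proof -
 have L': "isolated_family m (\<lambda>i. L (face_index j i))"
  using L by (simp add: isolated_family_def)
 show ?thesis
  by (rule Cyl_hom_eqI[OF Vf.End_nu_algebra alg_hom_comp[OF cyl_coface_works(1) rho_works(1)[OF L n]]
     rho_works(1)[OF L' n] _ X])
   (simp add: cyl_coface_works(2) rho_works(2)[OF L n] rho_works(2)[OF L' n])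
qed

abbreviation VM where "VM m n L \<equiv> Vf.End_module n (rho m n L)"

lemma VM_right_module: "[|isolated_family m L; 1 \<le> n|] ==> right_module (cyl_aug m n) (VM m n L)"
 by (rule Vf.End_module_right_module[OF Cyl_nu_algebra rho_works(1)])

definition single :: "nat \<Rightarrow> nat \<Rightarrow> ('k, 'a, 'e) form_ext \<Rightarrow> nat \<Rightarrow> ('k, 'a, 'e) form_ext" where
 "single n p u = (\<lambda>i. if i = p \<and> p < n then u else \<zero>\<^bsub>MF i\<^esub>)"

lemma single_closed: "u \<in> carrier (MF p) ==> single n p u \<in> carrier (Vn n)"
 by (auto simp: single_def Vn_sel)

lemma single_add:
 "[|u \<in> carrier (MF p); v \<in> carrier (MF p)|] ==>
  single n p (u \<oplus>\<^bsub>MF p\<^esub> v) = single n p u \<oplus>\<^bsub>Vn n\<^esub> single n p v"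
 by (rule ext) (auto simp: single_def Vn_sel)

lemma act_single:
 assumes l: "isolated l" and a: "a \<in> carrier A" and u: "u \<in> carrier (MF p)"
 shows "act n l a (single n p u) =
  single n p (u \<lhd>\<^bsub>MF p\<^esub> (a, \<zero>)) \<oplus>\<^bsub>Vn n\<^esub> single n (Suc p) (mcc p [l p \<odot>\<^bsub>A\<^esub> a] u)"
proof
 fix m
 have lp: "l i \<in> carrier K" for i using l by (simp add: isolated_def)
 have c: "u \<lhd>\<^bsub>MF p\<^esub> (a, \<zero>) \<in> carrier (MF p)"
  "mcc p [l p \<odot>\<^bsub>A\<^esub> a] u \<in> carrier (MF (Suc p))"
  using a u lp by (simp_all add: MF.ract_closed aug_elem msnoc_closed)
 have "act n l a (single n p u) m = (if n \<le> m then \<zero>\<^bsub>MF m\<^esub> else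
   case m of 0 \<Rightarrow> single n p u 0 \<lhd>\<^bsub>MF 0\<^esub> (a, \<zero>)
   | Suc q \<Rightarrow> single n p u (Suc q) \<lhd>\<^bsub>MF (Suc q)\<^esub> (a, \<zero>) \<oplus>\<^bsub>MF (Suc q)\<^esub>
     mcc q [l q \<odot>\<^bsub>A\<^esub> a] (single n p u q))"
  using single_closed[OF u, of n] by (simp add: act_def)
 also have "\<dots> = (single n p (u \<lhd>\<^bsub>MF p\<^esub> (a, \<zero>)) \<oplus>\<^bsub>Vn n\<^esub>
   single n (Suc p) (mcc p [l p \<odot>\<^bsub>A\<^esub> a] u)) m"
  using c a lp
  by (auto simp: single_def Vn_sel(3) MF.ract_zero_l aug_elem msnoc_zero split: nat.split)
 finally show "act n l a (single n p u) m = \<dots>" .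
qed

text \<open>A sequence with \<open>l\<^sub>0 = 0\<close> leaves \<open>E\<close> in degree 0 stable, so that \<open>e \<mapsto> e\<close> is linear along that copy and extends
  to a linear map \<open>det\<close> on the extension of scalars along it. These maps detect the components of elements
  of \<open>E \<otimes> Cyl\<close>.\<close>

definition base :: "nat \<Rightarrow> 'e \<Rightarrow> nat \<Rightarrow> ('k, 'a, 'e) form_ext" where
 "base n e = single n 0 (ftn 0 e (fm K A 0 \<one>\<^bsub>A1\<^esub> []))"

definition det :: "nat \<Rightarrow> nat \<Rightarrow> (nat \<Rightarrow> nat \<Rightarrow> 'k) \<Rightarrow> nat \<Rightarrow> ('k, 'a, 'e) cyl_ext \<Rightarrow> nat \<Rightarrow> ('k, 'a, 'e) form_ext" where
 "det m n L k = scalar_ext.ext_lift A1 E (gk m n k) (cyl_aug m n) (VM m n L) (base n)"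

lemma fm0_closed: "fm K A 0 \<one>\<^bsub>A1\<^esub> [] \<in> carrier (Om 0)"
 by (simp add: fm_closed)

lemma base_closed: "e \<in> carrier E ==> base n e \<in> carrier (Vn n)"
 by (simp add: base_def single_closed ft_closed fm0_closed)

lemma rho_gk:
 assumes L: "isolated_family m L" and n: "1 \<le> n" and "k \<le> m" "a \<in> carrier A" "c \<in> carrier K" "v \<in> carrier (Vn n)"
 shows "v \<lhd>\<^bsub>VM m n L\<^esub> gk m n k (a, c) = act n (L k) a v \<oplus>\<^bsub>Vn n\<^esub> c \<odot>\<^bsub>Vn n\<^esub> v"
 using assms by (simp add: aug_map_def Vf.End_module_sel rho_works(2))

lemma det_works:
 assumes L: "isolated_family m L" and n: "1 \<le> n" and k: "k \<le> m" "L k 0 = \<zero>"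
 shows "det m n L k \<in> rmod_hom (cyl_aug m n) (Ek m n k) (VM m n L)"
  and "[|e \<in> carrier E; b \<in> carrier (cyl_aug m n)|] ==>
   det m n L k (ek m n k e b) = base n e \<lhd>\<^bsub>VM m n L\<^esub> b"
proof -
 interpret S: scalar_ext "A1" E "gk m n k" "cyl_aug m n" by (rule gk_ext[OF k(1)])
 have Lk: "isolated (L k)" using L k by (simp add: isolated_family_def)
 have h: "base n \<in> add_homs E (VM m n L)"
  by (rule add_homs_I)
   (simp_all add: Vf.End_module_sel base_def ft_add_l fm0_closed single_add single_closed ft_closed)
 have semi: "base n (e \<lhd>\<^bsub>E\<^esub> a) = base n e \<lhd>\<^bsub>VM m n L\<^esub> gk m n k a"
  if e: "e \<in> carrier E" and a: "a \<in> carrier A1" for e a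
 proof -
  obtain r c where rc: "a = (r, c)" "r \<in> carrier A" "c \<in> carrier K" using a by (auto simp: aug_sel)
  let ?w = "ftn 0 e (fm K A 0 \<one>\<^bsub>A1\<^esub> [])"
  have w: "?w \<in> carrier (MF 0)" using e by (simp add: ft_closed fm0_closed)
  have wa: "fm K A 0 \<one>\<^bsub>A1\<^esub> [] \<lhd>\<^bsub>Om 0\<^esub> a = a \<rhd>\<^bsub>Om 0\<^esub> fm K A 0 \<one>\<^bsub>A1\<^esub> []"
  proof -
   have "fm K A 0 \<one>\<^bsub>A1\<^esub> [] \<lhd>\<^bsub>Om 0\<^esub> a =
     fm K A 0 (emb c) [] \<oplus>\<^bsub>Om 0\<^esub> fm K A 0 (r, \<zero>) []"
    using ract_eq[OF a fm0_closed] rc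
    by (simp add: lact_works(2) aug_scalar aug_elem rmul_works(2) mul_word_Nil)
   also have "\<dots> = fm K A 0 a []"
    using rc fmD(2)[OF aug_elem aug_scalar, of r c "[]" 0] aug_split[OF rc(2,3)]
     fmD(1)[OF aug_elem, of r "[]" 0] fmD(1)[OF aug_scalar, of c "[]" 0]
    by (simp add: Om.a_comm)
   finally show ?thesis using a by (simp add: lact_works(2))
  qed
  have sm: "c \<odot>\<^bsub>Vn n\<^esub> single n 0 ?w = single n 0 (?w \<lhd>\<^bsub>MF 0\<^esub> (emb c))"
   by (rule ext) (use rc in \<open>auto simp: Vn_sel single_def MF.ract_zero_l aug_scalar\<close>)
  have z: "single n (Suc 0) (mcc 0 [\<zero>\<^bsub>A\<^esub>] ?w) = \<zero>\<^bsub>Vn n\<^esub>"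
   using rc w by (intro ext) (auto simp: single_def Vn_sel msnoc_zero_r)
  have "base n e \<lhd>\<^bsub>VM m n L\<^esub> gk m n k a =
    single n 0 (?w \<lhd>\<^bsub>MF 0\<^esub> (r, \<zero>)) \<oplus>\<^bsub>Vn n\<^esub> single n 0 (?w \<lhd>\<^bsub>MF 0\<^esub> (emb c))"
   using rho_gk[OF L n k(1) rc(2,3) base_closed[OF e]] act_single[OF Lk rc(2) w, of n] rc w
   by (simp add: base_def sm k(2) z single_closed MF.ract_closed aug_elem)
  also have "\<dots> = single n 0 (?w \<lhd>\<^bsub>MF 0\<^esub> a)"
   using w rc aug_split[OF rc(2,3)]
   by (simp add: MF.ract_r_distr aug_elem aug_scalar MF.ract_closed flip: single_add)
  also have "?w \<lhd>\<^bsub>MF 0\<^esub> a = ftn 0 (e \<lhd>\<^bsub>E\<^esub> a) (fm K A 0 \<one>\<^bsub>A1\<^esub> [])"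
   using e a by (simp add: ft_ract fm0_closed wa ft_bal)
  finally show ?thesis by (simp add: base_def)
 qed
 note l = S.ext_lift_works[OF VM_right_module[OF L n] h semi, folded det_def]
 show "det m n L k \<in> rmod_hom (cyl_aug m n) S.X (VM m n L)" by (rule l(1))
 show "[|e \<in> carrier E; b \<in> carrier (cyl_aug m n)|] ==> det m n L k (S.et e b) = base n e \<lhd>\<^bsub>VM m n L\<^esub> b"
  by (rule l(2))
qed

text \<open>For recognising a composite of a linear map with \<open>det\<close> as another instance of \<open>det\<close>.\<close>

lemma det_unique:
 assumes L: "isolated_family m L" and n: "1 \<le> n" and k: "k \<le> m" "L k 0 = \<zero>"
  and g: "g \<in> add_homs (Ek m n k) (VM m n L)"
  and lin: "\<And>x b. [|x \<in> carrier (Ek m n k); b \<in> carrier (cyl_aug m n)|] ==>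
   g (x \<lhd>\<^bsub>Ek m n k\<^esub> b) = g x \<lhd>\<^bsub>VM m n L\<^esub> b"
  and b: "\<And>e. e \<in> carrier E ==>
   g (ek m n k e \<one>\<^bsub>cyl_aug m n\<^esub>) = base n e"
  and t: "t \<in> carrier (Ek m n k)"
 shows "g t = det m n L k t"
proof -
 interpret S: scalar_ext "A1" E "gk m n k" "cyl_aug m n" by (rule gk_ext[OF k(1)])
 interpret VM: right_module "cyl_aug m n" "VM m n L" by (rule VM_right_module[OF L n])
 note T = det_works[OF L n k]
 show ?thesis
  by (rule S.ext_lin_eqI[OF VM.right_module_axioms g rmod_homD(1)[OF T(1)] lin rmod_homD(3)[OF T(1)] _ t])
   (simp_all add: b T(2) VM.ract_one Vf.End_module_sel(1) base_closed)
qed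

lemma det_coface:
 assumes L: "isolated_family (Suc m) L" and n: "1 \<le> n" and k: "k \<le> m" "L (face_index j k) 0 = \<zero>"
  and sc: "scalar_ext2 A1 E (gk m n k) (cyl_aug m n) (aug_map (cyl_coface K A j m n))
   (gk (Suc m) n (face_index j k)) (cyl_aug (Suc m) n)"
  and t: "t \<in> carrier (Ek m n k)"
 shows "det (Suc m) n L (face_index j k) (ext_change E A1 (gk m n k) (cyl_aug m n)
   (aug_map (cyl_coface K A j m n)) (gk (Suc m) n (face_index j k)) (cyl_aug (Suc m) n) t) =
  det m n (\<lambda>i. L (face_index j i)) k t"
proof -
 interpret S: scalar_ext2 "A1" E "gk m n k" "cyl_aug m n" "aug_map (cyl_coface K A j m n)"
  "gk (Suc m) n (face_index j k)" "cyl_aug (Suc m) n" by (rule sc)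
 have L': "isolated_family m (\<lambda>i. L (face_index j i))" using L by (simp add: isolated_family_def)
 have kj: "face_index j k \<le> Suc m" using k by simp
 note T = det_works[OF L n kj k(2)] and T' = det_works[where L = "\<lambda>i. L (face_index j i)", OF L' n k]
 have VMeq: "add_homs X (VM (Suc m) n L) = add_homs X (VM m n (\<lambda>i. L (face_index j i)))"
  for X :: "('q, 'r) ring_scheme"
  by (simp add: hom_def Vf.End_module_sel)
 show ?thesis
 proof (rule S.P.ext_hom_eqI[OF add_homs_comp[OF S.ch_works(1) rmod_homD(1)[OF T(1)]] _ _ t])
  show "det m n (\<lambda>i. L (face_index j i)) k \<in> add_homs S.P.X (VM (Suc m) n L)"
   unfolding VMeq by (rule rmod_homD(1)[OF T'(1)])
  fix e b assume e: "e \<in> carrier E" and b: "b \<in> carrier (cyl_aug m n)"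
  then obtain X c where X: "b = (X, c)" "X \<in> carrier (Cyl K A m n)" "c \<in> carrier K" by (auto simp: aug_sel)
  have bc: "aug_map (cyl_coface K A j m n) b \<in> carrier (cyl_aug (Suc m) n)" using S.\<psi>D(1)[OF b] .
  show "det (Suc m) n L (face_index j k) (S.ch (S.P.et e b)) =
    det m n (\<lambda>i. L (face_index j i)) k (S.P.et e b)"
   using e b bc X
   by (simp add: S.ch_works(2) T(2) T'(2)) (simp add: aug_map_def Vf.End_module_sel rho_coface[OF L n])
 qed
qed

text \<open>On \<open>e \<otimes> \<delta>(a\<^sub>1) \<dots> \<delta>(a\<^sub>q)\<close>, the value is a multiple of \<open>e \<otimes> da\<^sub>1 \<dots> da\<^sub>q\<close>.\<close>

primrec kappa :: "(nat \<Rightarrow> 'k) \<Rightarrow> nat \<Rightarrow> 'k" where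
 "kappa l 0 = \<one>"
| "kappa l (Suc q) = kappa l q \<otimes> l q"

lemma kappa_closed: "(\<And>p. l p \<in> carrier K) ==> kappa l q \<in> carrier K"
 by (induction q) auto

definition PsiC :: "nat \<Rightarrow> nat \<Rightarrow> nat \<Rightarrow> nat \<Rightarrow> nat \<Rightarrow> ('k, 'a, 'e) form_ext \<Rightarrow> ('k, 'a, 'e) cyl_ext" where
 "PsiC m n k j q = scalar_form.Psi K A E (gk m n k) (cyl_aug m n)
   (replicate q (hdiff K (cyl_aug m n) (gk m n k) (gk m n j)))"

lemma PsiC_works:
 assumes "k \<le> m" "j \<le> m"
 shows "PsiC m n k j q \<in> add_homs (MF q) (Ek m n k)"
  and "[|e \<in> carrier E; set as \<subseteq> carrier A; length as = q|] ==>
   PsiC m n k j q (ftn q e (fm K A q \<one>\<^bsub>A1\<^esub> as)) =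
   ek m n k e
    (word_prod (cyl_aug m n) (replicate q (hdiff K (cyl_aug m n) (gk m n k) (gk m n j))) as)"
proof -
 interpret T: two_homs K A E "gk m n k" "cyl_aug m n" "gk m n j" by (rule gk_two[OF assms])
 have ds: "\<forall>d\<in>set (replicate q T.dl). T.kder d" by (simp add: T.dl_kder)
 show "PsiC m n k j q \<in> add_homs (MF q) T.S.X"
  using T.Psi_works(1)[OF ds] by (simp add: PsiC_def)
 show "[|e \<in> carrier E; set as \<subseteq> carrier A; length as = q|] ==>
   PsiC m n k j q (ftn q e (fm K A q \<one>\<^bsub>A1\<^esub> as)) =
   T.S.et e (word_prod (cyl_aug m n) (replicate q T.dl) as)"
  using T.Psi_word[OF ds] by (simp add: PsiC_def)
qed

lemmas PsiC_closed = add_homs_closed[OF PsiC_works(1)]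
lemmas PsiC_add = add_homs_add[OF PsiC_works(1)]

text \<open>The two copies act on a form \<open>v\<close> of degree \<open>p\<close> by \<open>va + l\<^sub>p v da\<close> and \<open>va + l'\<^sub>p v da\<close>, so their difference
acts by \<open>(l'\<^sub>p - l\<^sub>p) v da\<close>; a product of \<open>q\<close> differences collects \<open>q\<close> such factors.\<close>

lemma det_PsiC:
 assumes L: "isolated_family m L" and n: "1 \<le> n" and k: "k \<le> m" "L k 0 = \<zero>" and j: "j \<le> m"
  and u: "u \<in> carrier (MF q)"
 shows "det m n L k (PsiC m n k j q u) =
  single n q (u \<lhd>\<^bsub>MF q\<^esub> (\<zero>\<^bsub>A\<^esub>, kappa (\<lambda>p. L j p \<ominus> L k p) q))"
proof -
 interpret T: two_homs K A E "gk m n k" "cyl_aug m n" "gk m n j" by (rule gk_two[OF k(1) j])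
 interpret VM: right_module "cyl_aug m n" "VM m n L" by (rule VM_right_module[OF L n])
 note D = det_works[OF L n k]
 note Dh = rmod_homD[OF D(1)]
 let ?l = "\<lambda>p. L j p \<ominus> L k p"
 have Lc: "L i p \<in> carrier K" if "i \<le> m" for i p using L that by (simp add: isolated_family_def isolated_def)
 have lc: "?l p \<in> carrier K" for p
  using Lc[OF k(1)] Lc[OF j] ring.ring_simprules(4)[OF K_ring] by blast
 have kc: "kappa ?l q \<in> carrier K" for q by (rule kappa_closed) (rule lc)
 have VMadd: "add (VM m n L) = add (Vn n)" and VMc: "carrier (VM m n L) = carrier (Vn n)"
  by (simp_all add: Vf.End_module_sel)
 have right: "(\<lambda>u. single n q (u \<lhd>\<^bsub>MF q\<^esub> (\<zero>\<^bsub>A\<^esub>, kappa ?l q))) \<in> add_homs (MF q) (VM m n L)" for q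
  by (rule add_homs_I)
   (simp_all add: VMadd VMc single_closed MF.ract_closed aug_scalar kc MF.ract_l_distr single_add)
 have left: "(\<lambda>u. det m n L k (PsiC m n k j q u)) \<in> add_homs (MF q) (VM m n L)" for q
  by (rule add_homs_comp[OF PsiC_works(1)[OF k(1) j] Dh(1)])
 have d_single: "single n p u \<lhd>\<^bsub>VM m n L\<^esub> T.dl y = single n (Suc p) (mcc p [?l p \<odot>\<^bsub>A\<^esub> y] u)"
  if u: "u \<in> carrier (MF p)" and y: "y \<in> carrier A" for u p y
 proof -
  let ?s = "single n p u"
  have s: "?s \<in> carrier (Vn n)" by (rule single_closed[OF u])
  have iso: "isolated (L j)" "isolated (L k)" using L j k by (simp_all add: isolated_family_def)
  have g: "gk m n j (y, \<zero>) \<in> carrier (cyl_aug m n)" "gk m n k (y, \<zero>) \<in> carrier (cyl_aug m n)"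
   using T.\<beta>D(1) T.S.\<phi>D(1) y by (auto simp: aug_elem)
  have z: "\<zero> \<odot>\<^bsub>Vn n\<^esub> ?s = \<zero>\<^bsub>Vn n\<^esub>" using s by simp
  have a: "?s \<lhd>\<^bsub>VM m n L\<^esub> gk m n i (y, \<zero>) = act n (L i) y ?s" if "i \<le> m" for i
  proof -
   have "act n (L i) y ?s \<in> carrier (Vn n)"
    using Vf.EndD(1)[OF act_closed s] L y that by (simp add: isolated_family_def)
   then show ?thesis using rho_gk[OF L n that y _ s, of \<zero>] z by simp
  qed
  have mc: "mcc p [l \<odot>\<^bsub>A\<^esub> y] u \<in> carrier (MF (Suc p))" if "l \<in> carrier K" for l
   using that u y by (simp add: msnoc_closed)
  have ac: "act n (L i) y ?s \<in> carrier (Vn n)" if "i \<le> m" for i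
   using Vf.EndD(1)[OF act_closed s] L y that by (simp add: isolated_family_def)
  have mh: "(\<lambda>b. mcc p [b] u) \<in> add_homs A (MF (Suc p))"
   by (rule add_homs_I) (simp_all add: msnoc_closed msnoc_add_r u)
  have sh: "single n (Suc p) \<in> add_homs (MF (Suc p)) (Vn n)"
   by (rule add_homs_I) (simp_all add: single_closed single_add)
  have add_cancel: "(s \<oplus>\<^bsub>Vn n\<^esub> t) \<ominus>\<^bsub>Vn n\<^esub> (s \<oplus>\<^bsub>Vn n\<^esub> t') = t \<ominus>\<^bsub>Vn n\<^esub> t'"
   if "s \<in> carrier (Vn n)" "t \<in> carrier (Vn n)" "t' \<in> carrier (Vn n)" for s t t'
   by (rule Vf.M.add_diff_cancel[OF that])
  have mm: "mcc p [L j p \<odot>\<^bsub>A\<^esub> y] u \<ominus>\<^bsub>MF (Suc p)\<^esub> mcc p [L k p \<odot>\<^bsub>A\<^esub> y] u = mcc p [?l p \<odot>\<^bsub>A\<^esub> y] u"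
  proof -
   have "?l p \<odot>\<^bsub>A\<^esub> y = L j p \<odot>\<^bsub>A\<^esub> y \<ominus>\<^bsub>A\<^esub> L k p \<odot>\<^bsub>A\<^esub> y"
    using Lc[OF k(1), of p] Lc[OF j, of p] y
    by (simp add: a_minus_def smult_l_distr smult_l_minus)
   then show ?thesis
    using add_homs_minus[OF M.abelian_group_axioms MF.abelian_group_axioms mh] Lc[OF k(1), of p] Lc[OF j, of p] y
    by simp
  qed
  have "?s \<lhd>\<^bsub>VM m n L\<^esub> T.dl y = act n (L j) y ?s \<ominus>\<^bsub>Vn n\<^esub> act n (L k) y ?s"
   using s g a[OF j] a[OF k(1)] VM.ract_minus[of ?s "gk m n j (y, \<zero>)" "gk m n k (y, \<zero>)"]
   by (simp add: hdiff_def Vf.End_module_sel(1) Vf.End_module_minus)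
  also have "\<dots> = single n (Suc p) (mcc p [L j p \<odot>\<^bsub>A\<^esub> y] u) \<ominus>\<^bsub>Vn n\<^esub> single n (Suc p) (mcc p [L k p \<odot>\<^bsub>A\<^esub> y] u)"
   using u y mc[OF Lc[OF j]] mc[OF Lc[OF k(1)]] MF.ract_closed[OF u aug_elem[OF y]]
   by (simp add: act_single[OF iso(1) y u] act_single[OF iso(2) y u] add_cancel single_closed)
  also have "\<dots> = single n (Suc p) (mcc p [?l p \<odot>\<^bsub>A\<^esub> y] u)"
   using add_homs_minus[OF MF.abelian_group_axioms Vf.M.abelian_group_axioms sh mc[OF Lc[OF j, of p]] mc[OF Lc[OF k(1), of p]]]
   unfolding mm by (rule sym)
  finally show ?thesis .
 qed
 have word: "det m n L k (PsiC m n k j q (ftn q e (fm K A q \<one>\<^bsub>A1\<^esub> as))) =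
   single n q (ftn q e (fm K A q \<one>\<^bsub>A1\<^esub> as) \<lhd>\<^bsub>MF q\<^esub> (\<zero>\<^bsub>A\<^esub>, kappa ?l q))"
  if e: "e \<in> carrier E" and as: "set as \<subseteq> carrier A" "length as = q" for e as q
  using as
 proof (induction as arbitrary: q rule: rev_induct)
  case Nil
  have o: "(emb \<one>) = \<one>\<^bsub>A1\<^esub>" by (simp add: aug_sel)
  show ?case
   using Nil e D(2)[of e "\<one>\<^bsub>cyl_aug m n\<^esub>"]
   by (simp add: PsiC_works(2)[OF k(1) j] o MF.ract_one ft_closed fm0_closed VM.ract_one
     Vf.End_module_sel(1) base_closed) (simp add: base_def)
 next
  case (snoc y as)
  let ?p = "length as"
  let ?w = "ftn ?p e (fm K A ?p \<one>\<^bsub>A1\<^esub> as)"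
  have q: "q = Suc ?p" and as: "set as \<subseteq> carrier A" and y: "y \<in> carrier A" using snoc.prems by auto
  have f: "fm K A ?p \<one>\<^bsub>A1\<^esub> as \<in> carrier (Om ?p)" using as by (simp add: fm_closed)
  have w: "?w \<in> carrier (MF ?p)" using e f by (simp add: ft_closed)
  have next_w: "mcc ?p [y] ?w = ftn q e (fm K A q \<one>\<^bsub>A1\<^esub> (as @ [y]))"
   using e f y as by (simp add: q msnoc_ft snoc_fm)
  have "PsiC m n k j q (ftn q e (fm K A q \<one>\<^bsub>A1\<^esub> (as @ [y]))) =
    PsiC m n k j ?p ?w \<lhd>\<^bsub>T.S.X\<^esub> T.dl y"
  proof -
   have ds: "\<forall>d\<in>set (replicate ?p T.dl). T.kder d" by (simp add: T.dl_kder)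
   show ?thesis
    using T.Psi_mcc[OF ds T.dl_kder y, of ?w] w
    by (simp add: PsiC_def flip: next_w) (simp add: q replicate_append_same)
  qed
  then have "det m n L k (PsiC m n k j q (ftn q e (fm K A q \<one>\<^bsub>A1\<^esub> (as @ [y])))) =
    single n ?p (?w \<lhd>\<^bsub>MF ?p\<^esub> (\<zero>\<^bsub>A\<^esub>, kappa ?l ?p)) \<lhd>\<^bsub>VM m n L\<^esub> T.dl y"
   using snoc.IH[OF as refl] w y PsiC_closed[OF k(1) j w] by (simp add: Dh(3) T.dl_closed)
  also have "\<dots> = single n q (mcc ?p [?l ?p \<odot>\<^bsub>A\<^esub> y] (?w \<lhd>\<^bsub>MF ?p\<^esub> (\<zero>\<^bsub>A\<^esub>, kappa ?l ?p)))"
   using d_single[OF _ y] w kc by (simp add: q MF.ract_closed aug_scalar)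
  also have "mcc ?p [?l ?p \<odot>\<^bsub>A\<^esub> y] (?w \<lhd>\<^bsub>MF ?p\<^esub> (\<zero>\<^bsub>A\<^esub>, kappa ?l ?p)) =
    mcc ?p [kappa ?l q \<odot>\<^bsub>A\<^esub> y] ?w"
   using msnoc_scal(1)[of "?l ?p \<odot>\<^bsub>A\<^esub> y" "kappa ?l ?p" ?w ?p] lc kc w y
   by (simp add: q smult_assoc1)
  also have "\<dots> = mcc ?p [y] ?w \<lhd>\<^bsub>MF q\<^esub> (\<zero>\<^bsub>A\<^esub>, kappa ?l q)"
   using msnoc_scal(2)[OF y kc w, of q] by (simp only: q)
  finally show ?case by (simp add: next_w)
 qed
 show ?thesis by (rule mf_word_eqI[OF left right word u])
qed

text \<open>For these two sequences all the differences \<open>l'\<^sub>p - l\<^sub>p\<close> are 1, so no information is lost: an element of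
  \<open>E \<otimes> Cyl\<^sup>1\<close> is the sum of the elements which correspond to its components.\<close>

definition L_odd :: "nat \<Rightarrow> 'k" where "L_odd p = (if odd p then \<ominus> \<one> else \<zero>)"
definition L_even :: "nat \<Rightarrow> 'k" where "L_even p = (if even p then \<one> else \<zero>)"

lemma isolated_parity: "isolated L_odd" "isolated L_even"
 by (auto simp: isolated_def L_odd_def L_even_def)

definition comps :: "nat \<Rightarrow> ('k, 'a, 'e) cyl_ext \<Rightarrow> nat \<Rightarrow> ('k, 'a, 'e) form_ext" where
 "comps n = det 1 n (\<lambda>i. if i = 0 then L_odd else L_even) 0"

primrec psum :: "nat \<Rightarrow> (nat \<Rightarrow> ('k, 'a, 'e) form_ext) \<Rightarrow> nat \<Rightarrow> ('k, 'a, 'e) cyl_ext" where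
 "psum n v 0 = \<zero>\<^bsub>Ek 1 n 0\<^esub>"
| "psum n v (Suc q) = psum n v q \<oplus>\<^bsub>Ek 1 n 0\<^esub> PsiC 1 n 0 1 q (v q)"

lemma L_alt: "isolated_family 1 (\<lambda>i. if i = 0 then L_odd else L_even)"
 by (simp add: isolated_family_def isolated_parity)

lemma comps_works:
 assumes "1 \<le> n"
 shows "comps n \<in> add_homs (Ek 1 n 0) (Vn n)"
proof -
 have "L_odd 0 = \<zero>" by (simp add: L_odd_def)
 then have "comps n \<in> add_homs (Ek 1 n 0) (VM 1 n (\<lambda>i. if i = 0 then L_odd else L_even))"
  unfolding comps_def by (intro rmod_homD(1)[OF det_works(1)[OF L_alt assms]]) auto
 then show ?thesis by (simp add: hom_def Vf.End_module_sel)
qed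

lemma comps_PsiC:
 assumes n: "1 \<le> n" and u: "u \<in> carrier (MF q)"
 shows "comps n (PsiC 1 n 0 1 q u) = single n q u"
proof -
 have d: "(\<lambda>p. L_even p \<ominus> L_odd p) = (\<lambda>p. \<one>)"
 proof
  fix p
  have 1: "\<one> \<ominus> \<zero> = \<one>" "\<zero> \<ominus> \<ominus> \<one> = \<one>"
   using ring.ring_simprules[OF K_ring] by (simp_all add: a_minus_def)
  show "L_even p \<ominus> L_odd p = \<one>"
   using 1 by (simp add: L_even_def L_odd_def)
 qed
 have k: "kappa (\<lambda>p. \<one>) q = \<one>" by (induction q) auto
 have o: "(emb \<one>) = \<one>\<^bsub>A1\<^esub>" by (simp add: aug_sel)
 have "comps n (PsiC 1 n 0 1 q u) =
   single n q (u \<lhd>\<^bsub>MF q\<^esub> (\<zero>\<^bsub>A\<^esub>, kappa (\<lambda>p. L_even p \<ominus> L_odd p) q))"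
  using det_PsiC[OF L_alt n _ _ _ u, of 0 1] by (simp add: comps_def L_odd_def[of 0])
 also have "\<dots> = single n q u" unfolding d k o using u by (simp add: MF.ract_one)
 finally show ?thesis .
qed

lemma psum_closed: "v \<in> carrier (Vn n) ==> psum n v q \<in> carrier (Ek 1 n 0)"
proof -
 interpret S: scalar_ext "A1" E "gk 1 n 0" "cyl_aug 1 n" by (rule gk_ext) simp
 assume "v \<in> carrier (Vn n)"
 then show ?thesis by (induction q) (auto simp: Vn_sel intro!: PsiC_closed)
qed

lemma psum_add:
 assumes "v \<in> carrier (Vn n)" "w \<in> carrier (Vn n)"
 shows "psum n (v \<oplus>\<^bsub>Vn n\<^esub> w) q = psum n v q \<oplus>\<^bsub>Ek 1 n 0\<^esub> psum n w q"
proof (induction q)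
 interpret S: scalar_ext "A1" E "gk 1 n 0" "cyl_aug 1 n" by (rule gk_ext) simp
 case 0
 show ?case by simp
next
 interpret S: scalar_ext "A1" E "gk 1 n 0" "cyl_aug 1 n" by (rule gk_ext) simp
 case (Suc q)
 have "v q \<in> carrier (MF q)" "w q \<in> carrier (MF q)" using assms by (simp_all add: Vn_sel)
 moreover have "(v \<oplus>\<^bsub>Vn n\<^esub> w) q = v q \<oplus>\<^bsub>MF q\<^esub> w q" by (simp add: Vn_sel)
 ultimately show ?case
  using Suc psum_closed[OF assms(1), of q] psum_closed[OF assms(2), of q]
  by (simp add: PsiC_add PsiC_closed S.X.a_ac)
qed

lemma psum_single:
 assumes u: "u \<in> carrier (MF p)"
 shows "psum n (single n p u) q =
  (if p < q \<and> p < n then PsiC 1 n 0 1 p u else \<zero>\<^bsub>Ek 1 n 0\<^esub>)"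
proof (induction q)
 interpret S: scalar_ext "A1" E "gk 1 n 0" "cyl_aug 1 n" by (rule gk_ext) simp
 case 0
 show ?case by simp
next
 interpret S: scalar_ext "A1" E "gk 1 n 0" "cyl_aug 1 n" by (rule gk_ext) simp
 case (Suc q)
 have z: "PsiC 1 n 0 1 q \<zero>\<^bsub>MF q\<^esub> = \<zero>\<^bsub>S.X\<^esub>"
  by (rule add_homs_zero[OF MF.abelian_group_axioms S.X.abelian_group_axioms PsiC_works(1)]) simp_all
 have "PsiC 1 n 0 1 p u \<in> carrier S.X" using PsiC_closed[OF _ _ u, of 0 1 1 n] by simp
 then show ?case
  using Suc z by (cases "q = p") (auto simp: single_def)
qed

text \<open>Additive in \<open>t\<close>, so that it suffices to look at the elements \<open>e \<otimes> \<delta>(a\<^sub>1) \<dots> \<delta>(a\<^sub>q)\<close>; for \<open>q \<ge> n\<close> these vanish.\<close>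

lemma psum_comps:
 assumes n: "1 \<le> n" and t: "t \<in> carrier (Ek 1 n 0)"
 shows "psum n (comps n t) n = t"
proof -
 interpret T: two_homs K A E "gk 1 n 0" "cyl_aug 1 n" "gk 1 n 1" by (rule gk_two) simp_all
 note ch = comps_works[OF n]
 have "t \<in> T.words" by (rule cyl1_words[OF t])
 then show ?thesis
 proof (induction rule: T.words.induct)
  case (words_gen e ys)
  let ?q = "length ys"
  let ?w = "ftn ?q e (fm K A ?q \<one>\<^bsub>A1\<^esub> ys)"
  have w: "?w \<in> carrier (MF ?q)" using words_gen by (simp add: ft_closed fm_closed)
  have P: "PsiC 1 n 0 1 ?q ?w = T.S.et e (word_prod (cyl_aug 1 n) (replicate ?q T.dl) ys)"
   using PsiC_works(2)[of 0 1 1 e ys ?q n] words_gen by simp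
  have "psum n (comps n (PsiC 1 n 0 1 ?q ?w)) n = PsiC 1 n 0 1 ?q ?w"
  proof (cases "?q < n")
   case True
   then show ?thesis by (simp add: comps_PsiC[OF n w] psum_single[OF w])
  next
   case False
   then have "word_prod (cyl_aug 1 n) (replicate ?q T.dl) ys = \<zero>\<^bsub>cyl_aug 1 n\<^esub>"
    using gk_word_zero[of 0 1 1 n ys] n words_gen by simp
   then have "PsiC 1 n 0 1 ?q ?w = \<zero>\<^bsub>T.S.X\<^esub>" using P words_gen by (simp add: T.S.et_zero_r)
   then show ?thesis using False comps_PsiC[OF n w] psum_single[OF w, of n n] by simp
  qed
  then show ?case by (simp only: P)
 next
  case (words_add s t)
  then show ?case
   using T.words_closed add_homs_closed[OF ch]
   by (simp add: add_homs_add[OF ch] psum_add)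
 qed
qed

lemma det_psum:
 assumes L: "isolated_family 1 L" and n: "1 \<le> n" and L0: "L 0 0 = \<zero>" and v: "v \<in> carrier (Vn n)"
 shows "det 1 n L 0 (psum n v q) i = (if i < q \<and> i < n
  then v i \<lhd>\<^bsub>MF i\<^esub> (\<zero>\<^bsub>A\<^esub>, kappa (\<lambda>p. L 1 p \<ominus> L 0 p) i) else \<zero>\<^bsub>MF i\<^esub>)"
proof (induction q)
 interpret S: scalar_ext "A1" E "gk 1 n 0" "cyl_aug 1 n" by (rule gk_ext) simp
 note D = rmod_homD(1)[OF det_works(1)[OF L n le0 L0]]
 case 0
 have "det 1 n L 0 \<zero>\<^bsub>S.X\<^esub> = \<zero>\<^bsub>Vn n\<^esub>"
  using add_homs_zero[OF S.X.abelian_group_axioms Vf.End_module_abelian_group D] by (simp add: Vf.End_module_sel)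
 then show ?case by (simp add: Vn_sel)
next
 interpret S: scalar_ext "A1" E "gk 1 n 0" "cyl_aug 1 n" by (rule gk_ext) simp
 note D = rmod_homD(1)[OF det_works(1)[OF L n le0 L0]]
 case (Suc q)
 have vq: "v q \<in> carrier (MF q)" using v by (simp add: Vn_sel)
 have P: "PsiC 1 n 0 1 q (v q) \<in> carrier S.X" using PsiC_closed[OF _ _ vq, of 0 1 1 n] by simp
 have "det 1 n L 0 (psum n v (Suc q)) = det 1 n L 0 (psum n v q) \<oplus>\<^bsub>Vn n\<^esub> det 1 n L 0 (PsiC 1 n 0 1 q (v q))"
  using add_homs_add[OF D psum_closed[OF v] P] by (simp add: Vf.End_module_sel)
 moreover have "det 1 n L 0 (PsiC 1 n 0 1 q (v q)) =
   single n q (v q \<lhd>\<^bsub>MF q\<^esub> (\<zero>\<^bsub>A\<^esub>, kappa (\<lambda>p. L 1 p \<ominus> L 0 p) q))"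
  using det_PsiC[OF L n _ L0 _ vq, of 1] by simp
 moreover have "v i \<lhd>\<^bsub>MF i\<^esub> (\<zero>\<^bsub>A\<^esub>, kappa (\<lambda>p. L 1 p \<ominus> L 0 p) i) \<in> carrier (MF i)" for i
 proof -
  have "L j p \<in> carrier K" if "j \<le> 1" for j p using L that by (simp add: isolated_family_def isolated_def)
  then have "L 1 p \<ominus> L 0 p \<in> carrier K" for p using ring.ring_simprules(4)[OF K_ring] by simp
  then show ?thesis using v by (simp add: Vn_sel MF.ract_closed aug_scalar kappa_closed)
 qed
 ultimately show ?case using Suc by (auto simp: Vn_sel(3) single_def less_Suc_eq)
qed

end

section \<open>Stratifications in terms of the copies of the algebra\<close>

lemma ext_change_cong:
 assumes "\<And>a. a \<in> carrier A ==> \<phi> a = \<phi>' a" "\<And>a. a \<in> carrier A ==> \<chi> a = \<chi>' a"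
 shows "ext_change E A \<phi> B \<psi> \<chi> C = ext_change E A \<phi>' B \<psi> \<chi>' C"
  and "ext_trans E A \<phi> B \<psi> \<chi> C = ext_trans E A \<phi>' B \<psi> \<chi>' C" (is ?g1)
proof -
 note 1 = ring_bimodule_cong(2)[of A \<phi> \<phi>', OF assms(1)] and 2 = ext_scal_cong[of A \<phi> \<phi>', OF assms(1)]
  and 3 = ext_scal_cong[of A \<chi> \<chi>', OF assms(2)]
 show c: "ext_change E A \<phi> B \<psi> \<chi> C = ext_change E A \<phi>' B \<psi> \<chi>' C"
  by (intro ext) (simp only: ext_change_def 1 3)
 show ?g1
  by (intro ext) (simp only: ext_trans_def c 2 3)
qed

context form_module
begin

abbreviation coch where "coch j n k i \<equiv> ext_change E A1 (gk 1 n k) (cyl_aug 1 n)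
 (face1 K A j n) (gk 2 n i) (cyl_aug 2 n)"
abbreviation prch where "prch n k \<equiv> ext_change E A1 (gk 1 (Suc n) k) (cyl_aug 1 (Suc n))
 (aug_map (cyl_proj K A 1 n)) (gk 1 n k) (cyl_aug 1 n)"

lemma face0_gk:
 assumes "a \<in> carrier A1"
 shows "face0 K A 0 n a = gk 1 n 1 a" and "face0 K A 1 n a = gk 1 n 0 a"
proof -
 obtain r c where "a = (r, c)" "r \<in> carrier A" using assms by (auto simp: aug_sel)
 then show "face0 K A 0 n a = gk 1 n 1 a" and "face0 K A 1 n a = gk 1 n 0 a"
  by (simp_all add: aug_map_def cyl_coface0_eq One_nat_def)
qed

lemma face1_gk:
 "[|a \<in> carrier A1; k \<le> 1; i = face_index j k|] ==> face1 K A j n (gk 1 n k a) = gk 2 n i a"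
 using cyl_coface_works(2)[of k 1 "fst a" j n] by (auto simp: aug_map_def aug_sel split: prod.splits)

lemma sc_coface:
 assumes "k \<le> 1" "i = face_index j k"
 shows "scalar_ext2 A1 E (gk 1 n k) (cyl_aug 1 n) (face1 K A j n) (gk 2 n i) (cyl_aug 2 n)"
proof (intro scalar_ext2.intro scalar_ext2_axioms.intro gk_ext)
 show "face1 K A j n \<in> ring_hom (cyl_aug 1 n) (cyl_aug 2 n)"
  using aug_map_ring_hom[OF Cyl_nu_algebra Cyl_nu_algebra cyl_coface_works(1)[of j 1 n]] by simp
qed (use assms face1_gk in auto)

lemma sc_proj:
 assumes "k \<le> 1"
 shows "scalar_ext2 A1 E (gk 1 (Suc n) k) (cyl_aug 1 (Suc n)) (aug_map (cyl_proj K A 1 n))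
  (gk 1 n k) (cyl_aug 1 n)"
proof (intro scalar_ext2.intro scalar_ext2_axioms.intro gk_ext assms)
 show "aug_map (cyl_proj K A 1 n) \<in> ring_hom (cyl_aug 1 (Suc n)) (cyl_aug 1 n)"
  by (rule aug_map_ring_hom[OF Cyl_nu_algebra Cyl_nu_algebra cyl_proj_works(1)])
 show "gk 1 n k a = aug_map (cyl_proj K A 1 n) (gk 1 (Suc n) k a)" if "a \<in> carrier A1" for a
  using that cyl_proj_works(2)[OF assms, of "fst a" n] by (cases a) (simp add: aug_map_def aug_sel)
qed

text \<open>The coface \<open>\<partial>\<^sup>0\<close> misses the vertex 0 and \<open>\<partial>\<^sup>1\<close> misses the vertex 1, so \<open>\<partial>\<^sup>0(E)\<close> is the extension along copy 1 and
\<open>\<partial>\<^sup>1(E)\<close> the extension along copy 0.\<close>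

lemma face_gk:
 shows "face_mod K A E 0 n = Ek 1 n 1" and "face_mod K A E 1 n = Ek 1 n 0"
  and "face_unit K A E 0 n e = ek 1 n 1 e \<one>\<^bsub>cyl_aug 1 n\<^esub>"
  and "face_unit K A E 1 n e = ek 1 n 0 e \<one>\<^bsub>cyl_aug 1 n\<^esub>"
  and "face_proj K A E 0 n = prch n 1" and "face_proj K A E 1 n = prch n 0"
  and "face_map K A E E' 0 n f = ext_map E E' A1 (gk 1 n 1) (cyl_aug 1 n) f"
  and "face_map K A E E' 1 n f = ext_map E E' A1 (gk 1 n 0) (cyl_aug 1 n) f"
  and "face_form_proj K A E = tensor_lift E A1 (ring_bimodule (gk 1 2 0) (cyl_aug 1 2)) (MF 1)
   (\<lambda>e (x, c). ftn 1 e (snd (cyl_sq_zero K A x)))"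
proof -
 note 0 = ext_scal_cong[of "A1" "face0 K A 0 n" "gk 1 n 1" for n, OF face0_gk(1)]
  ext_change_cong(1)[of "A1" "face0 K A 0 (Suc n)" "gk 1 (Suc n) 1" "face0 K A 0 n" "gk 1 n 1" for n,
   OF face0_gk(1) face0_gk(1)]
  ring_bimodule_cong(2)[of "A1" "face0 K A 0 n" "gk 1 n 1" for n, OF face0_gk(1)]
  ext_scal_cong[of "A1" "face0 K A 1 n" "gk 1 n 0" for n, OF face0_gk(2)]
  ext_change_cong(1)[of "A1" "face0 K A 1 (Suc n)" "gk 1 (Suc n) 0" "face0 K A 1 n" "gk 1 n 0" for n,
   OF face0_gk(2) face0_gk(2)]
  ring_bimodule_cong(2)[of "A1" "face0 K A 1 n" "gk 1 n 0" for n, OF face0_gk(2)]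
 show "face_mod K A E 0 n = Ek 1 n 1" and "face_mod K A E 1 n = Ek 1 n 0"
  and "face_unit K A E 0 n e = ek 1 n 1 e \<one>\<^bsub>cyl_aug 1 n\<^esub>"
  and "face_unit K A E 1 n e = ek 1 n 0 e \<one>\<^bsub>cyl_aug 1 n\<^esub>"
  and "face_proj K A E 0 n = prch n 1" and "face_proj K A E 1 n = prch n 0"
  and "face_map K A E E' 0 n f = ext_map E E' A1 (gk 1 n 1) (cyl_aug 1 n) f"
  and "face_map K A E E' 1 n f = ext_map E E' A1 (gk 1 n 0) (cyl_aug 1 n) f"
  and "face_form_proj K A E = tensor_lift E A1 (ring_bimodule (gk 1 2 0) (cyl_aug 1 2)) (MF 1)
   (\<lambda>e (x, c). ftn 1 e (snd (cyl_sq_zero K A x)))"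
  by (simp_all only: face_mod_def face_unit_def face_proj_def face_map_def ext_map_def face_form_proj_def 0)
qed

lemma face2_gk: "a \<in> carrier A1 ==> i = face_index j 1 ==> (face1 K A j n \<circ> face0 K A 0 n) a = gk 2 n i a"
 "a \<in> carrier A1 ==> i = face_index j 0 ==> (face1 K A j n \<circ> face0 K A 1 n) a = gk 2 n i a"
 by (simp_all only: o_apply face0_gk) (rule face1_gk; simp)+

lemma face2_mod_gk: "face2_mod K A E 1 0 n = Ek 2 n 2"
 unfolding face2_mod_def by (rule ext_scal_cong(1)[OF face2_gk(1)]) simp_all

lemma face2_map_works:
 assumes h: "h \<in> rmod_hom (cyl_aug 1 n) (Ek 1 n 1) (Ek 1 n 0)"
  and i: "i = face_index j 1" "i' = face_index j 0"
 shows "face2_map K A E j n h \<in> add_homs (Ek 2 n i) (Ek 2 n i')" (is ?g1)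
  and "[|t \<in> carrier (Ek 2 n i); b \<in> carrier (cyl_aug 2 n)|] ==>
   face2_map K A E j n h (t \<lhd>\<^bsub>Ek 2 n i\<^esub> b) = face2_map K A E j n h t \<lhd>\<^bsub>Ek 2 n i'\<^esub> b" (is "PROP ?g2")
  and "e \<in> carrier E ==> face2_map K A E j n h (ek 2 n i e \<one>\<^bsub>cyl_aug 2 n\<^esub>) =
   coch j n 0 i' (h (ek 1 n 1 e \<one>\<^bsub>cyl_aug 1 n\<^esub>))" (is "PROP ?g3")
proof -
 have eq: "face2_map K A E j n h = (\<lambda>t. ext_trans E A1 (gk 1 n 0) (cyl_aug 1 n) (face1 K A j n) (gk 2 n i') (cyl_aug 2 n)
   (ext_map (Ek 1 n 1) (Ek 1 n 0) (cyl_aug 1 n) (face1 K A j n) (cyl_aug 2 n) h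
    (inv_into (carrier (ext_scal (Ek 1 n 1) (cyl_aug 1 n) (face1 K A j n) (cyl_aug 2 n)))
     (ext_trans E A1 (gk 1 n 1) (cyl_aug 1 n) (face1 K A j n) (gk 2 n i) (cyl_aug 2 n)) t)))"
  (is "_ = ?f")
 proof
  fix t
  have "face2_can K A E j 0 n = ext_trans E A1 (gk 1 n 1) (cyl_aug 1 n) (face1 K A j n) (gk 2 n i) (cyl_aug 2 n)"
   "face2_can K A E j 1 n = ext_trans E A1 (gk 1 n 0) (cyl_aug 1 n) (face1 K A j n) (gk 2 n i') (cyl_aug 2 n)"
   unfolding face2_can_def
   by (rule ext_change_cong(2)[OF face0_gk(1) face2_gk(1)[OF _ i(1)]], assumption+)
    (rule ext_change_cong(2)[OF face0_gk(2) face2_gk(2)[OF _ i(2)]], assumption+)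
  then show "face2_map K A E j n h t = ?f t"
   by (simp only: face2_map_def face_gk)
 qed
 note b = base_change_works[OF sc_coface[OF le_refl i(1)] sc_coface[OF le0 i(2)] h]
 show ?g1 unfolding eq by (rule b(1))
 show "PROP ?g2" unfolding eq by (rule b(2))
 show "PROP ?g3" unfolding eq by (rule b(3))
qed

text \<open>In terms of the copies, \<open>\<theta> n\<close> goes from copy 1 to copy 0, and the cocycle condition compares the way from
copy 2 through copy 1 to copy 0 with the direct way.\<close>

lemma stratification_gk:
 "stratification K A E \<theta> \<longleftrightarrow> \<theta> \<in> extensional {1..} \<and>
   (\<forall>n\<ge>1. \<theta> n \<in> rmod_iso (cyl_aug 1 n) (Ek 1 n 1) (Ek 1 n 0)) \<and>
   (\<forall>e\<in>carrier E. \<theta> 1 (ek 1 1 1 e \<one>\<^bsub>cyl_aug 1 1\<^esub>) = ek 1 1 0 e \<one>\<^bsub>cyl_aug 1 1\<^esub>) \<and>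
   (\<forall>n\<ge>1. \<forall>t\<in>carrier (Ek 1 (Suc n) 1). \<theta> n (prch n 1 t) = prch n 0 (\<theta> (Suc n) t)) \<and>
   (\<forall>n\<ge>1. \<forall>t\<in>carrier (Ek 2 n 2). face2_map K A E 2 n (\<theta> n) (face2_map K A E 0 n (\<theta> n) t) =
    face2_map K A E 1 n (\<theta> n) t)"
 unfolding stratification_def face_gk face2_mod_gk using E.right_module_axioms by simp

abbreviation u0 where "u0 e \<equiv> ftn 0 e (fm K A 0 \<one>\<^bsub>A1\<^esub> [])"
abbreviation sm where "sm n \<equiv> two_homs.semi K A E (gk 1 n 0) (cyl_aug 1 n) (gk 1 n 1)"

lemma u0_closed: "e \<in> carrier E ==> u0 e \<in> carrier (MF 0)"
 by (simp add: ft_closed fm0_closed)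

lemma PsiC_0: "[|k \<le> m; j \<le> m; e \<in> carrier E|] ==> PsiC m n k j 0 (u0 e) = ek m n k e \<one>\<^bsub>cyl_aug m n\<^esub>"
 using PsiC_works(2)[of k m j e "[]" 0 n] by simp

lemma PsiC_vanish:
 assumes "1 \<le> n" "n \<le> q" "u \<in> carrier (MF q)"
 shows "PsiC 1 n 0 1 q u = \<zero>\<^bsub>Ek 1 n 0\<^esub>"
 using psum_comps[OF assms(1), of "PsiC 1 n 0 1 q u"] PsiC_closed[of 0 1 1 u q n]
  comps_PsiC[OF assms(1,3)] psum_single[OF assms(3), of n n] assms by simp

lemma sm_eq: "sm n D e = ek 1 n 0 e \<one>\<^bsub>cyl_aug 1 n\<^esub> \<oplus>\<^bsub>Ek 1 n 0\<^esub> PsiC 1 n 0 1 1 (D e)"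
proof -
 interpret T: two_homs K A E "gk 1 n 0" "cyl_aug 1 n" "gk 1 n 1" by (rule gk_two) simp_all
 have "replicate 1 d = [d]" for d :: "'a \<Rightarrow> ('k, 'a) cterm set set \<times> 'k" by (simp add: One_nat_def)
 then show ?thesis by (simp add: T.semi_def PsiC_def)
qed

text \<open>The elements \<open>e \<otimes> 1 + \<Psi>\<^sub>1(u)\<close>, to which those of a stratification will turn out to belong, have components
\<open>e\<close> and \<open>u\<close> only.\<close>

lemma comps_first_order:
 assumes "1 \<le> n" "e \<in> carrier E" "u \<in> carrier (MF 1)"
 shows "comps n (ek 1 n 0 e \<one>\<^bsub>cyl_aug 1 n\<^esub> \<oplus>\<^bsub>Ek 1 n 0\<^esub> PsiC 1 n 0 1 1 u) = base n e \<oplus>\<^bsub>Vn n\<^esub> single n 1 u"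
proof -
 have "PsiC 1 n 0 1 0 (u0 e) \<in> carrier (Ek 1 n 0)" "PsiC 1 n 0 1 1 u \<in> carrier (Ek 1 n 0)"
  using assms by (simp_all add: PsiC_closed u0_closed)
 from add_homs_add[OF comps_works[OF assms(1)] this] show ?thesis
  using assms by (simp add: PsiC_0 comps_PsiC u0_closed flip: base_def)
   (simp add: base_def flip: PsiC_0[of 0 1 1 e n] comps_PsiC[OF assms(1) u0_closed])
qed

lemma cyl1_induct [consumes 1, case_names word add]:
 assumes t: "t \<in> carrier (Ek 1 n 0)"
  and word: "\<And>e ys. [|e \<in> carrier E; set ys \<subseteq> carrier A|] ==>
   P (PsiC 1 n 0 1 (length ys) (ftn (length ys) e (fm K A (length ys) \<one>\<^bsub>A1\<^esub> ys)))"
  and add: "\<And>x y. [|x \<in> carrier (Ek 1 n 0); y \<in> carrier (Ek 1 n 0); P x; P y|] ==> P (x \<oplus>\<^bsub>Ek 1 n 0\<^esub> y)"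
 shows "P t"
proof -
 interpret T: two_homs K A E "gk 1 n 0" "cyl_aug 1 n" "gk 1 n 1" by (rule gk_two) simp_all
 from cyl1_words[OF t] show ?thesis
 proof (induction rule: T.words.induct)
  case (words_gen e ys)
  then show ?case using word[OF words_gen] by (simp add: PsiC_works(2))
 qed (use add T.words_closed in blast)
qed

lemma comps_inj:
 assumes "1 \<le> n" "s \<in> carrier (Ek 1 n 0)" "t \<in> carrier (Ek 1 n 0)" "comps n s = comps n t"
 shows "s = t"
 using psum_comps[OF assms(1,2)] psum_comps[OF assms(1,3)] assms(4) by metis

lemma word_prod_map:
 assumes B: "ring B" "ring C" and \<psi>: "\<psi> \<in> ring_hom B C"
  and d: "\<forall>y\<in>Y. d y \<in> carrier B \<and> \<psi> (d y) = d' y"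
 shows "set ys \<subseteq> Y ==> word_prod B (replicate (length ys) d) ys \<in> carrier B \<and>
  \<psi> (word_prod B (replicate (length ys) d) ys) = word_prod C (replicate (length ys) d') ys"
proof (induction ys)
 case Nil
 then show ?case using ring_hom_one[OF \<psi>] B by (simp add: ring.ring_simprules)
next
 case (Cons y ys)
 then have "word_prod B (replicate (length ys) d) ys \<in> carrier B" "d y \<in> carrier B" using d by auto
 then show ?case using Cons d ring_hom_mult[OF \<psi>] B(1) by (simp add: ring.ring_simprules)
qed

lemma ext_change_PsiC:
 assumes sc: "scalar_ext2 A1 E (gk m n k) (cyl_aug m n) \<psi> (gk m' n' k') (cyl_aug m' n')"
  and k: "k \<le> m" "j \<le> m" "k' \<le> m'" "j' \<le> m'"
  and j: "\<And>y. y \<in> carrier A ==> \<psi> (gk m n j (y, \<zero>)) = gk m' n' j' (y, \<zero>)"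
  and u: "u \<in> carrier (MF q)"
 shows "ext_change E A1 (gk m n k) (cyl_aug m n) \<psi> (gk m' n' k') (cyl_aug m' n') (PsiC m n k j q u) =
  PsiC m' n' k' j' q u"
proof -
 interpret S: scalar_ext2 "A1" E "gk m n k" "cyl_aug m n" \<psi> "gk m' n' k'" "cyl_aug m' n'" by (rule sc)
 interpret T: two_homs K A E "gk m n k" "cyl_aug m n" "gk m n j" by (rule gk_two[OF k(1,2)])
 have \<psi>h: "\<psi> \<in> add_homs (cyl_aug m n) (cyl_aug m' n')" by (rule add_homs_I) (simp_all add: S.\<psi>D)
 show ?thesis
 proof (rule mf_word_eqI[OF add_homs_comp[OF PsiC_works(1)[OF k(1,2)] S.ch_works(1)] PsiC_works(1)[OF k(3,4)] _ u])
  fix e as assume e: "e \<in> carrier E" and as: "set as \<subseteq> carrier A" "length as = q"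
  have d: "\<forall>y\<in>carrier A. T.dl y \<in> carrier (cyl_aug m n) \<and>
   \<psi> (T.dl y) = hdiff K (cyl_aug m' n') (gk m' n' k') (gk m' n' j') y"
   using j S.comp add_homs_minus[OF S.P.B.abelian_group_axioms S.R.B.abelian_group_axioms \<psi>h]
   by (simp add: T.dl_closed) (simp add: hdiff_def T.\<beta>D(1) S.P.\<phi>D(1) aug_elem)
  show "S.ch (PsiC m n k j q (ftn q e (fm K A q \<one>\<^bsub>A1\<^esub> as))) =
    PsiC m' n' k' j' q (ftn q e (fm K A q \<one>\<^bsub>A1\<^esub> as))"
   using e as word_prod_map[OF cyl_aug_ring cyl_aug_ring S.\<psi> d as(1)]
   by (simp add: PsiC_works(2)[OF k(1,2)] PsiC_works(2)[OF k(3,4)] S.ch_works(2))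
 qed
qed

lemma proj_gk: "[|a \<in> carrier A1; k \<le> 1|] ==> aug_map (cyl_proj K A 1 n) (gk 1 (Suc n) k a) = gk 1 n k a"
 by (rule scalar_ext2.comp[OF sc_proj, symmetric])

lemma prch_PsiC: "u \<in> carrier (MF q) ==> prch n 0 (PsiC 1 (Suc n) 0 1 q u) = PsiC 1 n 0 1 q u"
 by (rule ext_change_PsiC[OF sc_proj]) (auto intro!: proj_gk simp: aug_elem)

lemma comps_prch:
 assumes n: "1 \<le> n" and t: "t \<in> carrier (Ek 1 (Suc n) 0)" and i: "i < n"
 shows "comps n (prch n 0 t) i = comps (Suc n) t i"
proof -
 interpret S: scalar_ext2 "A1" E "gk 1 (Suc n) 0" "cyl_aug 1 (Suc n)" "aug_map (cyl_proj K A 1 n)"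
  "gk 1 n 0" "cyl_aug 1 n" by (rule sc_proj) simp
 have Sn: "1 \<le> Suc n" by simp
 show ?thesis
  using t
 proof (induction rule: cyl1_induct)
  case (word e ys)
  then have "ftn (length ys) e (fm K A (length ys) \<one>\<^bsub>A1\<^esub> ys) \<in> carrier (MF (length ys))"
   by (simp add: ft_closed fm_closed)
  then show ?case using i by (simp add: prch_PsiC comps_PsiC[OF n] comps_PsiC[OF Sn] single_def)
 next
  case (add x y)
  then show ?case
   by (simp add: S.ch_add S.ch_closed add_homs_add[OF comps_works[OF n]] add_homs_add[OF comps_works[OF Sn]] Vn_sel)
 qed
qed

lemmas lact_zero_r = add_homs_zero[OF Omega_abelian_group Omega_abelian_group lact_works(1)]
lemmas form_ract_zero = add_homs_zero[OF Omega_abelian_group Omega_abelian_group ract_hom]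

text \<open>The projection \<open>E \<oplus> E \<otimes> \<Omega>\<^sup>1 \<rightarrow> E \<otimes> \<Omega>\<^sup>1\<close> is the component of degree 1.\<close>

lemma face_form_proj_works:
 shows "face_form_proj K A E \<in> add_homs (Ek 1 2 0) (MF 1)" (is ?g1)
  and "[|e \<in> carrier E; x \<in> carrier (Cyl K A 1 2); c \<in> carrier K|] ==>
   face_form_proj K A E (ek 1 2 0 e (x, c)) = ftn 1 e (snd (cyl_sq_zero K A x))" (is "PROP ?g2")
proof -
 interpret S: scalar_ext "A1" E "gk 1 2 0" "cyl_aug 1 2" by (rule gk_ext) simp
 interpret C: k_algebra K "Cyl K A 1 2" by (rule k_algebraI[OF Cyl_nu_algebra])
 let ?\<phi> = "\<lambda>e (x, c :: 'k). ftn 1 e (snd (cyl_sq_zero K A x))"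
 note z = alg_homD[OF cyl_sq_zero_works(1)]
 have sz: "snd (cyl_sq_zero K A x) \<in> carrier (Om 1)" if "x \<in> carrier (Cyl K A 1 2)" for x
  using z(1)[OF that] by (auto simp: sq_zero_sel)
 have sa: "snd (cyl_sq_zero K A (x \<oplus>\<^bsub>Cyl K A 1 2\<^esub> y)) =
   snd (cyl_sq_zero K A x) \<oplus>\<^bsub>Om 1\<^esub> snd (cyl_sq_zero K A y)"
  if "x \<in> carrier (Cyl K A 1 2)" "y \<in> carrier (Cyl K A 1 2)" for x y
  using z(2)[OF that] by (cases "cyl_sq_zero K A x"; cases "cyl_sq_zero K A y") (simp add: sq_zero_sel)
 have lact: "?\<phi> e (gk 1 2 0 a \<otimes>\<^bsub>cyl_aug 1 2\<^esub> b) = ftn 1 e (a \<rhd>\<^bsub>Om 1\<^esub> snd (cyl_sq_zero K A (fst b)))"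
  if a: "a \<in> carrier A1" and b: "b \<in> carrier (cyl_aug 1 2)" for e a b
 proof -
  obtain r k where r: "a = (r, k)" "r \<in> carrier A" "k \<in> carrier K" using a by (auto simp: aug_sel)
  obtain x c where x: "b = (x, c)" "x \<in> carrier (Cyl K A 1 2)" "c \<in> carrier K" using b by (auto simp: aug_sel)
  obtain s \<eta> where s: "cyl_sq_zero K A x = (s, \<eta>)" "s \<in> carrier A" "\<eta> \<in> carrier (Om 1)"
   using z(1)[OF x(2)] by (auto simp: sq_zero_sel)
  have l: "a \<rhd>\<^bsub>Om 1\<^esub> \<eta> = (r, \<zero>) \<rhd>\<^bsub>Om 1\<^esub> \<eta> \<oplus>\<^bsub>Om 1\<^esub> (emb k) \<rhd>\<^bsub>Om 1\<^esub> \<eta>"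
   using lact_l_distr[OF aug_elem[OF r(2)] aug_scalar[OF r(3)] s(3)] aug_split[OF r(2,3)] r(1) by simp
  have g: "cg 1 2 0 r \<in> carrier (Cyl K A 1 2)" using r by (auto intro: alg_homD(1)[OF cg_alg_hom])
  have "snd (cyl_sq_zero K A (cg 1 2 0 r \<otimes>\<^bsub>Cyl K A 1 2\<^esub> x \<oplus>\<^bsub>Cyl K A 1 2\<^esub> c \<odot>\<^bsub>Cyl K A 1 2\<^esub> cg 1 2 0 r
    \<oplus>\<^bsub>Cyl K A 1 2\<^esub> k \<odot>\<^bsub>Cyl K A 1 2\<^esub> x)) = a \<rhd>\<^bsub>Om 1\<^esub> \<eta>"
   unfolding l using g x(2,3) r(2,3) s(2,3)
   by (simp add: z C.nu_mult_closed cyl_sq_zero_works(2) s(1) sq_zero_sel lact_zero aug_scalar aug_elem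
     lact_closed form_ract_zero lact_zero_r)
  then show ?thesis using r(1) x(1) s(1) by (simp add: aug_map_def aug_sel)
 qed
 have *: "?\<phi> e b \<in> carrier (MF 1)"
  "e' \<in> carrier E ==> ?\<phi> (e \<oplus>\<^bsub>E\<^esub> e') b = ?\<phi> e b \<oplus>\<^bsub>MF 1\<^esub> ?\<phi> e' b"
  "b' \<in> carrier (cyl_aug 1 2) ==> ?\<phi> e (b \<oplus>\<^bsub>cyl_aug 1 2\<^esub> b') = ?\<phi> e b \<oplus>\<^bsub>MF 1\<^esub> ?\<phi> e b'"
  "a \<in> carrier A1 ==> ?\<phi> (e \<lhd>\<^bsub>E\<^esub> a) b = ?\<phi> e (gk 1 2 0 a \<otimes>\<^bsub>cyl_aug 1 2\<^esub> b)"
  if e: "e \<in> carrier E" and b: "b \<in> carrier (cyl_aug 1 2)" for e b e' b' a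
 proof -
  obtain x c where x: "b = (x, c)" "x \<in> carrier (Cyl K A 1 2)" using b by (auto simp: aug_sel)
  show "?\<phi> e b \<in> carrier (MF 1)" using e x sz by (simp add: ft_closed)
  show "e' \<in> carrier E ==> ?\<phi> (e \<oplus>\<^bsub>E\<^esub> e') b = ?\<phi> e b \<oplus>\<^bsub>MF 1\<^esub> ?\<phi> e' b"
   using e x sz by (simp add: ft_add_l)
  show "?\<phi> e (b \<oplus>\<^bsub>cyl_aug 1 2\<^esub> b') = ?\<phi> e b \<oplus>\<^bsub>MF 1\<^esub> ?\<phi> e b'" if "b' \<in> carrier (cyl_aug 1 2)"
  proof -
   obtain x' c' where "b' = (x', c')" "x' \<in> carrier (Cyl K A 1 2)" using \<open>b' \<in> _\<close> by (auto simp: aug_sel)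
   then show ?thesis using e x sz by (simp add: aug_sel sa ft_add_r)
  qed
  show "a \<in> carrier A1 ==> ?\<phi> (e \<lhd>\<^bsub>E\<^esub> a) b = ?\<phi> e (gk 1 2 0 a \<otimes>\<^bsub>cyl_aug 1 2\<^esub> b)"
   using lact[OF _ b, of a e] e x sz by (simp add: ft_bal)
 qed
 note l = S.ext_tensor_lift[where \<phi> = ?\<phi>, OF MF.abelian_group_axioms *, folded face_gk(9)]
 show ?g1 using l(1) by simp
 show "PROP ?g2"
  using l(3)[of e "(x, c)"] by (simp add: aug_sel)
qed

lemma face_form_proj_comps:
 assumes "t \<in> carrier (Ek 1 2 0)"
 shows "face_form_proj K A E t = comps 2 t 1"
 using assms
proof (induction rule: cyl1_induct)
 interpret S: scalar_ext "A1" E "gk 1 2 0" "cyl_aug 1 2" by (rule gk_ext) simp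
 interpret C: k_algebra K "Cyl K A 1 2" by (rule k_algebraI[OF Cyl_nu_algebra])
 note z = alg_hom_zero[OF Cyl_nu_algebra sq_zero_nu_algebra cyl_sq_zero_works(1)]
 case (word e ys)
 let ?q = "length ys"
 let ?w = "ftn ?q e (fm K A ?q \<one>\<^bsub>A1\<^esub> ys)"
 have w: "?w \<in> carrier (MF ?q)" using word by (simp add: ft_closed fm_closed)
 have two: "1 \<le> (2 :: nat)" by simp
 consider "ys = []" | y where "ys = [y]" "y \<in> carrier A" | "2 \<le> ?q"
  using word by (cases ys rule: remdups_adj.cases) auto
 then show ?case
 proof cases
  case 1
  have "\<one>\<^bsub>cyl_aug 1 2\<^esub> = (\<zero>\<^bsub>Cyl K A 1 2\<^esub>, \<one>)" by (simp add: aug_sel)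
  with 1 show ?thesis
   using word z comps_PsiC[OF two w] face_form_proj_works(2)[of e "\<zero>\<^bsub>Cyl K A 1 2\<^esub>" \<one>]
   by (simp add: PsiC_0 single_def sq_zero_sel ft_zero_r)
 next
  case (2 y)
  have c: "cg 1 2 1 y \<in> carrier (Cyl K A 1 2)" "cg 1 2 0 y \<in> carrier (Cyl K A 1 2)"
   using 2 by (auto intro!: alg_homD(1)[OF cg_alg_hom])
  have g: "gk 1 2 k (y, \<zero>) = (cg 1 2 k y, \<zero>)" for k by (simp add: aug_map_def)
  have d: "ftn 1 e (d_elem K A y) \<in> carrier (MF 1)"
   using word 2 by (simp add: ft_closed d_elem_closed)
  have "PsiC 1 2 0 1 ?q ?w = ek 1 2 0 e (gk 1 2 1 (y, \<zero>) \<ominus>\<^bsub>cyl_aug 1 2\<^esub> gk 1 2 0 (y, \<zero>))"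
   using word 2 c by (simp add: PsiC_works(2) hdiff_def g C.aug_elem)
  also have "\<dots> = ek 1 2 0 e (cg 1 2 1 y, \<zero>) \<ominus>\<^bsub>Ek 1 2 0\<^esub> ek 1 2 0 e (cg 1 2 0 y, \<zero>)"
   using word c by (simp add: g S.et_minus_r C.aug_elem)
  finally have "face_form_proj K A E (PsiC 1 2 0 1 ?q ?w) = ftn 1 e (d_elem K A y)"
   using word 2 c d add_homs_minus[OF S.X.abelian_group_axioms MF.abelian_group_axioms face_form_proj_works(1)]
   by (simp add: S.et_closed C.aug_elem face_form_proj_works(2) cyl_sq_zero_works ft_zero_r a_minus_def MF.neg_zero)
  then show ?thesis using comps_PsiC[OF two w] 2 by (simp add: single_def d_elem_def One_nat_def)
 next
  case 3
  then show ?thesis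
   using PsiC_vanish[OF two 3 w] comps_PsiC[OF two w]
    add_homs_zero[OF S.X.abelian_group_axioms MF.abelian_group_axioms face_form_proj_works(1)]
   by (simp add: single_def)
 qed
next
 case (add x y)
 have two: "1 \<le> (2 :: nat)" by simp
 show ?case
  using add by (simp add: add_homs_add[OF face_form_proj_works(1)] add_homs_add[OF comps_works[OF two]] Vn_sel)
qed

section \<open>The stratification of a flat connection\<close>

definition strat_of :: "('e \<Rightarrow> ('k, 'a, 'e) form_ext) \<Rightarrow> ('k, 'a, 'e) strat" where
 "strat_of D = (\<lambda>n\<in>{1..}. two_homs.transp K A E (gk 1 n 0) (cyl_aug 1 n) (gk 1 n 1) D)"

lemma strat_of_works:
 assumes D: "connection K A E D" and n: "1 \<le> n"
 shows "strat_of D n \<in> rmod_hom (cyl_aug 1 n) (Ek 1 n 1) (Ek 1 n 0)" (is ?g1)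
  and "e \<in> carrier E ==> strat_of D n (ek 1 n 1 e \<one>\<^bsub>cyl_aug 1 n\<^esub>) = sm n D e" (is "PROP ?g2")
  and "e \<in> carrier E ==> sm n D e \<in> carrier (Ek 1 n 0)" (is "PROP ?g3")
proof -
 interpret T: two_homs K A E "gk 1 n 0" "cyl_aug 1 n" "gk 1 n 1" by (rule gk_two) simp_all
 show ?g1
  using T.transp_works(1)[OF D] n by (simp add: strat_of_def)
 show "PROP ?g2"
  using T.transp_works(3)[OF D] n by (simp add: strat_of_def)
 show "PROP ?g3" by (rule T.semi_closed[OF D])
qed

text \<open>The \<open>\<theta> n\<close>, their projections and their base changes along the three cofaces are all instances of one
construction, for different pairs of homomorphisms to different algebras.\<close>

lemma strat_of_stratification:
 assumes D: "flat_connection K A E D"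
 shows "stratification K A E (strat_of D)"
 unfolding stratification_gk
proof (intro conjI allI ballI impI)
 have c: "connection K A E D" using D by (simp add: flat_connection_def)
 have De: "D e \<in> carrier (MF 1)" if "e \<in> carrier E" for e
  using add_homs_closed[OF connectionD(1)[OF c] that] .
 have two: "two_homs K A E (gk m n k) (cyl_aug m n) (gk m n j)" if "k \<le> m" "j \<le> m" for m n k j
  by (rule gk_two[OF that])
 show "strat_of D \<in> extensional {1..}" by (simp add: strat_of_def)
 show "strat_of D n \<in> rmod_iso (cyl_aug 1 n) (Ek 1 n 1) (Ek 1 n 0)" if "1 \<le> n" for n
  using that transp_iso[OF two[of 0 1 1 n] D] by (simp add: strat_of_def)
 show "strat_of D 1 (ek 1 1 1 e \<one>\<^bsub>cyl_aug 1 1\<^esub>) = ek 1 1 0 e \<one>\<^bsub>cyl_aug 1 1\<^esub>" if e: "e \<in> carrier E" for e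
 proof -
  interpret S: scalar_ext "A1" E "gk 1 1 0" "cyl_aug 1 1" by (rule gk_ext) simp
  show ?thesis
   using e by (simp add: strat_of_works[OF c] sm_eq PsiC_vanish[OF _ _ De] S.et_closed)
 qed
 show "strat_of D n (prch n 1 t) = prch n 0 (strat_of D (Suc n) t)"
  if n: "1 \<le> n" and t: "t \<in> carrier (Ek 1 (Suc n) 1)" for n t
 proof -
  interpret P0: scalar_ext2 "A1" E "gk 1 (Suc n) 0" "cyl_aug 1 (Suc n)" "aug_map (cyl_proj K A 1 n)"
   "gk 1 n 0" "cyl_aug 1 n" by (rule sc_proj) simp
  interpret P1: scalar_ext2 "A1" E "gk 1 (Suc n) 1" "cyl_aug 1 (Suc n)" "aug_map (cyl_proj K A 1 n)"
   "gk 1 n 1" "cyl_aug 1 n" by (rule sc_proj) simp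
  have Sn: "1 \<le> Suc n" by simp
  note s = rmod_homD[OF strat_of_works(1)[OF c n]] and s' = rmod_homD[OF strat_of_works(1)[OF c Sn]]
  show ?thesis
  proof (rule P1.P.ext_hom_eqI[OF add_homs_comp[OF P1.ch_works(1) s(1)] add_homs_comp[OF s'(1) P0.ch_works(1)] _ t])
   fix e b assume e: "e \<in> carrier E" and b: "b \<in> carrier (cyl_aug 1 (Suc n))"
   have u: "P1.P.et e \<one>\<^bsub>cyl_aug 1 (Suc n)\<^esub> \<in> carrier P1.P.X" "P1.R.et e \<one>\<^bsub>cyl_aug 1 n\<^esub> \<in> carrier P1.R.X"
    using e by (simp_all add: P1.P.et_closed P1.R.et_closed)
   have "prch n 0 (sm (Suc n) D e) = sm n D e"
    by (rule semi_base_change[where D = D, OF two[of 0 1 1 "Suc n"] two[of 0 1 1 n] sc_proj[of 0 n] _ e De[OF e]])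
     (auto intro: P1.comp)
   then show "strat_of D n (P1.ch (P1.P.et e b)) = P0.ch (strat_of D (Suc n) (P1.P.et e b))"
    using u e b
    by (subst (1 2) P1.P.et_unit)
     (simp_all add: P1.ch_ract P0.ch_ract s s' P1.\<psi>D P1.ch_works(2) strat_of_works[OF c] n)
  qed
 qed
 show "face2_map K A E 2 n (strat_of D n) (face2_map K A E 0 n (strat_of D n) t) = face2_map K A E 1 n (strat_of D n) t"
  if n: "1 \<le> n" and t: "t \<in> carrier (Ek 2 n 2)" for n t
 proof -
  let ?F = "\<lambda>j. face2_map K A E j n (strat_of D n)"
  let ?sm = "\<lambda>k j. two_homs.semi K A E (gk 2 n k) (cyl_aug 2 n) (gk 2 n j) D"
  let ?tr = "\<lambda>k j. two_homs.transp K A E (gk 2 n k) (cyl_aug 2 n) (gk 2 n j) D"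
  interpret E0: scalar_ext "A1" E "gk 2 n 0" "cyl_aug 2 n" by (rule gk_ext) simp
  interpret E1: scalar_ext "A1" E "gk 2 n 1" "cyl_aug 2 n" by (rule gk_ext) simp
  interpret E2: scalar_ext "A1" E "gk 2 n 2" "cyl_aug 2 n" by (rule gk_ext) simp
  have F: "?F j (ek 2 n i e \<one>\<^bsub>cyl_aug 2 n\<^esub>) = ?sm i' i e" "?F j \<in> add_homs (Ek 2 n i) (Ek 2 n i')"
   "[|x \<in> carrier (Ek 2 n i); b \<in> carrier (cyl_aug 2 n)|] ==>
    ?F j (x \<lhd>\<^bsub>Ek 2 n i\<^esub> b) = ?F j x \<lhd>\<^bsub>Ek 2 n i'\<^esub> b"
   if e: "e \<in> carrier E" and i: "i = face_index j 1" "i' = face_index j 0" for j i i' e x b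
  proof -
   note f = face2_map_works[OF strat_of_works(1)[OF c n] i]
   have "coch j n 0 i' (sm n D e) = ?sm i' i e"
    by (rule semi_base_change[where D = D, OF two[of 0 1 1 n] two[of i' 2 i n] sc_coface[of 0 i' j n] _ e De[OF e]])
     (use i in \<open>auto simp: face1_gk\<close>)
   then show "?F j (ek 2 n i e \<one>\<^bsub>cyl_aug 2 n\<^esub>) = ?sm i' i e"
    using f(3)[OF e] e by (simp add: strat_of_works[OF c] n)
   show "?F j \<in> add_homs (Ek 2 n i) (Ek 2 n i')" by (rule f(1))
   show "[|x \<in> carrier (Ek 2 n i); b \<in> carrier (cyl_aug 2 n)|] ==>
    ?F j (x \<lhd>\<^bsub>Ek 2 n i\<^esub> b) = ?F j x \<lhd>\<^bsub>Ek 2 n i'\<^esub> b" by (rule f(2))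
  qed
  have z: "\<zero>\<^bsub>E\<^esub> \<in> carrier E" by simp
  have 0: "1 = face_index 0 0" "2 = face_index 0 1" by (simp_all add: One_nat_def)
  have 1: "0 = face_index 1 0" "2 = face_index 1 1" by simp_all
  have 2: "0 = face_index 2 0" "1 = face_index 2 1" by simp_all
  note F0 = F[OF _ 0(2,1)] and F1 = F[OF _ 1(2,1)] and F2 = F[OF _ 2(2,1)]
  note F0h = F0(2,3)[OF z] and F1h = F1(2,3)[OF z] and F2h = F2(2,3)[OF z]
  note tr = two_homs.transp_works[OF two[of 0 2 1 n] c]
  have T: "?F 2 x = ?tr 0 1 x" if "x \<in> carrier (Ek 2 n 1)" for x
   by (rule E1.ext_lin_eqI[OF E0.ext_right_module F2h(1) rmod_homD(1)[OF tr(1)] F2h(2) rmod_homD(3)[OF tr(1)] _ that])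
    (simp_all add: F2(1) tr(3))
  show ?thesis
  proof (rule E2.ext_lin_eqI[OF E0.ext_right_module add_homs_comp[OF F0h(1) F2h(1)] F1h(1) _ F1h(2) _ t])
   show "?F 2 (?F 0 (x \<lhd>\<^bsub>E2.X\<^esub> b)) = ?F 2 (?F 0 x) \<lhd>\<^bsub>E0.X\<^esub> b"
    if "x \<in> carrier E2.X" "b \<in> carrier (cyl_aug 2 n)" for x b
    using that by (simp add: F0h(2) F2h(2) add_homs_closed[OF F0h(1)])
   fix e assume e: "e \<in> carrier E"
   have s: "?sm 1 2 e \<in> carrier (Ek 2 n 1)"
    by (rule two_homs.semi_closed[OF two c e]) simp_all
   show "?F 2 (?F 0 (E2.et e \<one>\<^bsub>cyl_aug 2 n\<^esub>)) = ?F 1 (E2.et e \<one>\<^bsub>cyl_aug 2 n\<^esub>)"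
    unfolding F0(1)[OF e] F1(1)[OF e] T[OF s]
    using D e by (intro transp_cocycle[OF two two two c e]) (simp_all add: flat_connection_def)
  qed
 qed
qed

section \<open>The connection of a stratification\<close>

lemma kappa_zero:
 assumes "\<And>p. l p \<in> carrier K" "l q = \<zero>" "q < i"
 shows "kappa l i = \<zero>"
 using assms(3)
proof (induction i)
 case (Suc i)
 then show ?case using assms(1,2) kappa_closed[of l i, OF assms(1)] by (cases "q = i") auto
qed simp

lemma det_comps:
 assumes M: "isolated_family 1 M" and M0: "M 0 = (\<lambda>_. \<zero>)" and n: "1 \<le> n" and t: "t \<in> carrier (Ek 1 n 0)" and i: "i < n"
 shows "det 1 n M 0 t i = comps n t i \<lhd>\<^bsub>MF i\<^esub> (\<zero>\<^bsub>A\<^esub>, kappa (M 1) i)"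
proof -
 have "M 1 p \<in> carrier K" for p using M by (simp add: isolated_family_def isolated_def)
 then have "M 1 p \<ominus> \<zero> = M 1 p" for p
  using ring.ring_simprules[OF K_ring] by (simp add: a_minus_def)
 then show ?thesis
  using det_psum[OF M n _ add_homs_closed[OF comps_works[OF n] t], of n i] psum_comps[OF n t] i by (simp add: M0)
qed

end

locale stratified_module = form_module K A E
 for K :: "('k, 'n) ring_scheme" (structure) and A :: "('k, 'a) module" (structure)
  and E :: "('a \<times> 'k, 'e) rmodule" +
 fixes \<theta> :: "('k, 'a, 'e) strat"
 assumes strat: "stratification K A E \<theta>"
begin

text \<open>The linear map \<open>\<theta> n\<close> is determined by these elements; their components \<open>comps n (sec n e)\<close> are now computed
one after the other.\<close>

definition sec :: "nat \<Rightarrow> 'e \<Rightarrow> ('k, 'a, 'e) cyl_ext" where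
 "sec n e = \<theta> n (ek 1 n 1 e \<one>\<^bsub>cyl_aug 1 n\<^esub>)"

lemma \<theta>_hom: "1 \<le> n ==> \<theta> n \<in> rmod_hom (cyl_aug 1 n) (Ek 1 n 1) (Ek 1 n 0)"
 using strat by (simp add: stratification_gk rmod_iso_def)

lemmas \<theta>D = rmod_homD[OF \<theta>_hom]

lemma sec_hom: "1 \<le> n ==> sec n \<in> add_homs E (Ek 1 n 0)"
proof -
 interpret S1: scalar_ext "A1" E "gk 1 n 1" "cyl_aug 1 n" by (rule gk_ext) simp
 assume n: "1 \<le> n"
 show "sec n \<in> add_homs E (Ek 1 n 0)"
  unfolding sec_def[abs_def] by (rule add_homs_comp[OF S1.et_hom_l \<theta>D(1)[OF n]]) simp
qed

lemmas sec_closed = add_homs_closed[OF sec_hom]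

lemma sec_ract:
 assumes n: "1 \<le> n" and e: "e \<in> carrier E" and a: "a \<in> carrier A1"
 shows "sec n (e \<lhd>\<^bsub>E\<^esub> a) = sec n e \<lhd>\<^bsub>Ek 1 n 0\<^esub> gk 1 n 1 a"
proof -
 interpret S1: scalar_ext "A1" E "gk 1 n 1" "cyl_aug 1 n" by (rule gk_ext) simp
 have "S1.et (e \<lhd>\<^bsub>E\<^esub> a) \<one>\<^bsub>cyl_aug 1 n\<^esub> = S1.et e \<one>\<^bsub>cyl_aug 1 n\<^esub> \<lhd>\<^bsub>S1.X\<^esub> gk 1 n 1 a"
  using e a by (simp add: S1.et_bal S1.et_ract S1.\<phi>D)
 then show ?thesis using e a by (simp add: sec_def \<theta>D(3)[OF n] S1.et_closed S1.\<phi>D)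
qed

lemma sec_proj: "[|1 \<le> n; e \<in> carrier E|] ==> prch n 0 (sec (Suc n) e) = sec n e"
proof -
 interpret P1: scalar_ext2 "A1" E "gk 1 (Suc n) 1" "cyl_aug 1 (Suc n)" "aug_map (cyl_proj K A 1 n)"
  "gk 1 n 1" "cyl_aug 1 n" by (rule sc_proj) simp
 assume n: "1 \<le> n" and e: "e \<in> carrier E"
 have "\<theta> n (P1.ch (P1.P.et e \<one>\<^bsub>cyl_aug 1 (Suc n)\<^esub>)) = prch n 0 (\<theta> (Suc n) (P1.P.et e \<one>\<^bsub>cyl_aug 1 (Suc n)\<^esub>))"
  using strat n e by (simp add: stratification_gk P1.P.et_closed)
 then show ?thesis using e by (simp add: sec_def P1.ch_works(2) P1.\<psi>D)
qed

lemma comps_sec_stable: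
 assumes "1 \<le> m" "m \<le> n" "i < m" "e \<in> carrier E"
 shows "comps n (sec n e) i = comps m (sec m e) i"
 using assms(2)
proof (induction n rule: dec_induct)
 case (step n)
 then show ?case
  using assms comps_prch[of n "sec (Suc n) e" i] sec_closed[of "Suc n" e] sec_proj[of n e] by simp
qed simp

lemma comps_sec_0:
 assumes "1 \<le> n" "e \<in> carrier E"
 shows "comps n (sec n e) 0 = u0 e"
proof -
 have one: "1 \<le> (1 :: nat)" by simp
 have "sec 1 e = PsiC 1 1 0 1 0 (u0 e)"
  using strat assms(2) by (simp add: sec_def stratification_gk PsiC_0)
 then have "comps 1 (sec 1 e) 0 = u0 e"
  using comps_PsiC[OF one u0_closed[OF assms(2)]] by (simp add: single_def)
 then show ?thesis using comps_sec_stable[OF one assms(1) _ assms(2), of 0] by simp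
qed

abbreviation D where "D \<equiv> strat_connection K A E \<theta>"

lemma D_eq: "e \<in> carrier E ==> D e = comps 2 (sec 2 e) 1"
 using face_form_proj_comps[OF sec_closed[of 2 e]]
 by (simp add: strat_connection_def strat_coface_def face_gk flip: sec_def)

lemma comps_sec_1: "[|2 \<le> n; e \<in> carrier E|] ==> comps n (sec n e) 1 = D e"
 using comps_sec_stable[of 2 n 1 e] by (simp add: D_eq)

lemma comps_sec_closed: "[|1 \<le> n; e \<in> carrier E|] ==> comps n (sec n e) \<in> carrier (Vn n)"
 by (rule add_homs_closed[OF comps_works sec_closed])

lemma D_closed: "e \<in> carrier E ==> D e \<in> carrier (MF 1)"
 using comps_sec_closed[of 2 e] by (simp add: D_eq Vn_sel)

text \<open>The element \<open>r\<close> acts through copy 1, whose sequence has the entry 1 in degree 0: it sends the component \<open>e\<close> of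
degree 0 to \<open>e \<otimes> dr\<close> in degree 1.\<close>

lemma D_leibniz:
 assumes e: "e \<in> carrier E" and r: "r \<in> carrier A" and c: "c \<in> carrier K"
 shows "D (e \<lhd>\<^bsub>E\<^esub> (r, c)) = (D e \<lhd>\<^bsub>MF 1\<^esub> (r, \<zero>) \<oplus>\<^bsub>MF 1\<^esub> ftn 1 e (d_elem K A r))
  \<oplus>\<^bsub>MF 1\<^esub> D e \<lhd>\<^bsub>MF 1\<^esub> (emb c)"
proof -
 interpret S: scalar_ext "A1" E "gk 1 2 1" "cyl_aug 1 2" by (rule gk_ext) simp
 let ?L = "\<lambda>i::nat. if i = 0 then L_odd else L_even"
 have two: "1 \<le> (2 :: nat)" by simp
 have a: "(r, c) \<in> carrier A1" using r c by (simp add: aug_sel)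
 let ?v = "comps 2 (sec 2 e)"
 have v: "?v \<in> carrier (Vn 2)" by (rule comps_sec_closed[OF two e])
 have "comps 2 (sec 2 e \<lhd>\<^bsub>Ek 1 2 0\<^esub> gk 1 2 1 (r, c)) = ?v \<lhd>\<^bsub>VM 1 2 ?L\<^esub> gk 1 2 1 (r, c)"
  unfolding comps_def
  by (rule rmod_homD(3)[OF det_works(1)[OF L_alt two le0]])
   (simp_all add: L_odd_def sec_closed e S.\<phi>D a)
 also have "\<dots> = act 2 L_even r ?v \<oplus>\<^bsub>Vn 2\<^esub> c \<odot>\<^bsub>Vn 2\<^esub> ?v"
  using rho_gk[OF L_alt two _ r c v, of 1] by simp
 finally have "D (e \<lhd>\<^bsub>E\<^esub> (r, c)) = (act 2 L_even r ?v \<oplus>\<^bsub>Vn 2\<^esub> c \<odot>\<^bsub>Vn 2\<^esub> ?v) 1"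
  using e a by (simp add: D_eq E.ract_closed sec_ract[OF two])
 also have "mcc 0 [r] (u0 e) = ftn 1 e (d_elem K A r)"
  using e r by (simp add: msnoc_ft fm0_closed d_elem_def snoc_fm One_nat_def)
 then have "(act 2 L_even r ?v \<oplus>\<^bsub>Vn 2\<^esub> c \<odot>\<^bsub>Vn 2\<^esub> ?v) 1 = (D e \<lhd>\<^bsub>MF 1\<^esub> (r, \<zero>) \<oplus>\<^bsub>MF 1\<^esub>
   ftn 1 e (d_elem K A r)) \<oplus>\<^bsub>MF 1\<^esub> D e \<lhd>\<^bsub>MF 1\<^esub> (emb c)"
  using v r comps_sec_0[OF two e] D_eq[OF e] by (simp add: Vn_sel(3,4) act_def L_even_def One_nat_def)
 finally show ?thesis .
qed

lemma D_connection: "connection K A E D"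
 unfolding connection_def
proof (intro conjI ballI E.right_module_axioms)
 have two: "1 \<le> (2 :: nat)" by simp
 show "D \<in> extensional (carrier E)" by (simp add: strat_connection_def)
 show "D \<in> add_homs E (MF 1)"
  by (rule add_homs_I)
   (simp_all add: D_closed, simp add: D_eq add_homs_add[OF sec_hom] add_homs_add[OF comps_works] sec_closed Vn_sel)
 fix e assume e: "e \<in> carrier E"
 have z: "D e \<lhd>\<^bsub>MF 1\<^esub> (emb \<zero>) = \<zero>\<^bsub>MF 1\<^esub>"
  using MF.ract_zero_r[OF D_closed[OF e]] by (simp add: aug_sel)
 have d: "ftn 1 e (d_elem K A r) \<in> carrier (MF 1)" if "r \<in> carrier A" for r
  using e that by (simp add: ft_closed d_elem_closed)
 have d0: "ftn 1 e (d_elem K A \<zero>\<^bsub>A\<^esub>) = \<zero>\<^bsub>MF 1\<^esub>"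
  using d_elem_props(1)[of "\<zero>\<^bsub>A\<^esub>" "\<zero>\<^bsub>A\<^esub>"] Om.idem_zero[OF d_elem_closed[of "\<zero>\<^bsub>A\<^esub>"]] e by (simp add: ft_zero_r)
 show "D (e \<lhd>\<^bsub>E\<^esub> (emb c)) = D e \<lhd>\<^bsub>MF 1\<^esub> (emb c)" if c: "c \<in> carrier K" for c
  using D_leibniz[OF e _ c, of "\<zero>\<^bsub>A\<^esub>"] MF.ract_closed[OF D_closed[OF e] aug_scalar[OF c]] by (simp add: z d0)
 show "D (e \<lhd>\<^bsub>E\<^esub> (a, \<zero>)) = D e \<lhd>\<^bsub>MF 1\<^esub> (a, \<zero>)
   \<oplus>\<^bsub>MF 1\<^esub> ftn 1 e (d_elem K A a)" if a: "a \<in> carrier A" for a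
  using D_leibniz[OF e a, of \<zero>] MF.ract_closed[OF D_closed[OF e] aug_elem[OF a]] d[OF a] by (simp add: z)
qed

text \<open>The cocycle condition as seen by forms: \<open>cmap\<close> is the second half of the way from copy 2 through copy 1 to
  copy 0, and its value on the first half is that of the direct way.\<close>

definition cmap :: "(nat \<Rightarrow> nat \<Rightarrow> 'k) \<Rightarrow> nat \<Rightarrow> ('k, 'a, 'e) cyl_ext \<Rightarrow> nat \<Rightarrow> ('k, 'a, 'e) form_ext" where
 "cmap L n x = det 2 n L 0 (face2_map K A E 2 n (\<theta> n) x)"

lemma cmap_works:
 assumes L: "isolated_family 2 L" and L0: "L 0 = (\<lambda>_. \<zero>)" and n: "1 \<le> n"
 shows "cmap L n \<in> add_homs (Ek 2 n 1) (VM 2 n L)" (is ?g1)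
  and "[|x \<in> carrier (Ek 2 n 1); b \<in> carrier (cyl_aug 2 n)|] ==>
   cmap L n (x \<lhd>\<^bsub>Ek 2 n 1\<^esub> b) = cmap L n x \<lhd>\<^bsub>VM 2 n L\<^esub> b" (is "PROP ?g2")
  and "[|e \<in> carrier E; i < n|] ==> cmap L n (ek 2 n 1 e \<one>\<^bsub>cyl_aug 2 n\<^esub>) i =
   comps n (sec n e) i \<lhd>\<^bsub>MF i\<^esub> (\<zero>\<^bsub>A\<^esub>, kappa (L 1) i)"
  and "[|e \<in> carrier E; i < n|] ==> cmap L n (coch 0 n 0 1 (sec n e)) i =
   comps n (sec n e) i \<lhd>\<^bsub>MF i\<^esub> (\<zero>\<^bsub>A\<^esub>, kappa (L 2) i)"
proof -
 interpret S2: scalar_ext "A1" E "gk 2 n 2" "cyl_aug 2 n" by (rule gk_ext) simp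
 have 0: "1 = face_index 0 0" "2 = face_index 0 1" by (simp_all add: One_nat_def)
 have 1: "0 = face_index 1 0" "2 = face_index 1 1" by simp_all
 have 2: "0 = face_index 2 0" "1 = face_index 2 1" by simp_all
 note F0 = face2_map_works[OF \<theta>_hom[OF n] 0(2,1)] and F1 = face2_map_works[OF \<theta>_hom[OF n] 1(2,1)]
  and F2 = face2_map_works[OF \<theta>_hom[OF n] 2(2,1)]
 have L0': "L 0 0 = \<zero>" by (simp add: L0)
 note T = rmod_homD[OF det_works(1)[OF L n le0 L0']]
 have d: "det 2 n L 0 (coch j n 0 0 (sec n e)) i =
   comps n (sec n e) i \<lhd>\<^bsub>MF i\<^esub> (\<zero>\<^bsub>A\<^esub>, kappa (L (face_index j 1)) i)"
  if e: "e \<in> carrier E" and i: "i < n" and j: "0 < j" for e i j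
 proof -
  have L': "isolated_family 1 (\<lambda>i. L (face_index j i))" using L by (simp add: isolated_family_def)
  have "det 2 n L 0 (coch j n 0 0 (sec n e)) = det 1 n (\<lambda>i. L (face_index j i)) 0 (sec n e)"
   using det_coface[of 1 L n 0 j, unfolded Suc_1, OF L n] sc_coface[of 0 0 j n] j L0' sec_closed[OF n e] by simp
  then show ?thesis using det_comps[OF L' _ n sec_closed[OF n e] i] j by (simp add: L0)
 qed
 show ?g1
  unfolding cmap_def[abs_def] by (rule add_homs_comp[OF F2(1) T(1)])
 show "PROP ?g2"
  by (simp add: cmap_def F2(2) T(3) add_homs_closed[OF F2(1)])
 assume e: "e \<in> carrier E" and i: "i < n"
 show "cmap L n (ek 2 n 1 e \<one>\<^bsub>cyl_aug 2 n\<^esub>) i = comps n (sec n e) i \<lhd>\<^bsub>MF i\<^esub> (\<zero>\<^bsub>A\<^esub>, kappa (L 1) i)"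
  using d[OF e i, of 2] by (simp add: cmap_def F2(3)[OF e] flip: sec_def)
 have t: "S2.et e \<one>\<^bsub>cyl_aug 2 n\<^esub> \<in> carrier S2.X" using e by (simp add: S2.et_closed)
 have "\<forall>n\<ge>1. \<forall>t\<in>carrier (Ek 2 n 2). face2_map K A E 2 n (\<theta> n) (face2_map K A E 0 n (\<theta> n) t) =
   face2_map K A E 1 n (\<theta> n) t"
  using strat by (simp add: stratification_gk)
 from this[rule_format, OF n t]
 have "face2_map K A E 2 n (\<theta> n) (coch 0 n 0 1 (sec n e)) = coch 1 n 0 0 (sec n e)"
  unfolding F0(3)[OF e] F1(3)[OF e] sec_def .
 then show "cmap L n (coch 0 n 0 1 (sec n e)) i = comps n (sec n e) i \<lhd>\<^bsub>MF i\<^esub> (\<zero>\<^bsub>A\<^esub>, kappa (L 2) i)"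
  using d[OF e i, of 1] by (simp add: cmap_def)
qed

text \<open>With the zero sequence on copy 0 and \<open>(0, -1, 0, -1, \<dots>)\<close> on copy 1, the coefficients \<open>\<kappa>\<^sub>q\<close> vanish for \<open>q \<ge> 1\<close>,
so the way through copy 1 begins with \<open>e \<otimes> 1 \<mapsto> e\<close>. What remains of it sees copies 1 and 2 with sequences
which retain all components. The direct way, from the zero sequence to \<open>(1, 0, 1, 0, \<dots>)\<close>, has
\<open>\<kappa>\<^sub>q = 0\<close> for \<open>q \<ge> 2\<close>.\<close>

lemma comps_sec_high:
 assumes n: "1 \<le> n" and e: "e \<in> carrier E" and i: "2 \<le> i"
 shows "comps n (sec n e) i = \<zero>\<^bsub>MF i\<^esub>"
proof (cases "i < n")
 case False
 then show ?thesis using comps_sec_closed[OF n e] by (simp add: Vn_sel)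
next
 case True
 let ?L = "\<lambda>i::nat. if i = 0 then (\<lambda>_. \<zero>) else if i = 1 then L_odd else L_even"
 have L: "isolated_family 2 ?L" using isolated_parity by (auto simp: isolated_family_def isolated_def)
 have L0: "?L 0 = (\<lambda>_. \<zero>)" by simp
 have Lc: "L_odd p \<in> carrier K" "L_even p \<in> carrier K" for p using isolated_parity by (auto simp: isolated_def)
 have o: "(emb \<one>) = \<one>\<^bsub>A1\<^esub>" and z: "(emb \<zero>) = \<zero>\<^bsub>A1\<^esub>" by (simp_all add: aug_sel)
 have cc: "comps n (sec n e) i \<in> carrier (MF i)" if "e \<in> carrier E" for e i
  using comps_sec_closed[OF n that] by (simp add: Vn_sel)
 let ?G = "cmap ?L n"
 note G = cmap_works[OF L L0 n]
 interpret C0: scalar_ext2 "A1" E "gk 1 n 0" "cyl_aug 1 n" "face1 K A 0 n" "gk 2 n 1" "cyl_aug 2 n"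
  by (rule sc_coface) (simp_all add: One_nat_def)
 have base: "?G (ek 2 n 1 e \<one>\<^bsub>cyl_aug 2 n\<^esub>) = base n e" if e: "e \<in> carrier E" for e
 proof
  fix i
  have v: "?G (ek 2 n 1 e \<one>\<^bsub>cyl_aug 2 n\<^esub>) \<in> carrier (Vn n)"
   using add_homs_closed[OF G(1) C0.R.et_closed[OF e, of "\<one>\<^bsub>cyl_aug 2 n\<^esub>"]] by (simp add: Vf.End_module_sel)
  consider "i = 0" | "0 < i" "i < n" | "n \<le> i" using n by linarith
  then show "?G (ek 2 n 1 e \<one>\<^bsub>cyl_aug 2 n\<^esub>) i = base n e i"
  proof cases
   case 1
   then show ?thesis
    using n G(3)[OF e, of 0] by (simp add: o MF.ract_one comps_sec_0 e u0_closed base_def single_def)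
  next
   case 2
   then show ?thesis
    using kappa_zero[of L_odd 0 i, unfolded L_odd_def[of 0]] Lc G(3)[OF e 2(2)]
    by (simp add: z MF.ract_zero_r cc e base_def single_def)
  next
   case 3
   then show ?thesis using v n by (simp add: Vn_sel base_def single_def)
  qed
 qed
 have c: "coch 0 n 0 1 (sec n e) \<in> carrier (Ek 2 n 1)" using C0.ch_closed sec_closed[OF n e] .
 have one: "1 \<le> (2 :: nat)" by simp
 have k1: "?L 1 0 = \<zero>" by (simp add: L_odd_def)
 have "?G (coch 0 n 0 1 (sec n e)) = det 2 n ?L 1 (coch 0 n 0 1 (sec n e))"
  by (rule det_unique[OF L n one k1 G(1) G(2) base c])
 also have "\<dots> = det 1 n (\<lambda>i. ?L (face_index 0 i)) 0 (sec n e)"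
  using det_coface[of 1 ?L n 0 0, unfolded Suc_1 One_nat_def[symmetric], OF L n] sc_coface[of 0 1 0 n] sec_closed[OF n e]
  by (simp add: L_odd_def One_nat_def)
 also have "\<dots> = comps n (sec n e)"
  by (simp add: comps_def One_nat_def if_distrib cong: if_cong)
 finally have "comps n (sec n e) i = comps n (sec n e) i \<lhd>\<^bsub>MF i\<^esub> (\<zero>\<^bsub>A\<^esub>, kappa L_even i)"
  using G(4)[OF e True] by simp
 also have "\<dots> = \<zero>\<^bsub>MF i\<^esub>"
  using kappa_zero[of L_even 1 i] Lc i by (simp add: L_even_def z MF.ract_zero_r cc e)
 finally show ?thesis .
qed

lemma sec_eq:
 assumes n: "1 \<le> n" and e: "e \<in> carrier E"
 shows "sec n e = sm n D e"
proof (rule comps_inj[OF n sec_closed[OF n e]])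
 show "sm n D e \<in> carrier (Ek 1 n 0)" by (rule strat_of_works(3)[OF D_connection n e])
 show "comps n (sec n e) = comps n (sm n D e)"
  unfolding sm_eq comps_first_order[OF n e D_closed[OF e]]
 proof
  fix i :: nat
  have v: "comps n (sec n e) \<in> carrier (Vn n)" by (rule comps_sec_closed[OF n e])
  consider "i = 0" | "i = 1" "2 \<le> n" | "i = 1" "n = 1" | "2 \<le> i" using n by linarith
  then show "comps n (sec n e) i = (base n e \<oplus>\<^bsub>Vn n\<^esub> single n 1 (D e)) i"
   using v n e
   by cases (simp_all add: Vn_sel base_def single_def comps_sec_0 comps_sec_1 comps_sec_high u0_closed D_closed)
 qed
qed

text \<open>Let copies 1 and 2 act with the sequences \<open>(1, 0, 0, \<dots>)\<close> and \<open>(0, 1, 0, \<dots>)\<close>, and copy 0 with zero. In degree 2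
the direct way gives zero. On the way through copy 1, \<open>e \<otimes> 1\<close> goes to \<open>e + \<nabla> e\<close>, and hence
\<open>e \<otimes> \<delta>(y)\<close>, for the difference \<open>\<delta>\<close> of copies 2 and 1, to \<open>\<nabla>(e) dy = \<nabla>(e \<otimes> dy)\<close> in degree 2. Applied to
\<open>\<nabla> e\<close> this is \<open>\<nabla>\<^sup>2 e\<close>. The cylinders with \<open>n = 3\<close> are the first ones which see forms of degree 2.\<close>

lemma D_flat: "flat_connection K A E D"
proof (rule flat_connectionI[OF D_connection])
 fix e assume e: "e \<in> carrier E"
 let ?L = "\<lambda>(i::nat) (p::nat). if i = Suc p \<and> p \<le> 1 then \<one> else \<zero>"
 have L: "isolated_family 2 ?L" by (auto simp: isolated_family_def isolated_def)
 have n: "1 \<le> (3 :: nat)" by simp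
 have k0: "\<zero> \<in> carrier K" and L0: "?L 0 = (\<lambda>_. \<zero>)" by auto
 have o: "(emb \<one>) = \<one>\<^bsub>A1\<^esub>" and z: "(emb \<zero>) = \<zero>\<^bsub>A1\<^esub>" by (simp_all add: aug_sel)
 let ?G = "cmap ?L 3"
 note G = cmap_works[OF L L0 n]
 interpret C0: scalar_ext2 "A1" E "gk 1 3 0" "cyl_aug 1 3" "face1 K A 0 3" "gk 2 3 1" "cyl_aug 2 3"
  by (rule sc_coface) (simp_all add: One_nat_def)
 interpret T: two_homs K A E "gk 2 3 1" "cyl_aug 2 3" "gk 2 3 2" by (rule gk_two) simp_all
 interpret VM: right_module "cyl_aug 2 3" "VM 2 3 ?L" by (rule VM_right_module[OF L n])
 have at: "(\<lambda>v. v 2) \<in> add_homs (VM 2 3 ?L) (MF 2)"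
  by (rule add_homs_I) (simp_all add: Vf.End_module_sel Vn_sel)
 have P: "PsiC 2 3 1 2 1 \<in> add_homs (MF 1) (Ek 2 3 1)" by (rule PsiC_works(1)) simp_all
 have high: "comps 3 (sec 3 e) 2 = \<zero>\<^bsub>MF 2\<^esub>" if "e \<in> carrier E" for e
  using comps_sec_high[OF n that] by simp
 have w2: "?G (ek 2 3 1 e \<one>\<^bsub>cyl_aug 2 3\<^esub>) 2 = \<zero>\<^bsub>MF 2\<^esub>" if "e \<in> carrier E" for e
  using G(3)[OF that, of 2] by (simp add: high that MF.ract_zero_l aug_scalar kappa_closed)
 have w1: "?G (ek 2 3 1 e \<one>\<^bsub>cyl_aug 2 3\<^esub>) 1 = D e" if "e \<in> carrier E" for e
  using G(3)[OF that, of 1] comps_sec_1[OF _ that, of 3] MF.ract_one[OF D_closed[OF that]]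
  by (simp add: o One_nat_def)
 have ext: "?G (PsiC 2 3 1 2 1 u) 2 = connection_ext K A E D 1 u" if u: "u \<in> carrier (MF 1)" for u
 proof (rule mf_word_eqI[OF add_homs_comp[OF add_homs_comp[OF P G(1)] at] _ _ u])
  show "connection_ext K A E D 1 \<in> add_homs (MF 1) (MF 2)"
   using connection_ext_works(1)[OF D_connection, of 1] by simp
  fix e as assume e: "e \<in> carrier E" and as: "set as \<subseteq> carrier A" "length as = 1"
  then obtain y where y: "as = [y]" "y \<in> carrier A" by (cases as) auto
  let ?w = "?G (ek 2 3 1 e \<one>\<^bsub>cyl_aug 2 3\<^esub>)"
  have ec: "ek 2 3 1 e \<one>\<^bsub>cyl_aug 2 3\<^esub> \<in> carrier (Ek 2 3 1)" using e by (simp add: C0.R.et_closed)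
  have w: "?w \<in> carrier (Vn 3)" using add_homs_closed[OF G(1) ec] by (simp add: Vf.End_module_sel)
  have g: "gk 2 3 k (y, \<zero>) \<in> carrier (cyl_aug 2 3)" if "k \<le> 2" for k
   using ring_hom_closed[OF gk_ring_hom[OF that] aug_elem[OF y(2)]] .
  have a: "(?w \<lhd>\<^bsub>VM 2 3 ?L\<^esub> gk 2 3 k (y, \<zero>)) 2 = mcc 1 [?L k 1 \<odot>\<^bsub>A\<^esub> y] (D e)" if "k \<le> 2" for k
  proof -
   have "l 1 \<in> carrier K ==> act 3 l y ?w 2 = mcc 1 [l 1 \<odot>\<^bsub>A\<^esub> y] (D e)" for l
   proof -
    assume "l 1 \<in> carrier K"
    then have "mcc 1 [l 1 \<odot>\<^bsub>A\<^esub> y] (D e) \<in> carrier (MF 2)"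
     using msnoc_closed[of "l 1 \<odot>\<^bsub>A\<^esub> y" "D e" 1] D_closed[OF e] y by simp
    moreover have "act 3 l y ?w (Suc 1) = ?w (Suc 1) \<lhd>\<^bsub>MF (Suc 1)\<^esub> (y, \<zero>)
      \<oplus>\<^bsub>MF (Suc 1)\<^esub> mcc 1 [l 1 \<odot>\<^bsub>A\<^esub> y] (?w 1)"
     using w by (simp add: act_def del: Suc_1)
    ultimately show ?thesis
     unfolding Suc_1 w2[OF e] w1[OF e] using y by (simp add: MF.ract_zero_l aug_elem)
   qed
   from this[of "?L k"] have "act 3 (?L k) y ?w 2 = mcc 1 [?L k 1 \<odot>\<^bsub>A\<^esub> y] (D e)" by simp
   moreover have "act 3 (?L k) y ?w 2 \<in> carrier (MF 2)"
    using Vf.EndD(1)[OF act_closed w, of "?L k" y] L y that by (simp add: isolated_family_def Vn_sel)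
   ultimately show ?thesis
    unfolding rho_gk[OF L n that y(2) k0 w] Vn_sel(3,4) w2[OF e]
    using MF.ract_zero_l[OF aug_scalar[OF k0]] by simp
  qed
  have "?G (PsiC 2 3 1 2 1 (ftn 1 e (fm K A 1 \<one>\<^bsub>A1\<^esub> as))) 2 = (?w \<lhd>\<^bsub>VM 2 3 ?L\<^esub> T.dl y) 2"
  proof -
   have "PsiC 2 3 1 2 1 (ftn 1 e (fm K A 1 \<one>\<^bsub>A1\<^esub> as)) = ek 2 3 1 e (T.dl y)"
   proof -
    have "replicate 1 T.dl = [T.dl]" by (simp add: One_nat_def)
    then show ?thesis using PsiC_works(2)[of 1 2 2 e as 1 3] e as y T.dl_closed[OF y(2)] by simp
   qed
   also have "\<dots> = ek 2 3 1 e \<one>\<^bsub>cyl_aug 2 3\<^esub> \<lhd>\<^bsub>Ek 2 3 1\<^esub> T.dl y"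
    by (rule C0.R.et_unit[OF e T.dl_closed[OF y(2)]])
   finally show ?thesis using G(2)[OF ec T.dl_closed[OF y(2)]] by simp
  qed
  also have "\<dots> = mcc 1 [y] (D e) \<ominus>\<^bsub>MF 2\<^esub> mcc 1 [\<zero>\<^bsub>A\<^esub>] (D e)"
  proof -
   have "(?w \<lhd>\<^bsub>VM 2 3 ?L\<^esub> T.dl y) 2 = (?w \<lhd>\<^bsub>VM 2 3 ?L\<^esub> gk 2 3 2 (y, \<zero>)) 2 \<ominus>\<^bsub>MF 2\<^esub>
     (?w \<lhd>\<^bsub>VM 2 3 ?L\<^esub> gk 2 3 1 (y, \<zero>)) 2"
    using w g VM.ract_closed[of ?w] add_homs_minus[OF VM.M.abelian_group_axioms MF.abelian_group_axioms at]
    by (simp add: hdiff_def VM.ract_minus Vf.End_module_sel(1))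
   then show ?thesis using a[of 1] a[of 2] y by simp
  qed
  also have "\<dots> = connection_ext K A E D 1 (ftn 1 e (fm K A 1 \<one>\<^bsub>A1\<^esub> as))"
   using connection_ext_word[OF D_connection e as(1), unfolded as(2)] y msnoc_zero_r[OF D_closed[OF e]]
    msnoc_closed[OF y(2) D_closed[OF e]]
   by (simp add: a_minus_def MF.neg_zero)
  finally show "?G (PsiC 2 3 1 2 1 (ftn 1 e (fm K A 1 \<one>\<^bsub>A1\<^esub> as))) 2 =
    connection_ext K A E D 1 (ftn 1 e (fm K A 1 \<one>\<^bsub>A1\<^esub> as))" .
 qed
 have De: "D e \<in> carrier (MF 1)" by (rule D_closed[OF e])
 have j: "face1 K A 0 3 (gk 1 3 1 (y, \<zero>)) = gk 2 3 2 (y, \<zero>)" if "y \<in> carrier A" for y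
  using that by (intro face1_gk) (simp_all add: aug_elem)
 have "coch 0 3 0 1 (sec 3 e) = ek 2 3 1 e \<one>\<^bsub>cyl_aug 2 3\<^esub> \<oplus>\<^bsub>Ek 2 3 1\<^esub> PsiC 2 3 1 2 1 (D e)"
  using e De PsiC_closed[of 0 1 1 "D e" 1 3] ext_change_PsiC[OF C0.scalar_ext2_axioms, of 1 2, OF _ _ _ _ j De]
  by (simp add: sec_eq sm_eq C0.ch_add C0.P.et_closed C0.ch_works(2) C0.\<psi>D)
 then have "?G (coch 0 3 0 1 (sec 3 e)) 2 = connection_ext K A E D 1 (D e)"
  using e De ext[OF De] add_homs_closed[OF P De] connection_ext_closed[OF D_connection De]
  by (simp add: add_homs_add[OF G(1)] C0.R.et_closed Vf.End_module_sel Vn_sel(3) w2)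
 moreover have "?G (coch 0 3 0 1 (sec 3 e)) 2 = \<zero>\<^bsub>MF 2\<^esub>"
  using G(4)[OF e, of 2] by (simp add: high e MF.ract_zero_l aug_scalar kappa_closed)
 ultimately show "connection_ext K A E D 1 (D e) = \<zero>\<^bsub>MF 2\<^esub>" by simp
qed

lemma \<theta>_eq: "\<theta> = strat_of D"
proof
 fix n
 show "\<theta> n = strat_of D n"
 proof (cases "1 \<le> n")
  case True
  interpret S1: scalar_ext "A1" E "gk 1 n 1" "cyl_aug 1 n" by (rule gk_ext) simp
  interpret S0: scalar_ext "A1" E "gk 1 n 0" "cyl_aug 1 n" by (rule gk_ext) simp
  show ?thesis
   by (rule S1.rmod_hom_eqI[OF S0.ext_right_module \<theta>_hom[OF True] strat_of_works(1)[OF D_connection True]])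
    (simp add: strat_of_works(2)[OF D_connection True] sec_eq[OF True, symmetric] sec_def)
 next
  case False
  then show ?thesis using strat by (simp add: stratification_gk strat_of_def extensional_def)
 qed
qed

end

section \<open>The isomorphism of categories\<close>

abbreviation form_map where
 "form_map K A E F f \<equiv> tensor_lift E (aug K A) (Omega K A 1) (mod_forms K A F 1) (\<lambda>e \<omega>. form_tens K A F 1 (f e) \<omega>)"

context form_module
begin

lemma strat_connection_strat_of:
 assumes "flat_connection K A E D"
 shows "strat_connection K A E (strat_of D) = D"
proof (rule extensionalityI)
 have c: "connection K A E D" using assms by (simp add: flat_connection_def)
 show "strat_connection K A E (strat_of D) \<in> extensional (carrier E)" by (simp add: strat_connection_def)
 show "D \<in> extensional (carrier E)" using c by (simp add: connection_def)
 fix e assume e: "e \<in> carrier E"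
 have De: "D e \<in> carrier (MF 1)" using add_homs_closed[OF connectionD(1)[OF c] e] .
 have two: "1 \<le> (2 :: nat)" by simp
 have "comps 2 (sm 2 D e) 1 = D e"
  unfolding sm_eq comps_first_order[OF two e De] using De by (simp add: Vn_sel base_def single_def)
 then show "strat_connection K A E (strat_of D) e = D e"
  using e face_form_proj_comps[OF strat_of_works(3)[OF c two e]] strat_of_works(2)[OF c two e]
  by (simp add: strat_connection_def strat_coface_def face_gk)
qed

lemma form_map_works:
 assumes Y: "form_module K A F" and f: "f \<in> rmod_hom A1 E F"
 shows "form_map K A E F f \<in> add_homs (MF 1) (mod_forms K A F 1)" (is ?g1)
  and "[|e \<in> carrier E; \<omega> \<in> carrier (Om 1)|] ==>
   form_map K A E F f (ftn 1 e \<omega>) = form_tens K A F 1 (f e) \<omega>" (is "PROP ?g2")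
proof -
 interpret Y: form_module K A F by fact
 note fD = rmod_homD[OF f]
 have *: "form_tens K A F 1 (f e) \<omega> \<in> carrier (mod_forms K A F 1)"
  "e' \<in> carrier E ==> form_tens K A F 1 (f (e \<oplus>\<^bsub>E\<^esub> e')) \<omega> =
   form_tens K A F 1 (f e) \<omega> \<oplus>\<^bsub>mod_forms K A F 1\<^esub> form_tens K A F 1 (f e') \<omega>"
  "\<omega>' \<in> carrier (Om 1) ==> form_tens K A F 1 (f e) (\<omega> \<oplus>\<^bsub>Om 1\<^esub> \<omega>') =
   form_tens K A F 1 (f e) \<omega> \<oplus>\<^bsub>mod_forms K A F 1\<^esub> form_tens K A F 1 (f e) \<omega>'"
  "a \<in> carrier A1 ==> form_tens K A F 1 (f (e \<lhd>\<^bsub>E\<^esub> a)) \<omega> = form_tens K A F 1 (f e) (a \<rhd>\<^bsub>Om 1\<^esub> \<omega>)"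
  if "e \<in> carrier E" "\<omega> \<in> carrier (Om 1)" for e \<omega> e' \<omega>' a
  using that by (simp_all add: fD Y.ft_closed Y.ft_add_l Y.ft_add_r Y.ft_bal)
 note l = mf_lift[where n = 1 and \<phi> = "\<lambda>e \<omega>. form_tens K A F 1 (f e) \<omega>", OF Y.MF.abelian_group_axioms *]
 show ?g1 by (rule l(1))
 show "PROP ?g2" by (rule l(3))
qed

text \<open>Both conditions compare \<open>e \<otimes> 1 + \<Psi>(\<nabla> e)\<close> before and after \<open>f\<close>, and \<open>f\<close> commutes with \<open>\<Psi>\<close>; the component of degree
1 recovers \<open>\<nabla> e\<close>.\<close>

lemma conn_hom_iff_strat_hom:
 assumes D: "flat_connection K A E D" and F: "flat_connection K A F D'"
 shows "strat_hom K A (E, strat_of D) (F, form_module.strat_of K A F D') = conn_hom K A (E, D) (F, D')"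
proof -
 have c: "connection K A E D" and c': "connection K A F D'" using D F by (simp_all add: flat_connection_def)
 interpret Y: form_module K A F
  using c' by (intro form_module.intro k_algebra_axioms) (simp add: connection_def)
 have De: "D e \<in> carrier (MF 1)" if "e \<in> carrier E" for e
  using add_homs_closed[OF connectionD(1)[OF c] that] .
 have De': "D' e \<in> carrier (mod_forms K A F 1)" if "e \<in> carrier F" for e
  using add_homs_closed[OF Y.connectionD(1)[OF c'] that] .
 have "(\<forall>n\<ge>1. \<forall>t\<in>carrier (face_mod K A E 0 n).
   Y.strat_of D' n (face_map K A E F 0 n f t) = face_map K A E F 1 n f (strat_of D n t)) \<longleftrightarrow>
  (\<forall>e\<in>carrier E. D' (f e) = form_map K A E F f (D e))"
  (is "?S \<longleftrightarrow> ?C") if f: "f \<in> rmod_hom A1 E F" for f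
 proof -
  note fD = rmod_homD[OF f]
  let ?m = "\<lambda>n k. ext_map E F A1 (gk 1 n k) (cyl_aug 1 n) f"
  have m: "?m n k \<in> rmod_hom (cyl_aug 1 n) (Ek 1 n k) (Y.Ek 1 n k)"
   "[|e \<in> carrier E; b \<in> carrier (cyl_aug 1 n)|] ==> ?m n k (ek 1 n k e b) = Y.ek 1 n k (f e) b"
   if "k \<le> 1" for n k e b
   using ext_map_works[OF gk_ext[OF that] Y.gk_ext[OF that] f] by blast+
  have P: "?m n 0 (PsiC 1 n 0 1 1 u) = Y.PsiC 1 n 0 1 1 (form_map K A E F f u)"
   if u: "u \<in> carrier (MF 1)" for n u
  proof (rule mf_word_eqI[OF add_homs_comp[OF PsiC_works(1) rmod_homD(1)[OF m(1)]]
     add_homs_comp[OF form_map_works(1)[OF Y.form_module_axioms f] Y.PsiC_works(1)] _ u])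
   fix e as assume e: "e \<in> carrier E" and as: "set as \<subseteq> carrier A" "length as = 1"
   interpret T: two_homs K A E "gk 1 n 0" "cyl_aug 1 n" "gk 1 n 1" by (rule gk_two) simp_all
   show "?m n 0 (PsiC 1 n 0 1 1 (ftn 1 e (fm K A 1 \<one>\<^bsub>A1\<^esub> as))) =
     Y.PsiC 1 n 0 1 1 (form_map K A E F f (ftn 1 e (fm K A 1 \<one>\<^bsub>A1\<^esub> as)))"
    using e as T.dl_word_closed[OF as(1), of 1]
    by (simp add: PsiC_works(2) Y.PsiC_works(2) m(2) form_map_works(2)[OF Y.form_module_axioms f] fm_closed fD)
  qed simp_all
  have sm_map: "?m n 0 (sm n D e) = Y.ek 1 n 0 (f e) \<one>\<^bsub>cyl_aug 1 n\<^esub> \<oplus>\<^bsub>Y.Ek 1 n 0\<^esub> Y.PsiC 1 n 0 1 1 (form_map K A E F f (D e))"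
   if e: "e \<in> carrier E" for n e
  proof -
   interpret S: scalar_ext "A1" E "gk 1 n 0" "cyl_aug 1 n" by (rule gk_ext) simp
   have "PsiC 1 n 0 1 1 (D e) \<in> carrier (Ek 1 n 0)" by (rule PsiC_closed[OF _ _ De[OF e]]) simp_all
   then show ?thesis
    using e by (simp add: sm_eq rmod_homD(5)[OF m(1)] S.et_closed m(2) P De)
  qed
  have fm: "form_map K A E F f (D e) \<in> carrier (mod_forms K A F 1)" if "e \<in> carrier E" for e
   by (rule add_homs_closed[OF form_map_works(1)[OF Y.form_module_axioms f] De[OF that]])
  show ?thesis
  proof
   assume S: ?S
   show ?C
   proof
    fix e assume e: "e \<in> carrier E"
    interpret S: scalar_ext "A1" E "gk 1 2 1" "cyl_aug 1 2" by (rule gk_ext) simp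
    have two: "1 \<le> (2 :: nat)" by simp
    have "Y.strat_of D' 2 (?m 2 1 (S.et e \<one>\<^bsub>cyl_aug 1 2\<^esub>)) = ?m 2 0 (strat_of D 2 (S.et e \<one>\<^bsub>cyl_aug 1 2\<^esub>))"
     using S[rule_format, of 2 "S.et e \<one>\<^bsub>cyl_aug 1 2\<^esub>"] e by (simp add: face_gk S.et_closed)
    then have "Y.sm 2 D' (f e) = ?m 2 0 (sm 2 D e)"
     using e by (simp add: m(2) Y.strat_of_works(2)[OF c' two] strat_of_works(2)[OF c two] fD)
    then have "Y.comps 2 (Y.sm 2 D' (f e)) 1 = Y.comps 2 (?m 2 0 (sm 2 D e)) 1" by simp
    then show "D' (f e) = form_map K A E F f (D e)"
     unfolding Y.sm_eq sm_map[OF e] Y.comps_first_order[OF two fD(4)[OF e] fm[OF e]]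
      Y.comps_first_order[OF two fD(4)[OF e] De'[OF fD(4)[OF e]]]
     using fm[OF e] De'[OF fD(4)[OF e]] by (simp add: Y.Vn_sel Y.base_def Y.single_def)
   qed
  next
   assume C: ?C
   show ?S
   proof (intro allI impI ballI)
    fix n :: nat and t assume n: "1 \<le> n" and t: "t \<in> carrier (face_mod K A E 0 n)"
    interpret S: scalar_ext "A1" E "gk 1 n 1" "cyl_aug 1 n" by (rule gk_ext) simp
    interpret S0: scalar_ext "A1" F "gk 1 n 0" "cyl_aug 1 n" by (rule Y.gk_ext) simp
    note s = rmod_homD[OF strat_of_works(1)[OF c n]] and s' = rmod_homD[OF Y.strat_of_works(1)[OF c' n]]
     and m0 = rmod_homD[OF m(1)[OF le0, of n]] and m1 = rmod_homD[OF m(1)[OF le_refl, of n]]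
    show "Y.strat_of D' n (face_map K A E F 0 n f t) = face_map K A E F 1 n f (strat_of D n t)"
     unfolding face_gk
    proof (rule S.ext_lin_eqI[OF S0.ext_right_module add_homs_comp[OF m1(1) s'(1)] add_homs_comp[OF s(1) m0(1)]
       _ _ _ t[unfolded face_gk]])
     show "Y.strat_of D' n (?m n 1 (S.et e \<one>\<^bsub>cyl_aug 1 n\<^esub>)) = ?m n 0 (strat_of D n (S.et e \<one>\<^bsub>cyl_aug 1 n\<^esub>))"
      if "e \<in> carrier E" for e
      using that C
      by (simp add: m(2) Y.strat_of_works(2)[OF c' n] strat_of_works(2)[OF c n] fD sm_map) (simp add: Y.sm_eq)
    qed (simp_all add: m0 m1 s s')
   qed
  qed
 qed
 then show ?thesis unfolding strat_hom_def conn_hom_def by auto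
qed

end

lemma rmod_hom_id: "right_module A E ==> restrict id (carrier E) \<in> rmod_hom A E E"
proof -
 assume "right_module A E"
 then interpret right_module A E .
 show ?thesis by (auto simp: rmod_hom_def hom_def ract_closed)
qed

lemma rmod_hom_compose:
 assumes E: "right_module A E" and f: "f \<in> rmod_hom A E F" and g: "g \<in> rmod_hom A F G"
 shows "compose (carrier E) g f \<in> rmod_hom A E G"
proof -
 interpret right_module A E by fact
 show ?thesis
  by (auto simp: rmod_hom_def hom_def compose_def ract_closed rmod_homD[OF f] rmod_homD[OF g])
qed

lemma conn_category_is_category:
 assumes nu: "nu_algebra K A"
 shows "is_category (conn_category K A :: (('a \<times> 'k, 'e) rmodule \<times> ('e \<Rightarrow> ('k, 'a, 'e) form_ext), 'e \<Rightarrow> 'e) category)"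
proof -
 let ?C = "conn_category K A :: (('a \<times> 'k, 'e) rmodule \<times> ('e \<Rightarrow> ('k, 'a, 'e) form_ext), 'e \<Rightarrow> 'e) category"
 have fmod: "form_module K A E" and DD: "\<And>e. e \<in> carrier E ==> D e \<in> carrier (mod_forms K A E 1)"
  if "flat_connection K A E D" for E :: "('a \<times> 'k, 'e) rmodule" and D
 proof -
  show E: "form_module K A E"
   using that k_algebraI[OF nu] by (intro form_module.intro) (simp_all add: flat_connection_def connection_def)
  show "D e \<in> carrier (mod_forms K A E 1)" if "e \<in> carrier E" for e
   using add_homs_closed[OF form_module.connectionD(1)[OF E] that] \<open>flat_connection K A E D\<close>
   by (simp add: flat_connection_def)
 qed
 have rm: "right_module (aug K A) E" if "flat_connection K A E D" for E :: "('a \<times> 'k, 'e) rmodule" and D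
  using that by (simp add: flat_connection_def connection_def)
 have hom: "f \<in> conn_hom K A (E, D) (F, D') \<longleftrightarrow>
   f \<in> rmod_hom (aug K A) E F \<and> (\<forall>e\<in>carrier E. D' (f e) = form_map K A E F f (D e))"
  for f and E F :: "('a \<times> 'k, 'e) rmodule" and D D' by (simp add: conn_hom_def)
 have id: "restrict id (carrier E) \<in> conn_hom K A (E, D) (E, D)"
  if D: "flat_connection K A E D" for E :: "('a \<times> 'k, 'e) rmodule" and D
 proof -
  interpret E: form_module K A E by (rule fmod[OF D])
  note i = rmod_hom_id[OF rm[OF D]]
  have "form_map K A E E (restrict id (carrier E)) u = u" if u: "u \<in> carrier (mod_forms K A E 1)" for u
  proof (rule E.mf_hom_eqI[OF E.form_map_works(1)[OF fmod[OF D] i] _ _ u])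
   show "(\<lambda>u. u) \<in> add_homs (mod_forms K A E 1) (mod_forms K A E 1)" by (simp add: hom_def)
  qed (simp only: E.form_map_works(2)[OF fmod[OF D] i] restrict_apply' id_apply)
  then show ?thesis using i by (simp add: hom DD[OF D])
 qed
 have comp: "compose (carrier E) g f \<in> conn_hom K A (E, D) (G, D'')"
  if D: "flat_connection K A E D" "flat_connection K A F D'" "flat_connection K A G D''"
   and f: "f \<in> conn_hom K A (E, D) (F, D')" and g: "g \<in> conn_hom K A (F, D') (G, D'')"
  for E F G :: "('a \<times> 'k, 'e) rmodule" and D D' D'' f g
 proof -
  interpret E: form_module K A E by (rule fmod[OF D(1)])
  interpret F: form_module K A F by (rule fmod[OF D(2)])
  have f: "f \<in> rmod_hom (aug K A) E F" "\<And>e. e \<in> carrier E ==> D' (f e) = form_map K A E F f (D e)"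
   and g: "g \<in> rmod_hom (aug K A) F G" "\<And>e. e \<in> carrier F ==> D'' (g e) = form_map K A F G g (D' e)"
   using f g by (auto simp: hom)
  note c = rmod_hom_compose[OF rm[OF D(1)] f(1) g(1)]
  note ff = E.form_map_works[OF fmod[OF D(2)] f(1)] and gg = F.form_map_works[OF fmod[OF D(3)] g(1)]
   and cc = E.form_map_works[OF fmod[OF D(3)] c]
  have "form_map K A E G (compose (carrier E) g f) u = form_map K A F G g (form_map K A E F f u)"
   if u: "u \<in> carrier (mod_forms K A E 1)" for u
   by (rule E.mf_hom_eqI[OF cc(1) add_homs_comp[OF ff(1) gg(1)] _ u])
    (simp add: ff(2) gg(2) cc(2) rmod_homD(4)[OF f(1)] compose_eq)
  then show ?thesis using c by (simp add: hom compose_eq f g rmod_homD(4)[OF f(1)] DD[OF D(1)])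
 qed
 have ext: "f \<in> extensional (carrier E)" "f \<in> carrier E \<rightarrow> carrier F" if "f \<in> conn_hom K A (E, D) (F, D')"
  for f and E F :: "('a \<times> 'k, 'e) rmodule" and D D'
  using that rmod_homD(2,4)[of f "aug K A" E F] by (auto simp: hom)
 have unit: "compose (carrier E) f (restrict id (carrier E)) = f" "compose (carrier E) (restrict id (carrier F)) f = f"
  if "f \<in> conn_hom K A (E, D) (F, D')" for f and E F :: "('a \<times> 'k, 'e) rmodule" and D D'
  using ext[OF that] compose_Id[of f "carrier E" "carrier F"] Id_compose[of f "carrier E" "carrier F"]
  by (simp_all add: id_def[abs_def])
 have obj: "flat_connection K A (fst X) (snd X)" if "X \<in> Obj ?C" for X using that by (auto simp: conn_category_def)
 have sel: "Hom ?C X Y = conn_hom K A (fst X, snd X) (fst Y, snd Y)" "Id ?C X = restrict id (carrier (fst X))"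
  "Comp ?C X Y Z g f = compose (carrier (fst X)) g f" for X Y Z f g
  by (simp_all add: conn_category_def case_prod_unfold)
 show ?thesis
  unfolding is_category_def sel
 proof (intro conjI ballI)
  fix X Y Z f g
  assume "X \<in> Obj ?C" "Y \<in> Obj ?C" "Z \<in> Obj ?C"
   "f \<in> conn_hom K A (fst X, snd X) (fst Y, snd Y)" "g \<in> conn_hom K A (fst Y, snd Y) (fst Z, snd Z)"
  then show "compose (carrier (fst X)) g f \<in> conn_hom K A (fst X, snd X) (fst Z, snd Z)"
   using comp[OF obj obj obj, of X Y Z f g] by blast
 qed (intro id unit compose_assoc[OF ext(2)] obj, assumption+)+
qed

text \<open>A bijection on objects which preserves sets of morphisms is an isomorphism.\<close>

lemma cat_isoI:
 assumes D: "is_category D"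
  and F: "\<And>X. X \<in> Obj C ==> F X \<in> Obj D \<and> G (F X) = X"
  and G: "\<And>Y. Y \<in> Obj D ==> G Y \<in> Obj C \<and> F (G Y) = Y"
  and Hom: "\<And>X Y. [|X \<in> Obj C; Y \<in> Obj C|] ==> Hom C X Y = Hom D (F X) (F Y)"
  and Id: "\<And>X. Id C X = Id D (F X)" and Comp: "\<And>X Y Z. Comp C X Y Z = Comp D (F X) (F Y) (F Z)"
 shows "is_cat_iso C D F (\<lambda>_ _ f. f)"
proof -
 have "is_category C"
  using D F unfolding is_category_def by (simp add: Hom Id Comp)
 moreover have "is_functor C D F (\<lambda>_ _ f. f)" "is_functor D C G (\<lambda>_ _ f. f)"
  using F G unfolding is_functor_def by (simp_all add: Hom Id Comp)
 ultimately show ?thesis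
  unfolding is_cat_iso_def using D F G by (intro conjI exI[of _ G] exI[of _ "\<lambda>_ _ f. f"]) auto
qed

theorem proposition2p1:
 fixes K :: "('k, 'n) ring_scheme" and R :: "('k, 'r) module"
 assumes "field K" and "quasi_free K R"
 shows "(\<forall>(E :: ('r \<times> 'k, 'e) rmodule) \<theta>.
      stratification K R E \<theta> \<longrightarrow> flat_connection K R E (strat_connection K R E \<theta>)) \<and>
     is_cat_iso
      (strat_category K R :: (('r \<times> 'k, 'e) rmodule \<times> ('k, 'r, 'e) strat, 'e \<Rightarrow> 'e) category)
      (conn_category K R :: (('r \<times> 'k, 'e) rmodule \<times> ('e \<Rightarrow> ('k, 'r, 'e) form_ext), 'e \<Rightarrow> 'e) category)
      (\<lambda>(E, \<theta>). (E, strat_connection K R E \<theta>)) (\<lambda>_ _ f. f)"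
proof -
 have nu: "nu_algebra K R" using assms(2) by (simp add: quasi_free_def)
 have fm: "form_module K R E" if "right_module (aug K R) E" for E :: "('r \<times> 'k, 'e) rmodule"
  using that k_algebraI[OF nu] by (rule form_module.intro[rotated])
 have sm: "stratified_module K R E \<theta>" if "stratification K R E \<theta>" for E :: "('r \<times> 'k, 'e) rmodule" and \<theta>
  using that fm[of E] by (intro stratified_module.intro stratified_module_axioms.intro) (simp_all add: stratification_def)
 have fc: "form_module K R E" if "flat_connection K R E D" for E :: "('r \<times> 'k, 'e) rmodule" and D
  using that by (intro fm) (simp add: flat_connection_def connection_def)
 have flat: "flat_connection K R E (strat_connection K R E \<theta>)" if "stratification K R E \<theta>"
  for E :: "('r \<times> 'k, 'e) rmodule" and \<theta>
  by (rule stratified_module.D_flat[OF sm[OF that]])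
 let ?F = "\<lambda>(E, \<theta>). (E, strat_connection K R E \<theta>)"
 let ?G = "\<lambda>(E, D). (E, form_module.strat_of K R E D)"
 have \<theta>: "form_module.strat_of K R E (strat_connection K R E \<theta>) = \<theta>" if "stratification K R E \<theta>"
  for E :: "('r \<times> 'k, 'e) rmodule" and \<theta>
  by (rule stratified_module.\<theta>_eq[OF sm[OF that], symmetric])
 have "is_cat_iso (strat_category K R) (conn_category K R :: (('r \<times> 'k, 'e) rmodule \<times> _, 'e \<Rightarrow> 'e) category) ?F (\<lambda>_ _ f. f)"
 proof (rule cat_isoI[where G = ?G, OF conn_category_is_category[OF nu]])
  show "?F X \<in> Obj (conn_category K R) \<and> ?G (?F X) = X" if "X \<in> Obj (strat_category K R)"
   for X :: "('r \<times> 'k, 'e) rmodule \<times> ('k, 'r, 'e) strat"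
   using that flat \<theta> by (auto simp: strat_category_def conn_category_def)
  show "?G Y \<in> Obj (strat_category K R) \<and> ?F (?G Y) = Y" if "Y \<in> Obj (conn_category K R)"
   for Y :: "('r \<times> 'k, 'e) rmodule \<times> ('e \<Rightarrow> ('k, 'r, 'e) form_ext)"
   using that form_module.strat_of_stratification[OF fc] form_module.strat_connection_strat_of[OF fc]
   by (auto simp: strat_category_def conn_category_def)
  show "Hom (strat_category K R) X Y = Hom (conn_category K R) (?F X) (?F Y)"
   if XY: "X \<in> Obj (strat_category K R)" "Y \<in> Obj (strat_category K R)"
   for X Y :: "('r \<times> 'k, 'e) rmodule \<times> ('k, 'r, 'e) strat"
  proof -
   obtain E \<theta> F \<theta>' where X: "X = (E, \<theta>)" "stratification K R E \<theta>" "Y = (F, \<theta>')" "stratification K R F \<theta>'"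
    using XY by (auto simp: strat_category_def)
   show ?thesis
    using form_module.conn_hom_iff_strat_hom[OF fc[OF flat[OF X(2)]] flat[OF X(2)] flat[OF X(4)]]
    by (simp add: X(1,3) \<theta>[OF X(2)] \<theta>[OF X(4)] strat_category_def conn_category_def)
  qed
 qed (auto simp: strat_category_def conn_category_def)
 then show ?thesis using flat by blast
qed

end
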